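(* Let $(\mathscr{E},\mathscr{L},\mathscr{B})$ be a normal labelled space. If the labelled space satisfies condition $(L_{\mathscr{B}})$, and $\{\emptyset\}$ and $\mathscr{B}$ are the only hereditary saturated subsets of $\mathscr{B}$, then $C^*(\mathscr{E},\mathscr{L},\mathscr{B})$ is simple. If, in addition, the groupoid $\mathcal{G}$ associated with the labelled space (defined in the context) is second countable, then the converse is also true: if $C^*(\mathscr{E},\mathscr{L},\mathscr{B})$ is simple, then the labelled space satisfies condition $(L_{\mathscr{B}})$ and $\{\emptyset\}$ and $\mathscr{B}$ are the only hereditary saturated subsets of $\mathscr{B}$.
   Context: **Labelled spaces.** A (directed) graph $\mathscr{E}=(\mathscr{E}^0,\mathscr{E}^1,r,s)$ consists of non-empty sets of vertices and edges and range/source maps $r,s:\mathscr{E}^1\to\mathscr{E}^0$; $\mathscr{E}^0_{sink}=\{v:s^{-1}(v)=\emptyset\}$. A path is a finite or infinite sequence of edges $\lambda_1\lambda_2\ldots$ with $r(\lambda_i)=s(\lambda_{i+1})$. A labelled graph is a graph with a surjective labelling map $\mathscr{L}:\mathscr{E}^1\to\mathscr{A}$ onto a non-empty set $\mathscr{A}$ (the alphabet), extended letterwise to paths. $\mathscr{L}^{\geq 1}$ is the set of labels of finite paths of length $\geq 1$; $\mathscr{L}^*=\{\omega\}\cup\mathscr{L}^{\geq1}$ with $\omega$ the empty word; $\overline{\mathscr{L}^\infty}$ is the set of infinite words over $\mathscr{A}$ all of whose finite beginnings lie in $\mathscr{L}^*$; $\overline{\mathscr{L}^{\leq\infty}}=\mathscr{L}^*\cup\overline{\mathscr{L}^\infty}$.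 $|\alpha|$ is the length of $\alpha$; $\alpha_{i,j}=\alpha_i\cdots\alpha_j$, and $\alpha_{i,j}=\omega$ if $j<i$. For $A\subseteq\mathscr{E}^0$: $r(A,\alpha)=\{r(\lambda): \mathscr{L}(\lambda)=\alpha,\ s(\lambda)\in A\}$ for $\alpha\in\mathscr{L}^{\geq1}$, $r(A,\omega)=A$, $r(\alpha)=r(\mathscr{E}^0,\alpha)$ (and $r(A,\alpha)=\emptyset$ if no such path exists), and $\mathscr{L}(A\mathscr{E}^1)=\{a\in\mathscr{A}:r(A,a)\neq\emptyset\}$. A labelled space is a triple $(\mathscr{E},\mathscr{L},\mathscr{B})$ with $\mathscr{B}$ a family of subsets of $\mathscr{E}^0$ closed under finite intersections and finite unions, containing $r(\alpha)$ for all $\alpha\in\mathscr{L}^{\geq1}$, and with $r(A,\alpha)\in\mathscr{B}$ for $A\in\mathscr{B}$, $\alpha\in\mathscr{L}^*$. It is weakly left-resolving if $r(A\cap B,\alpha)=r(A,\alpha)\cap r(B,\alpha)$ for all $A,B\in\mathscr{B}$, $\alpha\in\mathscr{L}^{\geq 1}$; it is normal if it is weakly left-resolving and $\mathscr{B}$ is closed under relative complements. $\mathscr{B}_\alpha=\{A\in\mathscr{B}: A\subseteq r(\alpha)\}$ (so $\mathscr{B}_\omega=\mathscr{B}$). **Condition $(L_{\mathscr{B}})$.** A cycle is a pair $(\alpha,A)$ with $\alpha\in\mathscr{L}^{\geq1}$ and $\emptyset\neq A\in\mathscr{B}_\alpha$ such that $r(B,\alpha)=B$ for every $B\in\mathscr{B}_\alpha$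 with $B\subseteq A$. A cycle $(\alpha,A)$ has an exit if there exist $0\leq k\leq|\alpha|$ and $\emptyset\neq B\in\mathscr{B}$ with $B\subseteq r(A,\alpha_{1,k})$ and $\mathscr{L}(B\mathscr{E}^1)\neq\{\alpha_{k+1}\}$ (where $\alpha_{|\alpha|+1}:=\alpha_1$). Condition $(L_{\mathscr{B}})$: every cycle has an exit. **Hereditary and saturated.** A non-empty $A\in\mathscr{B}$ is regular if $0<|\mathscr{L}(B\mathscr{E}^1)|<\infty$ for every $B\in\mathscr{B}$ with $\emptyset\neq B\subseteq A$; $\mathscr{B}_{reg}$ is the set of regular elements together with $\emptyset$. A non-empty subset $H\subseteq\mathscr{B}$ is hereditary if (i) $r(A,\alpha)\in H$ for $A\in H$, $\alpha\in\mathscr{L}^*$; (ii) $A\cup B\in H$ for $A,B\in H$; (iii) $B\in\mathscr{B}$, $B\subseteq A\in H$ imply $B\in H$. A hereditary $H$ is saturated if $A\in\mathscr{B}_{reg}$ and $r(A,a)\in H$ for all $a\in\mathscr{A}$ imply $A\in H$. **The C*-algebra.** $C^*(\mathscr{E},\mathscr{L},\mathscr{B})$ is the universal C*-algebra generated by projections $\{p_A:A\in\mathscr{B}\}$ and partial isometries $\{s_a:a\in\mathscr{A}\}$ subject to: (i) $p_{A\cap B}=p_Ap_B$, $p_{A\cup B}=p_A+p_B-p_{A\cap B}$, $p_\emptyset=0$; (ii) $p_As_a=s_ap_{r(A,a)}$; (iii) $s_a^*s_a=p_{r(a)}$ and $s_b^*s_a=0$ if $b\neq a$; (iv) $p_A=\sum_{a\in\mathscr{L}(A\mathscr{E}^1)}s_ap_{r(A,a)}s_a^*$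 for every $A\in\mathscr{B}$ such that $0<\#\mathscr{L}(A\mathscr{E}^1)<\infty$ and there is no $B\in\mathscr{B}$ with $\emptyset\neq B\subseteq A\cap\mathscr{E}^0_{sink}$. **Tight spectrum.** $E(S)=\{(\alpha,A,\alpha):\alpha\in\mathscr{L}^*,\ \emptyset\neq A\in\mathscr{B}_\alpha\}\cup\{0\}$ is a meet semilattice with zero, where for non-zero elements $(\alpha,A,\alpha)\leq(\beta,B,\beta)$ iff $\alpha=\beta\alpha'$ and $A\subseteq r(B,\alpha')$. A filter in $E(S)$ is a non-empty upward closed subset, closed under meets, not containing $0$; ultrafilters are maximal filters. Filters are identified with their characteristic functions, given the topology of pointwise convergence; the tight spectrum $\mathsf{T}$ is the closure of the set of ultrafilters; its elements are the tight filters. For $e\in E(S)$, $V_e=\{\xi\in\mathsf{T}:e\in\xi\}$; the sets $V_e\setminus(V_{e_1}\cup\dots\cup V_{e_n})$ form a basis of compact-open sets of the Hausdorff space $\mathsf{T}$. Each tight filter $\xi$ has an associated word $\alpha\in\overline{\mathscr{L}^{\leq\infty}}$ (write $\xi=\xi^\alpha$) and filters $\xi_n=\{A\in\mathscr{B}:(\alpha_{1,n},A,\alpha_{1,n})\in\xi\}$, $0\le n\le|\alpha|$ ($n<\infty$), where $\xi_0$ may be empty; $(\beta,A,\beta)\in\xi^\alpha$ iff $\beta$ is a beginning of $\alpha$ and $A\in\xi_{|\beta|}$, and $\xi$ is determined by $\alpha$ and the family $\{\xi_n\}$. $\mathsf{T}_\alpha$ denotes the tight filters with word $\alpha$. **Gluing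 and cutting maps.** For $\alpha\in\mathscr{L}^{\geq1}$ and $\beta\in\overline{\mathscr{L}^{\leq\infty}}$ with $\alpha\beta\in\overline{\mathscr{L}^{\leq\infty}}$, let $\mathsf{T}_{(\alpha)\beta}=\{\xi\in\mathsf{T}_\beta:\xi_0\text{ is an ultrafilter in }\mathscr{B}\text{ with }r(\alpha)\in\xi_0\}$. The map $G_{(\alpha)\beta}:\mathsf{T}_{(\alpha)\beta}\to\mathsf{T}_{\alpha\beta}$ sends $\xi$ to $\eta$, where: if $\beta=\omega$, $\eta_{|\alpha|}=\{C\cap r(\alpha):C\in\xi_0\}$ and $\eta_i=\{D\in\mathscr{B}_{\alpha_{1,i}}:r(D,\alpha_{i+1,|\alpha|})\in\eta_{|\alpha|}\}$ for $0\leq i<|\alpha|$; if $\beta\neq\omega$, $\eta_{|\alpha|+n}=\{C\cap r(\alpha\beta_{1,n}):C\in\xi_n\}$ for $1\leq n\leq|\beta|$ ($n<\infty$) and $\eta_i=\{D\in\mathscr{B}_{\alpha_{1,i}}:r(D,\alpha_{i+1,|\alpha|}\beta_1)\in\eta_{|\alpha|+1}\}$ for $0\le i\le|\alpha|$. Its inverse $H_{[\alpha]\beta}:\mathsf{T}_{\alpha\beta}\to\mathsf{T}_{(\alpha)\beta}$ sends $\xi$ to $\eta$ with $\eta_n=\{C\in\mathscr{B}_{\beta_{1,n}}:D\subseteq C\text{ for some }D\in\xi_{n+|\alpha|}\}$, $0\le n\le|\beta|$ ($n<\infty$). **Partial action and groupoid.** Let $\mathbb{F}$ be the free group on $\mathscr{A}$;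 identify its identity with $\omega$ and words over $\mathscr{A}$ with elements of $\mathbb{F}$. Put $V_\omega=\mathsf{T}$, $\phi_\omega=\mathrm{id}$; for $a\in\mathscr{A}$, $V_a=V_{(a,r(a),a)}$ (the disjoint union of the $\mathsf{T}_{a\beta}$), $V_{a^{-1}}=V_{(\omega,r(a),\omega)}$ (the disjoint union of the $\mathsf{T}_{(a)\beta}$), $\phi_a:V_{a^{-1}}\to V_a$ with $\phi_a|_{\mathsf{T}_{(a)\beta}}=G_{(a)\beta}$, and $\phi_{a^{-1}}=\phi_a^{-1}$. For $t=a_n\cdots a_1$ reduced, $a_i\in\mathscr{A}\cup\mathscr{A}^{-1}$, $n\geq2$, inductively $V_{t^{-1}}=\phi_{a_{n-1}\cdots a_1}^{-1}(V_{a_n^{-1}})$ and $\phi_t=\phi_{a_n}\circ\phi_{a_{n-1}\cdots a_1}$ on $V_{t^{-1}}$, so $\phi_t:V_{t^{-1}}\to V_t$. $\mathcal{G}=\{(\xi,t,\eta)\in\mathsf{T}\times\mathbb{F}\times\mathsf{T}:\eta\in V_{t^{-1}},\ \xi=\phi_t(\eta)\}$ with $(\xi,s,\eta)(\eta,t,\rho)=(\xi,st,\rho)$, $(\xi,t,\eta)^{-1}=(\eta,t^{-1},\xi)$, and the topology inherited from the product topology ($\mathbb{F}$ discrete). *)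

theory Defs
  imports
    "Graph_Theory.Arc_Walk"
    "HOL-Analysis.Analysis"
    "HOL-Library.Poly_Mapping"
begin

section \<open>Universal C*-algebras given by generators and relations\<close>

text \<open>
  The free *-algebra on a set of generators consists of the noncommutative complex polynomials,
  without constant term, in the generators and their formal adjoints. A letter \<open>(g, False)\<close>
  stands for the generator \<open>g\<close>, and \<open>(g, True)\<close> for its adjoint. Wrapping the words in a
  datatype makes them a multiplicative monoid in the additive notation that
  \<^theory>\<open>HOL-Library.Poly_Mapping\<close> uses for exponents, so that the library's
  convolution product on finitely supported functions is the product of the free algebra.
\<close>

datatype 'g monomial = Mono (letters: "('g \<times> bool) list")

instantiation monomial :: (type) monoid_add
begin

definition zero_monomial :: "'a monomial" where
  "zero_monomial = Mono []"

definition plus_monomial :: "'a monomial \<Rightarrow> 'a monomial \<Rightarrow> 'a monomial" where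
  "plus_monomial u v = Mono (letters u @ letters v)"

instance
  by standard (simp_all add: zero_monomial_def plus_monomial_def)

end

type_synonym 'g ncpoly = "'g monomial \<Rightarrow>\<^sub>0 complex"

definition nc_gen :: "'g \<Rightarrow> 'g ncpoly" where
  "nc_gen g = Poly_Mapping.single (Mono [(g, False)]) 1"

definition nc_scale :: "complex \<Rightarrow> 'g ncpoly \<Rightarrow> 'g ncpoly" where
  "nc_scale c x = Poly_Mapping.map (\<lambda>z. c * z) x"

definition mono_star :: "'g monomial \<Rightarrow> 'g monomial" where
  "mono_star m = Mono (rev (map (\<lambda>(g, b). (g, \<not> b)) (letters m)))"

text \<open>As \<^const>\<open>mono_star\<close> is an involution, this is the conjugate-linear extension of
  \<^const>\<open>mono_star\<close>.\<close>
definition nc_star :: "'g ncpoly \<Rightarrow> 'g ncpoly" where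
  "nc_star x = Poly_Mapping.map_key mono_star (Poly_Mapping.map cnj x)"

definition free_star_algebra :: "'g set \<Rightarrow> 'g ncpoly set" where
  "free_star_algebra X =
     {x. \<forall>m \<in> Poly_Mapping.keys x. letters m \<noteq> [] \<and> fst ` set (letters m) \<subseteq> X}"

definition cstar_seminorm_on :: "'g ncpoly set \<Rightarrow> ('g ncpoly \<Rightarrow> real) \<Rightarrow> bool" where
  "cstar_seminorm_on F q \<longleftrightarrow>
     (\<forall>x\<in>F. 0 \<le> q x) \<and>
     (\<forall>x\<in>F. \<forall>y\<in>F. q (x + y) \<le> q x + q y) \<and>
     (\<forall>c. \<forall>x\<in>F. q (nc_scale c x) = cmod c * q x) \<and>
     (\<forall>x\<in>F. \<forall>y\<in>F. q (x * y) \<le> q x * q y) \<and>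
     (\<forall>x\<in>F. q (nc_star x * x) = (q x)\<^sup>2)"

text \<open>
  The C*-seminorms vanishing on the relators \<open>R\<close> are exactly the functions
  \<open>x \<mapsto> \<parallel>\<pi>(x)\<parallel>\<close> for *-homomorphisms \<open>\<pi>\<close> from the free *-algebra into C*-algebras in
  which the relations hold (given such a seminorm, take the Hausdorff completion). Their supremum
  is finite whenever the relations bound the norm of each generator, as they do when the generators
  are projections and partial isometries.
\<close>
definition universal_seminorm :: "'g set \<Rightarrow> 'g ncpoly set \<Rightarrow> 'g ncpoly \<Rightarrow> real" where
  "universal_seminorm X R x =
     Sup {q x | q. cstar_seminorm_on (free_star_algebra X) q \<and> (\<forall>r\<in>R. q r = 0)}"

record 'c star_algebra =
  sa_carrier :: "'c set"
  sa_zero :: 'c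
  sa_add :: "'c \<Rightarrow> 'c \<Rightarrow> 'c"
  sa_scale :: "complex \<Rightarrow> 'c \<Rightarrow> 'c"
  sa_mult :: "'c \<Rightarrow> 'c \<Rightarrow> 'c"
  sa_star :: "'c \<Rightarrow> 'c"
  sa_norm :: "'c \<Rightarrow> real"

text \<open>Hausdorff completion of \<open>F\<close> with respect to a seminorm \<open>q\<close>: Cauchy sequences
  modulo null sequences, with the operations induced by the pointwise ones.\<close>

definition cauchy_seqs :: "'g ncpoly set \<Rightarrow> ('g ncpoly \<Rightarrow> real) \<Rightarrow> (nat \<Rightarrow> 'g ncpoly) set" where
  "cauchy_seqs F q =
     {f. range f \<subseteq> F \<and> (\<forall>e>0. \<exists>N. \<forall>m\<ge>N. \<forall>n\<ge>N. q (f m - f n) < e)}"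

definition null_rel ::
  "'g ncpoly set \<Rightarrow> ('g ncpoly \<Rightarrow> real) \<Rightarrow> ((nat \<Rightarrow> 'g ncpoly) \<times> (nat \<Rightarrow> 'g ncpoly)) set" where
  "null_rel F q =
     {(f, g). f \<in> cauchy_seqs F q \<and> g \<in> cauchy_seqs F q \<and> (\<lambda>n. q (f n - g n)) \<longlonglongrightarrow> 0}"

definition completion ::
  "'g ncpoly set \<Rightarrow> ('g ncpoly \<Rightarrow> real) \<Rightarrow> (nat \<Rightarrow> 'g ncpoly) set star_algebra" where
  "completion F q =
     \<lparr> sa_carrier = cauchy_seqs F q // null_rel F q,
       sa_zero = null_rel F q `` {\<lambda>n. 0},
       sa_add = (\<lambda>X Y. \<Union>f\<in>X. \<Union>g\<in>Y. null_rel F q `` {\<lambda>n. f n + g n}),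
       sa_scale = (\<lambda>c X. \<Union>f\<in>X. null_rel F q `` {\<lambda>n. nc_scale c (f n)}),
       sa_mult = (\<lambda>X Y. \<Union>f\<in>X. \<Union>g\<in>Y. null_rel F q `` {\<lambda>n. f n * g n}),
       sa_star = (\<lambda>X. \<Union>f\<in>X. null_rel F q `` {\<lambda>n. nc_star (f n)}),
       sa_norm = (\<lambda>X. THE r. \<forall>f\<in>X. (\<lambda>n. q (f n)) \<longlonglongrightarrow> r) \<rparr>"

definition universal_cstar ::
  "'g set \<Rightarrow> 'g ncpoly set \<Rightarrow> (nat \<Rightarrow> 'g ncpoly) set star_algebra" where
  "universal_cstar X R = completion (free_star_algebra X) (universal_seminorm X R)"

definition closed_ideal :: "'c star_algebra \<Rightarrow> 'c set \<Rightarrow> bool" where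
  "closed_ideal C I \<longleftrightarrow>
     I \<subseteq> sa_carrier C \<and>
     sa_zero C \<in> I \<and>
     (\<forall>x\<in>I. \<forall>y\<in>I. sa_add C x y \<in> I) \<and>
     (\<forall>c. \<forall>x\<in>I. sa_scale C c x \<in> I) \<and>
     (\<forall>x\<in>I. \<forall>y\<in>sa_carrier C. sa_mult C x y \<in> I \<and> sa_mult C y x \<in> I) \<and>
     (\<forall>f. \<forall>x\<in>sa_carrier C. range f \<subseteq> I \<and>
        (\<lambda>n. sa_norm C (sa_add C (f n) (sa_scale C (-1) x))) \<longlonglongrightarrow> 0 \<longrightarrow> x \<in> I)"

definition simple_cstar :: "'c star_algebra \<Rightarrow> bool" where
  "simple_cstar C \<longleftrightarrow> (\<forall>I. closed_ideal C I \<longrightarrow> I = {sa_zero C} \<or> I = sa_carrier C)"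


section \<open>Labelled spaces\<close>

text \<open>The source and range of an edge are its \<^const>\<open>tail\<close> and \<^const>\<open>head\<close>. The
  alphabet is by definition the image of the labelling map, which makes the latter surjective.\<close>

locale labelled_triple = pre_digraph E
  for E :: "('v, 'e) pre_digraph" +
  fixes Lab :: "'e \<Rightarrow> 'l"
    and B :: "'v set set"
begin

definition alphabet :: "'l set" where
  "alphabet = Lab ` arcs E"

definition sinks :: "'v set" where
  "sinks = {v \<in> verts E. \<forall>e \<in> arcs E. tail E e \<noteq> v}"

definition pos_words :: "'l list set" where
  "pos_words = {map Lab p | u p v. awalk u p v \<and> p \<noteq> []}"

definition words :: "'l list set" where
  "words = insert [] pos_words"

text \<open>For \<open>\<alpha> = []\<close> and \<open>A \<subseteq> verts E\<close> this is \<open>A\<close>.\<close>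
definition rel_range :: "'v set \<Rightarrow> 'l list \<Rightarrow> 'v set" where
  "rel_range A \<alpha> = {v. \<exists>u p. u \<in> A \<and> awalk u p v \<and> map Lab p = \<alpha>}"

definition word_range :: "'l list \<Rightarrow> 'v set" where
  "word_range \<alpha> = rel_range (verts E) \<alpha>"

definition out_labels :: "'v set \<Rightarrow> 'l set" where
  "out_labels A = {a \<in> alphabet. rel_range A [a] \<noteq> {}}"

definition B_at :: "'l list \<Rightarrow> 'v set set" where
  "B_at \<alpha> = {A \<in> B. A \<subseteq> word_range \<alpha>}"

subsection \<open>Cycles, hereditary and saturated sets\<close>

definition lb_cycle :: "'l list \<Rightarrow> 'v set \<Rightarrow> bool" where
  "lb_cycle \<alpha> A \<longleftrightarrow>
     \<alpha> \<in> pos_words \<and> A \<noteq> {} \<and> A \<in> B_at \<alpha> \<and> (\<forall>C \<in> B_at \<alpha>. C \<subseteq> A \<longrightarrow> rel_range C \<alpha> = C)"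

text \<open>Letters are numbered from 0 here, and the index modulo \<open>length \<alpha>\<close> implements the
  convention that the letter following the last one is the first one.\<close>
definition has_exit :: "'l list \<Rightarrow> 'v set \<Rightarrow> bool" where
  "has_exit \<alpha> A \<longleftrightarrow>
     (\<exists>k \<le> length \<alpha>. \<exists>C \<in> B. C \<noteq> {} \<and> C \<subseteq> rel_range A (take k \<alpha>) \<and>
        out_labels C \<noteq> {\<alpha> ! (k mod length \<alpha>)})"

definition condition_LB :: bool where
  "condition_LB \<longleftrightarrow> (\<forall>\<alpha> A. lb_cycle \<alpha> A \<longrightarrow> has_exit \<alpha> A)"

definition regular_set :: "'v set \<Rightarrow> bool" where
  "regular_set A \<longleftrightarrow>
     A \<in> B \<and> A \<noteq> {} \<and>
     (\<forall>C \<in> B. C \<noteq> {} \<and> C \<subseteq> A \<longrightarrow> out_labels C \<noteq> {} \<and> finite (out_labels C))"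

definition B_reg :: "'v set set" where
  "B_reg = insert {} {A. regular_set A}"

definition hereditary :: "'v set set \<Rightarrow> bool" where
  "hereditary H \<longleftrightarrow>
     H \<subseteq> B \<and> H \<noteq> {} \<and>
     (\<forall>A \<in> H. \<forall>\<alpha> \<in> words. rel_range A \<alpha> \<in> H) \<and>
     (\<forall>A \<in> H. \<forall>C \<in> H. A \<union> C \<in> H) \<and>
     (\<forall>A \<in> H. \<forall>C \<in> B. C \<subseteq> A \<longrightarrow> C \<in> H)"

definition saturated :: "'v set set \<Rightarrow> bool" where
  "saturated H \<longleftrightarrow>
     (\<forall>A \<in> B_reg. (\<forall>a \<in> alphabet. rel_range A [a] \<in> H) \<longrightarrow> A \<in> H)"

end

locale labelled_space = labelled_triple E Lab B + wf_digraph E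
  for E :: "('v, 'e) pre_digraph" and Lab :: "'e \<Rightarrow> 'l" and B :: "'v set set" +
  assumes arcs_nonempty: "arcs E \<noteq> {}"
    and B_subset: "A \<in> B \<Longrightarrow> A \<subseteq> verts E"
    and B_Int: "\<lbrakk>A \<in> B; C \<in> B\<rbrakk> \<Longrightarrow> A \<inter> C \<in> B"
    and B_Un: "\<lbrakk>A \<in> B; C \<in> B\<rbrakk> \<Longrightarrow> A \<union> C \<in> B"
    and B_word_range: "\<alpha> \<in> pos_words \<Longrightarrow> word_range \<alpha> \<in> B"
    and B_rel_range: "\<lbrakk>A \<in> B; \<alpha> \<in> words\<rbrakk> \<Longrightarrow> rel_range A \<alpha> \<in> B"

locale normal_labelled_space = labelled_space E Lab B
  for E :: "('v, 'e) pre_digraph" and Lab :: "'e \<Rightarrow> 'l" and B :: "'v set set" +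
  assumes weakly_left_resolving:
      "\<lbrakk>A \<in> B; C \<in> B; \<alpha> \<in> pos_words\<rbrakk> \<Longrightarrow>
         rel_range (A \<inter> C) \<alpha> = rel_range A \<alpha> \<inter> rel_range C \<alpha>"
    and B_Diff: "\<lbrakk>A \<in> B; C \<in> B\<rbrakk> \<Longrightarrow> A - C \<in> B"


section \<open>The C*-algebra of a labelled space\<close>

datatype ('v, 'l) generator = Proj "'v set" | Piso 'l

abbreviation gp :: "'v set \<Rightarrow> ('v, 'l) generator ncpoly" where
  "gp A \<equiv> nc_gen (Proj A)"

abbreviation gs :: "'l \<Rightarrow> ('v, 'l) generator ncpoly" where
  "gs a \<equiv> nc_gen (Piso a)"

context labelled_triple
begin

definition generators :: "('v, 'l) generator set" where
  "generators = Proj ` B \<union> Piso ` alphabet"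

inductive_set relators :: "('v, 'l) generator ncpoly set" where
  proj_idem: "A \<in> B \<Longrightarrow> gp A * gp A - gp A \<in> relators"
| proj_adj: "A \<in> B \<Longrightarrow> nc_star (gp A) - gp A \<in> relators"
| partial_isometry: "a \<in> alphabet \<Longrightarrow> gs a * nc_star (gs a) * gs a - gs a \<in> relators"
| p_Int: "\<lbrakk>A \<in> B; C \<in> B\<rbrakk> \<Longrightarrow> gp (A \<inter> C) - gp A * gp C \<in> relators"
| p_Un: "\<lbrakk>A \<in> B; C \<in> B\<rbrakk> \<Longrightarrow> gp (A \<union> C) - (gp A + gp C - gp (A \<inter> C)) \<in> relators"
| p_empty: "gp {} \<in> relators"
| p_s: "\<lbrakk>A \<in> B; a \<in> alphabet\<rbrakk> \<Longrightarrow> gp A * gs a - gs a * gp (rel_range A [a]) \<in> relators"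
| s_star_s: "a \<in> alphabet \<Longrightarrow> nc_star (gs a) * gs a - gp (word_range [a]) \<in> relators"
| s_orth: "\<lbrakk>a \<in> alphabet; b \<in> alphabet; b \<noteq> a\<rbrakk> \<Longrightarrow> nc_star (gs b) * gs a \<in> relators"
| p_sum: "\<lbrakk>A \<in> B; out_labels A \<noteq> {}; finite (out_labels A);
      \<not> (\<exists>C \<in> B. C \<noteq> {} \<and> C \<subseteq> A \<inter> sinks)\<rbrakk> \<Longrightarrow>
    gp A - (\<Sum>a \<in> out_labels A. gs a * gp (rel_range A [a]) * nc_star (gs a)) \<in> relators"

definition cstar_alg :: "(nat \<Rightarrow> ('v, 'l) generator ncpoly) set star_algebra" where
  "cstar_alg = universal_cstar generators relators"

end


section \<open>The tight spectrum\<close>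

text \<open>\<open>Idem \<alpha> A\<close> stands for \<open>(\<alpha>, A, \<alpha>)\<close>.\<close>
datatype ('v, 'l) idem = Zero | Idem "'l list" "'v set"

datatype 'l xword = Fin "'l list" | Inf "nat \<Rightarrow> 'l"

primrec xlength :: "'l xword \<Rightarrow> enat" where
  "xlength (Fin \<alpha>) = enat (length \<alpha>)"
| "xlength (Inf f) = \<infinity>"

text \<open>\<open>xtake n \<alpha>\<close> is \<open>\<alpha>\<^bsub>1,n\<^esub>\<close>, for \<open>n \<le> xlength \<alpha>\<close>.\<close>
primrec xtake :: "nat \<Rightarrow> 'l xword \<Rightarrow> 'l list" where
  "xtake n (Fin \<alpha>) = take n \<alpha>"
| "xtake n (Inf f) = map f [0..<n]"

primrec xappend :: "'l list \<Rightarrow> 'l xword \<Rightarrow> 'l xword" where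
  "xappend \<alpha> (Fin \<beta>) = Fin (\<alpha> @ \<beta>)"
| "xappend \<alpha> (Inf f) = Inf (\<lambda>n. if n < length \<alpha> then \<alpha> ! n else f (n - length \<alpha>))"

definition is_beginning :: "'l list \<Rightarrow> 'l xword \<Rightarrow> bool" where
  "is_beginning \<beta> \<alpha> \<longleftrightarrow> enat (length \<beta>) \<le> xlength \<alpha> \<and> xtake (length \<beta>) \<alpha> = \<beta>"

context labelled_triple
begin

definition ES :: "('v, 'l) idem set" where
  "ES = insert Zero {Idem \<alpha> A | \<alpha> A. \<alpha> \<in> words \<and> A \<noteq> {} \<and> A \<in> B_at \<alpha>}"

fun idem_le :: "('v, 'l) idem \<Rightarrow> ('v, 'l) idem \<Rightarrow> bool" where
  "idem_le Zero y = True"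
| "idem_le (Idem \<alpha> A) Zero = False"
| "idem_le (Idem \<alpha> A) (Idem \<beta> C) = (\<exists>\<alpha>'. \<alpha> = \<beta> @ \<alpha>' \<and> A \<subseteq> rel_range C \<alpha>')"

definition is_meet :: "('v, 'l) idem \<Rightarrow> ('v, 'l) idem \<Rightarrow> ('v, 'l) idem \<Rightarrow> bool" where
  "is_meet x y z \<longleftrightarrow>
     z \<in> ES \<and> idem_le z x \<and> idem_le z y \<and>
     (\<forall>w \<in> ES. idem_le w x \<and> idem_le w y \<longrightarrow> idem_le w z)"

definition es_filter :: "('v, 'l) idem set \<Rightarrow> bool" where
  "es_filter \<xi> \<longleftrightarrow>
     \<xi> \<subseteq> ES \<and> \<xi> \<noteq> {} \<and> Zero \<notin> \<xi> \<and>
     (\<forall>x \<in> \<xi>. \<forall>y \<in> ES. idem_le x y \<longrightarrow> y \<in> \<xi>) \<and>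
     (\<forall>x \<in> \<xi>. \<forall>y \<in> \<xi>. \<exists>z \<in> \<xi>. is_meet x y z)"

definition es_ultrafilter :: "('v, 'l) idem set \<Rightarrow> bool" where
  "es_ultrafilter \<xi> \<longleftrightarrow> es_filter \<xi> \<and> (\<forall>\<eta>. es_filter \<eta> \<and> \<xi> \<subseteq> \<eta> \<longrightarrow> \<eta> = \<xi>)"

text \<open>Pointwise convergence of characteristic functions on \<^term>\<open>ES\<close>.\<close>
definition filter_topology :: "('v, 'l) idem set topology" where
  "filter_topology =
     pullback_topology {\<xi>. es_filter \<xi>} (\<lambda>\<xi>. \<lambda>e\<in>ES. e \<in> \<xi>)
       (product_topology (\<lambda>_. discrete_topology (UNIV :: bool set)) ES)"

definition tight :: "('v, 'l) idem set set" where
  "tight = filter_topology closure_of {\<xi>. es_ultrafilter \<xi>}"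

definition tight_topology :: "('v, 'l) idem set topology" where
  "tight_topology = subtopology filter_topology tight"

definition V_of :: "('v, 'l) idem \<Rightarrow> ('v, 'l) idem set set" where
  "V_of e = {\<xi> \<in> tight. e \<in> \<xi>}"

text \<open>The word of a filter is the one whose non-empty beginnings are the non-empty words
  occurring in the filter. The empty word has to be left out, as it need not occur in a filter
  whose word is non-empty (\<open>\<xi>\<^sub>0\<close> may be empty).\<close>
definition filter_word :: "('v, 'l) idem set \<Rightarrow> 'l xword" where
  "filter_word \<xi> =
     (THE \<alpha>. \<forall>\<beta>. \<beta> \<noteq> [] \<longrightarrow> (is_beginning \<beta> \<alpha> \<longleftrightarrow> (\<exists>A. Idem \<beta> A \<in> \<xi>)))"

text \<open>The filters \<open>\<xi>\<^sub>n\<close> for \<open>n \<le> xlength (filter_word \<xi>)\<close>.\<close>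
definition component :: "('v, 'l) idem set \<Rightarrow> nat \<Rightarrow> 'v set set" where
  "component \<xi> n = {A \<in> B. Idem (xtake n (filter_word \<xi>)) A \<in> \<xi>}"

text \<open>The filter with word \<open>\<alpha>\<close> and family \<open>F\<close>.\<close>
definition filter_of :: "'l xword \<Rightarrow> (nat \<Rightarrow> 'v set set) \<Rightarrow> ('v, 'l) idem set" where
  "filter_of \<alpha> F = {Idem (xtake n \<alpha>) A | n A. enat n \<le> xlength \<alpha> \<and> A \<in> F n}"


section \<open>Gluing maps, the partial action and the groupoid\<close>

text \<open>The family \<open>\<eta>\<^sub>i\<close> of \<open>\<eta> = G\<^bsub>(\<alpha>)\<beta>\<^esub>(\<xi>)\<close>. With \<open>m = min 1 |\<beta>|\<close>, both cases of
  the definition read as follows: \<open>\<eta>\<close> is obtained from \<open>\<xi>\<close> by intersecting with ranges at the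
  levels \<open>\<ge> |\<alpha>| + m\<close>, and all lower levels are pulled back from level \<open>|\<alpha>| + m\<close>.\<close>
definition glue_family ::
  "'l list \<Rightarrow> 'l xword \<Rightarrow> ('v, 'l) idem set \<Rightarrow> nat \<Rightarrow> 'v set set" where
  "glue_family \<alpha> \<beta> \<xi> i =
     (let m = (if \<beta> = Fin [] then 0 else 1);
          upper = (\<lambda>n. {C \<inter> word_range (\<alpha> @ xtake n \<beta>) | C. C \<in> component \<xi> n})
      in if length \<alpha> + m \<le> i then upper (i - length \<alpha>)
         else {D \<in> B_at (take i \<alpha>). rel_range D (drop i \<alpha> @ xtake m \<beta>) \<in> upper m})"

definition glue :: "'l list \<Rightarrow> 'l xword \<Rightarrow> ('v, 'l) idem set \<Rightarrow> ('v, 'l) idem set" where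
  "glue \<alpha> \<beta> \<xi> = filter_of (xappend \<alpha> \<beta>) (glue_family \<alpha> \<beta> \<xi>)"

end

text \<open>The free group on the alphabet, as the set of reduced words in the letters and their
  inverses. As in \<open>t = a\<^sub>n \<cdots> a\<^sub>1\<close>, the head of the list is the leftmost letter.\<close>

datatype 'l fg_letter = Letter (underlying: 'l) | LetterInv (underlying: 'l)

fun fg_inv :: "'l fg_letter \<Rightarrow> 'l fg_letter" where
  "fg_inv (Letter a) = LetterInv a"
| "fg_inv (LetterInv a) = Letter a"

context labelled_triple
begin

definition free_group :: "'l fg_letter list set" where
  "free_group =
     {t. underlying ` set t \<subseteq> alphabet \<and> successively (\<lambda>x y. y \<noteq> fg_inv x) t}"

text \<open>\<open>letter_dom x\<close> is the domain \<open>V\<close> with index \<open>x\<^sup>-\<^sup>1\<close>, of the map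
  \<open>\<phi>\<^sub>x\<close> = \<open>letter_map x\<close>.\<close>

fun letter_dom :: "'l fg_letter \<Rightarrow> ('v, 'l) idem set set" where
  "letter_dom (Letter a) = V_of (Idem [] (word_range [a]))"
| "letter_dom (LetterInv a) = V_of (Idem [a] (word_range [a]))"

definition letter_map :: "'l fg_letter \<Rightarrow> ('v, 'l) idem set \<Rightarrow> ('v, 'l) idem set" where
  "letter_map x =
     (let \<phi> = (\<lambda>a \<xi>. glue [a] (filter_word \<xi>) \<xi>)
      in case x of
           Letter a \<Rightarrow> \<phi> a
         | LetterInv a \<Rightarrow> inv_into (letter_dom (Letter a)) (\<phi> a))"

primrec act :: "'l fg_letter list \<Rightarrow> ('v, 'l) idem set \<Rightarrow> ('v, 'l) idem set" where
  "act [] = id"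
| "act (x # t) = letter_map x \<circ> act t"

primrec act_dom :: "'l fg_letter list \<Rightarrow> ('v, 'l) idem set set" where
  "act_dom [] = tight"
| "act_dom (x # t) = {\<eta> \<in> act_dom t. act t \<eta> \<in> letter_dom x}"

definition groupoid ::
  "(('v, 'l) idem set \<times> 'l fg_letter list \<times> ('v, 'l) idem set) set" where
  "groupoid = {(act t \<eta>, t, \<eta>) | t \<eta>. t \<in> free_group \<and> \<eta> \<in> act_dom t}"

text \<open>The groupoid operations are not needed for second countability, which only concerns the
  underlying topological space.\<close>
definition groupoid_topology ::
  "(('v, 'l) idem set \<times> 'l fg_letter list \<times> ('v, 'l) idem set) topology" where
  "groupoid_topology =
     subtopology
       (prod_topology tight_topology (prod_topology (discrete_topology free_group) tight_topology))
       groupoid"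

end

end

theory Submission
  imports Defs "HOL-Real_Asymp.Real_Asymp"
begin

text \<open>
  A boundary path is a sequence of ultrafilters of \<open>B\<close> joined by letters. The letters act on
  boundary paths by prepending, and this yields concrete representations: a graded one, on boundary
  paths times the integers, an ungraded one, and, for hereditary saturated \<open>H\<close>, one on the paths
  that avoid \<open>H\<close>.

  The graded one computes the universal norm. Elements of degree 0 are cut into finitely many blocks
  of combinations of orthogonal projections, and a bound \<open>u \<le> K p\<close> between C*-seminorms on a
  *-subalgebra improves to \<open>u \<le> p\<close> on taking powers of \<open>x\<^sup>* x\<close>. For general \<open>x\<close>, the number of
  degrees occurring in \<open>(x\<^sup>* x) ^ m\<close> is linear in \<open>m\<close>, and the same argument applies.

  Hence a nonzero element of an ideal has a nonzero matrix entry, without loss of generality on the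
  diagonal. If every cycle has an exit, then compressing by the projection \<open>R\<close> of a small cylinder
  kills all monomials of nonzero degree in a polynomial approximation, so that \<open>R\<close> is at distance
  less than 1 from the ideal and lies in it. The sets whose projections lie in the ideal are
  hereditary and saturated. Conversely, the kernel of the representation avoiding \<open>H\<close> is a proper
  ideal, and so is the kernel of the ungraded representation, which is nonzero if some cycle has no
  exit.
\<close>

section \<open>Noncommutative polynomials\<close>

text \<open>All algebra happens in polynomials modulo the relators; the completion is touched only
  through Cauchy sequences. The obstacle is that a seminorm defined as a supremum is hard to bound
  from above. This is why it is identified with one concrete operator norm, whose size is visible in
  matrix entries.

  Boundary paths must be exactly as long as the summation relation demands: a path may stop only at
  an ultrafilter without regular members and has to go on at every other one. Hence ultrafilters
  instead of vertices as the points of a path, and saturation as the condition for paths avoiding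
  \<open>H\<close> to exist.

  The integer coordinate separates degrees, so a diagonal entry sees degree 0 only. Monomials of
  degree 0 become scalars on a small cylinder around the path because its ultrafilters are prime;
  the remaining ones are compressed to 0 on a smaller cylinder, which may leave the path. Both can
  be done one monomial at a time, since such decisions survive shrinking of the cylinder.\<close>

lemma ncpoly_induct [case_names single add]:
  fixes x :: "'a \<Rightarrow>\<^sub>0 'b::comm_monoid_add"
  assumes single: "\<And>m c. P (Poly_Mapping.single m c)"
    and add: "\<And>x y. P x \<Longrightarrow> P y \<Longrightarrow> P (x + y)"
  shows "P x"
proof (induction x rule: update_induct)
  case const
  show ?case using single[of undefined 0] by simp
next
  case (update f a b)
  have "Poly_Mapping.update a b f = Poly_Mapping.single a b + f"
  proof (rule poly_mapping_eqI)
    fix k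
    show "Poly_Mapping.lookup (Poly_Mapping.update a b f) k =
        Poly_Mapping.lookup (Poly_Mapping.single a b + f) k"
      using update(1) by (auto simp: lookup_update lookup_add lookup_single in_keys_iff when_def)
  qed
  then show ?case using single add update by metis
qed

lemma ncpoly_sum_keys:
  fixes x :: "'a \<Rightarrow>\<^sub>0 'b::comm_monoid_add"
  shows "x = (\<Sum>m\<in>Poly_Mapping.keys x. Poly_Mapping.single m (Poly_Mapping.lookup x m))"
proof (rule poly_mapping_eqI)
  fix k
  show "Poly_Mapping.lookup x k = Poly_Mapping.lookup
      (\<Sum>m\<in>Poly_Mapping.keys x. Poly_Mapping.single m (Poly_Mapping.lookup x m)) k"
    by (cases "k \<in> Poly_Mapping.keys x")
      (auto simp: lookup_sum lookup_single when_def in_keys_iff)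
qed

text \<open>Constants are multiples of the empty word and lie outside the free *-algebra, but the
  ambient ring is unital. They turn scalar multiplication into ring multiplication, which ring
  simplification can handle.\<close>

abbreviation cst :: "complex \<Rightarrow> 'g ncpoly" where
  "cst c \<equiv> Poly_Mapping.single 0 c"

lemma nc_scale_eq: "nc_scale c x = cst c * x"
  by (simp add: nc_scale_def mult_map_scale_conv_mult)

lemma cst_commute: "x * cst c = cst c * x"
  by (induction x rule: ncpoly_induct) (simp_all add: mult_single ring_distribs mult.commute)

lemma cst_mult: "cst c * cst d = cst (c * d)"
  by (simp add: mult_single)

lemma cst_add: "cst c + cst d = cst (c + d)"
  by (simp add: single_add)

lemma cst_one: "cst 1 = 1"
  by simp

lemma cst_minus_one: "cst (- 1) * x = - x"
  by (metis cst_one mult_1 mult_minus_left single_uminus)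

lemma nc_scale_minus_one: "nc_scale (- 1) x = - x"
  by (simp add: nc_scale_eq cst_minus_one)

section \<open>The involution on polynomials\<close>

lemma mono_star_star [simp]: "mono_star (mono_star m) = m"
  by (cases m) (auto simp: mono_star_def rev_map o_def case_prod_unfold)

lemma inj_mono_star: "inj mono_star"
  by (metis injI mono_star_star)

lemma mono_star_add: "mono_star (m + m') = mono_star m' + mono_star m"
  by (simp add: mono_star_def plus_monomial_def)

lemma mono_star_zero [simp]: "mono_star 0 = 0"
  by (simp add: mono_star_def zero_monomial_def)

lemma lookup_nc_star: "Poly_Mapping.lookup (nc_star x) m = cnj (Poly_Mapping.lookup x (mono_star m))"
  by (auto simp: nc_star_def map_key.rep_eq[OF inj_mono_star] map.rep_eq when_def)

lemma keys_nc_star: "Poly_Mapping.keys (nc_star x) = mono_star ` Poly_Mapping.keys x"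
  by (force simp: in_keys_iff lookup_nc_star image_iff intro: mono_star_star[symmetric])

lemma nc_star_single [simp]: "nc_star (Poly_Mapping.single m c) = Poly_Mapping.single (mono_star m) (cnj c)"
  by (rule poly_mapping_eqI) (auto simp: lookup_nc_star lookup_single when_def)

lemma nc_star_zero [simp]: "nc_star 0 = 0"
  by (rule poly_mapping_eqI) (auto simp: lookup_nc_star)

lemma nc_star_one [simp]: "nc_star 1 = 1"
  by (metis cst_one nc_star_single mono_star_zero complex_cnj_one)

lemma nc_star_add [simp]: "nc_star (x + y) = nc_star x + nc_star y"
  by (rule poly_mapping_eqI) (auto simp: lookup_nc_star lookup_add)

lemma nc_star_minus [simp]: "nc_star (- x) = - nc_star x"
  by (rule poly_mapping_eqI) (auto simp: lookup_nc_star)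

lemma nc_star_diff [simp]: "nc_star (x - y) = nc_star x - nc_star y"
  by (rule poly_mapping_eqI) (auto simp: lookup_nc_star lookup_minus)

lemma nc_star_sum: "nc_star (sum f A) = (\<Sum>i\<in>A. nc_star (f i))"
  by (induction A rule: infinite_finite_induct) auto

lemma nc_star_mult [simp]: "nc_star (x * y) = nc_star y * nc_star x"
proof (induction x rule: ncpoly_induct)
  case (single m c)
  show ?case
    by (induction y rule: ncpoly_induct)
      (simp_all add: mult_single mono_star_add ring_distribs mult.commute)
qed (simp add: ring_distribs)

lemma nc_star_star [simp]: "nc_star (nc_star x) = x"
  by (rule poly_mapping_eqI) (auto simp: lookup_nc_star)

lemma nc_star_power: "nc_star (x ^ n) = nc_star x ^ n"
  by (induction n) (auto simp: power_commutes)

text \<open>The unitization of \<open>free_star_algebra X\<close>. Elements such as \<open>1\<close>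
  or the empty product of generators act as multipliers of the free algebra without belonging to
  it.\<close>

definition unital_free :: "'g set \<Rightarrow> 'g ncpoly set" where
  "unital_free X = {x. \<forall>m \<in> Poly_Mapping.keys x. fst ` set (letters m) \<subseteq> X}"

lemma free_subset_unital: "x \<in> free_star_algebra X \<Longrightarrow> x \<in> unital_free X"
  by (auto simp: free_star_algebra_def unital_free_def)

section \<open>Closure properties of the free *-algebra and of its unitization\<close>

lemma letters_add [simp]: "letters (m + m') = letters m @ letters m'"
  by (simp add: plus_monomial_def)

lemma letters_zero [simp]: "letters 0 = []"
  by (simp add: zero_monomial_def)

lemma letters_mono_star: "fst ` set (letters (mono_star m)) = fst ` set (letters m)"
  "letters (mono_star m) = [] \<longleftrightarrow> letters m = []"
  by (force simp: mono_star_def image_iff)+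

lemma keys_mult_cases:
  assumes "m \<in> Poly_Mapping.keys (x * y)"
  obtains a b where "a \<in> Poly_Mapping.keys x" "b \<in> Poly_Mapping.keys y" "m = a + b"
  using assms keys_mult[of x y] by blast

lemma free_mult1: "x \<in> free_star_algebra X \<Longrightarrow> y \<in> unital_free X \<Longrightarrow> x * y \<in> free_star_algebra X"
  unfolding free_star_algebra_def unital_free_def
  by (fastforce elim!: keys_mult_cases)

lemma free_mult2: "x \<in> unital_free X \<Longrightarrow> y \<in> free_star_algebra X \<Longrightarrow> x * y \<in> free_star_algebra X"
  unfolding free_star_algebra_def unital_free_def
  by (fastforce elim!: keys_mult_cases)

lemma free_mult: "x \<in> free_star_algebra X \<Longrightarrow> y \<in> free_star_algebra X \<Longrightarrow> x * y \<in> free_star_algebra X"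
  using free_mult1 free_subset_unital by blast

lemma free_add: "x \<in> free_star_algebra X \<Longrightarrow> y \<in> free_star_algebra X \<Longrightarrow> x + y \<in> free_star_algebra X"
  unfolding free_star_algebra_def using keys_add[of x y] by blast

lemma free_uminus: "x \<in> free_star_algebra X \<Longrightarrow> - x \<in> free_star_algebra X"
  unfolding free_star_algebra_def by (simp add: in_keys_iff)

lemma free_diff: "x \<in> free_star_algebra X \<Longrightarrow> y \<in> free_star_algebra X \<Longrightarrow> x - y \<in> free_star_algebra X"
  using free_add[OF _ free_uminus, of x X y] by simp

lemma free_zero: "0 \<in> free_star_algebra X"
  by (simp add: free_star_algebra_def)

lemma free_star: "x \<in> free_star_algebra X \<Longrightarrow> nc_star x \<in> free_star_algebra X"
  unfolding free_star_algebra_def by (auto simp: keys_nc_star letters_mono_star)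

lemma free_sum: "(\<And>i. i \<in> A \<Longrightarrow> f i \<in> free_star_algebra X) \<Longrightarrow> sum f A \<in> free_star_algebra X"
  by (induction A rule: infinite_finite_induct) (auto intro: free_add free_zero)

lemma unital_cst: "cst c \<in> unital_free X"
  by (auto simp: unital_free_def)

lemma unital_one: "1 \<in> unital_free X"
  using unital_cst[of 1] by simp

lemma free_cst: "x \<in> free_star_algebra X \<Longrightarrow> cst c * x \<in> free_star_algebra X"
  by (rule free_mult2[OF unital_cst])

lemma free_scale: "x \<in> free_star_algebra X \<Longrightarrow> nc_scale c x \<in> free_star_algebra X"
  by (simp add: nc_scale_eq free_cst)

lemma free_power: "x \<in> free_star_algebra X \<Longrightarrow> n > 0 \<Longrightarrow> x ^ n \<in> free_star_algebra X"
proof (induction n)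
  case (Suc n)
  then show ?case by (cases "n = 0") (auto intro: free_mult)
qed simp

lemma unital_mult: "x \<in> unital_free X \<Longrightarrow> y \<in> unital_free X \<Longrightarrow> x * y \<in> unital_free X"
  unfolding unital_free_def
  by (fastforce elim!: keys_mult_cases)

lemma unital_add: "x \<in> unital_free X \<Longrightarrow> y \<in> unital_free X \<Longrightarrow> x + y \<in> unital_free X"
  unfolding unital_free_def using keys_add[of x y] by blast

lemma unital_uminus: "x \<in> unital_free X \<Longrightarrow> - x \<in> unital_free X"
  unfolding unital_free_def by (simp add: in_keys_iff)

lemma unital_diff: "x \<in> unital_free X \<Longrightarrow> y \<in> unital_free X \<Longrightarrow> x - y \<in> unital_free X"
  using unital_add[OF _ unital_uminus, of x X y] by simp

lemma unital_star: "x \<in> unital_free X \<Longrightarrow> nc_star x \<in> unital_free X"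
  unfolding unital_free_def by (auto simp: keys_nc_star letters_mono_star)

lemma unital_sum: "(\<And>i. i \<in> A \<Longrightarrow> f i \<in> unital_free X) \<Longrightarrow> sum f A \<in> unital_free X"
  by (induction A rule: infinite_finite_induct) (auto intro: unital_add free_subset_unital free_zero)

lemma free_gen: "g \<in> X \<Longrightarrow> nc_gen g \<in> free_star_algebra X"
  by (auto simp: nc_gen_def free_star_algebra_def)

lemma unital_gen: "g \<in> X \<Longrightarrow> nc_gen g \<in> unital_free X"
  by (simp add: free_gen free_subset_unital)

lemmas free_intros = free_add free_diff free_uminus free_zero free_star free_sum free_cst
  free_scale free_gen free_mult
lemmas unital_intros = unital_cst unital_one unital_mult unital_add unital_uminus unital_diff
  unital_star unital_sum unital_gen

text \<open>Seminorm axioms hold on the free algebra only; splitting off the constant term makes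
  them applicable to multipliers.\<close>

lemma unital_decomp:
  assumes "x \<in> unital_free X"
  shows "x - cst (Poly_Mapping.lookup x 0) \<in> free_star_algebra X"
proof -
  have "m \<in> Poly_Mapping.keys x \<and> letters m \<noteq> []"
    if m: "m \<in> Poly_Mapping.keys (x - cst (Poly_Mapping.lookup x 0))" for m
  proof -
    have "m \<noteq> 0" using m by (auto simp: in_keys_iff lookup_minus)
    then have "letters m \<noteq> []" by (metis monomial.collapse zero_monomial_def)
    then show ?thesis using m \<open>m \<noteq> 0\<close>
      by (auto simp: in_keys_iff lookup_minus lookup_single when_def)
  qed
  then show ?thesis using assms unfolding free_star_algebra_def unital_free_def by blast
qed

text \<open>The *-homomorphism onto the polynomials over \<open>X\<close> that kills all other
  letters. It allows the ideal of relations to be formed with arbitrary multipliers, although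
  seminorms are controlled only on polynomials in the generators.\<close>

definition restrict_gens :: "'g set \<Rightarrow> 'g ncpoly \<Rightarrow> 'g ncpoly" where
  "restrict_gens X x = (\<Sum>m \<in> {m \<in> Poly_Mapping.keys x. fst ` set (letters m) \<subseteq> X}.
      Poly_Mapping.single m (Poly_Mapping.lookup x m))"

lemma lookup_restrict_gens: "Poly_Mapping.lookup (restrict_gens X x) m =
    (if fst ` set (letters m) \<subseteq> X then Poly_Mapping.lookup x m else 0)"
  unfolding restrict_gens_def
  by (auto simp: lookup_sum lookup_single when_def in_keys_iff)

lemma restrict_gens_single: "restrict_gens X (Poly_Mapping.single m c) =
    (if fst ` set (letters m) \<subseteq> X then Poly_Mapping.single m c else 0)"
  by (rule poly_mapping_eqI) (auto simp: lookup_restrict_gens lookup_single when_def)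

lemma restrict_gens_add: "restrict_gens X (x + y) = restrict_gens X x + restrict_gens X y"
  by (rule poly_mapping_eqI) (auto simp: lookup_restrict_gens lookup_add)

lemma restrict_gens_mult: "restrict_gens X (x * y) = restrict_gens X x * restrict_gens X y"
proof (induction x rule: ncpoly_induct)
  case (single m c)
  show ?case
    by (induction y rule: ncpoly_induct)
      (auto simp add: mult_single restrict_gens_single restrict_gens_add ring_distribs image_Un)
qed (simp add: ring_distribs restrict_gens_add)

lemma restrict_gens_star: "restrict_gens X (nc_star x) = nc_star (restrict_gens X x)"
  by (rule poly_mapping_eqI) (auto simp: lookup_restrict_gens lookup_nc_star letters_mono_star)

lemma restrict_gens_unital: "restrict_gens X x \<in> unital_free X"
  unfolding unital_free_def mem_Collect_eq
proof
  fix m assume "m \<in> Poly_Mapping.keys (restrict_gens X x)"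
  then have "Poly_Mapping.lookup (restrict_gens X x) m \<noteq> 0"
    by (rule in_keys_iff[THEN iffD1])
  then show "fst ` set (letters m) \<subseteq> X" by (metis lookup_restrict_gens)
qed

lemma restrict_gens_id: "x \<in> unital_free X \<Longrightarrow> restrict_gens X x = x"
  by (rule poly_mapping_eqI) (force simp: lookup_restrict_gens unital_free_def in_keys_iff)


section \<open>C*-seminorms\<close>

text \<open>The exponents are powers of two because the C*-identity yields exact norms only for
  repeated squares.\<close>

lemma linear_less_exponential:
  fixes s a b :: real
  assumes "s > 1"
  shows "\<exists>k. a * 2 ^ k + b < s ^ (2 ^ k)"
proof -
  have "((\<lambda>n::nat. (a * real n + b) / s ^ n) \<longlongrightarrow> 0) sequentially"
    using assms by real_asymp
  then have "\<forall>\<^sub>F n in sequentially. (a * real n + b) / s ^ n < 1"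
    by (rule order_tendstoD) simp
  then obtain n0 where n0: "\<And>n. n \<ge> n0 \<Longrightarrow> (a * real n + b) / s ^ n < 1"
    by (auto simp: eventually_sequentially)
  have "n0 \<le> 2 ^ n0" by (simp add: less_imp_le)
  from n0[OF this] have "a * 2 ^ n0 + b < s ^ (2 ^ n0)"
    using assms by (simp add: divide_simps)
  then show ?thesis by blast
qed

locale cstar_seminorm =
  fixes X :: "'g set" and q :: "'g ncpoly \<Rightarrow> real"
  assumes seminorm: "cstar_seminorm_on (free_star_algebra X) q"
begin

abbreviation "F \<equiv> free_star_algebra X"

lemma nonneg: "x \<in> F \<Longrightarrow> 0 \<le> q x"
  and triangle: "x \<in> F \<Longrightarrow> y \<in> F \<Longrightarrow> q (x + y) \<le> q x + q y"
  and scale: "x \<in> F \<Longrightarrow> q (cst c * x) = cmod c * q x"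
  and submult: "x \<in> F \<Longrightarrow> y \<in> F \<Longrightarrow> q (x * y) \<le> q x * q y"
  and cstar: "x \<in> F \<Longrightarrow> q (nc_star x * x) = (q x)\<^sup>2"
  using seminorm by (auto simp: cstar_seminorm_on_def nc_scale_eq)

lemma zero: "q 0 = 0"
  using scale[OF free_zero, of 0] by simp

lemma minus: "x \<in> F \<Longrightarrow> q (- x) = q x"
  using scale[of x "-1"] by (simp add: cst_minus_one)

lemma triangle_diff: "x \<in> F \<Longrightarrow> y \<in> F \<Longrightarrow> q (x - y) \<le> q x + q y"
  using triangle[of x "- y"] by (simp add: minus free_uminus)

lemma diff_commute: "x \<in> F \<Longrightarrow> y \<in> F \<Longrightarrow> q (x - y) = q (y - x)"
  using minus[of "x - y"] by (simp add: free_diff)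

lemma star_le: "x \<in> F \<Longrightarrow> q x \<le> q (nc_star x)"
proof (cases "q x = 0")
  case False
  assume x: "x \<in> F"
  have "q x * q x \<le> q (nc_star x) * q x"
    using submult[of "nc_star x" x] cstar[of x] x by (simp add: free_star power2_eq_square)
  then show ?thesis using False nonneg[OF x] by simp
qed (simp add: nonneg free_star)

lemma star: "x \<in> F \<Longrightarrow> q (nc_star x) = q x"
  using star_le[of x] star_le[of "nc_star x"] by (simp add: free_star)

lemma sum_le: "(\<And>i. i \<in> A \<Longrightarrow> f i \<in> F) \<Longrightarrow> q (sum f A) \<le> (\<Sum>i\<in>A. q (f i))"
proof (induction A rule: infinite_finite_induct)
  case (insert i A)
  then show ?case using triangle[of "f i" "sum f A"] by (force intro: free_sum)
qed (auto simp: zero)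

text \<open>The multiplier may have a constant term, where submultiplicativity says nothing;
  homogeneity covers that term.\<close>

lemma unital_null1: assumes "x \<in> unital_free X" "y \<in> F" "q y = 0" shows "q (x * y) = 0"
proof -
  define c where "c = Poly_Mapping.lookup x 0"
  define x' where "x' = x - cst c"
  have x': "x' \<in> F" using unital_decomp[OF assms(1)] by (simp add: x'_def c_def)
  have "q (x * y) = q (cst c * y + x' * y)" by (simp add: x'_def ring_distribs)
  also have "\<dots> \<le> q (cst c * y) + q (x' * y)" using assms x' by (intro triangle) (auto intro: free_intros)
  also have "\<dots> \<le> 0" using assms x' submult[OF x' assms(2)] by (simp add: scale)
  finally show ?thesis using nonneg[OF free_mult2[OF assms(1,2)]] by simp
qed

lemma unital_null2: assumes "x \<in> unital_free X" "y \<in> F" "q y = 0" shows "q (y * x) = 0"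
proof -
  have "q (nc_star x * nc_star y) = 0"
    using assms by (intro unital_null1) (auto intro: unital_star free_star simp: star)
  then have "q (nc_star (y * x)) = 0" by simp
  then show ?thesis using star[of "y * x"] assms by (simp add: free_mult1)
qed

text \<open>In a C*-algebra the norm of a self-adjoint element is its spectral radius, so
  polynomial factors in bounds for the powers are harmless.\<close>
lemma le_by_powers:
  assumes h: "h \<in> F" "nc_star h = h" and M: "M \<ge> 0"
    and pow: "\<And>m. m > 0 \<Longrightarrow> q (h ^ m) \<le> (a * real m + b) * M ^ m"
  shows "q h \<le> M"
proof (rule ccontr)
  assume "\<not> q h \<le> M"
  then have gt: "q h > M" by simp
  \<comment> \<open>Repeated squaring with the C*-identity gives equality at these exponents;
    submultiplicativity would give only an upper bound.\<close>
  have pow2: "q (h ^ (2 ^ k)) = (q h) ^ (2 ^ k)" for k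
  proof (induction k)
    case (Suc k)
    have "q (h ^ (2 ^ Suc k)) = q (nc_star (h ^ 2 ^ k) * h ^ 2 ^ k)"
      by (simp add: nc_star_power h flip: power_add mult_2)
    also have "\<dots> = (q (h ^ 2 ^ k))\<^sup>2" by (rule cstar) (simp add: free_power h)
    also have "\<dots> = (q h) ^ (2 ^ Suc k)" by (simp add: Suc mult.commute flip: power_mult)
    finally show ?case .
  qed simp
  show False
  proof (cases "M = 0")
    case True
    then show ?thesis using pow[of 1] gt by simp
  next
    case False
    then have "M > 0" using M by simp
    then have "q h / M > 1" using gt by simp
    from linear_less_exponential[OF this, of a b] obtain k
      where k: "a * 2 ^ k + b < (q h / M) ^ 2 ^ k" by blast
    have "(q h) ^ (2 ^ k) \<le> (a * real (2 ^ k) + b) * M ^ (2 ^ k)"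
      using pow[of "2 ^ k"] by (simp add: pow2)
    then have "(q h / M) ^ 2 ^ k \<le> a * 2 ^ k + b"
      using \<open>M > 0\<close> by (simp add: power_divide divide_simps)
    then show False using k by simp
  qed
qed

text \<open>The single relation \<open>nc_star e * e = e\<close>, required modulo the kernel of
  \<open>q\<close>, contains self-adjointness and idempotence. With the C*-identity it gives
  \<open>t\<^sup>2 \<le> t\<close> for \<open>t = q e\<close>.\<close>

lemma projection_le_one:
  assumes "e \<in> F" "q (nc_star e * e - e) = 0" shows "q e \<le> 1"
proof -
  have "(q e)\<^sup>2 = q ((nc_star e * e - e) + e)" using assms by (simp add: cstar)
  also have "\<dots> \<le> q (nc_star e * e - e) + q e"
    using assms by (intro triangle) (auto intro: free_intros)
  also have "\<dots> = q e" using assms by simp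
  finally have "(q e)\<^sup>2 \<le> q e" .
  then show ?thesis using nonneg[OF assms(1)]
    by (smt (verit) mult_left_le_imp_le mult_cancel_left1 power2_eq_square mult_less_cancel_left1)
qed

lemma eq_of_null_diff: assumes "x \<in> F" "y \<in> F" "q (x - y) = 0" shows "q x = q y"
proof -
  have "q x \<le> q (x - y) + q y" using triangle[of "x - y" y] assms by (simp add: free_diff)
  moreover have "q y \<le> q (y - x) + q x" using triangle[of "y - x" x] assms by (simp add: free_diff)
  moreover have "q (y - x) = 0" using assms diff_commute by metis
  ultimately show ?thesis using assms(3) by linarith
qed

end

text \<open>A \<open>Sup\<close> of reals is meaningful only for bounded sets, hence the assumption
  \<open>bdd\<close>. Every axiom of a C*-seminorm then passes to the supremum.\<close>

lemma
  fixes R :: "'g ncpoly set"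
  assumes bdd: "\<And>x. x \<in> free_star_algebra X \<Longrightarrow> \<exists>b. \<forall>q. cstar_seminorm_on (free_star_algebra X) q \<and>
      (\<forall>r\<in>R. q r = 0) \<longrightarrow> q x \<le> b"
  shows universal_seminorm_ge: "\<And>q x. cstar_seminorm_on (free_star_algebra X) q \<Longrightarrow> \<forall>r\<in>R. q r = 0 \<Longrightarrow>
      x \<in> free_star_algebra X \<Longrightarrow> q x \<le> universal_seminorm X R x"
    and universal_seminorm_cstar: "cstar_seminorm X (universal_seminorm X R)"
    and universal_seminorm_null: "\<And>r. r \<in> R \<Longrightarrow> universal_seminorm X R r = 0"
proof -
  let ?F = "free_star_algebra X"
  let ?Q = "\<lambda>q. cstar_seminorm_on ?F q \<and> (\<forall>r\<in>R. q r = 0)"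
  let ?u = "universal_seminorm X R"
  \<comment> \<open>The zero seminorm makes the set under the supremum nonempty.\<close>
  have Q0: "?Q (\<lambda>_. 0)" by (simp add: cstar_seminorm_on_def)
  show ge: "q x \<le> ?u x" if "cstar_seminorm_on ?F q" "\<forall>r\<in>R. q r = 0" and x: "x \<in> ?F" for q x
  proof -
    obtain b where "\<forall>q. ?Q q \<longrightarrow> q x \<le> b" using bdd[OF x] by blast
    then have "bdd_above {q x |q. ?Q q}" by (auto simp: bdd_above_def)
    then show ?thesis unfolding universal_seminorm_def using that by (intro cSup_upper) auto
  qed
  have le: "?u x \<le> c" if "x \<in> ?F" "\<And>q. cstar_seminorm_on ?F q \<Longrightarrow> \<forall>r\<in>R. q r = 0 \<Longrightarrow> q x \<le> c" for x c
    unfolding universal_seminorm_def using Q0 that(2) by (intro cSup_least) blast+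
  have sn: "cstar_seminorm X q" if "cstar_seminorm_on ?F q" for q
    using that by (simp add: cstar_seminorm_def)
  have nn: "0 \<le> ?u x" if "x \<in> ?F" for x
    using ge[of "\<lambda>_. 0" x] Q0 that by simp
  have scale_le: "?u (nc_scale c x) \<le> cmod c * ?u x" if x: "x \<in> ?F" for c x
  proof (rule le)
    fix q assume q: "cstar_seminorm_on ?F q" "\<forall>r\<in>R. q r = 0"
    then have "q (nc_scale c x) = cmod c * q x" using x by (simp add: cstar_seminorm_on_def)
    also have "\<dots> \<le> cmod c * ?u x" by (intro mult_left_mono ge q x) simp
    finally show "q (nc_scale c x) \<le> cmod c * ?u x" .
  qed (simp add: x free_scale)
  have "cstar_seminorm_on ?F ?u"
    unfolding cstar_seminorm_on_def
  proof (intro conjI ballI allI)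
    fix x assume x: "x \<in> ?F"
    show "0 \<le> ?u x" by (rule nn[OF x])
    show "?u (nc_star x * x) = (?u x)\<^sup>2"
    proof (rule antisym)
      show "?u (nc_star x * x) \<le> (?u x)\<^sup>2"
      proof (rule le)
        fix q assume q: "cstar_seminorm_on ?F q" "\<forall>r\<in>R. q r = 0"
        then have "q (nc_star x * x) = (q x)\<^sup>2" using x by (simp add: cstar_seminorm_on_def)
        also have "\<dots> \<le> (?u x)\<^sup>2"
          using q x by (intro power_mono ge cstar_seminorm.nonneg[OF sn])
        finally show "q (nc_star x * x) \<le> (?u x)\<^sup>2" .
      qed (simp add: x free_mult free_star)
      \<comment> \<open>Taking the root puts the C*-identity into the form of a common upper bound
        for all \<open>q x\<close>, which is what a supremum respects.\<close>
      have "?u x \<le> sqrt (?u (nc_star x * x))"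
      proof (rule le[OF x])
        fix q assume q: "cstar_seminorm_on ?F q" "\<forall>r\<in>R. q r = 0"
        then have "(q x)\<^sup>2 = q (nc_star x * x)" using x by (simp add: cstar_seminorm_on_def)
        also have "\<dots> \<le> ?u (nc_star x * x)" using q x by (intro ge) (simp_all add: free_mult free_star)
        finally show "q x \<le> sqrt (?u (nc_star x * x))" by (rule real_le_rsqrt)
      qed
      then have "(?u x)\<^sup>2 \<le> (sqrt (?u (nc_star x * x)))\<^sup>2" by (intro power_mono nn x)
      then show "(?u x)\<^sup>2 \<le> ?u (nc_star x * x)" by (simp add: nn x free_mult free_star)
    qed
    fix c
    show "?u (nc_scale c x) = cmod c * ?u x"
    proof (cases "c = 0")
      case True
      then show ?thesis using scale_le[OF x, of c] nn[of "nc_scale c x"] x by (simp add: free_scale)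
    next
      case False
      have "cmod c * ?u x = cmod c * ?u (nc_scale (inverse c) (nc_scale c x))"
        using False by (simp add: nc_scale_eq cst_mult flip: mult.assoc)
      also have "\<dots> \<le> cmod c * (cmod (inverse c) * ?u (nc_scale c x))"
        by (intro mult_left_mono scale_le) (auto simp: x free_scale)
      also have "\<dots> = ?u (nc_scale c x)" using False by (simp add: norm_inverse)
      finally show ?thesis using scale_le[OF x, of c] by simp
    qed
  next
    fix x y assume x: "x \<in> ?F" and y: "y \<in> ?F"
    show "?u (x + y) \<le> ?u x + ?u y"
    proof (rule le)
      fix q assume q: "cstar_seminorm_on ?F q" "\<forall>r\<in>R. q r = 0"
      have "q (x + y) \<le> q x + q y" using q x y by (simp add: cstar_seminorm_on_def)
      also have "\<dots> \<le> ?u x + ?u y" using q x y by (intro add_mono ge)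
      finally show "q (x + y) \<le> ?u x + ?u y" .
    qed (simp add: x y free_add)
    show "?u (x * y) \<le> ?u x * ?u y"
    proof (rule le)
      fix q assume q: "cstar_seminorm_on ?F q" "\<forall>r\<in>R. q r = 0"
      have "q (x * y) \<le> q x * q y" using q x y by (simp add: cstar_seminorm_on_def)
      also have "\<dots> \<le> ?u x * ?u y"
        using q x y by (intro mult_mono ge nn cstar_seminorm.nonneg[OF sn])
      finally show "q (x * y) \<le> ?u x * ?u y" .
    qed (simp add: x y free_mult)
  qed
  then show "cstar_seminorm X ?u" by (simp add: cstar_seminorm_def)
  show "?u r = 0" if "r \<in> R" for r
  proof -
    have "{q r |q. ?Q q} = {0}" using Q0 that by auto
    then show ?thesis by (simp add: universal_seminorm_def)
  qed
qed


section \<open>Closed ideals of a completion\<close>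

context cstar_seminorm
begin

definition CS :: "(nat \<Rightarrow> 'g ncpoly) set" where
  "CS = cauchy_seqs F q"

definition null_seq :: "(nat \<Rightarrow> 'g ncpoly) \<Rightarrow> bool" where
  "null_seq f \<longleftrightarrow> (\<lambda>n. q (f n)) \<longlonglongrightarrow> 0"

definition cls :: "(nat \<Rightarrow> 'g ncpoly) \<Rightarrow> (nat \<Rightarrow> 'g ncpoly) set" where
  "cls f = null_rel F q `` {f}"

abbreviation "CC \<equiv> completion F q"

lemma CS_F: "f \<in> CS \<Longrightarrow> f n \<in> F"
  by (auto simp: CS_def cauchy_seqs_def)

lemma CS_cauchy: "f \<in> CS \<Longrightarrow> e > 0 \<Longrightarrow> \<exists>N. \<forall>m\<ge>N. \<forall>n\<ge>N. q (f m - f n) < e"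
  by (auto simp: CS_def cauchy_seqs_def)

lemma CSI: "(\<And>n. f n \<in> F) \<Longrightarrow> (\<And>e. e > 0 \<Longrightarrow> \<exists>N. \<forall>m\<ge>N. \<forall>n\<ge>N. q (f m - f n) < e) \<Longrightarrow> f \<in> CS"
  by (auto simp: CS_def cauchy_seqs_def)

lemma null_seqI:
  assumes "\<And>n. f n \<in> F" "\<And>e. e > 0 \<Longrightarrow> \<exists>N. \<forall>n\<ge>N. q (f n) < e"
  shows "null_seq f"
  unfolding null_seq_def
proof (rule LIMSEQ_I)
  fix e :: real assume "e > 0"
  then show "\<exists>N. \<forall>n\<ge>N. norm (q (f n) - 0) < e" using assms(2)[of e] nonneg[OF assms(1)] by auto
qed

lemma null_seqD:
  assumes "\<And>n. f n \<in> F" "null_seq f" "e > 0"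
  shows "\<exists>N. \<forall>n\<ge>N. q (f n) < e"
  using LIMSEQ_D[OF assms(2)[unfolded null_seq_def] assms(3)] by fastforce

lemma null_seq_add:
  assumes "\<And>n. f n \<in> F" "\<And>n. g n \<in> F" "null_seq f" "null_seq g"
  shows "null_seq (\<lambda>n. f n + g n)"
  unfolding null_seq_def
proof (rule tendsto_sandwich[of "\<lambda>_. 0" _ _ "\<lambda>n. q (f n) + q (g n)"])
  show "(\<lambda>n. q (f n) + q (g n)) \<longlonglongrightarrow> 0"
    using tendsto_add[OF assms(3,4)[unfolded null_seq_def]] by simp
qed (simp_all add: assms triangle nonneg free_add)

lemma null_seq_uminus: "(\<And>n. f n \<in> F) \<Longrightarrow> null_seq f \<Longrightarrow> null_seq (\<lambda>n. - f n)"
  by (simp add: null_seq_def minus)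

lemma CS_bounded: assumes "f \<in> CS" shows "\<exists>K>0. \<forall>n. q (f n) \<le> K"
proof -
  obtain N where N: "\<And>m n. m \<ge> N \<Longrightarrow> n \<ge> N \<Longrightarrow> q (f m - f n) < 1"
    using CS_cauchy[OF assms, of 1] by auto
  define K where "K = (\<Sum>n\<le>N. q (f n)) + 1"
  have pos: "0 \<le> q (f n)" for n using assms CS_F nonneg by blast
  have le: "q (f n) \<le> (\<Sum>n\<le>N. q (f n))" if "n \<le> N" for n
    using that pos by (intro member_le_sum) auto
  have "q (f n) \<le> K" for n
  proof (cases "n \<le> N")
    case True
    then show ?thesis using le[of n] by (simp add: K_def)
  next
    case False
    have "q (f n) \<le> q (f n - f N) + q (f N)"
      using triangle[of "f n - f N" "f N"] assms by (simp add: CS_F free_diff)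
    then show ?thesis using N[of n N] False le[of N] by (simp add: K_def)
  qed
  moreover have "K > 0" unfolding K_def using sum_nonneg[of "{..N}" "\<lambda>n. q (f n)"] pos by force
  ultimately show ?thesis by blast
qed

lemma CS_const: "x \<in> F \<Longrightarrow> (\<lambda>_. x) \<in> CS"
  by (rule CSI) (auto simp: zero)

lemma CS_add: assumes f: "f \<in> CS" and g: "g \<in> CS" shows "(\<lambda>n. f n + g n) \<in> CS"
proof (rule CSI)
  fix e :: real assume "e > 0"
  then obtain N M where N: "\<And>m n. m \<ge> N \<Longrightarrow> n \<ge> N \<Longrightarrow> q (f m - f n) < e / 2"
    and M: "\<And>m n. m \<ge> M \<Longrightarrow> n \<ge> M \<Longrightarrow> q (g m - g n) < e / 2"
    using CS_cauchy[OF f, of "e/2"] CS_cauchy[OF g, of "e/2"] by (meson half_gt_zero)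
  have "q ((f m + g m) - (f n + g n)) < e" if "m \<ge> max N M" "n \<ge> max N M" for m n
  proof -
    have "q ((f m + g m) - (f n + g n)) = q ((f m - f n) + (g m - g n))" by (simp add: algebra_simps)
    also have "\<dots> \<le> q (f m - f n) + q (g m - g n)"
      using f g by (intro triangle free_diff CS_F)
    also have "\<dots> < e" using N[of m n] M[of m n] that by simp
    finally show ?thesis .
  qed
  then show "\<exists>N. \<forall>m\<ge>N. \<forall>n\<ge>N. q (f m + g m - (f n + g n)) < e" by blast
qed (use f g CS_F free_add in blast)

lemma CS_mult: assumes f: "f \<in> CS" and g: "g \<in> CS" shows "(\<lambda>n. f n * g n) \<in> CS"
proof (rule CSI)
  fix e :: real assume e: "e > 0"
  obtain K where K: "K > 0" "\<And>n. q (f n) \<le> K" using CS_bounded[OF f] by auto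
  obtain L where L: "L > 0" "\<And>n. q (g n) \<le> L" using CS_bounded[OF g] by auto
  obtain N where N: "\<And>m n. m \<ge> N \<Longrightarrow> n \<ge> N \<Longrightarrow> q (f m - f n) < e / (2 * L)"
    using CS_cauchy[OF f, of "e / (2 * L)"] e L by auto
  obtain M where M: "\<And>m n. m \<ge> M \<Longrightarrow> n \<ge> M \<Longrightarrow> q (g m - g n) < e / (2 * K)"
    using CS_cauchy[OF g, of "e / (2 * K)"] e K by auto
  have "q (f m * g m - f n * g n) < e" if "m \<ge> max N M" "n \<ge> max N M" for m n
  proof -
    have "q (f m * g m - f n * g n) = q ((f m - f n) * g m + f n * (g m - g n))"
      by (simp add: algebra_simps)
    also have "\<dots> \<le> q ((f m - f n) * g m) + q (f n * (g m - g n))"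
      using f g by (intro triangle free_diff free_mult CS_F)
    also have "\<dots> \<le> q (f m - f n) * q (g m) + q (f n) * q (g m - g n)"
      using f g by (intro add_mono submult free_diff CS_F)
    also have "\<dots> \<le> q (f m - f n) * L + K * q (g m - g n)"
      using f g K L by (intro add_mono mult_left_mono mult_right_mono nonneg free_diff CS_F) auto
    also have "\<dots> < e / (2 * L) * L + K * (e / (2 * K))"
      using N[of m n] M[of m n] that K(1) L(1)
      by (intro add_strict_mono mult_strict_right_mono mult_strict_left_mono) auto
    also have "\<dots> = e" using K(1) L(1) by simp
    finally show ?thesis .
  qed
  then show "\<exists>N. \<forall>m\<ge>N. \<forall>n\<ge>N. q (f m * g m - f n * g n) < e" by blast
qed (use f g CS_F free_mult in blast)

lemma CS_scale: "f \<in> CS \<Longrightarrow> (\<lambda>n. nc_scale c (f n)) \<in> CS"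
proof (rule CSI)
  fix e :: real assume f: "f \<in> CS" and e: "e > 0"
  have "e / (cmod c + 1) > 0" using e by (simp add: add_nonneg_pos)
  then obtain N where N: "\<And>m n. m \<ge> N \<Longrightarrow> n \<ge> N \<Longrightarrow> q (f m - f n) < e / (cmod c + 1)"
    using CS_cauchy[OF f] by blast
  have "q (nc_scale c (f m) - nc_scale c (f n)) < e" if "m \<ge> N" "n \<ge> N" for m n
  proof -
    have "q (nc_scale c (f m) - nc_scale c (f n)) = cmod c * q (f m - f n)"
      using f by (simp add: nc_scale_eq scale free_diff CS_F flip: right_diff_distrib)
    also have "\<dots> \<le> (cmod c + 1) * q (f m - f n)"
      using f by (intro mult_right_mono nonneg free_diff CS_F) auto
    also have "\<dots> < (cmod c + 1) * (e / (cmod c + 1))"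
      using N[OF that] by (intro mult_strict_left_mono) (auto simp: add_nonneg_pos)
    also have "\<dots> = e" using norm_ge_zero[of c] by (simp add: add_nonneg_eq_0_iff)
    finally show ?thesis .
  qed
  then show "\<exists>N. \<forall>m\<ge>N. \<forall>n\<ge>N. q (nc_scale c (f m) - nc_scale c (f n)) < e" by blast
qed (use CS_F free_scale in blast)

lemma CS_uminus: "f \<in> CS \<Longrightarrow> (\<lambda>n. - f n) \<in> CS"
  using CS_scale[of f "-1"] by (simp add: nc_scale_minus_one)

lemma CS_diff: "f \<in> CS \<Longrightarrow> g \<in> CS \<Longrightarrow> (\<lambda>n. f n - g n) \<in> CS"
  using CS_add[OF _ CS_uminus, of f g] by simp

lemma CS_norm_convergent: assumes f: "f \<in> CS" shows "convergent (\<lambda>n. q (f n))"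
proof -
  have "Cauchy (\<lambda>n. q (f n))"
  proof (rule metric_CauchyI)
    fix e :: real assume "e > 0"
    then obtain N where N: "\<And>m n. m \<ge> N \<Longrightarrow> n \<ge> N \<Longrightarrow> q (f m - f n) < e"
      using CS_cauchy[OF f] by blast
    have "q (f m) \<le> q (f m - f n) + q (f n)" for m n
      using triangle[of "f m - f n" "f n"] f by (simp add: CS_F free_diff)
    then have "dist (q (f m)) (q (f n)) < e" if "m \<ge> N" "n \<ge> N" for m n
      using N[of m n] N[of n m] that unfolding dist_real_def by (smt (verit))
    then show "\<exists>M. \<forall>m\<ge>M. \<forall>n\<ge>M. dist (q (f m)) (q (f n)) < e" by blast
  qed
  then show ?thesis by (simp add: Cauchy_convergent_iff)
qed

lemma null_rel_iff: "(f, g) \<in> null_rel F q \<longleftrightarrow> f \<in> CS \<and> g \<in> CS \<and> null_seq (\<lambda>n. f n - g n)"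
  by (auto simp: null_rel_def CS_def null_seq_def)

lemma equiv_null_rel: "equiv CS (null_rel F q)"
proof (rule equivI)
  show "refl_on CS (null_rel F q)"
    by (rule refl_onI) (auto simp: null_rel_iff null_seq_def zero)
  show "sym (null_rel F q)"
  proof (rule symI)
    fix f g assume "(f, g) \<in> null_rel F q"
    then show "(g, f) \<in> null_rel F q"
      using null_seq_uminus[of "\<lambda>n. f n - g n"] by (simp add: null_rel_iff CS_F free_diff)
  qed
  show "trans (null_rel F q)"
  proof (rule transI)
    fix f g h assume "(f, g) \<in> null_rel F q" "(g, h) \<in> null_rel F q"
    then show "(f, h) \<in> null_rel F q"
      using null_seq_add[of "\<lambda>n. f n - g n" "\<lambda>n. g n - h n"]
      by (simp add: null_rel_iff CS_F free_diff)
  qed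
qed (auto simp: null_rel_iff)

lemma cls_eq_iff: "f \<in> CS \<Longrightarrow> g \<in> CS \<Longrightarrow> cls f = cls g \<longleftrightarrow> null_seq (\<lambda>n. f n - g n)"
  unfolding cls_def using eq_equiv_class_iff[OF equiv_null_rel, of f g] by (simp add: null_rel_iff)

lemma mem_cls: "f \<in> CS \<Longrightarrow> g \<in> cls f \<longleftrightarrow> g \<in> CS \<and> null_seq (\<lambda>n. f n - g n)"
  by (auto simp: cls_def null_rel_iff)

lemma self_mem_cls: "f \<in> CS \<Longrightarrow> f \<in> cls f"
  by (simp add: mem_cls null_seq_def zero)

lemma carrier_CC: "sa_carrier CC = cls ` CS"
  by (auto simp: completion_def quotient_def cls_def CS_def)

lemma zero_CC: "sa_zero CC = cls (\<lambda>_. 0)"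
  by (simp add: completion_def cls_def)

text \<open>The operations of \<open>completion\<close> are unions over representatives; the union
  collapses once the resulting class does not depend on them.\<close>

lemma UN_const1: "A \<noteq> {} \<Longrightarrow> (\<And>a. a \<in> A \<Longrightarrow> H a = K) \<Longrightarrow> (\<Union>a\<in>A. H a) = K"
  by auto

lemma null_seq_mult1:
  assumes "f \<in> CS" "\<And>n. g n \<in> F" "null_seq g" shows "null_seq (\<lambda>n. f n * g n)"
proof -
  obtain K where K: "K > 0" "\<And>n. q (f n) \<le> K" using CS_bounded[OF assms(1)] by auto
  have "(\<lambda>n. K * q (g n)) \<longlonglongrightarrow> 0"
    using tendsto_mult_right_zero[OF assms(3)[unfolded null_seq_def]] by simp
  moreover have "q (f n * g n) \<le> K * q (g n)" for n
    using submult[of "f n" "g n"] assms K(2)[of n] nonneg[of "g n"]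
    by (smt (verit) CS_F mult_right_mono)
  ultimately show ?thesis unfolding null_seq_def
    by (intro tendsto_sandwich[of "\<lambda>_. 0" "\<lambda>n. q (f n * g n)" _ "\<lambda>n. K * q (g n)"])
      (simp_all add: assms CS_F nonneg free_mult)
qed

lemma null_seq_mult2:
  assumes "f \<in> CS" "\<And>n. g n \<in> F" "null_seq g" shows "null_seq (\<lambda>n. g n * f n)"
proof -
  obtain K where K: "K > 0" "\<And>n. q (f n) \<le> K" using CS_bounded[OF assms(1)] by auto
  have "(\<lambda>n. q (g n) * K) \<longlonglongrightarrow> 0"
    using tendsto_mult_left_zero[OF assms(3)[unfolded null_seq_def]] by simp
  moreover have "q (g n * f n) \<le> q (g n) * K" for n
    using submult[of "g n" "f n"] assms K(2)[of n] nonneg[of "g n"]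
    by (smt (verit) CS_F mult_left_mono)
  ultimately show ?thesis unfolding null_seq_def
    by (intro tendsto_sandwich[of "\<lambda>_. 0" "\<lambda>n. q (g n * f n)" _ "\<lambda>n. q (g n) * K"])
      (simp_all add: assms CS_F nonneg free_mult)
qed

section \<open>The operations of the completion in terms of representatives\<close>

lemma add_CC: assumes "f \<in> CS" "g \<in> CS" shows "sa_add CC (cls f) (cls g) = cls (\<lambda>n. f n + g n)"
proof -
  have "cls (\<lambda>n. f' n + g' n) = cls (\<lambda>n. f n + g n)"
    if "f' \<in> CS" "null_seq (\<lambda>n. f n - f' n)" "g' \<in> CS" "null_seq (\<lambda>n. g n - g' n)" for f' g'
  proof -
    have "null_seq (\<lambda>n. - ((f n - f' n) + (g n - g' n)))"
      using that assms by (intro null_seq_uminus null_seq_add free_add free_diff CS_F)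
    also have "(\<lambda>n. - ((f n - f' n) + (g n - g' n))) = (\<lambda>n. (f' n + g' n) - (f n + g n))"
      by (simp add: algebra_simps)
    finally show ?thesis using that assms by (simp add: cls_eq_iff CS_add)
  qed
  note const = this
  have "(\<Union>f'\<in>cls f. \<Union>g'\<in>cls g. cls (\<lambda>n. f' n + g' n)) = cls (\<lambda>n. f n + g n)"
  proof (intro UN_const1)
    show "cls f \<noteq> {}" "cls g \<noteq> {}" using self_mem_cls assms by (metis empty_iff)+
    fix f' g' assume "f' \<in> cls f" "g' \<in> cls g"
    then show "cls (\<lambda>n. f' n + g' n) = cls (\<lambda>n. f n + g n)"
      unfolding mem_cls[OF assms(1)] mem_cls[OF assms(2)] by (intro const) simp_all
  qed
  then show ?thesis by (simp add: completion_def cls_def)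
qed

lemma mult_CC: assumes "f \<in> CS" "g \<in> CS" shows "sa_mult CC (cls f) (cls g) = cls (\<lambda>n. f n * g n)"
proof -
  have "cls (\<lambda>n. f' n * g' n) = cls (\<lambda>n. f n * g n)"
    if "f' \<in> CS" "null_seq (\<lambda>n. f n - f' n)" "g' \<in> CS" "null_seq (\<lambda>n. g n - g' n)" for f' g'
  proof -
    have "null_seq (\<lambda>n. - ((f n - f' n) * g n + f' n * (g n - g' n)))"
    proof -
      have F: "f n \<in> F" "f' n \<in> F" "g n \<in> F" "g' n \<in> F" for n
        using that assms by (simp_all add: CS_F)
      have "null_seq (\<lambda>n. (f n - f' n) * g n)" "null_seq (\<lambda>n. f' n * (g n - g' n))"
        using null_seq_mult2[OF assms(2) _ that(2)] null_seq_mult1[OF that(1) _ that(4)] F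
        by (simp_all add: free_diff)
      then have "null_seq (\<lambda>n. (f n - f' n) * g n + f' n * (g n - g' n))"
        using F by (intro null_seq_add free_mult free_diff)
      then show ?thesis using F by (intro null_seq_uminus free_add free_mult free_diff)
    qed
    also have "(\<lambda>n. - ((f n - f' n) * g n + f' n * (g n - g' n))) = (\<lambda>n. f' n * g' n - f n * g n)"
      by (simp add: algebra_simps)
    finally show ?thesis using that assms by (simp add: cls_eq_iff CS_mult)
  qed
  note const = this
  have "(\<Union>f'\<in>cls f. \<Union>g'\<in>cls g. cls (\<lambda>n. f' n * g' n)) = cls (\<lambda>n. f n * g n)"
  proof (intro UN_const1)
    show "cls f \<noteq> {}" "cls g \<noteq> {}" using self_mem_cls assms by (metis empty_iff)+
    fix f' g' assume "f' \<in> cls f" "g' \<in> cls g"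
    then show "cls (\<lambda>n. f' n * g' n) = cls (\<lambda>n. f n * g n)"
      unfolding mem_cls[OF assms(1)] mem_cls[OF assms(2)] by (intro const) simp_all
  qed
  then show ?thesis by (simp add: completion_def cls_def)
qed

lemma scale_CC: assumes "f \<in> CS" shows "sa_scale CC c (cls f) = cls (\<lambda>n. nc_scale c (f n))"
proof -
  have "cls (\<lambda>n. nc_scale c (f' n)) = cls (\<lambda>n. nc_scale c (f n))"
    if "f' \<in> CS" "null_seq (\<lambda>n. f n - f' n)" for f'
  proof -
    have "null_seq (\<lambda>n. cst c * (f n - f' n))"
      using that assms
      by (auto simp: null_seq_def scale free_diff CS_F intro: tendsto_mult_right_zero)
    then have "null_seq (\<lambda>n. - (cst c * (f n - f' n)))"
      using that assms by (intro null_seq_uminus free_cst free_diff CS_F)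
    also have "(\<lambda>n. - (cst c * (f n - f' n))) = (\<lambda>n. nc_scale c (f' n) - nc_scale c (f n))"
      by (simp add: algebra_simps nc_scale_eq)
    finally show ?thesis using that assms by (simp add: cls_eq_iff CS_scale)
  qed
  note const = this
  have "(\<Union>f'\<in>cls f. cls (\<lambda>n. nc_scale c (f' n))) = cls (\<lambda>n. nc_scale c (f n))"
  proof (intro UN_const1)
    show "cls f \<noteq> {}" using self_mem_cls assms by (metis empty_iff)
    fix f' assume "f' \<in> cls f"
    then show "cls (\<lambda>n. nc_scale c (f' n)) = cls (\<lambda>n. nc_scale c (f n))"
      unfolding mem_cls[OF assms(1)] by (intro const) simp_all
  qed
  then show ?thesis by (simp add: completion_def cls_def)
qed

text \<open>The definite description in \<open>completion\<close> is justified here: the limit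
  exists by completeness of the reals, and equivalent sequences have norms differing by a null
  sequence.\<close>

lemma norm_CC: assumes f: "f \<in> CS" shows "(\<lambda>n. q (f n)) \<longlonglongrightarrow> sa_norm CC (cls f)"
proof -
  obtain r where r: "(\<lambda>n. q (f n)) \<longlonglongrightarrow> r"
    using CS_norm_convergent[OF f] by (auto simp: convergent_def)
  have lim: "(\<lambda>n. q (g n)) \<longlonglongrightarrow> r" if g: "g \<in> cls f" for g
  proof -
    have gC: "g \<in> CS" and d: "null_seq (\<lambda>n. f n - g n)" using g f by (auto simp: mem_cls)
    have "(\<lambda>n. q (g n) - q (f n)) \<longlonglongrightarrow> 0"
    proof (rule tendsto_rabs_zero_cancel, rule tendsto_sandwich[of "\<lambda>_. 0" _ _ "\<lambda>n. q (f n - g n)"])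
      have "q (f n) \<le> q (f n - g n) + q (g n)" "q (g n) \<le> q (g n - f n) + q (f n)" for n
        using triangle[of "f n - g n" "g n"] triangle[of "g n - f n" "f n"] f gC
        by (auto simp: CS_F free_diff)
      then show "\<forall>\<^sub>F n in sequentially. \<bar>q (g n) - q (f n)\<bar> \<le> q (f n - g n)"
        using diff_commute f gC CS_F by (intro always_eventually allI) (smt (verit))
    qed (use d in \<open>auto simp: null_seq_def\<close>)
    from tendsto_add[OF this r] show ?thesis by simp
  qed
  have "sa_norm CC (cls f) = (THE r. \<forall>g\<in>cls f. (\<lambda>n. q (g n)) \<longlonglongrightarrow> r)"
    by (simp add: completion_def)
  also have "\<dots> = r"
  proof (rule the_equality)
    show "s = r" if "\<forall>g\<in>cls f. (\<lambda>n. q (g n)) \<longlonglongrightarrow> s" for s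
      using that r self_mem_cls[OF f] LIMSEQ_unique by blast
  qed (use lim in blast)
  finally show ?thesis using r by simp
qed

text \<open>The preimage of a closed ideal in the Cauchy sequences. Closedness is stated by
  approximation up to every positive error, which avoids sequences of classes in all later
  arguments.\<close>

definition seq_ideal :: "(nat \<Rightarrow> 'g ncpoly) set \<Rightarrow> bool" where
  "seq_ideal J \<longleftrightarrow> J \<subseteq> CS \<and> (\<forall>f\<in>CS. null_seq f \<longrightarrow> f \<in> J) \<and>
     (\<forall>f\<in>J. \<forall>g\<in>J. (\<lambda>n. f n + g n) \<in> J) \<and>
     (\<forall>f\<in>J. \<forall>g\<in>CS. (\<lambda>n. f n * g n) \<in> J \<and> (\<lambda>n. g n * f n) \<in> J) \<and>
     (\<forall>f\<in>J. \<forall>c. (\<lambda>n. nc_scale c (f n)) \<in> J) \<and>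
     (\<forall>g\<in>CS. (\<forall>e>0. \<exists>f\<in>J. \<exists>N. \<forall>n\<ge>N. q (f n - g n) < e) \<longrightarrow> g \<in> J)"

context
  fixes J
  assumes J: "seq_ideal J"
begin

lemma seq_ideal_CS: "f \<in> J \<Longrightarrow> f \<in> CS"
  and seq_ideal_null: "f \<in> CS \<Longrightarrow> null_seq f \<Longrightarrow> f \<in> J"
  and seq_ideal_add: "f \<in> J \<Longrightarrow> g \<in> J \<Longrightarrow> (\<lambda>n. f n + g n) \<in> J"
  and seq_ideal_mult1: "f \<in> J \<Longrightarrow> g \<in> CS \<Longrightarrow> (\<lambda>n. f n * g n) \<in> J"
  and seq_ideal_mult2: "f \<in> J \<Longrightarrow> g \<in> CS \<Longrightarrow> (\<lambda>n. g n * f n) \<in> J"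
  and seq_ideal_scale: "f \<in> J \<Longrightarrow> (\<lambda>n. nc_scale c (f n)) \<in> J"
  using J by (auto simp: seq_ideal_def)

lemma seq_ideal_closed:
  "g \<in> CS \<Longrightarrow> (\<And>e. e > 0 \<Longrightarrow> \<exists>f\<in>J. \<exists>N. \<forall>n\<ge>N. q (f n - g n) < e) \<Longrightarrow> g \<in> J"
  using J by (simp add: seq_ideal_def)

lemma seq_ideal_minus: "f \<in> J \<Longrightarrow> (\<lambda>n. - f n) \<in> J"
  using seq_ideal_scale[of f "-1"] by (simp add: nc_scale_minus_one)

lemma seq_ideal_eq:
  assumes "f \<in> J" "g \<in> CS" "null_seq (\<lambda>n. g n - f n)"
  shows "g \<in> J"
  using seq_ideal_add[OF assms(1) seq_ideal_null[OF CS_diff assms(3)]] assms seq_ideal_CS by simp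

end

lemma seq_ideal_of_closed_ideal:
  assumes I: "closed_ideal CC I"
  shows "seq_ideal {f \<in> CS. cls f \<in> I}"
  unfolding seq_ideal_def
proof (intro conjI ballI allI impI)
  show "f \<in> {f \<in> CS. cls f \<in> I}" if f: "f \<in> CS" "null_seq f" for f
  proof -
    have "cls f = sa_zero CC" unfolding zero_CC
      using f by (subst cls_eq_iff) (auto intro: CS_const free_zero)
    then show ?thesis using I f by (simp add: closed_ideal_def)
  qed
  show "(\<lambda>n. f n + g n) \<in> {f \<in> CS. cls f \<in> I}"
    if "f \<in> {f \<in> CS. cls f \<in> I}" "g \<in> {f \<in> CS. cls f \<in> I}" for f g
    using that I by (auto simp: closed_ideal_def CS_add simp flip: add_CC)
  show "(\<lambda>n. f n * g n) \<in> {f \<in> CS. cls f \<in> I}" "(\<lambda>n. g n * f n) \<in> {f \<in> CS. cls f \<in> I}"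
    if "f \<in> {f \<in> CS. cls f \<in> I}" "g \<in> CS" for f g
    using that I by (auto simp: closed_ideal_def CS_mult carrier_CC simp flip: mult_CC)
  show "(\<lambda>n. nc_scale c (f n)) \<in> {f \<in> CS. cls f \<in> I}"
    if "f \<in> {f \<in> CS. cls f \<in> I}" for f c
    using that I by (auto simp: closed_ideal_def CS_scale simp flip: scale_CC)
  fix g assume g: "g \<in> CS"
    and ap: "\<forall>e>0. \<exists>f\<in>{f \<in> CS. cls f \<in> I}. \<exists>N. \<forall>n\<ge>N. q (f n - g n) < e"
  \<comment> \<open>\<open>closed_ideal\<close> speaks of convergent sequences in the ideal, so one
    with errors \<open>1 / (k + 1)\<close> is extracted from the approximation property.\<close>
  have "\<forall>k. \<exists>f. f \<in> CS \<and> cls f \<in> I \<and> (\<exists>N. \<forall>n\<ge>N. q (f n - g n) < 1 / (real k + 1))"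
  proof
    fix k :: nat
    have "1 / (real k + 1) > 0" by simp
    from ap[rule_format, OF this] show "\<exists>f. f \<in> CS \<and> cls f \<in> I \<and>
      (\<exists>N. \<forall>n\<ge>N. q (f n - g n) < 1 / (real k + 1))" by auto
  qed
  from choice[OF this] obtain h where h: "\<And>k. h k \<in> CS" "\<And>k. cls (h k) \<in> I"
    "\<And>k. \<exists>N. \<forall>n\<ge>N. q (h k n - g n) < 1 / (real k + 1)"
    by blast
  have eq: "sa_add CC (cls (h k)) (sa_scale CC (- 1) (cls g)) = cls (\<lambda>n. h k n - g n)" for k
    using h(1) g by (simp add: scale_CC add_CC CS_uminus nc_scale_minus_one)
  have b: "sa_norm CC (cls (\<lambda>n. h k n - g n)) \<in> {0..1 / (real k + 1)}" for k
  proof -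
    have "(\<lambda>n. q (h k n - g n)) \<longlonglongrightarrow> sa_norm CC (cls (\<lambda>n. h k n - g n))"
      using h(1) g by (intro norm_CC CS_diff)
    moreover have "\<exists>N. \<forall>n\<ge>N. q (h k n - g n) \<le> 1 / (real k + 1)" using h(3) less_imp_le by metis
    moreover have "0 \<le> q (h k n - g n)" for n using h(1) g by (intro nonneg free_diff CS_F)
    ultimately show ?thesis
      using LIMSEQ_le_const2 LIMSEQ_le_const[of _ _ 0] by (meson atLeastAtMost_iff)
  qed
  have "(\<lambda>k. sa_norm CC (sa_add CC (cls (h k)) (sa_scale CC (- 1) (cls g)))) \<longlonglongrightarrow> 0"
    unfolding eq
  proof (rule tendsto_sandwich[of "\<lambda>_. 0" _ _ "\<lambda>k. 1 / (real k + 1)"])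
    show "(\<lambda>k. 1 / (real k + 1)) \<longlonglongrightarrow> 0" by real_asymp
  qed (use b in auto)
  moreover have "range (\<lambda>k. cls (h k)) \<subseteq> I" using h by auto
  moreover have "cls g \<in> sa_carrier CC" using g by (auto simp: carrier_CC)
  moreover have "\<And>f x. x \<in> sa_carrier CC \<Longrightarrow> range f \<subseteq> I \<Longrightarrow>
      (\<lambda>n. sa_norm CC (sa_add CC (f n) (sa_scale CC (- 1) x))) \<longlonglongrightarrow> 0 \<Longrightarrow> x \<in> I"
    using I by (simp add: closed_ideal_def)
  ultimately have "cls g \<in> I" by blast
  then show "g \<in> {f \<in> CS. cls f \<in> I}" using g by simp
qed auto

lemma simple_completionI:
  assumes "\<And>J f. seq_ideal J \<Longrightarrow> f \<in> J \<Longrightarrow> \<not> null_seq f \<Longrightarrow> J = CS"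
  shows "simple_cstar CC"
  unfolding simple_cstar_def
proof (intro allI impI)
  fix I assume I: "closed_ideal CC I"
  let ?J = "{f \<in> CS. cls f \<in> I}"
  have sub: "I \<subseteq> cls ` CS" using I by (simp add: closed_ideal_def carrier_CC)
  show "I = {sa_zero CC} \<or> I = sa_carrier CC"
  proof (cases "\<exists>f\<in>?J. \<not> null_seq f")
    case True
    then have "?J = CS" using assms[OF seq_ideal_of_closed_ideal[OF I]] by blast
    then show ?thesis using sub by (auto simp: carrier_CC)
  next
    case False
    have "X = sa_zero CC" if X: "X \<in> I" for X
    proof -
      obtain f where "f \<in> CS" "X = cls f" using X sub by auto
      then show ?thesis using False X unfolding zero_CC
        by (auto simp: cls_eq_iff CS_const free_zero)
    qed
    then show ?thesis using I by (auto simp: closed_ideal_def)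
  qed
qed

text \<open>The sequences that are null for the smaller seminorm \<open>q'\<close> form a closed
  ideal. By \<open>x\<close> it is nonzero, so simplicity makes it everything. Both proofs of
  non-simplicity go through this criterion.\<close>

lemma simple_completionD:
  assumes simple: "simple_cstar CC" and q': "cstar_seminorm X q'"
    and le: "\<And>x. x \<in> F \<Longrightarrow> q' x \<le> q x"
    and x: "x \<in> F" "q' x = 0" "q x \<noteq> 0" and y: "y \<in> F"
  shows "q' y = 0"
proof -
  interpret q': cstar_seminorm X q' by (rule q')
  define J where "J = {f \<in> CS. q'.null_seq f}"
  define I where "I = cls ` J"
  have CS': "f \<in> q'.CS" if f: "f \<in> CS" for f
  proof (rule q'.CSI)
    show "f n \<in> F" for n using that by (rule CS_F)
    fix e :: real assume "e > 0"
    then obtain N where N: "\<And>m n. m \<ge> N \<Longrightarrow> n \<ge> N \<Longrightarrow> q (f m - f n) < e"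
      using CS_cauchy[OF f] by blast
    have "q' (f m - f n) < e" if mn: "m \<ge> N" "n \<ge> N" for m n
      using le[OF free_diff[OF CS_F[OF f] CS_F[OF f]], of m n] N[OF mn] by simp
    then show "\<exists>N. \<forall>m\<ge>N. \<forall>n\<ge>N. q' (f m - f n) < e" by blast
  qed
  have nullJ: "q'.null_seq f" if "\<And>n. f n \<in> F" "null_seq f" for f
    unfolding q'.null_seq_def
    by (rule tendsto_sandwich[of "\<lambda>_. 0" _ _ "\<lambda>n. q (f n)"])
      (use that q'.nonneg le in \<open>auto simp: null_seq_def\<close>)
  \<comment> \<open>Independence of the representative: \<open>q' \<le> q\<close> turns
    \<open>q\<close>-null sequences into \<open>q'\<close>-null ones.\<close>
  have mem: "cls f \<in> I \<longleftrightarrow> f \<in> J" if f: "f \<in> CS" for f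
  proof
    assume "cls f \<in> I"
    then obtain g where g: "g \<in> CS" "q'.null_seq g" "cls f = cls g" by (auto simp: I_def J_def)
    then have "null_seq (\<lambda>n. f n - g n)" using cls_eq_iff f by simp
    then have "q'.null_seq (\<lambda>n. f n - g n)" using f g by (intro nullJ free_diff CS_F)
    then have "q'.null_seq (\<lambda>n. (f n - g n) + g n)"
      using f g by (intro q'.null_seq_add free_diff CS_F)
    then show "f \<in> J" using f by (simp add: J_def)
  qed (auto simp: I_def)
  have IE: "\<exists>f. f \<in> J \<and> f \<in> CS \<and> Z = cls f" if "Z \<in> I" for Z
    using that by (auto simp: I_def J_def)
  have "closed_ideal CC I"
    unfolding closed_ideal_def
  proof (intro conjI ballI allI impI)
    show "I \<subseteq> sa_carrier CC" by (auto simp: I_def J_def carrier_CC)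
    show "sa_zero CC \<in> I" unfolding zero_CC
      by (subst mem) (auto simp: J_def CS_const free_zero q'.null_seq_def q'.zero)
    show "sa_add CC Z W \<in> I" if ZW: "Z \<in> I" "W \<in> I" for Z W
    proof -
      obtain f g where "f \<in> J" "f \<in> CS" "Z = cls f" "g \<in> J" "g \<in> CS" "W = cls g"
        using IE[OF ZW(1)] IE[OF ZW(2)] by blast
      then show ?thesis
        by (auto simp: add_CC mem CS_add J_def CS_F intro!: q'.null_seq_add)
    qed
    show "sa_scale CC c Z \<in> I" if Z: "Z \<in> I" for c Z
    proof -
      obtain f where f: "f \<in> J" "f \<in> CS" "Z = cls f" using IE[OF Z] by blast
      then have "q'.null_seq (\<lambda>n. nc_scale c (f n))"
        by (auto simp: q'.null_seq_def nc_scale_eq q'.scale CS_F J_def intro!: tendsto_mult_right_zero)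
      then show ?thesis using f by (auto simp: scale_CC mem CS_scale J_def)
    qed
    fix Z W assume Z: "Z \<in> I" and W: "W \<in> sa_carrier CC"
    obtain f g where f: "f \<in> J" "f \<in> CS" "Z = cls f" "g \<in> CS" "W = cls g"
      using IE[OF Z] W by (auto simp: carrier_CC)
    then have "q'.null_seq (\<lambda>n. f n * g n)" "q'.null_seq (\<lambda>n. g n * f n)"
      using q'.null_seq_mult1[OF CS'[OF f(4)], of f] q'.null_seq_mult2[OF CS'[OF f(4)], of f]
      by (auto simp: CS_F J_def)
    with f show "sa_mult CC Z W \<in> I" "sa_mult CC W Z \<in> I"
      by (auto simp: mult_CC mem CS_mult J_def)
  next
    fix h Z assume Z: "Z \<in> sa_carrier CC" and h: "range h \<subseteq> I \<and>
      (\<lambda>n. sa_norm CC (sa_add CC (h n) (sa_scale CC (- 1) Z))) \<longlonglongrightarrow> 0"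
    obtain g where g: "g \<in> CS" "Z = cls g" using Z by (auto simp: carrier_CC)
    have "\<forall>k. \<exists>f. f \<in> J \<and> f \<in> CS \<and> h k = cls f" using IE h by blast
    then obtain k where k: "\<And>n. k n \<in> J" "\<And>n. k n \<in> CS" "\<And>n. h n = cls (k n)" by metis
    have "q'.null_seq g"
    proof (rule q'.null_seqI)
      fix e :: real assume e: "e > 0"
      have "sa_add CC (h j) (sa_scale CC (- 1) Z) = cls (\<lambda>n. k j n - g n)" for j
        using k g by (simp add: scale_CC add_CC CS_uminus nc_scale_minus_one)
      then have "(\<lambda>j. sa_norm CC (cls (\<lambda>n. k j n - g n))) \<longlonglongrightarrow> 0" using h by simp
      then have "\<forall>\<^sub>F j in sequentially. sa_norm CC (cls (\<lambda>n. k j n - g n)) < e / 2"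
        using e by (intro order_tendstoD(2)) auto
      then obtain j where j: "sa_norm CC (cls (\<lambda>n. k j n - g n)) < e / 2"
        by (auto simp: eventually_sequentially)
      have "(\<lambda>n. q (k j n - g n)) \<longlonglongrightarrow> sa_norm CC (cls (\<lambda>n. k j n - g n))"
        using k g by (intro norm_CC CS_diff)
      then have "\<forall>\<^sub>F n in sequentially. q (k j n - g n) < e / 2"
        using j order_tendstoD(2) by blast
      then obtain N1 where N1: "\<And>n. n \<ge> N1 \<Longrightarrow> q (k j n - g n) < e / 2"
        by (auto simp: eventually_sequentially)
      obtain N2 where N2: "\<And>n. n \<ge> N2 \<Longrightarrow> q' (k j n) < e / 2"
        using q'.null_seqD[of "k j" "e / 2"] k(1)[of j] CS_F e by (auto simp: J_def)
      have "q' (g n) < e" if n: "n \<ge> max N1 N2" for n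
      proof -
        have "q' (g n) = q' (k j n - (k j n - g n))" by simp
        also have "\<dots> \<le> q' (k j n) + q' (k j n - g n)"
          using k g by (intro q'.triangle_diff free_diff CS_F)
        also have "q' (k j n - g n) \<le> q (k j n - g n)" using k g by (intro le free_diff CS_F)
        finally show ?thesis using N1[of n] N2[of n] n by simp
      qed
      then show "\<exists>N. \<forall>n\<ge>N. q' (g n) < e" by blast
    qed (use g CS_F in blast)
    then show "Z \<in> I" using g by (simp add: mem J_def)
  qed
  then have "I = {sa_zero CC} \<or> I = sa_carrier CC" using simple by (simp add: simple_cstar_def)
  moreover have "I \<noteq> {sa_zero CC}"
  proof
    assume eq: "I = {sa_zero CC}"
    have "cls (\<lambda>_. x) \<in> I" using x by (subst mem) (auto simp: CS_const J_def q'.null_seq_def)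
    then have "cls (\<lambda>_. x) = cls (\<lambda>_. 0)" using eq by (simp add: zero_CC)
    then show False using x cls_eq_iff[of "\<lambda>_. x" "\<lambda>_. 0"]
      by (simp add: CS_const free_zero null_seq_def LIMSEQ_const_iff)
  qed
  ultimately have "cls (\<lambda>_. y) \<in> I" using y by (simp add: carrier_CC CS_const)
  then show ?thesis using y
    by (simp add: mem CS_const J_def q'.null_seq_def LIMSEQ_const_iff)
qed

text \<open>For a projection \<open>e\<close> and \<open>f\<close> in the ideal, \<open>(e - f) ^ k\<close> is \<open>e\<close> up to an element of the
  ideal, while its norm tends to zero.\<close>
lemma projection_in_ideal:
  assumes J: "seq_ideal J" and e: "e \<in> F" "q (e * e - e) = 0"
    and f: "f \<in> J" and r: "r < 1" "\<And>n. n \<ge> N \<Longrightarrow> q (e - f n) \<le> r"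
  shows "(\<lambda>_. e) \<in> J"
proof -
  have JC: "J \<subseteq> CS" using seq_ideal_CS[OF J] by blast
  note J_add = seq_ideal_add[OF J] and J_minus = seq_ideal_minus[OF J]
    and J_mult = seq_ideal_mult1[OF J] seq_ideal_mult2[OF J]
  have eC: "(\<lambda>_. e) \<in> CS" by (rule CS_const[OF e(1)])
  have fF: "f n \<in> F" for n using f JC CS_F by blast
  have r0: "r \<ge> 0" using r(2)[of N] nonneg[OF free_diff[OF e(1) fF[of N]]] by simp
  have "\<exists>g\<in>J. \<forall>n\<ge>N. q (e - g n) \<le> r ^ Suc k" for k
  proof (induction k)
    case 0
    then show ?case using f r by auto
  next
    case (Suc k)
    then obtain g where g: "g \<in> J" "\<And>n. n \<ge> N \<Longrightarrow> q (e - g n) \<le> r ^ Suc k" by blast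
    \<comment> \<open>Chosen so that \<open>e - h n = (e - g n) * (e - f n)\<close> holds exactly;
      the first summand compensates that \<open>e\<close> is idempotent only modulo the kernel of
      \<open>q\<close>.\<close>
    define h where "h = (\<lambda>n. - (e * e - e) + (e * f n + (g n * e + - (g n * f n))))"
    have "(\<lambda>_. - (e * e - e)) \<in> J"
    proof -
      have "(\<lambda>_. e * e - e) \<in> J"
        using J e CS_const[of "e * e - e"]
        by (auto simp: seq_ideal_def null_seq_def free_diff free_mult)
      then show ?thesis by (rule J_minus)
    qed
    moreover have "(\<lambda>n. e * f n) \<in> J" by (rule J_mult(2)[OF f eC])
    moreover have "(\<lambda>n. g n * e) \<in> J" by (rule J_mult(1)[OF g(1) eC])
    moreover have "(\<lambda>n. - (g n * f n)) \<in> J"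
      using J_minus[OF J_mult(1)[OF g(1)]] f JC by blast
    ultimately have "h \<in> J" unfolding h_def by (intro J_add)
    moreover have "q (e - h n) \<le> r ^ Suc (Suc k)" if n: "n \<ge> N" for n
    proof -
      have "e - h n = (e - g n) * (e - f n)" by (simp add: h_def algebra_simps)
      then have "q (e - h n) \<le> q (e - g n) * q (e - f n)"
        using g f JC e by (metis submult free_diff CS_F subsetD)
      also have "\<dots> \<le> r ^ Suc k * r"
        using g f JC e n r r0 fF by (intro mult_mono nonneg free_diff) auto
      finally show ?thesis by (simp add: mult.commute)
    qed
    ultimately show ?case by blast
  qed
  then have ex: "\<exists>g\<in>J. \<forall>n\<ge>N. q (e - g n) \<le> r ^ Suc k" for k .
  have "\<exists>g\<in>J. \<exists>N. \<forall>n\<ge>N. q (g n - e) < d" if d: "d > 0" for d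
  proof -
    obtain k where "r ^ k < d" using real_arch_pow_inv[OF d r(1)] by blast
    moreover have "r ^ Suc k \<le> r ^ k" using r0 r(1) by (simp add: mult_left_le_one_le)
    moreover obtain g where g: "g \<in> J" "\<And>n. n \<ge> N \<Longrightarrow> q (e - g n) \<le> r ^ Suc k" using ex by blast
    ultimately have "q (g n - e) < d" if "n \<ge> N" for n
      using g(2)[OF that] diff_commute[of e "g n"] e(1) g(1) JC CS_F by force
    then show ?thesis using g by blast
  qed
  then show ?thesis by (rule seq_ideal_closed[OF J eC])
qed

end

section \<open>Representations by partial bijections\<close>

text \<open>Finitely supported functions on \<open>'x\<close> form a pre-Hilbert space. The letter \<open>(g, b)\<close> acts by
  composition with the partial bijection \<open>\<tau> g b\<close>, so \<open>\<tau>\<close> describes the inverses of the maps that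
  move the point masses.\<close>

definition fsupp :: "('x \<Rightarrow> complex) \<Rightarrow> bool" where
  "fsupp f \<longleftrightarrow> finite {x. f x \<noteq> 0}"

text \<open>Linear in the first argument. Summing over its support gives a finite sum whenever
  \<open>f\<close> has finite support, whatever \<open>g\<close> is.\<close>

definition inner2 :: "('x \<Rightarrow> complex) \<Rightarrow> ('x \<Rightarrow> complex) \<Rightarrow> complex" where
  "inner2 f g = (\<Sum>x | f x \<noteq> 0. f x * cnj (g x))"

definition nrm2 :: "('x \<Rightarrow> complex) \<Rightarrow> real" where
  "nrm2 f = L2_set (\<lambda>x. cmod (f x)) {x. f x \<noteq> 0}"

definition delta :: "'x \<Rightarrow> 'x \<Rightarrow> complex" where
  "delta \<xi> = (\<lambda>x. if x = \<xi> then 1 else 0)"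

lemma inner2_superset: "finite A \<Longrightarrow> {x. f x \<noteq> 0} \<subseteq> A \<Longrightarrow> inner2 f g = (\<Sum>x\<in>A. f x * cnj (g x))"
  unfolding inner2_def by (rule sum.mono_neutral_left) auto

lemma nrm2_superset: "finite A \<Longrightarrow> {x. f x \<noteq> 0} \<subseteq> A \<Longrightarrow> nrm2 f = L2_set (\<lambda>x. cmod (f x)) A"
  unfolding nrm2_def L2_set_def by (intro arg_cong[of _ _ sqrt] sum.mono_neutral_left) auto

lemma nrm2_nonneg [simp]: "0 \<le> nrm2 f"
  by (simp add: nrm2_def)

lemma nrm2_sq: "(nrm2 f)\<^sup>2 = (\<Sum>x | f x \<noteq> 0. (cmod (f x))\<^sup>2)"
  unfolding nrm2_def L2_set_def by (simp add: sum_nonneg)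

lemma nrm2_zero [simp]: "nrm2 (\<lambda>x. 0) = 0"
  by (simp add: nrm2_def)

lemma nrm2_eq_0: "fsupp f \<Longrightarrow> nrm2 f = 0 \<Longrightarrow> f = (\<lambda>x. 0)"
  unfolding nrm2_def fsupp_def by (subst (asm) L2_set_eq_0_iff) auto

lemma fsupp_add: "fsupp f \<Longrightarrow> fsupp g \<Longrightarrow> fsupp (\<lambda>x. f x + g x)"
  unfolding fsupp_def by (rule finite_subset[of _ "{x. f x \<noteq> 0} \<union> {x. g x \<noteq> 0}"]) auto

lemma fsupp_scale: "fsupp f \<Longrightarrow> fsupp (\<lambda>x. c * f x)"
  unfolding fsupp_def by (rule finite_subset[of _ "{x. f x \<noteq> 0}"]) auto

lemma fsupp_zero [simp]: "fsupp (\<lambda>x. 0)"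
  by (simp add: fsupp_def)

lemma fsupp_delta [simp]: "fsupp (delta \<xi>)"
  by (simp add: fsupp_def delta_def)

lemma nrm2_delta [simp]: "nrm2 (delta \<xi>) = 1"
  by (simp add: nrm2_def delta_def L2_set_def)

lemma nrm2_scale: "fsupp f \<Longrightarrow> nrm2 (\<lambda>x. c * f x) = cmod c * nrm2 f"
  using nrm2_superset[of "{x. f x \<noteq> 0}" "\<lambda>x. c * f x"]
  by (auto simp: nrm2_def L2_set_right_distrib norm_mult fsupp_def)

lemma nrm2_add: assumes "fsupp f" "fsupp g" shows "nrm2 (\<lambda>x. f x + g x) \<le> nrm2 f + nrm2 g"
proof -
  let ?A = "{x. f x \<noteq> 0} \<union> {x. g x \<noteq> 0}"
  have A: "finite ?A" using assms by (simp add: fsupp_def)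
  have "nrm2 (\<lambda>x. f x + g x) = L2_set (\<lambda>x. cmod (f x + g x)) ?A"
    using A by (intro nrm2_superset) auto
  also have "\<dots> \<le> L2_set (\<lambda>x. cmod (f x) + cmod (g x)) ?A"
    by (intro L2_set_mono norm_triangle_ineq) auto
  also have "\<dots> \<le> L2_set (\<lambda>x. cmod (f x)) ?A + L2_set (\<lambda>x. cmod (g x)) ?A"
    by (rule L2_set_triangle_ineq)
  also have "\<dots> = nrm2 f + nrm2 g"
    using A by (subst (1 2) nrm2_superset[of ?A]) auto
  finally show ?thesis .
qed

lemma nrm2_le_value: assumes "fsupp f" shows "cmod (f x) \<le> nrm2 f"
proof (cases "f x = 0")
  case False
  have "cmod (f x) \<le> L2_set (\<lambda>x. cmod (f x)) {x. f x \<noteq> 0}"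
    using assms False by (intro member_le_L2_set) (auto simp: fsupp_def)
  then show ?thesis by (simp add: nrm2_def)
qed simp

lemma inner2_Cauchy_Schwarz: assumes "fsupp f" "fsupp g" shows "cmod (inner2 f g) \<le> nrm2 f * nrm2 g"
proof -
  let ?A = "{x. f x \<noteq> 0} \<union> {x. g x \<noteq> 0}"
  have A: "finite ?A" using assms by (simp add: fsupp_def)
  have "inner2 f g = (\<Sum>x\<in>?A. f x * cnj (g x))" using A by (intro inner2_superset) auto
  then have "cmod (inner2 f g) \<le> (\<Sum>x\<in>?A. \<bar>cmod (f x)\<bar> * \<bar>cmod (g x)\<bar>)"
    using norm_sum[of "\<lambda>x. f x * cnj (g x)" ?A] by (simp add: norm_mult)
  also have "\<dots> \<le> L2_set (\<lambda>x. cmod (f x)) ?A * L2_set (\<lambda>x. cmod (g x)) ?A"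
    by (rule L2_set_mult_ineq)
  also have "\<dots> = nrm2 f * nrm2 g"
    using A by (subst (1 2) nrm2_superset[of ?A]) auto
  finally show ?thesis .
qed

lemma inner2_self: "inner2 f f = complex_of_real ((nrm2 f)\<^sup>2)"
  unfolding inner2_def nrm2_sq by (simp add: complex_norm_square[symmetric])

text \<open>Used for both values of \<open>b\<close>, the axiom says that
  \<open>\<tau> g False\<close> and \<open>\<tau> g True\<close> are mutually inverse partial
  injections. This is what makes adjoint letters act as adjoint operators.\<close>

locale partial_bij_rep =
  fixes \<tau> :: "'g \<Rightarrow> bool \<Rightarrow> 'x \<Rightarrow> 'x option"
  assumes tau_inv: "\<tau> g b x = Some y \<Longrightarrow> \<tau> g (\<not> b) y = Some x"
begin

text \<open>Functions are pulled back along the partial maps, so the leftmost letter of a word moves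
  the point before the others do.\<close>

fun wact :: "('g \<times> bool) list \<Rightarrow> 'x \<Rightarrow> 'x option" where
  "wact [] x = Some x"
| "wact ((g, b) # w) x = Option.bind (\<tau> g b x) (wact w)"

lemma wact_append: "wact (u @ v) x = Option.bind (wact u x) (wact v)"
  by (induction u x rule: wact.induct) (auto split: Option.bind_split)

lemma wact_inv: "wact w x = Some y \<Longrightarrow> wact (rev (map (\<lambda>(g, b). (g, \<not> b)) w)) y = Some x"
  by (induction w x rule: wact.induct)
    (auto simp: wact_append Option.bind_eq_Some_conv dest: tau_inv)

definition mact :: "'g monomial \<Rightarrow> 'x \<Rightarrow> 'x option" where
  "mact m = wact (letters m)"

lemma mact_add: "mact (m + m') x = Option.bind (mact m x) (mact m')"
  by (simp add: mact_def wact_append)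

lemma mact_zero [simp]: "mact 0 x = Some x"
  by (simp add: mact_def)

lemma mact_star: "mact m x = Some y \<longleftrightarrow> mact (mono_star m) y = Some x"
  using wact_inv[of "letters m" x y] wact_inv[of "letters (mono_star m)" y x]
  by (auto simp: mact_def mono_star_def rev_map o_def case_prod_unfold)

section \<open>The operators of monomials and polynomials\<close>

definition mop :: "'g monomial \<Rightarrow> ('x \<Rightarrow> complex) \<Rightarrow> 'x \<Rightarrow> complex" where
  "mop m f \<eta> = (case mact m \<eta> of None \<Rightarrow> 0 | Some \<xi> \<Rightarrow> f \<xi>)"

definition act_on :: "'g ncpoly \<Rightarrow> ('x \<Rightarrow> complex) \<Rightarrow> 'x \<Rightarrow> complex" where
  "act_on x f \<eta> = (\<Sum>m\<in>Poly_Mapping.keys x. Poly_Mapping.lookup x m * mop m f \<eta>)"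

lemma act_on_superset: "finite A \<Longrightarrow> Poly_Mapping.keys x \<subseteq> A \<Longrightarrow>
    act_on x f \<eta> = (\<Sum>m\<in>A. Poly_Mapping.lookup x m * mop m f \<eta>)"
  unfolding act_on_def by (rule sum.mono_neutral_left) (auto simp: in_keys_iff)

lemma act_on_add: "act_on (x + y) f = (\<lambda>\<eta>. act_on x f \<eta> + act_on y f \<eta>)"
proof
  fix \<eta>
  let ?A = "Poly_Mapping.keys x \<union> Poly_Mapping.keys y"
  have "act_on (x + y) f \<eta> = (\<Sum>m\<in>?A. Poly_Mapping.lookup (x + y) m * mop m f \<eta>)"
    using keys_add[of x y] by (intro act_on_superset) auto
  also have "\<dots> = (\<Sum>m\<in>?A. Poly_Mapping.lookup x m * mop m f \<eta>) + (\<Sum>m\<in>?A. Poly_Mapping.lookup y m * mop m f \<eta>)"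
    by (simp add: lookup_add ring_distribs sum.distrib)
  also have "\<dots> = act_on x f \<eta> + act_on y f \<eta>"
    by (subst (1 2) act_on_superset[of ?A]) auto
  finally show "act_on (x + y) f \<eta> = act_on x f \<eta> + act_on y f \<eta>" .
qed

lemma act_on_single: "act_on (Poly_Mapping.single m c) f = (\<lambda>\<eta>. c * mop m f \<eta>)"
  by (simp add: act_on_def fun_eq_iff)

lemma act_on_zero [simp]: "act_on 0 f = (\<lambda>\<eta>. 0)"
  by (simp add: act_on_def fun_eq_iff)

lemma mop_mop: "mop m (mop m' f) = mop (m + m') f"
  by (auto simp: mop_def mact_add fun_eq_iff split: option.splits)

lemma mop_add: "mop m (\<lambda>\<eta>. f \<eta> + g \<eta>) = (\<lambda>\<eta>. mop m f \<eta> + mop m g \<eta>)"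
  by (auto simp: mop_def fun_eq_iff split: option.splits)

lemma mop_scale: "mop m (\<lambda>\<eta>. c * f \<eta>) = (\<lambda>\<eta>. c * mop m f \<eta>)"
  by (auto simp: mop_def fun_eq_iff split: option.splits)

lemma act_on_fun_add: "act_on x (\<lambda>\<eta>. f \<eta> + g \<eta>) = (\<lambda>\<eta>. act_on x f \<eta> + act_on x g \<eta>)"
  by (simp add: act_on_def fun_eq_iff mop_add ring_distribs sum.distrib)

lemma act_on_fun_scale: "act_on x (\<lambda>\<eta>. c * f \<eta>) = (\<lambda>\<eta>. c * act_on x f \<eta>)"
  by (simp add: act_on_def fun_eq_iff mop_scale sum_distrib_left algebra_simps)

lemma act_on_mult: "act_on (x * y) f = act_on x (act_on y f)"
proof (induction x rule: ncpoly_induct)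
  case (single m c)
  show ?case
    by (induction y rule: ncpoly_induct)
      (simp_all add: mult_single act_on_single mop_scale mop_mop mop_add ring_distribs act_on_add mult.assoc)
qed (simp add: ring_distribs act_on_add)

lemma act_on_uminus: "act_on (- x) f = (\<lambda>\<eta>. - act_on x f \<eta>)"
  by (simp add: act_on_def fun_eq_iff sum_negf)

lemma act_on_diff: "act_on (x - y) f = (\<lambda>\<eta>. act_on x f \<eta> - act_on y f \<eta>)"
  using act_on_add[of x "- y" f] by (simp add: act_on_uminus)

lemma act_on_sum: "act_on (sum h A) f = (\<lambda>\<eta>. \<Sum>i\<in>A. act_on (h i) f \<eta>)"
  by (induction A rule: infinite_finite_induct) (auto simp: act_on_add)

lemma act_on_cst: "act_on (cst c) f = (\<lambda>\<eta>. c * f \<eta>)"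
  by (simp add: act_on_single mop_def)

lemma act_on_one: "act_on 1 f = f"
  using act_on_cst[of 1 f] by simp

lemma act_on_gen: "act_on (nc_gen g) f \<eta> = (case \<tau> g False \<eta> of None \<Rightarrow> 0 | Some \<xi> \<Rightarrow> f \<xi>)"
  by (auto simp: nc_gen_def act_on_single mop_def mact_def split: option.splits Option.bind_splits)

lemma act_on_gen_star:
  "act_on (nc_star (nc_gen g)) f \<eta> = (case \<tau> g True \<eta> of None \<Rightarrow> 0 | Some \<xi> \<Rightarrow> f \<xi>)"
  by (auto simp: nc_gen_def act_on_single mop_def mact_def mono_star_def split: option.splits Option.bind_splits)

text \<open>The support of the image is an injective image of a part of the support of
  \<open>f\<close>. Finite support and the contraction property both follow from it.\<close>

lemma mop_supp: "{\<eta>. mop m f \<eta> \<noteq> 0} = (\<lambda>\<xi>. the (mact (mono_star m) \<xi>)) ` {\<xi>. f \<xi> \<noteq> 0 \<and> mact (mono_star m) \<xi> \<noteq> None}"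
proof -
  have "\<eta> \<in> (\<lambda>\<xi>. the (mact (mono_star m) \<xi>)) ` {\<xi>. f \<xi> \<noteq> 0 \<and> mact (mono_star m) \<xi> \<noteq> None}"
    if "mop m f \<eta> \<noteq> 0" for \<eta>
  proof -
    obtain \<xi> where "mact m \<eta> = Some \<xi>" "f \<xi> \<noteq> 0"
      using \<open>mop m f \<eta> \<noteq> 0\<close> by (auto simp: mop_def split: option.splits)
    then show ?thesis using mact_star[of m \<eta> \<xi>] by (auto intro!: image_eqI[of _ _ \<xi>])
  qed
  moreover have "mop m f \<eta> \<noteq> 0" if "f \<xi> \<noteq> 0" "mact (mono_star m) \<xi> = Some \<eta>" for \<xi> \<eta>
    using that mact_star[of m \<eta> \<xi>] by (simp add: mop_def)
  ultimately show ?thesis by force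
qed

lemma inj_mact_star: "inj_on (\<lambda>\<xi>. the (mact (mono_star m) \<xi>)) {\<xi>. f \<xi> \<noteq> 0 \<and> mact (mono_star m) \<xi> \<noteq> None}"
  by (rule inj_onI) (use mact_star in \<open>force\<close>)

lemma fsupp_mop: "fsupp f \<Longrightarrow> fsupp (mop m f)"
  unfolding fsupp_def mop_supp by auto

lemma fsupp_act_on: "fsupp f \<Longrightarrow> fsupp (act_on x f)"
  by (induction x rule: ncpoly_induct)
    (auto simp: act_on_single act_on_add intro: fsupp_add fsupp_scale fsupp_mop)

lemma nrm2_mop: assumes "fsupp f" shows "nrm2 (mop m f) \<le> nrm2 f"
proof -
  let ?S = "{\<xi>. f \<xi> \<noteq> 0 \<and> mact (mono_star m) \<xi> \<noteq> None}"
  let ?t = "\<lambda>\<xi>. the (mact (mono_star m) \<xi>)"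
  have "(nrm2 (mop m f))\<^sup>2 = (\<Sum>\<xi>\<in>?S. (cmod (mop m f (?t \<xi>)))\<^sup>2)"
    unfolding nrm2_sq mop_supp by (subst sum.reindex[OF inj_mact_star]) simp
  also have "\<dots> = (\<Sum>\<xi>\<in>?S. (cmod (f \<xi>))\<^sup>2)"
  proof (intro sum.cong refl)
    fix \<xi> assume "\<xi> \<in> ?S"
    then obtain \<eta> where \<eta>: "mact (mono_star m) \<xi> = Some \<eta>" by auto
    then have "mact m \<eta> = Some \<xi>" by (simp add: mact_star[of m])
    then show "(cmod (mop m f (?t \<xi>)))\<^sup>2 = (cmod (f \<xi>))\<^sup>2" using \<eta> by (simp add: mop_def)
  qed
  also have "\<dots> \<le> (\<Sum>\<xi> | f \<xi> \<noteq> 0. (cmod (f \<xi>))\<^sup>2)"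
    using assms by (intro sum_mono2) (auto simp: fsupp_def)
  finally have "(nrm2 (mop m f))\<^sup>2 \<le> (nrm2 f)\<^sup>2" unfolding nrm2_sq[of f] .
  then show ?thesis by (rule power2_le_imp_le) simp
qed

lemma act_on_bounded: "\<exists>c\<ge>0. \<forall>f. fsupp f \<longrightarrow> nrm2 (act_on x f) \<le> c * nrm2 f"
proof (induction x rule: ncpoly_induct)
  case (single m c)
  then show ?case
    by (intro exI[of _ "cmod c"]) (auto simp: act_on_single nrm2_scale fsupp_mop intro: mult_left_mono nrm2_mop)
next
  case (add x y)
  then obtain c d where c: "c \<ge> 0" "\<And>f. fsupp f \<Longrightarrow> nrm2 (act_on x f) \<le> c * nrm2 f"
    and d: "d \<ge> 0" "\<And>f. fsupp f \<Longrightarrow> nrm2 (act_on y f) \<le> d * nrm2 f" by blast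
  have "nrm2 (act_on (x + y) f) \<le> (c + d) * nrm2 f" if "fsupp f" for f
    using nrm2_add[of "act_on x f" "act_on y f"] c(2)[OF that] d(2)[OF that] that
    by (simp add: act_on_add fsupp_act_on ring_distribs)
  then show ?case using c(1) d(1) by (intro exI[of _ "c + d"]) auto
qed

lemma inner2_mop: assumes "fsupp f" "fsupp g"
  shows "inner2 (mop m f) g = inner2 f (mop (mono_star m) g)"
proof -
  have "inner2 (mop m f) g = (\<Sum>\<eta> | mop m f \<eta> \<noteq> 0 \<and> g \<eta> \<noteq> 0. mop m f \<eta> * cnj (g \<eta>))"
    unfolding inner2_def using fsupp_mop[OF assms(1)] by (intro sum.mono_neutral_right) (auto simp: fsupp_def)
  also have "\<dots> = (\<Sum>\<xi> | f \<xi> \<noteq> 0 \<and> mop (mono_star m) g \<xi> \<noteq> 0. f \<xi> * cnj (mop (mono_star m) g \<xi>))"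
  proof (rule sum.reindex_bij_witness[of _ "\<lambda>\<xi>. the (mact (mono_star m) \<xi>)" "\<lambda>\<eta>. the (mact m \<eta>)"])
    fix \<eta> assume "\<eta> \<in> {\<eta>. mop m f \<eta> \<noteq> 0 \<and> g \<eta> \<noteq> 0}"
    then obtain \<xi> where \<xi>: "mact m \<eta> = Some \<xi>" "f \<xi> \<noteq> 0" "g \<eta> \<noteq> 0"
      by (auto simp: mop_def split: option.splits)
    moreover have "mact (mono_star m) \<xi> = Some \<eta>" using \<xi>(1) by (simp add: mact_star[of m])
    ultimately show "the (mact (mono_star m) (the (mact m \<eta>))) = \<eta>"
      "the (mact m \<eta>) \<in> {\<xi>. f \<xi> \<noteq> 0 \<and> mop (mono_star m) g \<xi> \<noteq> 0}"
      "f (the (mact m \<eta>)) * cnj (mop (mono_star m) g (the (mact m \<eta>))) = mop m f \<eta> * cnj (g \<eta>)"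
      by (simp_all add: mop_def)
  next
    fix \<xi> assume "\<xi> \<in> {\<xi>. f \<xi> \<noteq> 0 \<and> mop (mono_star m) g \<xi> \<noteq> 0}"
    then obtain \<eta> where \<eta>: "mact (mono_star m) \<xi> = Some \<eta>" "f \<xi> \<noteq> 0" "g \<eta> \<noteq> 0"
      by (auto simp: mop_def split: option.splits)
    moreover have "mact m \<eta> = Some \<xi>" using \<eta>(1) by (simp add: mact_star[of m])
    ultimately show "the (mact m (the (mact (mono_star m) \<xi>))) = \<xi>"
      "the (mact (mono_star m) \<xi>) \<in> {\<eta>. mop m f \<eta> \<noteq> 0 \<and> g \<eta> \<noteq> 0}"
      by (simp_all add: mop_def)
  qed
  also have "\<dots> = inner2 f (mop (mono_star m) g)"
    unfolding inner2_def using assms by (intro sum.mono_neutral_left) (auto simp: fsupp_def)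
  finally show ?thesis .
qed

lemma inner2_add_left: "fsupp f \<Longrightarrow> fsupp g \<Longrightarrow> inner2 (\<lambda>x. f x + g x) h = inner2 f h + inner2 g h"
  by (subst (1 2 3) inner2_superset[of "{x. f x \<noteq> 0} \<union> {x. g x \<noteq> 0}"])
    (auto simp: fsupp_def ring_distribs sum.distrib)

lemma inner2_add_right: "inner2 f (\<lambda>x. g x + h x) = inner2 f g + inner2 f h"
  by (simp add: inner2_def ring_distribs sum.distrib)

lemma inner2_scale_left: "fsupp f \<Longrightarrow> inner2 (\<lambda>x. c * f x) h = c * inner2 f h"
  by (subst inner2_superset[of "{x. f x \<noteq> 0}"])
    (auto simp: fsupp_def inner2_def sum_distrib_left algebra_simps)

lemma inner2_scale_right: "inner2 f (\<lambda>x. c * h x) = cnj c * inner2 f h"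
  by (simp add: inner2_def sum_distrib_left algebra_simps)

lemma inner2_adjoint: assumes "fsupp f" "fsupp g"
  shows "inner2 (act_on x f) g = inner2 f (act_on (nc_star x) g)"
  using assms
  by (induction x rule: ncpoly_induct)
    (simp_all add: act_on_single act_on_add inner2_scale_left inner2_scale_right inner2_mop fsupp_mop
      fsupp_act_on inner2_add_left inner2_add_right)

text \<open>The operator norm, computed on finitely supported functions alone; the space itself is
  never completed.\<close>

definition opn :: "'g ncpoly \<Rightarrow> real" where
  "opn x = Inf_class.Inf {c. c \<ge> 0 \<and> (\<forall>f. fsupp f \<longrightarrow> nrm2 (act_on x f) \<le> c * nrm2 f)}"

lemma opn_le: "c \<ge> 0 \<Longrightarrow> (\<And>f. fsupp f \<Longrightarrow> nrm2 (act_on x f) \<le> c * nrm2 f) \<Longrightarrow> opn x \<le> c"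
  unfolding opn_def by (rule cInf_lower) (auto intro: bdd_belowI[of _ 0])

lemma opn_nonneg: "0 \<le> opn x"
  unfolding opn_def using act_on_bounded[of x] by (intro cInf_greatest) auto

lemma opn_bound: assumes "fsupp f" shows "nrm2 (act_on x f) \<le> opn x * nrm2 f"
proof (cases "nrm2 f = 0")
  case True
  then have "f = (\<lambda>x. 0)" using nrm2_eq_0 assms by blast
  then have "act_on x f = (\<lambda>x. 0)" using act_on_fun_scale[of x 0 f] by simp
  then show ?thesis using True by simp
next
  case False
  then have pos: "nrm2 f > 0" using nrm2_nonneg[of f] by linarith
  have "nrm2 (act_on x f) / nrm2 f \<le> opn x"
    unfolding opn_def using act_on_bounded[of x] pos assms
    by (intro cInf_greatest) (auto simp: divide_simps)
  then show ?thesis using pos by (simp add: divide_simps)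
qed

lemma opn_star_le: "opn (nc_star x) \<le> opn x"
proof (rule opn_le[OF opn_nonneg])
  fix f :: "'x \<Rightarrow> complex" assume f: "fsupp f"
  let ?g = "act_on (nc_star x) f"
  have g: "fsupp ?g" using f by (rule fsupp_act_on)
  have "complex_of_real ((nrm2 ?g)\<^sup>2) = inner2 ?g ?g" by (simp add: inner2_self)
  also have "\<dots> = inner2 f (act_on x ?g)" using f g by (subst inner2_adjoint) auto
  finally have "(nrm2 ?g)\<^sup>2 = cmod (inner2 f (act_on x ?g))" by (metis norm_of_real abs_power2)
  also have "\<dots> \<le> nrm2 f * nrm2 (act_on x ?g)"
    using f g by (intro inner2_Cauchy_Schwarz fsupp_act_on)
  also have "\<dots> \<le> nrm2 f * (opn x * nrm2 ?g)" by (intro mult_left_mono opn_bound g) simp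
  finally have "nrm2 ?g * nrm2 ?g \<le> (opn x * nrm2 f) * nrm2 ?g" by (simp add: power2_eq_square algebra_simps)
  then show "nrm2 ?g \<le> opn x * nrm2 f"
    using nrm2_nonneg[of ?g] nrm2_nonneg[of f] opn_nonneg[of x]
    by (metis mult_nonneg_nonneg mult_right_le_imp_le order_le_less)
qed

lemma opn_cstar_seminorm: "cstar_seminorm_on A opn"
  unfolding cstar_seminorm_on_def
proof (intro conjI ballI allI)
  fix x y :: "'g ncpoly" and c
  show "0 \<le> opn x" by (rule opn_nonneg)
  show "opn (x + y) \<le> opn x + opn y"
  proof (rule opn_le)
    fix f :: "'x \<Rightarrow> complex" assume f: "fsupp f"
    have "nrm2 (act_on (x + y) f) \<le> nrm2 (act_on x f) + nrm2 (act_on y f)"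
      unfolding act_on_add using f by (intro nrm2_add fsupp_act_on)
    also have "\<dots> \<le> opn x * nrm2 f + opn y * nrm2 f" by (intro add_mono opn_bound f)
    finally show "nrm2 (act_on (x + y) f) \<le> (opn x + opn y) * nrm2 f" by (simp add: ring_distribs)
  qed (simp add: opn_nonneg)
  show mult: "opn (x * y) \<le> opn x * opn y" for x y
  proof (rule opn_le)
    fix f :: "'x \<Rightarrow> complex" assume f: "fsupp f"
    have "nrm2 (act_on (x * y) f) \<le> opn x * nrm2 (act_on y f)"
      unfolding act_on_mult using f by (intro opn_bound fsupp_act_on)
    also have "\<dots> \<le> opn x * (opn y * nrm2 f)" by (intro mult_left_mono opn_bound f opn_nonneg)
    finally show "nrm2 (act_on (x * y) f) \<le> opn x * opn y * nrm2 f" by simp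
  qed (simp add: opn_nonneg)
  have scale: "opn (nc_scale c x) \<le> cmod c * opn x" for c x
  proof (rule opn_le)
    fix f :: "'x \<Rightarrow> complex" assume f: "fsupp f"
    have "nrm2 (act_on (nc_scale c x) f) = cmod c * nrm2 (act_on x f)"
      using f by (simp add: nc_scale_eq act_on_mult act_on_cst nrm2_scale fsupp_act_on)
    also have "\<dots> \<le> cmod c * (opn x * nrm2 f)" by (intro mult_left_mono opn_bound f) simp
    finally show "nrm2 (act_on (nc_scale c x) f) \<le> cmod c * opn x * nrm2 f" by simp
  qed (simp add: opn_nonneg)
  show "opn (nc_scale c x) = cmod c * opn x"
  proof (cases "c = 0")
    case True
    then show ?thesis using scale[of c x] opn_nonneg[of "nc_scale c x"] by simp
  next
    case False
    have "cmod c * opn x = cmod c * opn (nc_scale (inverse c) (nc_scale c x))"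
      using False by (simp add: nc_scale_eq cst_mult flip: mult.assoc)
    also have "\<dots> \<le> cmod c * (cmod (inverse c) * opn (nc_scale c x))"
      by (intro mult_left_mono scale) auto
    also have "\<dots> = opn (nc_scale c x)" using False by (simp add: norm_inverse)
    finally show ?thesis using scale[of c x] by simp
  qed
  show "opn (nc_star x * x) = (opn x)\<^sup>2"
  proof (rule antisym)
    have "opn (nc_star x * x) \<le> opn (nc_star x) * opn x" by (rule mult)
    also have "\<dots> \<le> opn x * opn x" by (intro mult_right_mono opn_star_le opn_nonneg)
    finally show "opn (nc_star x * x) \<le> (opn x)\<^sup>2" by (simp add: power2_eq_square)
    have "opn x \<le> sqrt (opn (nc_star x * x))"
    proof (rule opn_le)
      fix f :: "'x \<Rightarrow> complex" assume f: "fsupp f"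
      have "complex_of_real ((nrm2 (act_on x f))\<^sup>2) = inner2 (act_on x f) (act_on x f)"
        by (simp add: inner2_self)
      also have "\<dots> = inner2 f (act_on (nc_star x * x) f)"
        using f by (simp add: inner2_adjoint fsupp_act_on act_on_mult)
      finally have "(nrm2 (act_on x f))\<^sup>2 = cmod (inner2 f (act_on (nc_star x * x) f))"
        by (metis norm_of_real abs_power2)
      also have "\<dots> \<le> nrm2 f * nrm2 (act_on (nc_star x * x) f)"
        using f by (intro inner2_Cauchy_Schwarz fsupp_act_on)
      also have "\<dots> \<le> nrm2 f * (opn (nc_star x * x) * nrm2 f)"
        by (intro mult_left_mono opn_bound f) simp
      finally have "nrm2 (act_on x f) \<le> sqrt (opn (nc_star x * x) * (nrm2 f)\<^sup>2)"
        by (intro real_le_rsqrt) (simp add: power2_eq_square algebra_simps)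
      then show "nrm2 (act_on x f) \<le> sqrt (opn (nc_star x * x)) * nrm2 f"
        by (simp add: real_sqrt_mult)
    qed (simp add: opn_nonneg)
    then have "(opn x)\<^sup>2 \<le> (sqrt (opn (nc_star x * x)))\<^sup>2" by (intro power_mono opn_nonneg)
    then show "(opn x)\<^sup>2 \<le> opn (nc_star x * x)" by (simp add: opn_nonneg)
  qed
qed

lemma cstar_seminorm_opn: "cstar_seminorm X opn"
  by (simp add: cstar_seminorm_def opn_cstar_seminorm)

lemma opn_star: "opn (nc_star x) = opn x"
  using opn_star_le[of x] opn_star_le[of "nc_star x"] by simp

lemma opn_mult: "opn (x * y) \<le> opn x * opn y"
  and opn_add: "opn (x + y) \<le> opn x + opn y"
  and opn_cstar: "opn (nc_star x * x) = (opn x)\<^sup>2"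
  using opn_cstar_seminorm[of UNIV] by (auto simp: cstar_seminorm_on_def)

lemma opn_power: "opn (x ^ Suc m) \<le> opn x ^ Suc m"
proof (induction m)
  case (Suc m)
  have "opn (x ^ Suc (Suc m)) \<le> opn x * opn (x ^ Suc m)" using opn_mult[of x "x ^ Suc m"] by simp
  also have "\<dots> \<le> opn x * opn x ^ Suc m" by (intro mult_left_mono Suc opn_nonneg)
  finally show ?case by simp
qed simp

lemma opn_eq_0: assumes "\<And>f. fsupp f \<Longrightarrow> act_on x f = (\<lambda>\<eta>. 0)" shows "opn x = 0"
proof -
  have "opn x \<le> 0" using assms by (intro opn_le) auto
  then show ?thesis using opn_nonneg[of x] by simp
qed

lemma act_on_opn_0: "opn x = 0 \<Longrightarrow> fsupp f \<Longrightarrow> act_on x f = (\<lambda>\<eta>. 0)"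
  using opn_bound[of f x] nrm2_eq_0[OF fsupp_act_on, of f x] nrm2_nonneg[of "act_on x f"]
  by (metis antisym mult_zero_left)

text \<open>The matrix coefficient in row \<open>\<eta>\<close> and column
  \<open>\<xi>\<close>.\<close>

definition entry :: "'g ncpoly \<Rightarrow> 'x \<Rightarrow> 'x \<Rightarrow> complex" where
  "entry x \<eta> \<xi> = act_on x (delta \<xi>) \<eta>"

lemma entry_le: "cmod (entry x \<eta> \<xi>) \<le> opn x"
proof -
  have "cmod (entry x \<eta> \<xi>) \<le> nrm2 (act_on x (delta \<xi>))"
    unfolding entry_def by (intro nrm2_le_value fsupp_act_on) simp
  also have "\<dots> \<le> opn x" using opn_bound[of "delta \<xi>" x] by simp
  finally show ?thesis .
qed

lemma entry_add: "entry (x + y) \<eta> \<xi> = entry x \<eta> \<xi> + entry y \<eta> \<xi>"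
  and entry_diff: "entry (x - y) \<eta> \<xi> = entry x \<eta> \<xi> - entry y \<eta> \<xi>"
  and entry_zero: "entry 0 \<eta> \<xi> = 0"
  and entry_cst: "entry (cst c * x) \<eta> \<xi> = c * entry x \<eta> \<xi>"
  by (simp_all add: entry_def act_on_add act_on_diff act_on_mult act_on_cst)

lemma act_on_entries: assumes "fsupp f"
  shows "act_on x f \<eta> = (\<Sum>\<xi> | f \<xi> \<noteq> 0. f \<xi> * entry x \<eta> \<xi>)"
proof -
  have *: "act_on x (\<lambda>\<eta>. \<Sum>\<xi>\<in>A. f \<xi> * delta \<xi> \<eta>) \<eta> = (\<Sum>\<xi>\<in>A. f \<xi> * entry x \<eta> \<xi>)" if "finite A" for A
    using that
  proof (induction A)
    case empty
    then show ?case using act_on_fun_scale[of x 0] by (simp add: fun_eq_iff)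
  next
    case (insert a A)
    then show ?case by (simp add: act_on_fun_add act_on_fun_scale entry_def)
  qed
  have "f = (\<lambda>\<eta>. \<Sum>\<xi> | f \<xi> \<noteq> 0. f \<xi> * delta \<xi> \<eta>)"
  proof
    fix \<eta>
    have "(\<Sum>\<xi> | f \<xi> \<noteq> 0. f \<xi> * delta \<xi> \<eta>) = (\<Sum>\<xi> | f \<xi> \<noteq> 0. if \<xi> = \<eta> then f \<xi> else 0)"
      by (intro sum.cong) (auto simp: delta_def)
    also have "\<dots> = f \<eta>" using assms by (simp add: fsupp_def sum.delta)
    finally show "f \<eta> = (\<Sum>\<xi> | f \<xi> \<noteq> 0. f \<xi> * delta \<xi> \<eta>)" by simp
  qed
  then show ?thesis using *[of "{\<xi>. f \<xi> \<noteq> 0}"] assms by (simp add: fsupp_def)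
qed

text \<open>The norm limit of such a sequence vanishes because its limit in the weak operator topology does.\<close>
lemma opn_null_of_entries:
  assumes cauchy: "\<And>e. e > 0 \<Longrightarrow> \<exists>N. \<forall>m\<ge>N. \<forall>n\<ge>N. opn (y m - y n) < e"
    and entries: "\<And>\<eta> \<xi>. (\<lambda>k. entry (y k) \<eta> \<xi>) \<longlonglongrightarrow> 0"
  shows "(\<lambda>k. opn (y k)) \<longlonglongrightarrow> 0"
proof (rule LIMSEQ_I)
  fix e :: real assume e: "e > 0"
  obtain N where N: "\<And>m n. m \<ge> N \<Longrightarrow> n \<ge> N \<Longrightarrow> opn (y m - y n) < e / 2"
    using cauchy[of "e / 2"] e by auto
  have "opn (y K) \<le> e / 2" if K: "K \<ge> N" for K
  proof (rule opn_le)
    fix f :: "'x \<Rightarrow> complex" assume f: "fsupp f"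
    let ?g = "act_on (y K) f"
    have g: "fsupp ?g" using f by (rule fsupp_act_on)
    have ent: "(\<lambda>k. act_on (y k) f \<eta>) \<longlonglongrightarrow> 0" for \<eta>
      unfolding act_on_entries[OF f]
      by (intro tendsto_null_sum tendsto_mult_right_zero entries)
    \<comment> \<open>The sum is moved to the support of \<open>?g\<close>, which does not depend on
      \<open>k\<close>, so that the limit can be taken term by term.\<close>
    have inn: "inner2 (act_on (y k) f) ?g = (\<Sum>\<eta> | ?g \<eta> \<noteq> 0. act_on (y k) f \<eta> * cnj (?g \<eta>))" for k
    proof -
      let ?h = "act_on (y k) f"
      have h: "fsupp ?h" using f by (rule fsupp_act_on)
      have "inner2 ?h ?g = (\<Sum>\<eta>\<in>{\<eta>. ?h \<eta> \<noteq> 0} \<union> {\<eta>. ?g \<eta> \<noteq> 0}. ?h \<eta> * cnj (?g \<eta>))"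
        using g h by (intro inner2_superset) (auto simp: fsupp_def)
      also have "\<dots> = (\<Sum>\<eta> | ?g \<eta> \<noteq> 0. ?h \<eta> * cnj (?g \<eta>))"
        using g h by (intro sum.mono_neutral_right) (auto simp: fsupp_def)
      finally show ?thesis .
    qed
    have "(\<lambda>k. inner2 (act_on (y k) f) ?g) \<longlonglongrightarrow> 0"
      unfolding inn by (intro tendsto_null_sum tendsto_mult_left_zero ent)
    then have lim: "(\<lambda>k. cmod (inner2 (act_on (y k) f) ?g) + e / 2 * nrm2 f * nrm2 ?g) \<longlonglongrightarrow>
        0 + e / 2 * nrm2 f * nrm2 ?g"
      by (intro tendsto_add tendsto_norm_zero tendsto_const)
    have "(nrm2 ?g)\<^sup>2 \<le> cmod (inner2 (act_on (y k) f) ?g) + e / 2 * nrm2 f * nrm2 ?g"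
      if k: "k \<ge> N" for k
    proof -
      \<comment> \<open>With \<open>K\<close> fixed and \<open>k\<close> tending to infinity, the
        part from \<open>y k\<close> tends to 0 against the fixed vector \<open>?g\<close>, while
        \<open>y K - y k\<close> is small in norm uniformly in \<open>k\<close>.\<close>
      have "complex_of_real ((nrm2 ?g)\<^sup>2) = inner2 (act_on (y k + (y K - y k)) f) ?g"
        by (simp add: inner2_self)
      also have "\<dots> = inner2 (act_on (y k) f) ?g + inner2 (act_on (y K - y k) f) ?g"
        unfolding act_on_add using f g by (intro inner2_add_left fsupp_act_on)
      finally have "(nrm2 ?g)\<^sup>2 = cmod (inner2 (act_on (y k) f) ?g + inner2 (act_on (y K - y k) f) ?g)"
        by (metis norm_of_real abs_power2)
      also have "\<dots> \<le> cmod (inner2 (act_on (y k) f) ?g) + cmod (inner2 (act_on (y K - y k) f) ?g)"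
        by (rule norm_triangle_ineq)
      also have "cmod (inner2 (act_on (y K - y k) f) ?g) \<le> nrm2 (act_on (y K - y k) f) * nrm2 ?g"
        using f g by (intro inner2_Cauchy_Schwarz fsupp_act_on)
      also have "\<dots> \<le> opn (y K - y k) * nrm2 f * nrm2 ?g"
        by (intro mult_right_mono opn_bound f) simp
      also have "\<dots> \<le> e / 2 * nrm2 f * nrm2 ?g"
        using N[OF K k] by (intro mult_right_mono) auto
      finally show ?thesis by simp
    qed
    then have "(nrm2 ?g)\<^sup>2 \<le> 0 + e / 2 * nrm2 f * nrm2 ?g"
      by (intro LIMSEQ_le_const[OF lim]) blast
    then have "nrm2 ?g * nrm2 ?g \<le> (e / 2 * nrm2 f) * nrm2 ?g" by (simp add: power2_eq_square)
    then show "nrm2 ?g \<le> e / 2 * nrm2 f"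
      using nrm2_nonneg[of ?g] nrm2_nonneg[of f] e
      by (metis mult_nonneg_nonneg mult_right_le_imp_le order_le_less half_gt_zero)
  qed (use e in simp)
  then show "\<exists>N. \<forall>n\<ge>N. norm (opn (y n) - 0) < e"
    using e opn_nonneg by (intro exI[of _ N]) (force intro: order_le_less_trans)
qed

end

section \<open>Relative ranges and ultrafilters\<close>

context labelled_space
begin

lemma rel_range_Nil: "A \<subseteq> verts E \<Longrightarrow> rel_range A [] = A"
  by (auto simp: rel_range_def awalk_Nil_iff)

lemma rel_range_append: "rel_range A (\<alpha> @ \<beta>) = rel_range (rel_range A \<alpha>) \<beta>"
proof -
  have "v \<in> rel_range (rel_range A \<alpha>) \<beta>" if v: "v \<in> rel_range A (\<alpha> @ \<beta>)" for v
  proof -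
    obtain u p where p: "u \<in> A" "awalk u p v" "map Lab p = \<alpha> @ \<beta>"
      using v unfolding rel_range_def by blast
    then obtain p1 p2 where "p = p1 @ p2" "map Lab p1 = \<alpha>" "map Lab p2 = \<beta>"
      by (auto simp: map_eq_append_conv)
    then show ?thesis using p by (auto simp: rel_range_def)
  qed
  moreover have "v \<in> rel_range A (\<alpha> @ \<beta>)" if v: "v \<in> rel_range (rel_range A \<alpha>) \<beta>" for v
  proof -
    obtain u p v' p' where "u \<in> A" "awalk u p v'" "map Lab p = \<alpha>" "awalk v' p' v" "map Lab p' = \<beta>"
      using v unfolding rel_range_def by blast
    then show ?thesis
      by (auto simp: rel_range_def intro!: exI[of _ u] exI[of _ "p @ p'"] awalk_appendI)
  qed
  ultimately show ?thesis by blast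
qed

lemma rel_range_Cons: "rel_range A (a # \<alpha>) = rel_range (rel_range A [a]) \<alpha>"
  using rel_range_append[of A "[a]" \<alpha>] by simp

lemma rel_range_mono: "A \<subseteq> C \<Longrightarrow> rel_range A \<alpha> \<subseteq> rel_range C \<alpha>"
  by (auto simp: rel_range_def)

lemma rel_range_Un: "rel_range (A \<union> C) \<alpha> = rel_range A \<alpha> \<union> rel_range C \<alpha>"
  by (auto simp: rel_range_def)

lemma rel_range_empty [simp]: "rel_range {} \<alpha> = {}"
  by (auto simp: rel_range_def)

lemma rel_range_subset: "rel_range A \<alpha> \<subseteq> word_range \<alpha>"
  unfolding word_range_def rel_range_def using awalk_hd_in_verts by blast

lemma word_range_append: "word_range (\<alpha> @ \<beta>) = rel_range (word_range \<alpha>) \<beta>"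
  by (simp add: word_range_def rel_range_append)

lemma word_range_Nil: "word_range [] = verts E"
  by (simp add: word_range_def rel_range_Nil)

lemma rel_range_not_word: "\<alpha> \<notin> words \<Longrightarrow> rel_range A \<alpha> = {}"
  by (auto simp: words_def pos_words_def rel_range_def)

lemma pos_words_iff: "\<alpha> \<in> pos_words \<longleftrightarrow> \<alpha> \<noteq> [] \<and> word_range \<alpha> \<noteq> {}"
proof
  assume "\<alpha> \<in> pos_words"
  then obtain u p v where "\<alpha> = map Lab p" "awalk u p v" "p \<noteq> []" by (auto simp: pos_words_def)
  then show "\<alpha> \<noteq> [] \<and> word_range \<alpha> \<noteq> {}" unfolding word_range_def rel_range_def
    using awalk_hd_in_verts by blast
qed (use rel_range_not_word in \<open>auto simp: words_def word_range_def\<close>)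

lemma alphabet_iff: "a \<in> alphabet \<longleftrightarrow> word_range [a] \<noteq> {}"
proof
  assume "a \<in> alphabet"
  then obtain e where "e \<in> arcs E" "a = Lab e" by (auto simp: alphabet_def)
  then have "awalk (tail E e) [e] (head E e)" "[a] = map Lab [e]" using arc_implies_awalk by auto
  then have "[a] \<in> pos_words" unfolding pos_words_def by (metis (mono_tags, lifting) list.distinct(1) mem_Collect_eq)
  then show "word_range [a] \<noteq> {}" by (simp add: pos_words_iff)
next
  assume "word_range [a] \<noteq> {}"
  then obtain u p v where "awalk u p v" "map Lab p = [a]" by (auto simp: word_range_def rel_range_def)
  then show "a \<in> alphabet" by (auto simp: alphabet_def awalk_Cons_iff)
qed

lemma rel_range_alphabet: "rel_range A [a] \<noteq> {} \<Longrightarrow> a \<in> alphabet"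
  using rel_range_subset[of A "[a]"] by (auto simp: alphabet_iff)

lemma rel_range_out: "a \<notin> out_labels A \<Longrightarrow> rel_range A [a] = {}"
  unfolding out_labels_def using rel_range_alphabet by blast

lemma rel_range_out_Cons: "a \<notin> out_labels A \<Longrightarrow> rel_range A (a # \<alpha>) = {}"
  by (subst rel_range_Cons) (simp add: rel_range_out)

lemma out_labels_mono: "A \<subseteq> C \<Longrightarrow> out_labels A \<subseteq> out_labels C"
  unfolding out_labels_def using rel_range_mono by blast

lemma out_labels_sinks:
  assumes "A \<subseteq> verts E" "A \<subseteq> sinks" shows "out_labels A = {}"
proof -
  have "rel_range A [a] = {}" for a
    using assms by (fastforce simp: rel_range_def sinks_def awalk_Cons_iff)
  then show ?thesis by (simp add: out_labels_def)
qed

lemma word_range_in_B: "\<alpha> \<in> words \<Longrightarrow> \<alpha> \<noteq> [] \<Longrightarrow> word_range \<alpha> \<in> B"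
  using B_word_range by (simp add: words_def)

lemma regular_subset: "regular_set A \<Longrightarrow> C \<in> B \<Longrightarrow> C \<subseteq> A \<Longrightarrow> C \<noteq> {} \<Longrightarrow> regular_set C"
  unfolding regular_set_def by blast

lemma B_at_iff: "A \<in> B_at \<alpha> \<longleftrightarrow> A \<in> B \<and> A \<subseteq> word_range \<alpha>"
  by (simp add: B_at_def)

end

section \<open>Ranges and ultrafilters in a normal labelled space\<close>

context normal_labelled_space
begin

lemma B_nonempty: "\<exists>A\<in>B. A \<noteq> {}"
proof -
  obtain e where "e \<in> arcs E" using arcs_nonempty by blast
  then have "Lab e \<in> alphabet" by (simp add: alphabet_def)
  then have "[Lab e] \<in> pos_words" by (simp add: alphabet_iff pos_words_iff)
  then show ?thesis using B_word_range pos_words_iff by blast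
qed

lemma B_empty: "{} \<in> B"
  using B_nonempty B_Diff by (metis Diff_cancel)

text \<open>Non-words have empty ranges, and \<open>{}\<close> is in \<open>B\<close> as a relative
  complement, so the side condition on the word disappears.\<close>

lemma B_rel: "A \<in> B \<Longrightarrow> rel_range A \<alpha> \<in> B"
  using B_rel_range rel_range_not_word B_empty by metis

lemma B_wr: "\<alpha> \<noteq> [] \<Longrightarrow> word_range \<alpha> \<in> B"
  using word_range_in_B rel_range_not_word B_empty unfolding word_range_def by metis

lemma rel_range_NilB [simp]: "A \<in> B \<Longrightarrow> rel_range A [] = A"
  using B_subset by (simp add: rel_range_Nil)

lemma rel_range_Int: "A \<in> B \<Longrightarrow> C \<in> B \<Longrightarrow> rel_range (A \<inter> C) \<alpha> = rel_range A \<alpha> \<inter> rel_range C \<alpha>"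
  using weakly_left_resolving[of A C \<alpha>] rel_range_not_word[of \<alpha>]
  by (cases "\<alpha> = []") (auto simp: B_Int words_def)

lemma rel_range_disjoint:
  "A \<in> B \<Longrightarrow> C \<in> B \<Longrightarrow> A \<inter> C = {} \<Longrightarrow> rel_range A \<alpha> \<inter> rel_range C \<alpha> = {}"
  using rel_range_Int[of A C \<alpha>] by simp

text \<open>Weak left-resolution keeps disjoint sets disjoint. With unions and intersections this
  makes taking ranges a homomorphism of Boolean rings on \<open>B\<close>.\<close>

lemma rel_range_Diff: "A \<in> B \<Longrightarrow> C \<in> B \<Longrightarrow> rel_range (A - C) \<alpha> = rel_range A \<alpha> - rel_range C \<alpha>"
  using rel_range_disjoint[of "A - C" C \<alpha>] rel_range_Un[of "A - C" C \<alpha>] rel_range_Un[of A C \<alpha>]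
  by (auto simp: B_Diff)

text \<open>Primeness is stated relative to a member \<open>A\<close>, because \<open>B\<close> need
  not have a largest element in which complements could be taken.\<close>

definition ultra :: "'v set set \<Rightarrow> bool" where
  "ultra U \<longleftrightarrow> U \<subseteq> B \<and> U \<noteq> {} \<and> {} \<notin> U \<and> (\<forall>A\<in>U. \<forall>C\<in>B. A \<subseteq> C \<longrightarrow> C \<in> U) \<and>
     (\<forall>A\<in>U. \<forall>C\<in>U. A \<inter> C \<in> U) \<and> (\<forall>A\<in>U. \<forall>C\<in>B. A \<inter> C \<in> U \<or> A - C \<in> U)"

lemma ultra_B: "ultra U \<Longrightarrow> A \<in> U \<Longrightarrow> A \<in> B"
  and ultra_ne: "ultra U \<Longrightarrow> U \<noteq> {}"
  and ultra_not_empty: "ultra U \<Longrightarrow> {} \<notin> U"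
  by (auto simp: ultra_def)

lemma ultra_up: "ultra U \<Longrightarrow> A \<in> U \<Longrightarrow> C \<in> B \<Longrightarrow> A \<subseteq> C \<Longrightarrow> C \<in> U"
  unfolding ultra_def by simp

lemma ultra_Int: "ultra U \<Longrightarrow> A \<in> U \<Longrightarrow> C \<in> U \<Longrightarrow> A \<inter> C \<in> U"
  unfolding ultra_def by simp

lemma ultra_prime: "ultra U \<Longrightarrow> A \<in> U \<Longrightarrow> C \<in> B \<Longrightarrow> A \<inter> C \<in> U \<or> A - C \<in> U"
  unfolding ultra_def by simp

text \<open>Maximality in usable form: a set of \<open>U'\<close> outside \<open>U\<close> would
  have its complement in a member of \<open>U\<close>, hence also in \<open>U'\<close>.\<close>

lemma ultra_subset_eq:
  assumes U: "ultra U" and U': "ultra U'" and sub: "U \<subseteq> U'"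
  shows "U = U'"
proof
  show "U' \<subseteq> U"
  proof
    fix D assume D: "D \<in> U'"
    obtain A where A: "A \<in> U" using ultra_ne[OF U] by blast
    have "A - D \<notin> U"
    proof
      assume "A - D \<in> U"
      then have "(A - D) \<inter> D \<in> U'" using sub D ultra_Int[OF U'] by blast
      moreover have "(A - D) \<inter> D = {}" by blast
      ultimately show False using ultra_not_empty[OF U'] by simp
    qed
    then have "A \<inter> D \<in> U" using ultra_prime[OF U A] ultra_B[OF U' D] by blast
    then show "D \<in> U" using ultra_up[OF U] ultra_B[OF U' D] by blast
  qed
qed (rule sub)

lemma hereditary_empty: "hereditary H \<Longrightarrow> {} \<in> H"
  unfolding hereditary_def using B_empty by (metis empty_subsetI ex_in_conv)

lemma hereditary_rel: "hereditary H \<Longrightarrow> A \<in> H \<Longrightarrow> rel_range A \<alpha> \<in> H"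
  using hereditary_empty rel_range_not_word unfolding hereditary_def by metis

text \<open>The prime ideal theorem relative to \<open>H\<close>. Zorn's lemma gives a filter
  maximal among those avoiding \<open>H\<close>, and closure of \<open>H\<close> under unions makes
  it prime.\<close>

lemma ultra_exists:
  assumes H: "hereditary H" and G: "G \<subseteq> B" "G \<noteq> {}" "G \<inter> H = {}"
    and dir: "\<And>A C. A \<in> G \<Longrightarrow> C \<in> G \<Longrightarrow> \<exists>D\<in>G. D \<subseteq> A \<inter> C"
  shows "\<exists>U. ultra U \<and> G \<subseteq> U \<and> U \<inter> H = {}"
proof -
  define fil where "fil U \<longleftrightarrow> U \<subseteq> B \<and> G \<subseteq> U \<and> (\<forall>A\<in>U. \<forall>C\<in>B. A \<subseteq> C \<longrightarrow> C \<in> U) \<and>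
     (\<forall>A\<in>U. \<forall>C\<in>U. A \<inter> C \<in> U) \<and> U \<inter> H = {}" for U
  have filD: "U \<subseteq> B" "G \<subseteq> U" "\<And>A C. A \<in> U \<Longrightarrow> C \<in> B \<Longrightarrow> A \<subseteq> C \<Longrightarrow> C \<in> U"
    "\<And>A C. A \<in> U \<Longrightarrow> C \<in> U \<Longrightarrow> A \<inter> C \<in> U" "U \<inter> H = {}" if "fil U" for U
    using that unfolding fil_def by simp_all
  have H_Un: "A \<union> C \<in> H" if "A \<in> H" "C \<in> H" for A C using H that by (simp add: hereditary_def)
  have H_sub: "C \<in> H" if "A \<in> H" "C \<subseteq> A" "C \<in> B" for A C using H that unfolding hereditary_def by blast
  define cl where "cl K = {S \<in> B. \<exists>D\<in>K. D \<subseteq> S}" for K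
  have fil_cl: "fil (cl K)" if K: "K \<subseteq> B" "\<And>A. A \<in> G \<Longrightarrow> \<exists>D\<in>K. D \<subseteq> A"
    "\<And>A C. A \<in> K \<Longrightarrow> C \<in> K \<Longrightarrow> \<exists>D\<in>K. D \<subseteq> A \<inter> C" "K \<inter> H = {}" for K
    unfolding fil_def
  proof (intro conjI ballI impI)
    show "cl K \<subseteq> B" unfolding cl_def by blast
    show "G \<subseteq> cl K" unfolding cl_def using K(2) G(1) by blast
    show "C \<in> cl K" if "A \<in> cl K" "C \<in> B" "A \<subseteq> C" for A C
      using that unfolding cl_def by (blast intro: order_trans)
    show "A \<inter> C \<in> cl K" if AC: "A \<in> cl K" "C \<in> cl K" for A C
    proof -
      obtain A' C' where A': "A' \<in> K" "A' \<subseteq> A" "C' \<in> K" "C' \<subseteq> C" using AC unfolding cl_def by blast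
      obtain D where D: "D \<in> K" "D \<subseteq> A' \<inter> C'" using K(3)[OF A'(1,3)] by blast
      have "D \<subseteq> A \<inter> C" using D(2) A'(2,4) by blast
      moreover have "A \<inter> C \<in> B" using AC B_Int by (simp add: cl_def)
      ultimately show ?thesis using D(1) unfolding cl_def by blast
    qed
    have "A \<in> H" if "C \<in> H" "A \<subseteq> C" "A \<in> K" for A C
      using H_sub[OF that(1,2)] that(3) K(1) by blast
    then show "cl K \<inter> H = {}" using K(4) unfolding cl_def by blast
  qed
  have "fil (cl G)" using G dir by (intro fil_cl) auto
  then have "{U. fil U} \<noteq> {}" by blast
  moreover have "\<Union>C \<in> {U. fil U}" if C: "C \<noteq> {}" "subset.chain {U. fil U} C" for C
  proof -
    have fil: "fil U" if "U \<in> C" for U using that C(2) unfolding subset_chain_def by blast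
    have lin: "X \<subseteq> Y \<or> Y \<subseteq> X" if "X \<in> C" "Y \<in> C" for X Y
      using C(2) that unfolding subset_chain_def by blast
    have "fil (\<Union>C)" unfolding fil_def
    proof (intro conjI ballI impI)
      show "\<Union>C \<subseteq> B" using filD(1)[OF fil] by blast
      obtain U where "U \<in> C" using C(1) by blast
      then show "G \<subseteq> \<Union>C" using filD(2)[OF fil] by blast
      show "D \<in> \<Union>C" if "A \<in> \<Union>C" "D \<in> B" "A \<subseteq> D" for A D using that filD(3)[OF fil] by blast
      show "\<Union>C \<inter> H = {}" using filD(5)[OF fil] by blast
      show "A \<inter> A' \<in> \<Union>C" if AA: "A \<in> \<Union>C" "A' \<in> \<Union>C" for A A'
      proof -
        obtain X Y where XY: "X \<in> C" "Y \<in> C" "A \<in> X" "A' \<in> Y" using AA by blast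
        then consider "A \<in> Y" "A' \<in> Y" | "A \<in> X" "A' \<in> X" using lin[OF XY(1,2)] by blast
        then show ?thesis
          by cases (use filD(4)[OF fil[OF XY(1)]] filD(4)[OF fil[OF XY(2)]] XY(1,2) in blast)+
      qed
    qed
    then show ?thesis by simp
  qed
  ultimately obtain U where U: "fil U" and max: "\<And>X. fil X \<Longrightarrow> U \<subseteq> X \<Longrightarrow> X = U"
    using subset_Zorn_nonempty[of "{U. fil U}"] by auto
  note UD = filD[OF U]
  \<comment> \<open>By maximality, adjoining \<open>C\<close> must create a member of
    \<open>H\<close>.\<close>
  have ext: "\<exists>D\<in>U. D \<inter> C \<in> H" if C: "C \<in> B" "C \<notin> U" for C
  proof (rule ccontr)
    assume no: "\<not> (\<exists>D\<in>U. D \<inter> C \<in> H)"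
    let ?K = "(\<lambda>D. D \<inter> C) ` U"
    have "fil (cl ?K)"
    proof (rule fil_cl)
      show "?K \<subseteq> B" using UD(1) C(1) by (auto intro!: B_Int)
      show "\<exists>D\<in>?K. D \<subseteq> A" if "A \<in> G" for A
        using subsetD[OF UD(2) that] by (intro bexI[of _ "A \<inter> C"]) auto
      show "\<exists>D\<in>?K. D \<subseteq> A \<inter> A'" if AA: "A \<in> ?K" "A' \<in> ?K" for A A'
      proof -
        obtain D D' where "D \<in> U" "D' \<in> U" "A = D \<inter> C" "A' = D' \<inter> C" using AA by blast
        then show ?thesis using UD(4)[of D D'] by (intro bexI[of _ "(D \<inter> D') \<inter> C"]) auto
      qed
      show "?K \<inter> H = {}" using no by blast
    qed
    moreover have "U \<subseteq> cl ?K"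
    proof
      fix D assume D: "D \<in> U"
      then have "D \<inter> C \<in> ?K" by (rule imageI)
      moreover have "D \<inter> C \<subseteq> D" by simp
      ultimately show "D \<in> cl ?K" using D UD(1) unfolding cl_def by blast
    qed
    ultimately have "cl ?K = U" by (rule max)
    moreover obtain D where "D \<in> U" using UD(2) G(2) by blast
    then have "D \<inter> C \<in> ?K" "D \<inter> C \<subseteq> C" by auto
    then have "C \<in> cl ?K" using C(1) unfolding cl_def by blast
    ultimately show False using C by blast
  qed
  have prime: "A \<inter> C \<in> U \<or> A - C \<in> U" if A: "A \<in> U" and C: "C \<in> B" for A C
  proof (rule ccontr)
    assume no: "\<not> (A \<inter> C \<in> U \<or> A - C \<in> U)"
    have AB: "A \<in> B" using A UD by blast
    \<comment> \<open>Inside \<open>D \<inter> D'\<close>, the set \<open>A\<close> is covered by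
      two members of \<open>H\<close>, hence lies in \<open>H\<close>.\<close>
    obtain D D' where D: "D \<in> U" "D \<inter> (A \<inter> C) \<in> H" "D' \<in> U" "D' \<inter> (A - C) \<in> H"
      using ext[OF B_Int[OF AB C]] ext[OF B_Diff[OF AB C]] no by blast
    have inU: "D \<inter> D' \<inter> A \<in> U" using UD(4) A D by blast
    moreover have "D \<inter> D' \<inter> A \<in> H"
    proof (rule H_sub[OF H_Un[OF D(2,4)]])
      show "D \<inter> D' \<inter> A \<in> B" using inU UD by blast
    qed blast
    ultimately show False using UD by blast
  qed
  have "{} \<notin> U" using UD(5) hereditary_empty[OF H] by blast
  moreover have "U \<noteq> {}" using UD(2) G(2) by blast
  ultimately have "ultra U" unfolding ultra_def using UD(1,3,4) prime by simp
  then show ?thesis using UD by blast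
qed

text \<open>Each component of a boundary path determines the preceding one by this formula. The
  result is empty if no member of \<open>B\<close> has its range along \<open>a\<close> in
  \<open>U\<close>.\<close>

definition pull :: "'l \<Rightarrow> 'v set set \<Rightarrow> 'v set set" where
  "pull a U = {A \<in> B. rel_range A [a] \<in> U}"

text \<open>Preimages under the Boolean homomorphism \<open>A \<mapsto> rel_range A [a]\<close>
  inherit all properties of an ultrafilter except nonemptiness.\<close>

lemma ultra_pull:
  assumes U: "ultra U" and ne: "pull a U \<noteq> {}"
  shows "ultra (pull a U)"
  unfolding ultra_def
proof (intro conjI ballI impI)
  show "{} \<notin> pull a U" using ultra_not_empty[OF U] by (simp add: pull_def)
  show "C \<in> pull a U" if "A \<in> pull a U" "C \<in> B" "A \<subseteq> C" for A C
    using that rel_range_mono[OF that(3)] ultra_up[OF U] B_rel by (auto simp: pull_def)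
  show "A \<inter> C \<in> pull a U" if "A \<in> pull a U" "C \<in> pull a U" for A C
    using that ultra_Int[OF U] by (auto simp: pull_def rel_range_Int B_Int)
  show "A \<inter> C \<in> pull a U \<or> A - C \<in> pull a U" if "A \<in> pull a U" "C \<in> B" for A C
    using that ultra_prime[OF U, of "rel_range A [a]" "rel_range C [a]"]
    by (auto simp: pull_def rel_range_Int rel_range_Diff B_Int B_Diff B_rel)
qed (use ne in \<open>auto simp: pull_def\<close>)

text \<open>Saturation is what allows a boundary path avoiding \<open>H\<close> to be continued.\<close>
lemma ultra_step:
  assumes H: "hereditary H" "saturated H" and U: "ultra U" "U \<inter> H = {}"
    and C: "C \<in> U" "regular_set C"
  shows "\<exists>a U'. ultra U' \<and> U' \<inter> H = {} \<and> word_range [a] \<in> U' \<and> pull a U' = U"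
proof -
  have "\<exists>a\<in>out_labels C. \<forall>D\<in>U. rel_range D [a] \<notin> H"
  proof (rule ccontr)
    assume "\<not> (\<exists>a\<in>out_labels C. \<forall>D\<in>U. rel_range D [a] \<notin> H)"
    then obtain D where D: "\<And>a. a \<in> out_labels C \<Longrightarrow> D a \<in> U \<and> rel_range (D a) [a] \<in> H"
      by metis
    have fin: "finite (out_labels C)" using C by (auto simp: regular_set_def)
    \<comment> \<open>A regular set emits finitely many labels, so the bad sets \<open>D a\<close>
      can be intersected. The intersection is regular with all ranges in \<open>H\<close>, and
      saturation puts it into \<open>H\<close>.\<close>
    have "\<exists>D'\<in>U. D' \<subseteq> C \<and> (\<forall>a\<in>S. D' \<subseteq> D a)" if "S \<subseteq> out_labels C" "finite S" for S
      using that(2,1)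
    proof (induction S)
      case empty
      then show ?case using C by blast
    next
      case (insert a S)
      then obtain D' where "D' \<in> U" "D' \<subseteq> C" "\<forall>a\<in>S. D' \<subseteq> D a" by blast
      then show ?case using ultra_Int[OF U(1)] D[of a] insert.prems
        by (intro bexI[of _ "D' \<inter> D a"]) auto
    qed
    from this[OF order_refl fin] obtain D' where D': "D' \<in> U" "D' \<subseteq> C"
      "\<And>a. a \<in> out_labels C \<Longrightarrow> D' \<subseteq> D a" by blast
    have D'B: "D' \<in> B" "D' \<noteq> {}" using D'(1) ultra_B[OF U(1)] ultra_not_empty[OF U(1)] by auto
    have "rel_range D' [a] \<in> H" for a
    proof (cases "a \<in> out_labels C")
      case True
      then have "rel_range D' [a] \<subseteq> rel_range (D a) [a]" using D'(3) rel_range_mono by blast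
      then show ?thesis using D[OF True] H(1) B_rel[OF D'B(1)] unfolding hereditary_def by blast
    next
      case False
      then have "rel_range D' [a] = {}"
        using rel_range_out rel_range_mono[OF D'(2), of "[a]"] by blast
      then show ?thesis by (simp add: hereditary_empty H)
    qed
    moreover have "D' \<in> B_reg" using regular_subset[OF C(2) D'B(1) D'(2) D'B(2)] by (simp add: B_reg_def)
    ultimately have "D' \<in> H" using H(2) by (simp add: saturated_def)
    then show False using U D' by blast
  qed
  then obtain a where a: "a \<in> out_labels C" "\<And>D. D \<in> U \<Longrightarrow> rel_range D [a] \<notin> H" by blast
  define G where "G = (\<lambda>D. rel_range D [a]) ` U"
  have "\<exists>U'. ultra U' \<and> G \<subseteq> U' \<and> U' \<inter> H = {}"
  proof (rule ultra_exists[OF H(1)])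
    show "G \<subseteq> B" using ultra_B[OF U(1)] B_rel by (auto simp: G_def)
    show "G \<noteq> {}" "G \<inter> H = {}" using ultra_ne[OF U(1)] a by (auto simp: G_def)
    show "\<exists>D\<in>G. D \<subseteq> A \<inter> A'" if AA: "A \<in> G" "A' \<in> G" for A A'
    proof -
      obtain S S' where S: "S \<in> U" "S' \<in> U" "A = rel_range S [a]" "A' = rel_range S' [a]"
        using AA unfolding G_def by blast
      then have "rel_range (S \<inter> S') [a] \<in> G" using ultra_Int[OF U(1)] by (auto simp: G_def)
      then show ?thesis using S ultra_B[OF U(1)] by (auto simp: rel_range_Int)
    qed
  qed
  then obtain U' where U': "ultra U'" "G \<subseteq> U'" "U' \<inter> H = {}" by blast
  \<comment> \<open>Only one inclusion is immediate; maximality of \<open>U\<close> supplies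
    equality.\<close>
  have sub: "U \<subseteq> pull a U'" using U'(2) ultra_B[OF U(1)] by (auto simp: pull_def G_def)
  then have "pull a U' \<noteq> {}" using ultra_ne[OF U(1)] by blast
  then have "U = pull a U'" using ultra_subset_eq[OF U(1) ultra_pull[OF U'(1)] sub] by blast
  moreover have "word_range [a] \<in> U'"
    using U'(2) C(1) ultra_up[OF U'(1) _ B_wr rel_range_subset, of C "[a]"] by (auto simp: G_def)
  ultimately show ?thesis using U' by blast
qed


section \<open>Boundary paths and their representations\<close>

type_synonym ('a, 'b) boundary = "(nat \<Rightarrow> 'a set set) \<times> (nat \<Rightarrow> 'b option)"

text \<open>A boundary path is a sequence \<open>V\<close> of ultrafilters together with the labels \<open>w\<close> of the steps
  from \<open>V n\<close> to \<open>V (Suc n)\<close>; only \<open>V 0\<close> may be empty instead of an ultrafilter. A path stopping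
  after \<open>n\<close> steps is continued constantly, with \<open>w\<close> equal to \<^const>\<open>None\<close>.\<close>

definition bpath :: "'v set set \<Rightarrow> ('v, 'l) boundary \<Rightarrow> bool" where
  "bpath H \<xi> \<longleftrightarrow> (\<forall>n. fst \<xi> n \<inter> H = {} \<and>
     (case snd \<xi> n of
        Some a \<Rightarrow> ultra (fst \<xi> (Suc n)) \<and> word_range [a] \<in> fst \<xi> (Suc n) \<and> fst \<xi> n = pull a (fst \<xi> (Suc n))
      | None \<Rightarrow> ultra (fst \<xi> n) \<and> (\<forall>A\<in>fst \<xi> n. \<not> regular_set A) \<and> fst \<xi> (Suc n) = fst \<xi> n \<and>
          snd \<xi> (Suc n) = None))"

definition shift :: "('v, 'l) boundary \<Rightarrow> ('v, 'l) boundary" where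
  "shift \<xi> = (\<lambda>n. fst \<xi> (Suc n), \<lambda>n. snd \<xi> (Suc n))"

text \<open>The gluing map for a single letter. Later components are only renumbered, and the new
  initial one is forced by \<open>pull\<close>.\<close>

definition prepend :: "'l \<Rightarrow> ('v, 'l) boundary \<Rightarrow> ('v, 'l) boundary" where
  "prepend a \<xi> = (case_nat (pull a (fst \<xi> 0)) (fst \<xi>), case_nat (Some a) (snd \<xi>))"

lemma shift_simps [simp]: "fst (shift \<xi>) n = fst \<xi> (Suc n)" "snd (shift \<xi>) n = snd \<xi> (Suc n)"
  by (simp_all add: shift_def)

lemma prepend_simps [simp]: "fst (prepend a \<xi>) 0 = pull a (fst \<xi> 0)" "snd (prepend a \<xi>) 0 = Some a"
  "fst (prepend a \<xi>) (Suc n) = fst \<xi> n" "snd (prepend a \<xi>) (Suc n) = snd \<xi> n"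
  by (simp_all add: prepend_def)

lemma shift_prepend [simp]: "shift (prepend a \<xi>) = \<xi>"
  by (simp add: shift_def)

lemma bpath_Some: "bpath H \<xi> \<Longrightarrow> snd \<xi> n = Some a \<Longrightarrow>
    ultra (fst \<xi> (Suc n)) \<and> word_range [a] \<in> fst \<xi> (Suc n) \<and> fst \<xi> n = pull a (fst \<xi> (Suc n))"
  unfolding bpath_def by (drule spec[of _ n]) simp

lemma bpath_None: "bpath H \<xi> \<Longrightarrow> snd \<xi> n = None \<Longrightarrow>
    ultra (fst \<xi> n) \<and> (\<forall>A\<in>fst \<xi> n. \<not> regular_set A) \<and> fst \<xi> (Suc n) = fst \<xi> n \<and> snd \<xi> (Suc n) = None"
  unfolding bpath_def by (drule spec[of _ n]) simp

lemma bpath_avoid: "bpath H \<xi> \<Longrightarrow> fst \<xi> n \<inter> H = {}"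
  unfolding bpath_def by blast

text \<open>Only the initial component can fail to be an ultrafilter, by being empty; a member
  excludes this.\<close>

lemma bpath_ultra: "bpath H \<xi> \<Longrightarrow> A \<in> fst \<xi> n \<Longrightarrow> ultra (fst \<xi> n)"
  using bpath_None[of H \<xi> n] bpath_Some[of H \<xi> n] ultra_pull
  by (cases "snd \<xi> n") (metis empty_iff)+

lemma bpath_shift: "bpath H \<xi> \<Longrightarrow> bpath H (shift \<xi>)"
  unfolding bpath_def shift_simps by blast

lemma prepend_shift: assumes "bpath H \<xi>" "snd \<xi> 0 = Some a" shows "prepend a (shift \<xi>) = \<xi>"
proof (rule prod_eqI; rule ext)
  fix n
  show "fst (prepend a (shift \<xi>)) n = fst \<xi> n" "snd (prepend a (shift \<xi>)) n = snd \<xi> n"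
    using bpath_Some[OF assms] assms(2) by (cases n; simp)+
qed

lemma bpath_prepend:
  assumes H: "hereditary H" and \<xi>: "bpath H \<xi>" and a: "word_range [a] \<in> fst \<xi> 0"
  shows "bpath H (prepend a \<xi>)"
  unfolding bpath_def
proof
  fix n
  show "fst (prepend a \<xi>) n \<inter> H = {} \<and>
     (case snd (prepend a \<xi>) n of
        Some b \<Rightarrow> ultra (fst (prepend a \<xi>) (Suc n)) \<and> word_range [b] \<in> fst (prepend a \<xi>) (Suc n) \<and>
          fst (prepend a \<xi>) n = pull b (fst (prepend a \<xi>) (Suc n))
      | None \<Rightarrow> ultra (fst (prepend a \<xi>) n) \<and> (\<forall>A\<in>fst (prepend a \<xi>) n. \<not> regular_set A) \<and>
          fst (prepend a \<xi>) (Suc n) = fst (prepend a \<xi>) n \<and> snd (prepend a \<xi>) (Suc n) = None)"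
  proof (cases n)
    case 0
    \<comment> \<open>By heredity, a member of \<open>H\<close> pulled back from the initial
      component would have its range in both \<open>H\<close> and that component.\<close>
    have "pull a (fst \<xi> 0) \<inter> H = {}"
      using bpath_avoid[OF \<xi>, of 0] hereditary_rel[OF H] by (auto simp: pull_def)
    then show ?thesis using 0 a bpath_ultra[OF \<xi> a] by simp
  next
    case (Suc m)
    then show ?thesis using \<xi>[unfolded bpath_def, rule_format, of m] by (simp split: option.splits)
  qed
qed

text \<open>\<open>ultra_step\<close> is iterated from an ultrafilter that contains \<open>A\<close>
  and avoids \<open>H\<close>.\<close>

lemma bpath_exists:
  assumes H: "hereditary H" "saturated H" and A: "A \<in> B" "A \<notin> H"
  shows "\<exists>\<xi>. bpath H \<xi> \<and> A \<in> fst \<xi> 0"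
proof -
  obtain U0 where U0: "ultra U0" "A \<in> U0" "U0 \<inter> H = {}"
    using ultra_exists[OF H(1), of "{A}"] A by auto
  let ?P = "\<lambda>U p. ultra (snd p) \<and> snd p \<inter> H = {} \<and> word_range [fst p] \<in> snd p \<and> pull (fst p) (snd p) = U"
  \<comment> \<open>The path goes on exactly as long as there is a regular member, which is what the
    two cases of \<open>bpath\<close> require.\<close>
  define nxt where "nxt U = (if \<exists>C\<in>U. regular_set C then Some (SOME p. ?P U p) else None)" for U
  have nxt: "?P U p" if p: "nxt U = Some p" and U: "ultra U" "U \<inter> H = {}" for U p
  proof -
    obtain C where "C \<in> U" "regular_set C" using p unfolding nxt_def by (metis option.distinct(1))
    then have "\<exists>p. ?P U p" using ultra_step[OF H U] by auto
    then show ?thesis using someI_ex[of "?P U"] p by (simp add: nxt_def split: if_splits)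
  qed
  define V where "V = rec_nat U0 (\<lambda>n U. case nxt U of None \<Rightarrow> U | Some p \<Rightarrow> snd p)"
  define w where "w n = map_option fst (nxt (V n))" for n
  have V0: "V 0 = U0" and VS: "V (Suc n) = (case nxt (V n) of None \<Rightarrow> V n | Some p \<Rightarrow> snd p)" for n
    unfolding V_def by simp_all
  have V: "ultra (V n) \<and> V n \<inter> H = {}" for n
  proof (induction n)
    case (Suc n)
    then show ?case using nxt[of "V n"] by (auto simp: VS split: option.splits)
  qed (use U0 V0 in auto)
  have "bpath H (V, w)" unfolding bpath_def
  proof
    fix n
    show "fst (V, w) n \<inter> H = {} \<and>
     (case snd (V, w) n of
        Some a \<Rightarrow> ultra (fst (V, w) (Suc n)) \<and> word_range [a] \<in> fst (V, w) (Suc n) \<and>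
          fst (V, w) n = pull a (fst (V, w) (Suc n))
      | None \<Rightarrow> ultra (fst (V, w) n) \<and> (\<forall>A\<in>fst (V, w) n. \<not> regular_set A) \<and>
          fst (V, w) (Suc n) = fst (V, w) n \<and> snd (V, w) (Suc n) = None)"
    proof (cases "nxt (V n)")
      case None
      then have "V (Suc n) = V n" by (simp add: VS)
      then show ?thesis using None V[of n] by (auto simp: w_def nxt_def split: if_splits)
    next
      case (Some p)
      then show ?thesis using nxt[OF Some] V[of n] by (auto simp: w_def VS)
    qed
  qed
  then show ?thesis using U0 V0 by (intro exI[of _ "(V, w)"]) simp
qed

lemma hereditary_trivial: "hereditary {{}}" and saturated_trivial: "saturated {{}}"
proof -
  show "hereditary {{}}" using B_empty by (auto simp: hereditary_def)
  show "saturated {{}}"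
    unfolding saturated_def B_reg_def using rel_range_out
    by (auto simp: regular_set_def out_labels_def)
qed

end

text \<open>The grading \<open>d\<close> is 1 or 0: the first case yields the regular representation, the second
  one a multiple of the representation on the boundary path space.\<close>
locale bpath_rep = normal_labelled_space E Lab B
  for E :: "('v, 'e) pre_digraph" and Lab :: "'e \<Rightarrow> 'l" and B :: "'v set set" +
  fixes H :: "'v set set" and d :: int
  assumes hereditary_H: "hereditary H" and saturated_H: "saturated H"
begin

text \<open>\<open>gs a\<close> sends the point mass at a path to the one at its prolongation by
  \<open>a\<close>; as functions are pulled back, its letter acts on points by removing
  \<open>a\<close>. Pairs that are not boundary paths lie outside all domains.\<close>

fun tau :: "('v, 'l) generator \<Rightarrow> bool \<Rightarrow> ('v, 'l) boundary \<times> int \<Rightarrow>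
    (('v, 'l) boundary \<times> int) option" where
  "tau (Proj A) b (\<xi>, i) = (if bpath H \<xi> \<and> A \<in> fst \<xi> 0 then Some (\<xi>, i) else None)"
| "tau (Piso a) False (\<xi>, i) = (if bpath H \<xi> \<and> snd \<xi> 0 = Some a then Some (shift \<xi>, i - d) else None)"
| "tau (Piso a) True (\<xi>, i) = (if bpath H \<xi> \<and> word_range [a] \<in> fst \<xi> 0 then Some (prepend a \<xi>, i + d) else None)"

sublocale partial_bij_rep tau
proof
  fix g b and x y :: "('v, 'l) boundary \<times> int"
  obtain \<xi> i where x: "x = (\<xi>, i)" by (cases x)
  assume "tau g b x = Some y"
  then show "tau g (\<not> b) y = Some x"
    by (cases g; cases b)
      (auto simp: x bpath_shift prepend_shift bpath_prepend[OF hereditary_H] dest: bpath_Some split: if_splits)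
qed

lemma act_gp: "act_on (gp A) f (\<xi>, i) = (if bpath H \<xi> \<and> A \<in> fst \<xi> 0 then f (\<xi>, i) else 0)"
  and act_gp_star: "act_on (nc_star (gp A)) f (\<xi>, i) = (if bpath H \<xi> \<and> A \<in> fst \<xi> 0 then f (\<xi>, i) else 0)"
  and act_gs: "act_on (gs a) f (\<xi>, i) = (if bpath H \<xi> \<and> snd \<xi> 0 = Some a then f (shift \<xi>, i - d) else 0)"
  and act_gs_star: "act_on (nc_star (gs a)) f (\<xi>, i) =
    (if bpath H \<xi> \<and> word_range [a] \<in> fst \<xi> 0 then f (prepend a \<xi>, i + d) else 0)"
  by (simp_all add: act_on_gen act_on_gen_star)

lemma bpath_regular: "bpath H \<xi> \<Longrightarrow> A \<in> fst \<xi> 0 \<Longrightarrow> regular_set A \<Longrightarrow> \<exists>a. snd \<xi> 0 = Some a"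
  using bpath_None[of H \<xi> 0] by (cases "snd \<xi> 0") auto

lemma bpath_out: assumes "bpath H \<xi>" "A \<in> fst \<xi> n" "snd \<xi> n = Some a"
  shows "rel_range A [a] \<in> fst \<xi> (Suc n)" "a \<in> out_labels A"
proof -
  show r: "rel_range A [a] \<in> fst \<xi> (Suc n)"
    using bpath_Some[OF assms(1,3)] assms(2) by (simp add: pull_def)
  then have "rel_range A [a] \<noteq> {}" using bpath_Some[OF assms(1,3)] ultra_not_empty by metis
  then show "a \<in> out_labels A" using rel_range_out by blast
qed

text \<open>Translates the side condition of \<open>p_sum\<close>, which speaks of sinks, into
  regularity: a member of \<open>B\<close> inside \<open>A\<close> emitting no label would consist
  of sinks.\<close>

lemma regularI_sum:
  assumes "A \<in> B" "out_labels A \<noteq> {}" "finite (out_labels A)"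
    "\<not> (\<exists>C \<in> B. C \<noteq> {} \<and> C \<subseteq> A \<inter> sinks)"
  shows "regular_set A"
proof -
  have "out_labels C \<noteq> {}" if C: "C \<in> B" "C \<noteq> {}" "C \<subseteq> A" for C
  proof
    assume o: "out_labels C = {}"
    have "C \<subseteq> sinks"
    proof
      fix v assume v: "v \<in> C"
      have False if e: "e \<in> arcs E" "tail E e = v" for e
      proof -
        have "awalk v [e] (head E e)" "map Lab [e] = [Lab e]" using arc_implies_awalk[OF e(1)] e(2) by auto
        then have "head E e \<in> rel_range C [Lab e]" using v unfolding rel_range_def mem_Collect_eq by metis
        then show False using o rel_range_out by blast
      qed
      then show "v \<in> sinks" using v C B_subset by (auto simp: sinks_def)
    qed
    then show False using assms(4) C by blast
  qed
  moreover have "finite (out_labels C)" if "C \<subseteq> A" for C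
    using out_labels_mono[OF that] assms(3) finite_subset by blast
  moreover have "A \<noteq> {}" using assms(2) by (auto simp: out_labels_def)
  ultimately show ?thesis using assms(1) by (simp add: regular_set_def)
qed

lemma bpath_Int: "bpath H \<xi> \<Longrightarrow> A \<in> B \<Longrightarrow> C \<in> B \<Longrightarrow> A \<inter> C \<in> fst \<xi> n \<longleftrightarrow> A \<in> fst \<xi> n \<and> C \<in> fst \<xi> n"
  using bpath_ultra[of H \<xi>] ultra_Int[of "fst \<xi> n" A C] ultra_up[of "fst \<xi> n" "A \<inter> C"]
  by (metis inf_le1 inf_le2)

lemma bpath_Un: assumes \<xi>: "bpath H \<xi>" and AC: "A \<in> B" "C \<in> B"
  shows "A \<union> C \<in> fst \<xi> n \<longleftrightarrow> A \<in> fst \<xi> n \<or> C \<in> fst \<xi> n"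
proof
  assume U: "A \<union> C \<in> fst \<xi> n"
  note ul = bpath_ultra[OF \<xi> U]
  have "(A \<union> C) \<inter> A = A" "(A \<union> C) - A \<subseteq> C" by auto
  then show "A \<in> fst \<xi> n \<or> C \<in> fst \<xi> n"
    using ultra_prime[OF ul U AC(1)] ultra_up[OF ul _ AC(2), of "(A \<union> C) - A"] by auto
next
  assume "A \<in> fst \<xi> n \<or> C \<in> fst \<xi> n"
  then show "A \<union> C \<in> fst \<xi> n"
    using ultra_up[OF bpath_ultra[OF \<xi>] _ B_Un[OF AC]] by (metis Un_upper1 Un_upper2)
qed

lemma bpath_empty: "bpath H \<xi> \<Longrightarrow> {} \<notin> fst \<xi> n"
  using bpath_ultra ultra_not_empty by blast

lemma bpath_pull: "bpath H \<xi> \<Longrightarrow> snd \<xi> n = Some a \<Longrightarrow> A \<in> fst \<xi> n \<longleftrightarrow> A \<in> B \<and> rel_range A [a] \<in> fst \<xi> (Suc n)"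
  using bpath_Some[of H \<xi> n a] by (simp add: pull_def)

lemma bpath_wr: "bpath H \<xi> \<Longrightarrow> snd \<xi> n = Some a \<Longrightarrow> word_range [a] \<in> fst \<xi> (Suc n)"
  using bpath_Some[of H \<xi> n a] by simp

lemma act_relators_pt: "r \<in> relators \<Longrightarrow> act_on r f (\<xi>, i) = 0"
proof (induction rule: relators.induct)
  case (p_sum A)
  have reg: "regular_set A" using p_sum by (rule regularI_sum)
  have tm: "act_on (gs a * gp (rel_range A [a]) * nc_star (gs a)) f (\<xi>, i) =
      (if bpath H \<xi> \<and> A \<in> fst \<xi> 0 \<and> snd \<xi> 0 = Some a then f (\<xi>, i) else 0)" for a
    using p_sum(1)
    by (auto simp: act_on_mult act_gp act_gs act_gs_star bpath_shift prepend_shift bpath_pull bpath_wr)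
  \<comment> \<open>Regularity of \<open>A\<close> forces the path to continue, so exactly one
    summand survives for a path through \<open>A\<close>.\<close>
  have "(\<Sum>a\<in>out_labels A. if bpath H \<xi> \<and> A \<in> fst \<xi> 0 \<and> snd \<xi> 0 = Some a then f (\<xi>, i) else 0) =
      (if bpath H \<xi> \<and> A \<in> fst \<xi> 0 then f (\<xi>, i) else 0)"
  proof (cases "bpath H \<xi> \<and> A \<in> fst \<xi> 0")
    case True
    then obtain b where b: "snd \<xi> 0 = Some b" using bpath_regular reg by blast
    then have "b \<in> out_labels A" using bpath_out True by blast
    then show ?thesis using True b p_sum(3) by (simp add: sum.delta)
  qed auto
  then show ?case by (simp add: act_on_diff act_on_sum tm act_gp)
qed (auto simp: act_on_diff act_on_add act_on_mult act_gp act_gp_star act_gs act_gs_star bpath_shift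
    prepend_shift bpath_prepend[OF hereditary_H] bpath_Int bpath_Un bpath_empty bpath_pull bpath_wr)

lemma act_relators: "r \<in> relators \<Longrightarrow> act_on r f = (\<lambda>\<eta>. 0)"
  using act_relators_pt by (metis (no_types) ext surj_pair)

lemma opn_relators: "r \<in> relators \<Longrightarrow> opn r = 0"
  by (intro opn_eq_0 act_relators)

end

section \<open>Calculus modulo the relations\<close>

text \<open>These cases govern every product of an adjoint word with a word: one cancels into the
  other, or the letters at which they diverge are orthogonal.\<close>

lemma list_compare:
  obtains \<tau> where "\<gamma> = \<beta> @ \<tau>"
  | \<tau> where "\<beta> = \<gamma> @ \<tau>" "\<tau> \<noteq> []"
  | \<sigma> b c \<beta>' \<gamma>' where "\<beta> = \<sigma> @ b # \<beta>'" "\<gamma> = \<sigma> @ c # \<gamma>'" "b \<noteq> c"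
proof -
  have "(\<exists>\<tau>. \<gamma> = \<beta> @ \<tau>) \<or> (\<exists>\<tau>. \<beta> = \<gamma> @ \<tau> \<and> \<tau> \<noteq> []) \<or>
      (\<exists>\<sigma> b c \<beta>' \<gamma>'. \<beta> = \<sigma> @ b # \<beta>' \<and> \<gamma> = \<sigma> @ c # \<gamma>' \<and> b \<noteq> c)"
  proof (induction \<beta> arbitrary: \<gamma>)
    case (Cons b \<beta>)
    show ?case
    proof (cases \<gamma>)
      case (Cons c \<gamma>')
      show ?thesis
      proof (cases "b = c")
        case True
        from Cons.IH[of \<gamma>'] show ?thesis unfolding Cons True by (metis append_Cons)
      next
        case False
        then show ?thesis unfolding Cons by (metis append_Nil)
      qed
    qed auto
  qed auto
  then show ?thesis using that by blast
qed

context labelled_triple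
begin

text \<open>The two-sided *-ideal generated by the relators in the whole unital ring. Arbitrary
  multipliers spare all side conditions; scalars are covered by multiplication with
  constants.\<close>

inductive_set nul :: "('v, 'l) generator ncpoly set" where
  nul_base: "r \<in> relators \<Longrightarrow> r \<in> nul"
| nul_zero: "0 \<in> nul"
| nul_add: "x \<in> nul \<Longrightarrow> y \<in> nul \<Longrightarrow> x + y \<in> nul"
| nul_left: "x \<in> nul \<Longrightarrow> a * x \<in> nul"
| nul_right: "x \<in> nul \<Longrightarrow> x * a \<in> nul"
| nul_star: "x \<in> nul \<Longrightarrow> nc_star x \<in> nul"

definition eqv :: "('v, 'l) generator ncpoly \<Rightarrow> ('v, 'l) generator ncpoly \<Rightarrow> bool" (infix \<open>\<doteq>\<close> 50) where
  "x \<doteq> y \<longleftrightarrow> x - y \<in> nul"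

lemma nul_minus: "x \<in> nul \<Longrightarrow> - x \<in> nul"
  using nul_left[of x "- 1"] by simp

lemma eqv_refl [simp]: "x \<doteq> x"
  by (simp add: eqv_def nul_zero)

lemma eqv_sym: "x \<doteq> y \<Longrightarrow> y \<doteq> x"
  using nul_minus[of "x - y"] by (simp add: eqv_def)

lemma eqv_trans [trans]: "x \<doteq> y \<Longrightarrow> y \<doteq> z \<Longrightarrow> x \<doteq> z"
  using nul_add[of "x - y" "y - z"] by (simp add: eqv_def)

lemma eqv_add: assumes "x \<doteq> x'" "y \<doteq> y'" shows "x + y \<doteq> x' + y'"
  using nul_add[of "x - x'" "y - y'"] assms by (simp add: eqv_def algebra_simps)

lemma eqv_left: "x \<doteq> x' \<Longrightarrow> a * x \<doteq> a * x'"
  using nul_left[of "x - x'" a] by (simp add: eqv_def algebra_simps)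

lemma eqv_right: "x \<doteq> x' \<Longrightarrow> x * a \<doteq> x' * a"
  using nul_right[of "x - x'" a] by (simp add: eqv_def algebra_simps)

lemma eqv_mult: "x \<doteq> x' \<Longrightarrow> y \<doteq> y' \<Longrightarrow> x * y \<doteq> x' * y'"
  using eqv_trans[OF eqv_left eqv_right] by blast

lemma eqv_star: "x \<doteq> x' \<Longrightarrow> nc_star x \<doteq> nc_star x'"
  using nul_star[of "x - x'"] by (simp add: eqv_def)

lemma eqv_uminus: "x \<doteq> x' \<Longrightarrow> - x \<doteq> - x'"
  using eqv_left[of x x' "- 1"] by simp

lemma eqv_diff: "x \<doteq> x' \<Longrightarrow> y \<doteq> y' \<Longrightarrow> x - y \<doteq> x' - y'"
  using eqv_add[of x x' "- y" "- y'"] eqv_uminus by simp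

lemma eqv_sum: "(\<And>i. i \<in> I \<Longrightarrow> f i \<doteq> g i) \<Longrightarrow> sum f I \<doteq> sum g I"
  by (induction I rule: infinite_finite_induct) (auto intro: eqv_add)

lemma eqv_base: "x - y \<in> relators \<Longrightarrow> x \<doteq> y"
  by (simp add: eqv_def nul_base)

lemma eqv_0_mult: "x \<doteq> 0 \<Longrightarrow> a * x * b \<doteq> 0"
  using eqv_right[OF eqv_left[of x 0 a], of b] by simp

end

section \<open>Finiteness of the universal seminorm and its kernel\<close>

context normal_labelled_space
begin

abbreviation "FF \<equiv> free_star_algebra generators"
abbreviation "uu \<equiv> universal_seminorm generators relators"

lemma gp_free: "A \<in> B \<Longrightarrow> gp A \<in> FF" and gs_free: "a \<in> alphabet \<Longrightarrow> gs a \<in> FF"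
  by (auto intro: free_gen simp: generators_def)

lemma relators_free: "r \<in> relators \<Longrightarrow> r \<in> FF"
proof (induction rule: relators.induct)
  case (p_sum A)
  then show ?case
    by (intro free_diff free_sum free_mult free_star gp_free gs_free B_rel) (auto simp: out_labels_def)
qed (intro free_intros free_mult gp_free gs_free B_Int B_Un B_rel B_empty B_wr; simp)+

lemma generator_seminorm_le:
  assumes q: "cstar_seminorm_on FF q" "\<forall>r\<in>relators. q r = 0" and g: "g \<in> generators"
  shows "q (nc_gen g) \<le> 1"
proof -
  interpret q: cstar_seminorm generators q using q by (simp add: cstar_seminorm_def)
  have p: "q (gp A) \<le> 1" if A: "A \<in> B" for A
  proof (rule q.projection_le_one)
    \<comment> \<open>Combines the two relators for self-adjointness and idempotence into the one
      relation that \<open>projection_le_one\<close> asks for.\<close>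
    have "q (nc_star (gp A) * gp A - gp A) = q ((nc_star (gp A) - gp A) * gp A + (gp A * gp A - gp A))"
      by (simp add: algebra_simps)
    also have "\<dots> \<le> q ((nc_star (gp A) - gp A) * gp A) + q (gp A * gp A - gp A)"
      using A by (intro q.triangle free_intros free_mult gp_free)
    also have "\<dots> \<le> q (nc_star (gp A) - gp A) * q (gp A) + q (gp A * gp A - gp A)"
      using A by (intro add_right_mono q.submult free_intros free_mult gp_free)
    also have "\<dots> = 0" using q(2) A by (simp add: relators.proj_idem relators.proj_adj)
    finally show "q (nc_star (gp A) * gp A - gp A) = 0"
      using q.nonneg[of "nc_star (gp A) * gp A - gp A"] A
      by (simp add: free_diff free_mult free_star gp_free)
  qed (use A gp_free in auto)
  have "q (gs a) \<le> 1" if a: "a \<in> alphabet" for a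
  proof -
    have wr: "word_range [a] \<in> B" by (intro B_wr) simp
    have "q (nc_star (gs a) * gs a - gp (word_range [a])) = 0" using q(2) a relators.s_star_s by blast
    then have "q (nc_star (gs a) * gs a) = q (gp (word_range [a]))"
      using a wr by (intro q.eq_of_null_diff free_mult free_star gp_free gs_free)
    then have "(q (gs a))\<^sup>2 \<le> 1" using p[OF wr] a by (simp add: q.cstar gs_free)
    then show ?thesis by (simp add: power_le_one_iff q.nonneg a gs_free)
  qed
  then show ?thesis using p g by (auto simp: generators_def)
qed

text \<open>Every letter has norm at most 1 in every admissible seminorm, so the sum of the absolute
  values of the coefficients is a common bound.\<close>

lemma relators_bounded:
  assumes x: "x \<in> FF"
  shows "\<exists>b. \<forall>q. cstar_seminorm_on FF q \<and> (\<forall>r\<in>relators. q r = 0) \<longrightarrow> q x \<le> b"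
proof (intro exI allI impI)
  fix q assume q: "cstar_seminorm_on FF q \<and> (\<forall>r\<in>relators. q r = 0)"
  interpret q: cstar_seminorm generators q using q by (simp add: cstar_seminorm_def)
  have letter: "Poly_Mapping.single (Mono [l]) 1 \<in> FF \<and> q (Poly_Mapping.single (Mono [l]) 1) \<le> 1"
    if l: "fst l \<in> generators" for l
  proof -
    obtain g b where gb: "l = (g, b)" by (cases l)
    have g: "nc_gen g \<in> FF" "q (nc_gen g) \<le> 1"
      using generator_seminorm_le q l gb by (auto intro: free_gen)
    show ?thesis
    proof (cases b)
      case True
      then have "Poly_Mapping.single (Mono [l]) 1 = nc_star (nc_gen g)"
        by (simp add: gb nc_gen_def mono_star_def)
      then show ?thesis using g by (simp add: free_star q.star)
    next
      case False
      then show ?thesis using g by (simp add: gb nc_gen_def)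
    qed
  qed
  have word: "Poly_Mapping.single (Mono ls) 1 \<in> FF \<and> q (Poly_Mapping.single (Mono ls) 1) \<le> 1"
    if "ls \<noteq> []" "fst ` set ls \<subseteq> generators" for ls
    using that
  proof (induction ls rule: list_nonempty_induct)
    case (single l)
    then show ?case using letter by simp
  next
    case (cons l ls)
    let ?l = "Poly_Mapping.single (Mono [l]) 1 :: ('v, 'l) generator ncpoly"
      and ?ls = "Poly_Mapping.single (Mono ls) 1 :: ('v, 'l) generator ncpoly"
    have eq: "Poly_Mapping.single (Mono (l # ls)) 1 = ?l * ?ls"
      by (simp add: mult_single plus_monomial_def)
    have l: "?l \<in> FF" "q ?l \<le> 1" using letter cons.prems by auto
    have ls: "?ls \<in> FF" "q ?ls \<le> 1" using cons by auto
    have "q (?l * ?ls) \<le> q ?l * q ?ls" using l ls by (intro q.submult)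
    also have "\<dots> \<le> 1" using l ls q.nonneg by (intro mult_le_one) auto
    finally show ?case unfolding eq using l ls free_mult by blast
  qed
  have mono: "Poly_Mapping.single m c \<in> FF \<and> q (Poly_Mapping.single m c) \<le> cmod c"
    if m: "m \<in> Poly_Mapping.keys x" for m c
  proof -
    have eq: "Poly_Mapping.single m c = cst c * Poly_Mapping.single (Mono (letters m)) 1"
      by (simp add: mult_single)
    have w: "Poly_Mapping.single (Mono (letters m)) 1 \<in> FF \<and> q (Poly_Mapping.single (Mono (letters m)) 1) \<le> 1"
      using x m by (intro word) (auto simp: free_star_algebra_def)
    then have "cmod c * q (Poly_Mapping.single (Mono (letters m)) 1) \<le> cmod c"
      by (intro mult_left_le) auto
    with w show ?thesis unfolding eq by (auto simp: q.scale intro: free_cst)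
  qed
  have "q x = q (\<Sum>m\<in>Poly_Mapping.keys x. Poly_Mapping.single m (Poly_Mapping.lookup x m))"
    by (simp flip: ncpoly_sum_keys)
  also have "\<dots> \<le> (\<Sum>m\<in>Poly_Mapping.keys x. q (Poly_Mapping.single m (Poly_Mapping.lookup x m)))"
    using mono by (intro q.sum_le) auto
  also have "\<dots> \<le> (\<Sum>m\<in>Poly_Mapping.keys x. cmod (Poly_Mapping.lookup x m))"
    using mono by (intro sum_mono) auto
  finally show "q x \<le> (\<Sum>m\<in>Poly_Mapping.keys x. cmod (Poly_Mapping.lookup x m))" .
qed

sublocale U: cstar_seminorm generators uu
  using universal_seminorm_cstar[of generators relators] relators_bounded by blast

lemma uu_ge: "cstar_seminorm_on FF q \<Longrightarrow> \<forall>r\<in>relators. q r = 0 \<Longrightarrow> x \<in> FF \<Longrightarrow> q x \<le> uu x"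
  using universal_seminorm_ge[of generators relators q x] relators_bounded by blast

lemma uu_relators: "r \<in> relators \<Longrightarrow> uu r = 0"
  using universal_seminorm_null[of generators relators r] relators_bounded by blast

text \<open>Elements of \<open>nul\<close> may contain foreign letters, on which the seminorm is not
  controlled. Restriction is a *-homomorphism that removes them and fixes the relators.\<close>

lemma uu_nul: "x \<in> nul \<Longrightarrow> restrict_gens generators x \<in> FF \<and> uu (restrict_gens generators x) = 0"
proof (induction rule: nul.induct)
  case (nul_base r)
  then show ?case
    using relators_free uu_relators by (simp add: restrict_gens_id free_subset_unital)
next
  case nul_zero
  then show ?case by (simp add: restrict_gens_id free_subset_unital free_zero U.zero)
next
  case (nul_add x y)
  then show ?case
    using U.triangle[of "restrict_gens generators x" "restrict_gens generators y"]
      U.nonneg[of "restrict_gens generators x + restrict_gens generators y"]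
    by (simp add: restrict_gens_add free_add)
next
  case (nul_left x a)
  then show ?case
    by (simp add: restrict_gens_mult free_mult2 restrict_gens_unital U.unital_null1)
next
  case (nul_right x a)
  then show ?case
    by (simp add: restrict_gens_mult free_mult1 restrict_gens_unital U.unital_null2)
next
  case (nul_star x)
  then show ?case by (simp add: restrict_gens_star free_star U.star)
qed

lemma uu_eqv_diff: assumes "x \<in> FF" "y \<in> FF" "x \<doteq> y" shows "uu (x - y) = 0"
  using uu_nul[of "x - y"] assms
  by (simp add: eqv_def restrict_gens_id free_subset_unital free_diff)

lemma uu_eqv: "x \<in> FF \<Longrightarrow> y \<in> FF \<Longrightarrow> x \<doteq> y \<Longrightarrow> uu x = uu y"
  using uu_eqv_diff U.eq_of_null_diff by blast

lemma uu_eqv_0: "x \<in> FF \<Longrightarrow> x \<doteq> 0 \<Longrightarrow> uu x = 0"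
  using uu_eqv[of x 0] by (simp add: free_zero U.zero)

section \<open>The defining relations as congruences\<close>

lemma gp_mult: "A \<in> B \<Longrightarrow> C \<in> B \<Longrightarrow> gp A * gp C \<doteq> gp (A \<inter> C)"
  by (rule eqv_sym, rule eqv_base, rule relators.p_Int)

lemma gp_star: "A \<in> B \<Longrightarrow> nc_star (gp A) \<doteq> gp A"
  by (rule eqv_base, rule relators.proj_adj)

lemma gp_empty: "gp {} \<doteq> 0"
  by (rule eqv_base) (simp add: relators.p_empty)

lemma gp_gs: "A \<in> B \<Longrightarrow> a \<in> alphabet \<Longrightarrow> gp A * gs a \<doteq> gs a * gp (rel_range A [a])"
  by (rule eqv_base, rule relators.p_s)

lemma gs_star_gp: assumes "A \<in> B" "a \<in> alphabet"
  shows "nc_star (gs a) * gp A \<doteq> gp (rel_range A [a]) * nc_star (gs a)"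
proof -
  have "nc_star (gs a) * gp A \<doteq> nc_star (gs a) * nc_star (gp A)"
    using assms by (intro eqv_left eqv_sym[OF gp_star])
  also have "\<dots> = nc_star (gp A * gs a)" by simp
  also have "\<dots> \<doteq> nc_star (gs a * gp (rel_range A [a]))"
    using assms by (intro eqv_star gp_gs)
  also have "\<dots> = nc_star (gp (rel_range A [a])) * nc_star (gs a)" by simp
  also have "\<dots> \<doteq> gp (rel_range A [a]) * nc_star (gs a)"
    using assms by (intro eqv_right gp_star B_rel)
  finally show ?thesis .
qed

lemma gs_star_gs: "a \<in> alphabet \<Longrightarrow> nc_star (gs a) * gs a \<doteq> gp (word_range [a])"
  by (rule eqv_base, rule relators.s_star_s)

lemma gs_orth: "a \<in> alphabet \<Longrightarrow> b \<in> alphabet \<Longrightarrow> b \<noteq> a \<Longrightarrow> nc_star (gs b) * gs a \<doteq> 0"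
  by (rule eqv_base) (simp add: relators.s_orth)

lemma gp_Un: "A \<in> B \<Longrightarrow> C \<in> B \<Longrightarrow> gp (A \<union> C) \<doteq> gp A + gp C - gp (A \<inter> C)"
  by (rule eqv_base, rule relators.p_Un)

lemma gp_Un_disjoint: assumes "A \<in> B" "C \<in> B" "A \<inter> C = {}" shows "gp (A \<union> C) \<doteq> gp A + gp C"
proof -
  have "gp (A \<union> C) \<doteq> gp A + gp C - gp {}" using gp_Un[OF assms(1,2)] assms(3) by simp
  also have "\<dots> \<doteq> gp A + gp C - 0" by (intro eqv_diff gp_empty eqv_refl)
  finally show ?thesis by simp
qed

lemma gs_gp_word_range: assumes a: "a \<in> alphabet" shows "gs a * gp (word_range [a]) \<doteq> gs a"
proof -
  have "gs a * gp (word_range [a]) \<doteq> gs a * (nc_star (gs a) * gs a)"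
    using a by (intro eqv_left eqv_sym[OF gs_star_gs])
  also have "\<dots> = gs a * nc_star (gs a) * gs a" by (simp add: mult.assoc)
  also have "\<dots> \<doteq> gs a" using a by (intro eqv_base relators.partial_isometry)
  finally show ?thesis .
qed

section \<open>Words in the partial isometries and the spanning elements\<close>

definition sw :: "'l list \<Rightarrow> ('v, 'l) generator ncpoly" where
  "sw \<alpha> = prod_list (map gs \<alpha>)"

abbreviation ss :: "'l list \<Rightarrow> ('v, 'l) generator ncpoly" where
  "ss \<alpha> \<equiv> nc_star (sw \<alpha>)"

lemma sw_simps [simp]: "sw [] = 1" "sw (a # \<alpha>) = gs a * sw \<alpha>" "sw (\<alpha> @ \<beta>) = sw \<alpha> * sw \<beta>"
  by (simp_all add: sw_def)

lemma gp_sw: "A \<in> B \<Longrightarrow> set \<alpha> \<subseteq> alphabet \<Longrightarrow> gp A * sw \<alpha> \<doteq> sw \<alpha> * gp (rel_range A \<alpha>)"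
proof (induction \<alpha> arbitrary: A)
  case (Cons a \<alpha>)
  have "gp A * sw (a # \<alpha>) = (gp A * gs a) * sw \<alpha>" by (simp add: mult.assoc)
  also have "\<dots> \<doteq> (gs a * gp (rel_range A [a])) * sw \<alpha>" using Cons.prems by (intro eqv_right gp_gs) auto
  also have "\<dots> = gs a * (gp (rel_range A [a]) * sw \<alpha>)" by (simp add: mult.assoc)
  also have "\<dots> \<doteq> gs a * (sw \<alpha> * gp (rel_range (rel_range A [a]) \<alpha>))"
    using Cons.prems by (intro eqv_left Cons.IH B_rel) auto
  also have "\<dots> = sw (a # \<alpha>) * gp (rel_range A (a # \<alpha>))"
    by (simp add: mult.assoc rel_range_Cons[of A a \<alpha>])
  finally show ?case .
qed simp

lemma ss_gp: assumes "A \<in> B" "set \<alpha> \<subseteq> alphabet" shows "ss \<alpha> * gp A \<doteq> gp (rel_range A \<alpha>) * ss \<alpha>"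
proof -
  have "ss \<alpha> * gp A \<doteq> ss \<alpha> * nc_star (gp A)" using assms by (intro eqv_left eqv_sym[OF gp_star])
  also have "\<dots> = nc_star (gp A * sw \<alpha>)" by simp
  also have "\<dots> \<doteq> nc_star (sw \<alpha> * gp (rel_range A \<alpha>))" using assms by (intro eqv_star gp_sw)
  also have "\<dots> = nc_star (gp (rel_range A \<alpha>)) * ss \<alpha>" by simp
  also have "\<dots> \<doteq> gp (rel_range A \<alpha>) * ss \<alpha>" using assms by (intro eqv_right gp_star B_rel)
  finally show ?thesis .
qed

text \<open>For the empty word the right side would be \<open>gp (verts E)\<close>, and
  \<open>verts E\<close> need not be in \<open>B\<close>. This is why \<open>[]\<close> is treated
  separately in what follows.\<close>

lemma ss_sw: "\<alpha> \<noteq> [] \<Longrightarrow> set \<alpha> \<subseteq> alphabet \<Longrightarrow> ss \<alpha> * sw \<alpha> \<doteq> gp (word_range \<alpha>)"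
proof (induction \<alpha> rule: rev_nonempty_induct)
  case (single a)
  then show ?case using gs_star_gs by simp
next
  case (snoc a \<alpha>)
  have wr: "word_range \<alpha> \<in> B" "word_range [a] \<in> B" using snoc by (auto intro: B_wr)
  have "ss (\<alpha> @ [a]) * sw (\<alpha> @ [a]) = nc_star (gs a) * (ss \<alpha> * sw \<alpha>) * gs a" by (simp add: mult.assoc)
  also have "\<dots> \<doteq> nc_star (gs a) * gp (word_range \<alpha>) * gs a"
    using snoc by (intro eqv_right eqv_left snoc.IH) auto
  also have "\<dots> = nc_star (gs a) * (gp (word_range \<alpha>) * gs a)" by (simp add: mult.assoc)
  also have "\<dots> \<doteq> nc_star (gs a) * (gs a * gp (rel_range (word_range \<alpha>) [a]))"
    using snoc wr by (intro eqv_left gp_gs) auto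
  also have "\<dots> = (nc_star (gs a) * gs a) * gp (word_range (\<alpha> @ [a]))"
    by (simp add: mult.assoc word_range_append)
  also have "\<dots> \<doteq> gp (word_range [a]) * gp (word_range (\<alpha> @ [a]))"
    using snoc by (intro eqv_right gs_star_gs) auto
  also have "\<dots> \<doteq> gp (word_range [a] \<inter> word_range (\<alpha> @ [a]))"
    by (intro gp_mult B_wr) auto
  also have "word_range [a] \<inter> word_range (\<alpha> @ [a]) = word_range (\<alpha> @ [a])"
    using rel_range_subset[of "word_range \<alpha>" "[a]"] by (auto simp: word_range_append)
  finally show ?case .
qed

text \<open>Next to \<open>gp A\<close> the product \<open>ss \<alpha> * sw \<alpha>\<close> is
  absorbed, and in this form the empty word is included.\<close>

lemma gp_ss_sw: assumes "A \<in> B" "A \<subseteq> word_range \<alpha>" "set \<alpha> \<subseteq> alphabet"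
  shows "gp A * (ss \<alpha> * sw \<alpha>) \<doteq> gp A" "(ss \<alpha> * sw \<alpha>) * gp A \<doteq> gp A"
proof -
  show "gp A * (ss \<alpha> * sw \<alpha>) \<doteq> gp A"
  proof (cases "\<alpha> = []")
    case False
    have "gp A * (ss \<alpha> * sw \<alpha>) \<doteq> gp A * gp (word_range \<alpha>)" using False assms by (intro eqv_left ss_sw)
    also have "\<dots> \<doteq> gp (A \<inter> word_range \<alpha>)" using assms False by (intro gp_mult B_wr)
    finally show ?thesis using assms by (simp add: Int_absorb2)
  qed simp
  show "(ss \<alpha> * sw \<alpha>) * gp A \<doteq> gp A"
  proof (cases "\<alpha> = []")
    case False
    have "(ss \<alpha> * sw \<alpha>) * gp A \<doteq> gp (word_range \<alpha>) * gp A" using False assms by (intro eqv_right ss_sw)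
    also have "\<dots> \<doteq> gp (word_range \<alpha> \<inter> A)" using assms False by (intro gp_mult B_wr)
    finally show ?thesis using assms by (simp add: Int_absorb1)
  qed simp
qed

lemma ss_sw_orth:
  assumes "b \<noteq> c" "set (\<sigma> @ b # \<beta>) \<subseteq> alphabet" "set (\<sigma> @ c # \<gamma>) \<subseteq> alphabet"
  shows "ss (\<sigma> @ b # \<beta>) * sw (\<sigma> @ c # \<gamma>) \<doteq> 0"
proof -
  have "nc_star (gs b) * (ss \<sigma> * sw \<sigma>) * gs c \<doteq> 0"
  proof (cases "\<sigma> = []")
    case True
    then show ?thesis using assms gs_orth by simp
  next
    case False
    have "nc_star (gs b) * (ss \<sigma> * sw \<sigma>) * gs c \<doteq> nc_star (gs b) * gp (word_range \<sigma>) * gs c"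
      using assms False by (intro eqv_right eqv_left ss_sw) auto
    also have "\<dots> = nc_star (gs b) * (gp (word_range \<sigma>) * gs c)" by (simp add: mult.assoc)
    also have "\<dots> \<doteq> nc_star (gs b) * (gs c * gp (rel_range (word_range \<sigma>) [c]))"
      using assms False by (intro eqv_left gp_gs B_wr) auto
    also have "\<dots> = (nc_star (gs b) * gs c) * gp (rel_range (word_range \<sigma>) [c])" by (simp add: mult.assoc)
    also have "\<dots> \<doteq> 0 * gp (rel_range (word_range \<sigma>) [c])" using assms by (intro eqv_right gs_orth) auto
    finally show ?thesis by simp
  qed
  from eqv_0_mult[OF this, of "ss \<beta>" "sw \<gamma>"] show ?thesis by (simp add: mult.assoc)
qed

text \<open>The two containments let \<open>gp A\<close> absorb
  \<open>ss \<alpha> * sw \<alpha>\<close> and \<open>ss \<beta> * sw \<beta>\<close>, so products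
  of spanning elements need no further cutting down.\<close>

definition valid :: "'l list \<Rightarrow> 'v set \<Rightarrow> 'l list \<Rightarrow> bool" where
  "valid \<alpha> A \<beta> \<longleftrightarrow> A \<in> B \<and> A \<subseteq> word_range \<alpha> \<and> A \<subseteq> word_range \<beta> \<and> set \<alpha> \<subseteq> alphabet \<and> set \<beta> \<subseteq> alphabet"

definition tri :: "'l list \<Rightarrow> 'v set \<Rightarrow> 'l list \<Rightarrow> ('v, 'l) generator ncpoly" where
  "tri \<alpha> A \<beta> = sw \<alpha> * gp A * ss \<beta>"

lemma tri_empty: "tri \<alpha> {} \<beta> \<doteq> 0"
  unfolding tri_def by (rule eqv_0_mult[OF gp_empty])

lemma tri_star: "A \<in> B \<Longrightarrow> nc_star (tri \<alpha> A \<beta>) \<doteq> tri \<beta> A \<alpha>"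
  unfolding tri_def by (simp add: mult.assoc) (intro eqv_left eqv_right gp_star)

lemma rel_range_sub_wr: "A \<subseteq> word_range \<alpha> \<Longrightarrow> rel_range A \<tau> \<subseteq> word_range (\<alpha> @ \<tau>)"
  by (simp add: word_range_append rel_range_mono)

lemma valid_mult1: "valid \<alpha> A \<beta> \<Longrightarrow> valid (\<beta> @ \<tau>) C \<delta> \<Longrightarrow> valid (\<alpha> @ \<tau>) (rel_range A \<tau> \<inter> C) \<delta>"
  using rel_range_sub_wr[of A \<alpha> \<tau>] by (auto simp: valid_def B_Int B_rel)

lemma valid_mult2: "valid \<alpha> A (\<gamma> @ \<tau>) \<Longrightarrow> valid \<gamma> C \<delta> \<Longrightarrow> valid \<alpha> (A \<inter> rel_range C \<tau>) (\<delta> @ \<tau>)"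
  using rel_range_sub_wr[of C \<delta> \<tau>] by (auto simp: valid_def B_Int B_rel)

text \<open>With \<open>tri_mult2\<close> and \<open>tri_mult0\<close> this is the multiplication
  table of the spanning elements, one rule for each case of \<open>list_compare\<close>.\<close>

lemma tri_mult1:
  assumes "valid \<alpha> A \<beta>" "valid (\<beta> @ \<tau>) C \<delta>"
  shows "tri \<alpha> A \<beta> * tri (\<beta> @ \<tau>) C \<delta> \<doteq> tri (\<alpha> @ \<tau>) (rel_range A \<tau> \<inter> C) \<delta>"
proof -
  have "tri \<alpha> A \<beta> * tri (\<beta> @ \<tau>) C \<delta> = sw \<alpha> * ((gp A * (ss \<beta> * sw \<beta>)) * (sw \<tau> * (gp C * ss \<delta>)))"
    by (simp add: tri_def mult.assoc)
  also have "\<dots> \<doteq> sw \<alpha> * (gp A * (sw \<tau> * (gp C * ss \<delta>)))"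
    using assms by (intro eqv_left eqv_right gp_ss_sw) (auto simp: valid_def)
  also have "\<dots> = sw \<alpha> * ((gp A * sw \<tau>) * (gp C * ss \<delta>))" by (simp add: mult.assoc)
  also have "\<dots> \<doteq> sw \<alpha> * ((sw \<tau> * gp (rel_range A \<tau>)) * (gp C * ss \<delta>))"
    using assms by (intro eqv_left eqv_right gp_sw) (auto simp: valid_def)
  also have "\<dots> = (sw \<alpha> * sw \<tau>) * ((gp (rel_range A \<tau>) * gp C) * ss \<delta>)" by (simp add: mult.assoc)
  also have "\<dots> \<doteq> (sw \<alpha> * sw \<tau>) * (gp (rel_range A \<tau> \<inter> C) * ss \<delta>)"
    using assms by (intro eqv_left eqv_right gp_mult) (auto simp: valid_def B_rel)
  finally show ?thesis by (simp add: tri_def mult.assoc)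
qed

lemma tri_mult2:
  assumes "valid \<alpha> A (\<gamma> @ \<tau>)" "valid \<gamma> C \<delta>"
  shows "tri \<alpha> A (\<gamma> @ \<tau>) * tri \<gamma> C \<delta> \<doteq> tri \<alpha> (A \<inter> rel_range C \<tau>) (\<delta> @ \<tau>)"
proof -
  have "tri \<alpha> A (\<gamma> @ \<tau>) * tri \<gamma> C \<delta> = (sw \<alpha> * gp A * ss \<tau>) * ((ss \<gamma> * sw \<gamma>) * gp C) * ss \<delta>"
    by (simp add: tri_def mult.assoc)
  also have "\<dots> \<doteq> (sw \<alpha> * gp A * ss \<tau>) * gp C * ss \<delta>"
    using assms by (intro eqv_left eqv_right gp_ss_sw) (auto simp: valid_def)
  also have "\<dots> = (sw \<alpha> * gp A) * (ss \<tau> * gp C) * ss \<delta>" by (simp add: mult.assoc)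
  also have "\<dots> \<doteq> (sw \<alpha> * gp A) * (gp (rel_range C \<tau>) * ss \<tau>) * ss \<delta>"
    using assms by (intro eqv_left eqv_right ss_gp) (auto simp: valid_def)
  also have "\<dots> = sw \<alpha> * (gp A * gp (rel_range C \<tau>)) * (ss \<tau> * ss \<delta>)" by (simp add: mult.assoc)
  also have "\<dots> \<doteq> sw \<alpha> * gp (A \<inter> rel_range C \<tau>) * (ss \<tau> * ss \<delta>)"
    using assms by (intro eqv_left eqv_right gp_mult) (auto simp: valid_def B_rel)
  finally show ?thesis by (simp add: tri_def mult.assoc)
qed

lemma tri_mult0:
  assumes "valid \<alpha> A (\<sigma> @ b # \<beta>)" "valid (\<sigma> @ c # \<gamma>) C \<delta>" "b \<noteq> c"
  shows "tri \<alpha> A (\<sigma> @ b # \<beta>) * tri (\<sigma> @ c # \<gamma>) C \<delta> \<doteq> 0"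
proof -
  have "ss (\<sigma> @ b # \<beta>) * sw (\<sigma> @ c # \<gamma>) \<doteq> 0"
    using assms by (intro ss_sw_orth) (auto simp: valid_def)
  from eqv_0_mult[OF this, of "sw \<alpha> * gp A" "gp C * ss \<delta>"] show ?thesis
    by (simp add: tri_def mult.assoc del: sw_simps)
qed

lemma unital_sw: "set \<alpha> \<subseteq> alphabet \<Longrightarrow> sw \<alpha> \<in> unital_free generators"
  by (induction \<alpha>) (auto intro!: unital_intros simp: generators_def)

lemma tri_free: "valid \<alpha> A \<beta> \<Longrightarrow> tri \<alpha> A \<beta> \<in> FF"
  unfolding tri_def
  by (intro free_mult1[OF free_mult2] unital_star unital_sw gp_free) (auto simp: valid_def)

section \<open>Linear combinations of spanning elements\<close>

type_synonym ('a, 'b) lincomb = "(complex \<times> 'b list \<times> 'a set \<times> 'b list) list"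

definition lin :: "('v, 'l) lincomb \<Rightarrow> ('v, 'l) generator ncpoly" where
  "lin L = (\<Sum>(c, \<alpha>, A, \<beta>)\<leftarrow>L. cst c * tri \<alpha> A \<beta>)"

definition good :: "('l list \<Rightarrow> 'l list \<Rightarrow> bool) \<Rightarrow> ('v, 'l) lincomb \<Rightarrow> bool" where
  "good P L \<longleftrightarrow> (\<forall>(c, \<alpha>, A, \<beta>) \<in> set L. valid \<alpha> A \<beta> \<and> P \<alpha> \<beta>)"

text \<open>\<open>P\<close> restricts the pairs of words that occur, for instance by degree, length
  or letters. Closure of such a class under products becomes a condition on \<open>P\<close>
  alone.\<close>

definition rep :: "('l list \<Rightarrow> 'l list \<Rightarrow> bool) \<Rightarrow> ('v, 'l) generator ncpoly \<Rightarrow> bool" where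
  "rep P x \<longleftrightarrow> (\<exists>L. good P L \<and> x \<doteq> lin L)"

lemma lin_simps [simp]: "lin [] = 0" "lin ((c, \<alpha>, A, \<beta>) # L) = cst c * tri \<alpha> A \<beta> + lin L"
  "lin (L @ L') = lin L + lin L'"
  by (simp_all add: lin_def)

lemma good_simps [simp]: "good P []" "good P ((c, \<alpha>, A, \<beta>) # L) \<longleftrightarrow> valid \<alpha> A \<beta> \<and> P \<alpha> \<beta> \<and> good P L"
  "good P (L @ L') \<longleftrightarrow> good P L \<and> good P L'"
  by (simp_all add: good_def ball_Un)

lemma lin_induct [case_names Nil Cons]:
  assumes "Q []" "\<And>c \<alpha> A \<beta> L. Q L \<Longrightarrow> Q ((c, \<alpha>, A, \<beta>) # L)"
  shows "Q (L :: ('v, 'l) lincomb)"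
  using assms by (induction L) (auto simp: split_paired_all)

lemma lin_free: "good P L \<Longrightarrow> lin L \<in> FF"
  by (induction L rule: lin_induct) (auto intro: free_intros tri_free)

lemma rep_zero: "rep P 0"
  unfolding rep_def by (rule exI[of _ "[]"]) simp

lemma rep_tri: "valid \<alpha> A \<beta> \<Longrightarrow> P \<alpha> \<beta> \<Longrightarrow> rep P (tri \<alpha> A \<beta>)"
  unfolding rep_def by (rule exI[of _ "[(1, \<alpha>, A, \<beta>)]"]) simp

lemma rep_add: assumes "rep P x" "rep P y" shows "rep P (x + y)"
proof -
  obtain L L' where "good P L" "x \<doteq> lin L" "good P L'" "y \<doteq> lin L'" using assms by (auto simp: rep_def)
  then show ?thesis unfolding rep_def by (intro exI[of _ "L @ L'"]) (auto intro: eqv_add)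
qed

lemma rep_eqv: "rep P x \<Longrightarrow> y \<doteq> x \<Longrightarrow> rep P y"
  unfolding rep_def using eqv_trans by blast

lemma rep_cst: assumes "rep P x" shows "rep P (cst c * x)"
proof -
  obtain L where L: "good P L" "x \<doteq> lin L" using assms by (auto simp: rep_def)
  let ?L = "map (\<lambda>(d, \<alpha>, A, \<beta>). (c * d, \<alpha>, A, \<beta>)) L"
  have "good P ?L" using L(1) by (auto simp: good_def)
  moreover have "lin ?L = cst c * lin L"
    by (induction L rule: lin_induct) (simp_all add: ring_distribs cst_mult flip: mult.assoc)
  ultimately show ?thesis unfolding rep_def using eqv_left[OF L(2), of "cst c"] by metis
qed

text \<open>\<open>c1\<close> and \<open>c2\<close> describe what happens to the outer words in the
  two cases where the product is a spanning element again.\<close>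

lemma rep_mult_tri:
  assumes "valid \<alpha> A \<beta>" "P \<alpha> \<beta>" "valid \<gamma> C \<delta>" "P' \<gamma> \<delta>"
    and c1: "\<And>\<alpha> \<beta> \<tau> \<delta>. P \<alpha> \<beta> \<Longrightarrow> P' (\<beta> @ \<tau>) \<delta> \<Longrightarrow> P'' (\<alpha> @ \<tau>) \<delta>"
    and c2: "\<And>\<alpha> \<gamma> \<tau> \<delta>. P \<alpha> (\<gamma> @ \<tau>) \<Longrightarrow> P' \<gamma> \<delta> \<Longrightarrow> P'' \<alpha> (\<delta> @ \<tau>)"
  shows "rep P'' (tri \<alpha> A \<beta> * tri \<gamma> C \<delta>)"
proof (cases rule: list_compare[of \<gamma> \<beta>])
  case (1 \<tau>)
  show ?thesis unfolding 1
    by (rule rep_eqv[OF _ tri_mult1], rule rep_tri, rule valid_mult1) (use assms 1 c1 in auto)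
next
  case (2 \<tau>)
  show ?thesis unfolding 2
    by (rule rep_eqv[OF _ tri_mult2], rule rep_tri, rule valid_mult2) (use assms 2 c2 in auto)
next
  case (3 \<sigma> b c \<beta>' \<gamma>')
  show ?thesis unfolding 3
    by (rule rep_eqv[OF rep_zero tri_mult0]) (use assms 3 in auto)
qed

lemma rep_mult:
  assumes "rep P x" "rep P' y"
    and c1: "\<And>\<alpha> \<beta> \<tau> \<delta>. P \<alpha> \<beta> \<Longrightarrow> P' (\<beta> @ \<tau>) \<delta> \<Longrightarrow> P'' (\<alpha> @ \<tau>) \<delta>"
    and c2: "\<And>\<alpha> \<gamma> \<tau> \<delta>. P \<alpha> (\<gamma> @ \<tau>) \<Longrightarrow> P' \<gamma> \<delta> \<Longrightarrow> P'' \<alpha> (\<delta> @ \<tau>)"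
  shows "rep P'' (x * y)"
proof -
  obtain L L' where L: "good P L" "x \<doteq> lin L" "good P' L'" "y \<doteq> lin L'"
    using assms(1,2) by (auto simp: rep_def)
  have 1: "rep P'' (tri \<alpha> A \<beta> * lin L')" if v: "valid \<alpha> A \<beta>" "P \<alpha> \<beta>" for \<alpha> A \<beta>
    using L(3)
  proof (induction L' rule: lin_induct)
    case (Cons c \<gamma> C \<delta> L')
    have "tri \<alpha> A \<beta> * lin ((c, \<gamma>, C, \<delta>) # L') = cst c * (tri \<alpha> A \<beta> * tri \<gamma> C \<delta>) + tri \<alpha> A \<beta> * lin L'"
      by (simp add: ring_distribs cst_commute flip: mult.assoc)
    also have "rep P'' \<dots>"
      using Cons v by (intro rep_add rep_cst rep_mult_tri[of _ _ _ P _ _ _ P']) (auto intro: c1 c2)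
    finally show ?case .
  qed (simp add: rep_zero)
  have "rep P'' (lin L * lin L')" using L(1)
  proof (induction L rule: lin_induct)
    case (Cons c \<alpha> A \<beta> L)
    have "lin ((c, \<alpha>, A, \<beta>) # L) * lin L' = cst c * (tri \<alpha> A \<beta> * lin L') + lin L * lin L'"
      by (simp add: ring_distribs mult.assoc)
    also have "rep P'' \<dots>" using Cons by (intro rep_add rep_cst 1) auto
    finally show ?case .
  qed (simp add: rep_zero)
  then show ?thesis by (rule rep_eqv) (intro eqv_mult L)
qed

lemma rep_star: assumes "rep P x" "\<And>\<alpha> \<beta>. P \<alpha> \<beta> \<Longrightarrow> P' \<beta> \<alpha>" shows "rep P' (nc_star x)"
proof -
  obtain L where L: "good P L" "x \<doteq> lin L" using assms by (auto simp: rep_def)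
  have "rep P' (nc_star (lin L))" using L(1)
  proof (induction L rule: lin_induct)
    case (Cons c \<alpha> A \<beta> L)
    have v: "valid \<beta> A \<alpha>" "A \<in> B" using Cons.prems by (auto simp: valid_def)
    have "nc_star (lin ((c, \<alpha>, A, \<beta>) # L)) = cst (cnj c) * nc_star (tri \<alpha> A \<beta>) + nc_star (lin L)"
      by (simp add: cst_commute)
    also have "rep P' \<dots>"
      using Cons assms(2) v by (intro rep_add rep_cst rep_eqv[OF rep_tri tri_star]) auto
    finally show ?case .
  qed (simp add: rep_zero)
  then show ?thesis by (rule rep_eqv) (intro eqv_star L)
qed

lemma rep_gp: "A \<in> B \<Longrightarrow> P [] [] \<Longrightarrow> rep P (gp A)"
  using rep_tri[of "[]" A "[]" P] B_subset by (simp add: tri_def valid_def word_range_Nil)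

lemma rep_gs: assumes "a \<in> alphabet" "P [a] []" shows "rep P (gs a)"
proof -
  have "rep P (tri [a] (word_range [a]) [])"
    using assms B_subset[OF B_wr[of "[a]"]] by (intro rep_tri) (auto simp: valid_def B_wr word_range_Nil)
  then show ?thesis
    by (rule rep_eqv) (use eqv_sym[OF gs_gp_word_range[OF assms(1)]] in \<open>simp add: tri_def\<close>)
qed

text \<open>Each generator is a spanning element modulo the relations, and the multiplication table
  carries this over to nonempty words.\<close>

lemma rep_free: assumes x: "x \<in> FF" shows "rep (\<lambda>_ _. True) x"
proof -
  let ?rep = "rep (\<lambda>_ _. True)"
  have letter: "?rep (Poly_Mapping.single (Mono [l]) 1)" if l: "fst l \<in> generators" for l
  proof -
    obtain g b where gb: "l = (g, b)" by (cases l)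
    have g: "?rep (nc_gen g)" using l gb by (auto simp: generators_def intro: rep_gp rep_gs)
    then have "?rep (nc_star (nc_gen g))" by (rule rep_star) simp
    with g show ?thesis by (cases b) (simp_all add: gb nc_gen_def mono_star_def)
  qed
  have word: "?rep (Poly_Mapping.single (Mono ls) 1)"
    if "ls \<noteq> []" "fst ` set ls \<subseteq> generators" for ls
    using that
  proof (induction ls rule: list_nonempty_induct)
    case (single l)
    then show ?case using letter by simp
  next
    case (cons l ls)
    let ?l = "Poly_Mapping.single (Mono [l]) 1 :: ('v, 'l) generator ncpoly"
      and ?ls = "Poly_Mapping.single (Mono ls) 1 :: ('v, 'l) generator ncpoly"
    have "?rep (?l * ?ls)" using letter[of l] cons by (intro rep_mult[of "\<lambda>_ _. True" _ "\<lambda>_ _. True"]) auto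
    moreover have "Poly_Mapping.single (Mono (l # ls)) 1 = ?l * ?ls"
      by (simp add: mult_single plus_monomial_def)
    ultimately show ?case by simp
  qed
  have "?rep (\<Sum>m\<in>M. Poly_Mapping.single m (Poly_Mapping.lookup x m))"
    if "finite M" "M \<subseteq> Poly_Mapping.keys x" for M
    using that
  proof (induction M)
    case (insert m M)
    have "Poly_Mapping.single m (Poly_Mapping.lookup x m) =
        cst (Poly_Mapping.lookup x m) * Poly_Mapping.single (Mono (letters m)) 1"
      by (simp add: mult_single)
    moreover have "?rep (Poly_Mapping.single (Mono (letters m)) 1)"
      using insert.prems x by (intro word) (auto simp: free_star_algebra_def)
    ultimately have "?rep (Poly_Mapping.single m (Poly_Mapping.lookup x m))"
      by (simp add: rep_cst)
    then show ?case using insert by (simp add: rep_add)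
  qed (simp add: rep_zero)
  from this[of "Poly_Mapping.keys x"] show ?thesis by (simp flip: ncpoly_sum_keys)
qed

end

section \<open>The relations hold in the boundary path representations\<close>

context bpath_rep
begin

lemma opn_nul: "x \<in> nul \<Longrightarrow> opn x = 0"
proof (induction rule: nul.induct)
  case (nul_base r)
  then show ?case by (rule opn_relators)
next
  case nul_zero
  then show ?case by (intro opn_eq_0) simp
next
  case (nul_add x y)
  then show ?case using opn_add[of x y] opn_nonneg[of "x + y"] by simp
next
  case (nul_left x a)
  then show ?case using opn_mult[of a x] opn_nonneg[of "a * x"] by simp
next
  case (nul_right x a)
  then show ?case using opn_mult[of x a] opn_nonneg[of "x * a"] by simp
next
  case (nul_star x)
  then show ?case by (simp add: opn_star)
qed

lemma act_on_eqv: "x \<doteq> y \<Longrightarrow> fsupp f \<Longrightarrow> act_on x f = act_on y f"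
  using act_on_opn_0[OF opn_nul, of "x - y" f] by (simp add: eqv_def act_on_diff fun_eq_iff)

lemma entry_eqv: "x \<doteq> y \<Longrightarrow> entry x \<eta> \<xi> = entry y \<eta> \<xi>"
  by (simp add: entry_def act_on_eqv)

lemma opn_eqv: assumes "x \<doteq> y" shows "opn x = opn y"
proof (rule antisym)
  show "opn x \<le> opn y" using act_on_eqv[OF assms] opn_bound[of _ y] by (intro opn_le opn_nonneg) simp
  show "opn y \<le> opn x" using act_on_eqv[OF assms] opn_bound[of _ x] by (intro opn_le opn_nonneg) simp
qed

lemma opn_le_uu: "x \<in> FF \<Longrightarrow> opn x \<le> uu x"
  by (intro uu_ge opn_cstar_seminorm) (simp_all add: opn_relators)

end

section \<open>The universal norm is the norm of the regular representation\<close>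

context bpath_rep
begin

definition pre :: "'l list \<Rightarrow> ('v, 'l) boundary \<Rightarrow> ('v, 'l) boundary" where
  "pre \<gamma> \<xi> = foldr prepend \<gamma> \<xi>"

lemma pre_simps [simp]: "pre [] \<xi> = \<xi>" "pre (a # \<gamma>) \<xi> = prepend a (pre \<gamma> \<xi>)"
  by (simp_all add: pre_def)

text \<open>The condition under which every stage of \<open>pre \<gamma> \<xi>\<close> is a boundary
  path. The empty word is separate because its range need not be in \<open>B\<close>.\<close>

definition okp :: "'l list \<Rightarrow> ('v, 'l) boundary \<Rightarrow> bool" where
  "okp \<gamma> \<xi> \<longleftrightarrow> bpath H \<xi> \<and> (\<gamma> = [] \<or> word_range \<gamma> \<in> fst \<xi> 0)"

lemma okp_Nil [simp]: "okp [] \<xi> \<longleftrightarrow> bpath H \<xi>"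
  by (simp add: okp_def)

lemma okp_Cons: assumes "okp (a # \<alpha>) \<xi>" shows "okp \<alpha> \<xi>"
proof -
  have "word_range (a # \<alpha>) \<subseteq> word_range \<alpha>"
    using word_range_append[of "[a]" \<alpha>] rel_range_subset[of "word_range [a]" \<alpha>] by simp
  moreover have "bpath H \<xi>" "word_range (a # \<alpha>) \<in> fst \<xi> 0" using assms by (simp_all add: okp_def)
  ultimately have "\<alpha> \<noteq> [] \<Longrightarrow> word_range \<alpha> \<in> fst \<xi> 0"
    using ultra_up[OF bpath_ultra] B_wr by blast
  then show ?thesis using \<open>bpath H \<xi>\<close> by (auto simp: okp_def)
qed

lemma okpI: "bpath H \<xi> \<Longrightarrow> C \<in> fst \<xi> 0 \<Longrightarrow> C \<subseteq> word_range \<gamma> \<Longrightarrow> okp \<gamma> \<xi>"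
  using ultra_up[OF bpath_ultra[of H \<xi> C 0], of C "word_range \<gamma>"] B_wr[of \<gamma>] by (auto simp: okp_def)

lemma pre_fst: "okp \<gamma> \<xi> \<Longrightarrow> D \<in> B \<Longrightarrow> D \<in> fst (pre \<gamma> \<xi>) 0 \<longleftrightarrow> rel_range D \<gamma> \<in> fst \<xi> 0"
proof (induction \<gamma> arbitrary: D)
  case (Cons a \<gamma>)
  have "D \<in> fst (pre (a # \<gamma>) \<xi>) 0 \<longleftrightarrow> rel_range D [a] \<in> fst (pre \<gamma> \<xi>) 0"
    using Cons.prems(2) by (simp add: pull_def)
  also have "\<dots> \<longleftrightarrow> rel_range (rel_range D [a]) \<gamma> \<in> fst \<xi> 0"
    using Cons.prems okp_Cons by (intro Cons.IH B_rel) auto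
  also have "rel_range (rel_range D [a]) \<gamma> = rel_range D (a # \<gamma>)" by (rule rel_range_Cons[symmetric])
  finally show ?case .
qed simp

lemma okp_wr: assumes "okp (a # \<gamma>) \<xi>" shows "word_range [a] \<in> fst (pre \<gamma> \<xi>) 0"
  using assms pre_fst[OF okp_Cons[OF assms] B_wr[of "[a]"]] word_range_append[of "[a]" \<gamma>]
  by (simp add: okp_def)

lemma bpath_pre: "okp \<gamma> \<xi> \<Longrightarrow> bpath H (pre \<gamma> \<xi>)"
proof (induction \<gamma>)
  case (Cons a \<gamma>)
  then show ?case using bpath_prepend[OF hereditary_H] okp_wr okp_Cons by simp
qed simp

lemma act_sw: "okp \<gamma> \<xi> \<Longrightarrow> act_on (sw \<gamma>) f (pre \<gamma> \<xi>, i) = f (\<xi>, i - d * int (length \<gamma>))"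
proof (induction \<gamma> arbitrary: i)
  case (Cons a \<gamma>)
  have "act_on (sw (a # \<gamma>)) f (pre (a # \<gamma>) \<xi>, i) = act_on (sw \<gamma>) f (pre \<gamma> \<xi>, i - d)"
    using bpath_pre[OF Cons.prems] by (simp add: act_on_mult act_gs)
  also have "\<dots> = f (\<xi>, i - d - d * int (length \<gamma>))" using Cons okp_Cons by blast
  finally show ?case by (simp add: algebra_simps)
qed (simp add: act_on_one)

lemma act_ss: "okp \<gamma> \<xi> \<Longrightarrow> act_on (ss \<gamma>) f (\<xi>, i) = f (pre \<gamma> \<xi>, i + d * int (length \<gamma>))"
proof (induction \<gamma> arbitrary: f)
  case (Cons a \<gamma>)
  have "act_on (ss (a # \<gamma>)) f (\<xi>, i) = act_on (nc_star (gs a)) f (pre \<gamma> \<xi>, i + d * int (length \<gamma>))"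
    using Cons okp_Cons by (simp add: act_on_mult)
  also have "\<dots> = f (pre (a # \<gamma>) \<xi>, i + d * int (length \<gamma>) + d)"
    using bpath_pre[OF okp_Cons[OF Cons.prems]] okp_wr[OF Cons.prems] by (simp add: act_gs_star)
  finally show ?case by (simp add: algebra_simps)
qed (simp add: act_on_one)

lemma entry_star: "entry (nc_star x) \<xi> \<eta> = cnj (entry x \<eta> \<xi>)"
proof -
  have delta: "inner2 (delta \<zeta>) g = cnj (g \<zeta>)" for g :: "_ \<Rightarrow> complex" and \<zeta>
    by (simp add: inner2_def delta_def)
  have "inner2 (act_on x (delta \<xi>)) (delta \<eta>) = entry x \<eta> \<xi>"
  proof (cases "entry x \<eta> \<xi> = 0")
    case True
    then have "inner2 (act_on x (delta \<xi>)) (delta \<eta>) = 0" unfolding inner2_def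
      by (intro sum.neutral) (auto simp: entry_def delta_def[of \<eta>])
    then show ?thesis using True by simp
  next
    case False
    have "inner2 (act_on x (delta \<xi>)) (delta \<eta>) =
        (\<Sum>\<zeta> | act_on x (delta \<xi>) \<zeta> \<noteq> 0. if \<zeta> = \<eta> then act_on x (delta \<xi>) \<eta> else 0)"
      unfolding inner2_def by (intro sum.cong) (auto simp: delta_def[of \<eta>])
    also have "\<dots> = entry x \<eta> \<xi>"
      using False fsupp_act_on[OF fsupp_delta, of x \<xi>] by (simp add: sum.delta fsupp_def entry_def)
    finally show ?thesis .
  qed
  moreover have "inner2 (act_on x (delta \<xi>)) (delta \<eta>) = inner2 (delta \<xi>) (act_on (nc_star x) (delta \<eta>))"
    by (rule inner2_adjoint) simp_all
  ultimately show ?thesis by (simp add: delta entry_def) (metis complex_cnj_cnj)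
qed

end

section \<open>The partition of unity and the blocks of elements of degree 0\<close>

context normal_labelled_space
begin

text \<open>The projection complementary to the ranges of the \<open>gs a\<close> with
  \<open>a \<in> S\<close>. It has a constant term and is used as a multiplier only.\<close>

definition Qs :: "'l set \<Rightarrow> ('v, 'l) generator ncpoly" where
  "Qs S = 1 - (\<Sum>a\<in>S. gs a * nc_star (gs a))"

lemma Qs_star: "nc_star (Qs S) = Qs S"
  by (simp add: Qs_def nc_star_sum)

context
  fixes S :: "'l set"
  assumes S: "finite S" "S \<subseteq> alphabet"
begin

lemma unital_Qs: "Qs S \<in> unital_free generators"
  unfolding Qs_def using S
  by (intro unital_diff unital_one unital_sum unital_mult unital_star free_subset_unital gs_free) auto

lemma Qs_gp: assumes A: "A \<in> B" shows "Qs S * gp A \<doteq> gp A * Qs S"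
proof -
  have "gs a * nc_star (gs a) * gp A \<doteq> gp A * (gs a * nc_star (gs a))" if "a \<in> S" for a
  proof -
    have a: "a \<in> alphabet" using that S by blast
    have "gs a * nc_star (gs a) * gp A = gs a * (nc_star (gs a) * gp A)" by (simp add: mult.assoc)
    also have "\<dots> \<doteq> gs a * (gp (rel_range A [a]) * nc_star (gs a))" using A a by (intro eqv_left gs_star_gp)
    also have "\<dots> = (gs a * gp (rel_range A [a])) * nc_star (gs a)" by (simp add: mult.assoc)
    also have "\<dots> \<doteq> (gp A * gs a) * nc_star (gs a)" using A a by (intro eqv_right eqv_sym[OF gp_gs])
    finally show ?thesis by (simp add: mult.assoc)
  qed
  then have "gp A - (\<Sum>a\<in>S. gs a * nc_star (gs a) * gp A) \<doteq> gp A - (\<Sum>a\<in>S. gp A * (gs a * nc_star (gs a)))"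
    by (intro eqv_diff eqv_sum) auto
  then show ?thesis by (simp add: Qs_def algebra_simps sum_distrib_left sum_distrib_right)
qed

lemma Qs_gs: assumes b: "b \<in> S" shows "Qs S * gs b \<doteq> 0"
proof -
  have "gs a * nc_star (gs a) * gs b \<doteq> (if a = b then gs b else 0)" if "a \<in> S" for a
  proof (cases "a = b")
    case True
    then show ?thesis using that S by (auto intro: eqv_base relators.partial_isometry)
  next
    case False
    have "gs a * (nc_star (gs a) * gs b) \<doteq> gs a * 0"
      using that b S False by (intro eqv_left gs_orth) auto
    then show ?thesis using False by (simp add: mult.assoc)
  qed
  then have "gs b - (\<Sum>a\<in>S. gs a * nc_star (gs a) * gs b) \<doteq> gs b - (\<Sum>a\<in>S. if a = b then gs b else 0)"
    by (intro eqv_diff eqv_sum) auto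
  then show ?thesis using b S by (simp add: Qs_def algebra_simps sum_distrib_right)
qed

lemma Qs_sw: assumes "\<sigma> \<noteq> []" "set \<sigma> \<subseteq> S" shows "Qs S * sw \<sigma> \<doteq> 0"
proof -
  obtain a \<sigma>' where \<sigma>: "\<sigma> = a # \<sigma>'" using assms(1) by (cases \<sigma>) auto
  have "Qs S * gs a * sw \<sigma>' \<doteq> 0 * sw \<sigma>'" using assms \<sigma> by (intro eqv_right Qs_gs) auto
  then show ?thesis by (simp add: \<sigma> mult.assoc)
qed

lemma Qs_Qs: "Qs S * Qs S \<doteq> Qs S"
proof -
  have "(\<Sum>a\<in>S. Qs S * gs a * nc_star (gs a)) \<doteq> (\<Sum>a\<in>S. 0 * nc_star (gs a))"
    by (intro eqv_sum eqv_right Qs_gs)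
  then have "Qs S - (\<Sum>a\<in>S. Qs S * gs a * nc_star (gs a)) \<doteq> Qs S - 0" by (intro eqv_diff) auto
  moreover have "Qs S * Qs S = Qs S - (\<Sum>a\<in>S. Qs S * gs a * nc_star (gs a))"
    by (subst (2) Qs_def) (simp add: algebra_simps sum_distrib_left)
  ultimately show ?thesis by simp
qed

context
  fixes N :: nat
begin

text \<open>The elements \<open>ee \<gamma>\<close> form a partition of unity that splits the elements of degree 0
  into boundedly many blocks, on each of which they are combinations of orthogonal projections.\<close>
definition qq :: "'l list \<Rightarrow> ('v, 'l) generator ncpoly" where
  "qq \<gamma> = (if length \<gamma> < N then Qs S else 1)"

definition ee :: "'l list \<Rightarrow> ('v, 'l) generator ncpoly" where
  "ee \<gamma> = sw \<gamma> * qq \<gamma> * ss \<gamma>"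

definition bounded_words :: "'l list set" where
  "bounded_words = {\<gamma>. set \<gamma> \<subseteq> S \<and> length \<gamma> \<le> N}"

lemma qq_star: "nc_star (qq \<gamma>) = qq \<gamma>"
  by (simp add: qq_def Qs_star)

lemma ee_star: "nc_star (ee \<gamma>) = ee \<gamma>"
  by (simp add: ee_def qq_star mult.assoc)

lemma qq_gp: "A \<in> B \<Longrightarrow> qq \<gamma> * gp A \<doteq> gp A * qq \<gamma>"
  by (simp add: qq_def Qs_gp)

lemma qq_qq: "qq \<gamma> * qq \<gamma> \<doteq> qq \<gamma>"
  by (simp add: qq_def Qs_Qs)

lemma unital_qq: "qq \<gamma> \<in> unital_free generators"
  by (simp add: qq_def unital_Qs unital_one)

lemma unital_ee: "\<gamma> \<in> bounded_words \<Longrightarrow> ee \<gamma> \<in> unital_free generators"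
  unfolding ee_def using S
  by (intro unital_mult unital_star unital_sw unital_qq) (auto simp: bounded_words_def)

lemma finite_bounded_words: "finite bounded_words"
  unfolding bounded_words_def by (rule finite_lists_length_le[OF S(1)])

end

lemma sum_words_Suc:
  fixes f :: "'l list \<Rightarrow> 'b::comm_monoid_add"
  shows "(\<Sum>\<gamma> | set \<gamma> \<subseteq> S \<and> length \<gamma> = Suc n. f \<gamma>) =
    (\<Sum>\<gamma> | set \<gamma> \<subseteq> S \<and> length \<gamma> = n. \<Sum>a\<in>S. f (\<gamma> @ [a]))"
proof -
  let ?W = "\<lambda>n. {\<gamma>. set \<gamma> \<subseteq> S \<and> length \<gamma> = n}"
  have fin: "finite (?W n)" by (rule finite_lists_length_eq[OF S(1)])
  have "(\<Sum>\<gamma>\<in>?W n. \<Sum>a\<in>S. f (\<gamma> @ [a])) = (\<Sum>(\<gamma>, a)\<in>?W n \<times> S. f (\<gamma> @ [a]))"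
    using fin S by (subst sum.cartesian_product) simp
  also have "\<dots> = (\<Sum>\<gamma>\<in>?W (Suc n). f \<gamma>)"
  proof (rule sum.reindex_bij_witness[of _ "\<lambda>\<gamma>. (butlast \<gamma>, last \<gamma>)" "\<lambda>(\<gamma>, a). \<gamma> @ [a]"])
    fix \<gamma> assume \<gamma>: "\<gamma> \<in> ?W (Suc n)"
    then have ne: "\<gamma> \<noteq> []" by auto
    then have eq: "butlast \<gamma> @ [last \<gamma>] = \<gamma>" by simp
    then show "(case (butlast \<gamma>, last \<gamma>) of (\<gamma>, a) \<Rightarrow> \<gamma> @ [a]) = \<gamma>" by simp
    have "set (butlast \<gamma>) \<subseteq> S" "last \<gamma> \<in> S" using \<gamma> ne in_set_butlastD last_in_set by fastforce+
    then show "(butlast \<gamma>, last \<gamma>) \<in> ?W n \<times> S" using \<gamma> by simp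
  qed auto
  finally show ?thesis by simp
qed

text \<open>In terms of paths, \<open>ee N \<gamma>\<close> selects those whose longest beginning
  over \<open>S\<close> of length at most \<open>N\<close> is \<open>\<gamma>\<close>. Passing from
  \<open>N\<close> to \<open>Suc N\<close> splits the summands of length \<open>N\<close> according
  to the next letter; the identity is exact in the polynomial ring.\<close>

lemma sum_ee: "(\<Sum>\<gamma>\<in>bounded_words N. ee N \<gamma>) = 1"
proof (induction N)
  case 0
  have "bounded_words 0 = {[]}" by (auto simp: bounded_words_def)
  then show ?case by (simp add: ee_def qq_def)
next
  case (Suc N)
  let ?W = "\<lambda>n. {\<gamma>. set \<gamma> \<subseteq> S \<and> length \<gamma> = n}"
  have fin: "finite (?W n)" for n by (rule finite_lists_length_eq[OF S(1)])
  have bounded_words: "bounded_words (Suc N) = bounded_words N \<union> ?W (Suc N)" "bounded_words N \<inter> ?W (Suc N) = {}" by (auto simp: bounded_words_def)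
  have "(\<Sum>\<gamma>\<in>bounded_words (Suc N). ee (Suc N) \<gamma>) = (\<Sum>\<gamma>\<in>bounded_words N. ee (Suc N) \<gamma>) + (\<Sum>\<gamma>\<in>?W (Suc N). ee (Suc N) \<gamma>)"
    unfolding bounded_words(1) by (intro sum.union_disjoint finite_bounded_words fin bounded_words(2))
  also have "(\<Sum>\<gamma>\<in>?W (Suc N). ee (Suc N) \<gamma>) = (\<Sum>\<gamma>\<in>?W (Suc N). sw \<gamma> * ss \<gamma>)"
    by (intro sum.cong) (auto simp: ee_def qq_def)
  also have "\<dots> = (\<Sum>\<gamma>\<in>?W N. \<Sum>a\<in>S. sw (\<gamma> @ [a]) * ss (\<gamma> @ [a]))" by (rule sum_words_Suc)
  also have "\<dots> = (\<Sum>\<gamma>\<in>?W N. sw \<gamma> * (1 - Qs S) * ss \<gamma>)"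
    by (intro sum.cong) (auto simp: Qs_def sum_distrib_left sum_distrib_right mult.assoc)
  also have "\<dots> = (\<Sum>\<gamma>\<in>bounded_words N. if length \<gamma> = N then sw \<gamma> * (1 - Qs S) * ss \<gamma> else 0)"
    by (intro sum.mono_neutral_cong_left finite_bounded_words) (auto simp: bounded_words_def)
  also have "(\<Sum>\<gamma>\<in>bounded_words N. ee (Suc N) \<gamma>) + \<dots> = (\<Sum>\<gamma>\<in>bounded_words N. ee N \<gamma>)"
    unfolding sum.distrib[symmetric]
    by (intro sum.cong) (auto simp: bounded_words_def ee_def qq_def algebra_simps)
  finally show ?case using Suc by simp
qed

context
  fixes N :: nat
begin

abbreviation "qN \<equiv> qq N"
abbreviation "eN \<equiv> ee N"

text \<open>Only a \<open>\<gamma>\<close> that extends \<open>\<alpha>\<close> survives. If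
  \<open>\<alpha>\<close> is properly longer, the cut-off factor of \<open>ee \<gamma>\<close> kills
  its next letter; diverging words are orthogonal.\<close>

lemma ee_left:
  assumes v: "A \<in> B" "A \<subseteq> word_range \<alpha>" "\<alpha> \<in> bounded_words N" and \<gamma>: "\<gamma> \<in> bounded_words N"
  shows "(\<exists>\<alpha>'. \<gamma> = \<alpha> @ \<alpha>' \<and> eN \<gamma> * (sw \<alpha> * gp A) \<doteq> sw \<gamma> * qN \<gamma> * (gp (rel_range A \<alpha>') * ss \<alpha>')) \<or>
    eN \<gamma> * (sw \<alpha> * gp A) \<doteq> 0"
proof -
  have al: "set \<alpha> \<subseteq> alphabet" "set \<gamma> \<subseteq> alphabet" using v \<gamma> S by (auto simp: bounded_words_def)
  show ?thesis
  proof (cases rule: list_compare[of \<gamma> \<alpha>])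
    case (1 \<alpha>')
    have "eN \<gamma> * (sw \<alpha> * gp A) = sw \<gamma> * qN \<gamma> * (ss \<alpha>' * ((ss \<alpha> * sw \<alpha>) * gp A))"
      by (simp add: ee_def 1 mult.assoc)
    also have "\<dots> \<doteq> sw \<gamma> * qN \<gamma> * (ss \<alpha>' * gp A)" using v al by (intro eqv_left gp_ss_sw)
    also have "\<dots> \<doteq> sw \<gamma> * qN \<gamma> * (gp (rel_range A \<alpha>') * ss \<alpha>')"
      using v al 1 by (intro eqv_left ss_gp) auto
    finally show ?thesis using 1 by blast
  next
    case (2 \<tau>)
    \<comment> \<open>The strict inequality ensures that the factor in \<open>ee \<gamma>\<close> is
      \<open>Qs S\<close> and not 1.\<close>
    then have len: "length \<gamma> < N" using v(3) by (auto simp: bounded_words_def length_greater_0_conv[symmetric] simp del: length_greater_0_conv)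
    have \<tau>: "set \<tau> \<subseteq> S" "set \<tau> \<subseteq> alphabet" using 2 v(3) S by (auto simp: bounded_words_def)
    have "Qs S * ((ss \<gamma> * sw \<gamma>) * sw \<tau>) \<doteq> 0"
    proof (cases "\<gamma> = []")
      case True
      then show ?thesis using Qs_sw[OF 2(2) \<tau>(1)] by simp
    next
      case False
      have "Qs S * ((ss \<gamma> * sw \<gamma>) * sw \<tau>) \<doteq> Qs S * (gp (word_range \<gamma>) * sw \<tau>)"
        using False al by (intro eqv_left eqv_right ss_sw)
      also have "\<dots> \<doteq> Qs S * (sw \<tau> * gp (rel_range (word_range \<gamma>) \<tau>))"
        using False \<tau> by (intro eqv_left gp_sw B_wr)
      also have "\<dots> = (Qs S * sw \<tau>) * gp (rel_range (word_range \<gamma>) \<tau>)" by (simp add: mult.assoc)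
      also have "\<dots> \<doteq> 0 * gp (rel_range (word_range \<gamma>) \<tau>)" by (intro eqv_right Qs_sw 2(2) \<tau>)
      finally show ?thesis by simp
    qed
    from eqv_0_mult[OF this, of "sw \<gamma>" "gp A"] have "eN \<gamma> * (sw \<alpha> * gp A) \<doteq> 0"
      by (simp add: ee_def qq_def len 2 mult.assoc)
    then show ?thesis by blast
  next
    case (3 \<sigma> b c \<beta>' \<gamma>')
    have "ss \<gamma> * sw \<alpha> \<doteq> 0" unfolding 3 using al 3 by (intro ss_sw_orth) auto
    from eqv_0_mult[OF this, of "sw \<gamma> * qN \<gamma>" "gp A"] show ?thesis
      by (simp add: ee_def mult.assoc)
  qed
qed

text \<open>For fixed \<open>\<delta>\<close> these multiply like matrix units indexed by words. The
  word \<open>\<delta>\<close> enters only through its length, which decides the cut-off factor, so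
  it can be shared by words of equal length.\<close>

definition tq :: "'l list \<Rightarrow> 'l list \<Rightarrow> 'v set \<Rightarrow> 'l list \<Rightarrow> ('v, 'l) generator ncpoly" where
  "tq \<delta> \<gamma> A \<gamma>' = sw \<gamma> * (qN \<delta> * gp A) * ss \<gamma>'"

lemma tq_empty: "tq \<delta> \<gamma> {} \<gamma>' \<doteq> 0"
  unfolding tq_def using eqv_0_mult[OF gp_empty, of "sw \<gamma> * qN \<delta>" "ss \<gamma>'"] by (simp add: mult.assoc)

lemma tq_star: assumes A: "A \<in> B" shows "nc_star (tq \<delta> \<gamma> A \<gamma>') \<doteq> tq \<delta> \<gamma>' A \<gamma>"
proof -
  have "nc_star (tq \<delta> \<gamma> A \<gamma>') = sw \<gamma>' * (nc_star (gp A) * qN \<delta>) * ss \<gamma>"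
    by (simp add: tq_def qq_star mult.assoc)
  also have "\<dots> \<doteq> sw \<gamma>' * (gp A * qN \<delta>) * ss \<gamma>" using A by (intro eqv_left eqv_right gp_star)
  also have "\<dots> \<doteq> sw \<gamma>' * (qN \<delta> * gp A) * ss \<gamma>" using A by (intro eqv_left eqv_right eqv_sym[OF qq_gp])
  finally show ?thesis by (simp add: tq_def)
qed

lemma tq_mult:
  assumes A: "A \<in> B" "A \<subseteq> word_range \<gamma>" "set \<gamma> \<subseteq> alphabet" and C: "C \<in> B"
  shows "tq \<delta> \<alpha> A \<gamma> * tq \<delta> \<gamma> C \<beta> \<doteq> tq \<delta> \<alpha> (A \<inter> C) \<beta>"
proof -
  have "tq \<delta> \<alpha> A \<gamma> * tq \<delta> \<gamma> C \<beta> = (sw \<alpha> * qN \<delta>) * (gp A * (ss \<gamma> * sw \<gamma>)) * (qN \<delta> * gp C * ss \<beta>)"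
    by (simp add: tq_def mult.assoc)
  also have "\<dots> \<doteq> (sw \<alpha> * qN \<delta>) * gp A * (qN \<delta> * gp C * ss \<beta>)"
    using A by (intro eqv_left eqv_right gp_ss_sw)
  also have "\<dots> = (sw \<alpha> * qN \<delta>) * (gp A * qN \<delta>) * (gp C * ss \<beta>)" by (simp add: mult.assoc)
  also have "\<dots> \<doteq> (sw \<alpha> * qN \<delta>) * (qN \<delta> * gp A) * (gp C * ss \<beta>)"
    using A by (intro eqv_left eqv_right eqv_sym[OF qq_gp])
  also have "\<dots> = sw \<alpha> * (qN \<delta> * qN \<delta>) * (gp A * gp C * ss \<beta>)" by (simp add: mult.assoc)
  also have "\<dots> \<doteq> sw \<alpha> * qN \<delta> * (gp A * gp C * ss \<beta>)" by (intro eqv_left eqv_right qq_qq)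
  also have "\<dots> \<doteq> sw \<alpha> * qN \<delta> * (gp (A \<inter> C) * ss \<beta>)" using A C by (intro eqv_left eqv_right gp_mult)
  finally show ?thesis by (simp add: tq_def mult.assoc)
qed

lemma tq_free: "A \<in> B \<Longrightarrow> set \<gamma> \<subseteq> alphabet \<Longrightarrow> set \<gamma>' \<subseteq> alphabet \<Longrightarrow> tq \<delta> \<gamma> A \<gamma>' \<in> FF"
  unfolding tq_def by (intro free_mult1[OF free_mult2[OF _ free_mult2]] unital_sw unital_star unital_qq gp_free)

text \<open>The left factor requires \<open>\<gamma> = \<alpha> @ \<alpha>'\<close>, the right one
  that \<open>\<gamma>'\<close> extends \<open>\<beta> @ \<alpha>'\<close>, a word as long as
  \<open>\<gamma>\<close>. A proper extension is killed by the cut-off in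
  \<open>ee \<gamma>\<close>, so the two words have equal length. A vanishing block is recorded as
  \<open>A' = {}\<close>.\<close>

lemma block:
  assumes v: "valid \<alpha> A \<beta>" "\<alpha> \<in> bounded_words N" "\<beta> \<in> bounded_words N" "length \<alpha> = length \<beta>"
    and \<gamma>: "\<gamma> \<in> bounded_words N" "\<gamma>' \<in> bounded_words N"
  shows "\<exists>A'\<in>B. A' \<subseteq> word_range \<gamma> \<and> A' \<subseteq> word_range \<gamma>' \<and> (A' = {} \<or> length \<gamma> = length \<gamma>') \<and>
    eN \<gamma> * tri \<alpha> A \<beta> * eN \<gamma>' \<doteq> tq \<gamma> \<gamma> A' \<gamma>'"
proof -
  have zero: ?thesis if "eN \<gamma> * tri \<alpha> A \<beta> * eN \<gamma>' \<doteq> 0"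
    using eqv_trans[OF that eqv_sym[OF tq_empty]] B_empty by blast
  have A: "A \<in> B" "A \<subseteq> word_range \<alpha>" "A \<subseteq> word_range \<beta>" using v by (auto simp: valid_def)
  from ee_left[OF A(1,2) v(2) \<gamma>(1)] show ?thesis
  proof (elim disjE exE conjE)
    assume z: "eN \<gamma> * (sw \<alpha> * gp A) \<doteq> 0"
    from eqv_right[OF z, of "ss \<beta> * eN \<gamma>'"] show ?thesis
      by (intro zero) (simp add: tri_def mult.assoc)
  next
    fix \<alpha>' assume \<gamma>_eq: "\<gamma> = \<alpha> @ \<alpha>'"
      and l: "eN \<gamma> * (sw \<alpha> * gp A) \<doteq> sw \<gamma> * qN \<gamma> * (gp (rel_range A \<alpha>') * ss \<alpha>')"
    define D where "D = rel_range A \<alpha>'"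
    define \<delta> where "\<delta> = \<beta> @ \<alpha>'"
    have D: "D \<in> B" "D \<subseteq> word_range \<gamma>" "D \<subseteq> word_range \<delta>"
      using A rel_range_sub_wr by (auto simp: D_def \<delta>_def \<gamma>_eq B_rel)
    have len: "length \<delta> = length \<gamma>" using v by (simp add: \<delta>_def \<gamma>_eq)
    have \<delta>: "\<delta> \<in> bounded_words N" using v \<gamma> len by (auto simp: bounded_words_def \<delta>_def \<gamma>_eq)
    have "eN \<gamma> * tri \<alpha> A \<beta> * eN \<gamma>' = (eN \<gamma> * (sw \<alpha> * gp A)) * (ss \<beta> * eN \<gamma>')"
      by (simp add: tri_def mult.assoc)
    also have "\<dots> \<doteq> (sw \<gamma> * qN \<gamma> * (gp D * ss \<alpha>')) * (ss \<beta> * eN \<gamma>')"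
      unfolding D_def by (intro eqv_right l)
    also have "\<dots> = sw \<gamma> * qN \<gamma> * (gp D * (ss \<delta> * eN \<gamma>'))" by (simp add: \<delta>_def mult.assoc)
    finally have 1: "eN \<gamma> * tri \<alpha> A \<beta> * eN \<gamma>' \<doteq> sw \<gamma> * qN \<gamma> * (gp D * (ss \<delta> * eN \<gamma>'))" .
    have flip: "gp D * (ss \<delta> * eN \<gamma>') \<doteq> nc_star (eN \<gamma>' * (sw \<delta> * gp D))"
    proof -
      have "gp D * (ss \<delta> * eN \<gamma>') \<doteq> nc_star (gp D) * (ss \<delta> * eN \<gamma>')"
        using D by (intro eqv_right eqv_sym[OF gp_star])
      then show ?thesis by (simp add: ee_star mult.assoc)
    qed
    from ee_left[OF D(1,3) \<delta> \<gamma>(2)] show ?thesis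
    proof (elim disjE exE conjE)
      assume z: "eN \<gamma>' * (sw \<delta> * gp D) \<doteq> 0"
      have "gp D * (ss \<delta> * eN \<gamma>') \<doteq> 0" using eqv_trans[OF flip eqv_star[OF z]] by simp
      from eqv_trans[OF 1 eqv_left[OF this]] show ?thesis by (intro zero) simp
    next
      fix \<delta>' assume \<gamma>'_eq: "\<gamma>' = \<delta> @ \<delta>'"
        and r: "eN \<gamma>' * (sw \<delta> * gp D) \<doteq> sw \<gamma>' * qN \<gamma>' * (gp (rel_range D \<delta>') * ss \<delta>')"
      have al: "set \<delta>' \<subseteq> S" using \<gamma>(2) by (auto simp: bounded_words_def \<gamma>'_eq)
      have "gp D * (ss \<delta> * eN \<gamma>') \<doteq> nc_star (sw \<gamma>' * qN \<gamma>' * (gp (rel_range D \<delta>') * ss \<delta>'))"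
        by (rule eqv_trans[OF flip eqv_star[OF r]])
      also have "\<dots> = sw \<delta>' * (nc_star (gp (rel_range D \<delta>')) * (qN \<gamma>' * ss \<gamma>'))"
        by (simp add: qq_star mult.assoc)
      also have "\<dots> \<doteq> sw \<delta>' * (gp (rel_range D \<delta>') * (qN \<gamma>' * ss \<gamma>'))"
        using D by (intro eqv_left eqv_right gp_star B_rel)
      finally have 2: "gp D * (ss \<delta> * eN \<gamma>') \<doteq> sw \<delta>' * (gp (rel_range D \<delta>') * (qN \<gamma>' * ss \<gamma>'))" .
      show ?thesis
      proof (cases "\<delta>' = []")
        case True
        then have eq: "\<gamma>' = \<delta>" using \<gamma>'_eq by simp
        have q: "qN \<gamma>' = qN \<gamma>" using len eq by (simp add: qq_def)
        have "eN \<gamma> * tri \<alpha> A \<beta> * eN \<gamma>' \<doteq> sw \<gamma> * qN \<gamma> * (gp D * (qN \<gamma> * ss \<gamma>'))"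
          using eqv_trans[OF 1 eqv_left[OF 2]] True D q by simp
        also have "\<dots> = sw \<gamma> * (qN \<gamma> * (gp D * qN \<gamma>)) * ss \<gamma>'" by (simp add: mult.assoc)
        also have "\<dots> \<doteq> sw \<gamma> * (qN \<gamma> * (qN \<gamma> * gp D)) * ss \<gamma>'"
          using D by (intro eqv_left eqv_right eqv_sym[OF qq_gp])
        also have "\<dots> = sw \<gamma> * (qN \<gamma> * qN \<gamma> * gp D) * ss \<gamma>'" by (simp add: mult.assoc)
        also have "\<dots> \<doteq> sw \<gamma> * (qN \<gamma> * gp D) * ss \<gamma>'" by (intro eqv_left eqv_right qq_qq)
        finally have "eN \<gamma> * tri \<alpha> A \<beta> * eN \<gamma>' \<doteq> tq \<gamma> \<gamma> D \<gamma>'" by (simp add: tq_def)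
        then show ?thesis using D eq len by metis
      next
        case False
        then have "length \<gamma> < N" using \<gamma>(2) len by (auto simp: bounded_words_def \<gamma>'_eq length_greater_0_conv[symmetric] simp del: length_greater_0_conv)
        then have "qN \<gamma> * sw \<delta>' \<doteq> 0" using Qs_sw[OF False al] by (simp add: qq_def)
        from eqv_0_mult[OF this, of "sw \<gamma>" "gp (rel_range D \<delta>') * (qN \<gamma>' * ss \<gamma>')"]
        have "sw \<gamma> * qN \<gamma> * (sw \<delta>' * (gp (rel_range D \<delta>') * (qN \<gamma>' * ss \<gamma>'))) \<doteq> 0"
          by (simp add: mult.assoc)
        from eqv_trans[OF eqv_trans[OF 1 eqv_left[OF 2]] this] show ?thesis by (rule zero)
      qed
    qed
  qed
qed

end

end

text \<open>Adds a multiple of a projection to a combination of orthogonal ones.\<close>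
fun refine :: "complex \<Rightarrow> 'v set \<Rightarrow> (complex \<times> 'v set) list \<Rightarrow> (complex \<times> 'v set) list" where
  "refine c A [] = [(c, A)]"
| "refine c A ((e, C) # M) = (e + c, C \<inter> A) # (e, C - A) # refine c (A - C) M"

definition plin :: "(complex \<times> 'v set) list \<Rightarrow> ('v, 'l) generator ncpoly" where
  "plin M = (\<Sum>(c, A)\<leftarrow>M. cst c * gp A)"

lemma plin_simps [simp]: "plin [] = 0" "plin ((c, A) # M) = cst c * gp A + plin M"
  by (simp_all add: plin_def)

lemma refine_sets:
  "(e, C) \<in> set (refine c A M) \<Longrightarrow> C \<subseteq> A \<union> \<Union>(snd ` set M)"
proof (induction c A M rule: refine.induct)
  case (2 c A e' C' M)
  have "C = C' \<inter> A \<or> C = C' - A \<or> (e, C) \<in> set (refine c (A - C') M)" using "2.prems" by auto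
  then show ?case using "2.IH" by auto
qed simp

lemma refine_B: "A \<in> B \<Longrightarrow> snd ` set M \<subseteq> B \<Longrightarrow> snd ` set (refine c A M) \<subseteq> B"
  by (induction c A M rule: refine.induct) (auto simp: B_Int B_Diff)

abbreviation disjoint_sets_list :: "(complex \<times> 'v set) list \<Rightarrow> bool" where
  "disjoint_sets_list \<equiv> sorted_wrt (\<lambda>x y. snd x \<inter> snd y = {})"

lemma refine_disjoint: "disjoint_sets_list M \<Longrightarrow> disjoint_sets_list (refine c A M)"
proof (induction c A M rule: refine.induct)
  case (2 c A e C M)
  have "C \<inter> D = {}" if D: "(e', D) \<in> set (refine c (A - C) M)" for e' D
    using refine_sets[OF D] "2.prems" by fastforce
  then have "C \<inter> snd y = {}" if "y \<in> set (refine c (A - C) M)" for y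
    using that by (cases y) auto
  then show ?case using "2.IH" "2.prems" by auto
qed simp

lemma plin_refine: "A \<in> B \<Longrightarrow> snd ` set M \<subseteq> B \<Longrightarrow> plin (refine c A M) \<doteq> cst c * gp A + plin M"
proof (induction c A M rule: refine.induct)
  case (2 c A e C M)
  have B: "A \<in> B" "C \<in> B" using 2 by auto
  have C: "gp C \<doteq> gp (C \<inter> A) + gp (C - A)"
    using gp_Un_disjoint[OF B_Int[OF B(2,1)] B_Diff[OF B(2,1)]] by (simp add: Int_Diff_Un Int_Diff Diff_Int_distrib)
  have "gp ((C \<inter> A) \<union> (A - C)) \<doteq> gp (C \<inter> A) + gp (A - C)"
    using B by (intro gp_Un_disjoint B_Int B_Diff) auto
  moreover have "(C \<inter> A) \<union> (A - C) = A" by auto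
  ultimately have A: "gp A \<doteq> gp (C \<inter> A) + gp (A - C)" by simp
  have "plin (refine c A ((e, C) # M)) =
      cst (e + c) * gp (C \<inter> A) + (cst e * gp (C - A) + plin (refine c (A - C) M))" by simp
  also have "\<dots> \<doteq> cst (e + c) * gp (C \<inter> A) + (cst e * gp (C - A) + (cst c * gp (A - C) + plin M))"
    using 2 by (intro eqv_add eqv_refl "2.IH") (auto intro: B_Diff)
  also have "\<dots> = cst c * (gp (C \<inter> A) + gp (A - C)) + (cst e * (gp (C \<inter> A) + gp (C - A)) + plin M)"
    by (simp add: algebra_simps flip: cst_add)
  also have "\<dots> \<doteq> cst c * gp A + (cst e * gp C + plin M)"
    by (intro eqv_add eqv_left eqv_sym[OF A] eqv_sym[OF C] eqv_refl)
  finally show ?case by simp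
qed simp

lemma plin_disjointify:
  assumes "snd ` set M \<subseteq> B"
  shows "\<exists>M'. plin M \<doteq> plin M' \<and> snd ` set M' \<subseteq> B \<and> disjoint_sets_list M' \<and> \<Union>(snd ` set M') \<subseteq> \<Union>(snd ` set M)"
  using assms
proof (induction M)
  case Nil
  show ?case by (rule exI[of _ "[]"]) simp
next
  case (Cons cA M)
  obtain c A where cA: "cA = (c, A)" by (cases cA)
  obtain M' where M': "plin M \<doteq> plin M'" "snd ` set M' \<subseteq> B" "disjoint_sets_list M'" "\<Union>(snd ` set M') \<subseteq> \<Union>(snd ` set M)"
    using Cons by auto
  have A: "A \<in> B" using Cons cA by auto
  have "plin (cA # M) \<doteq> cst c * gp A + plin M'" unfolding cA plin_simps by (intro eqv_add eqv_refl M')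
  also have "\<dots> \<doteq> plin (refine c A M')" by (intro eqv_sym[OF plin_refine] A M')
  finally have 1: "plin (cA # M) \<doteq> plin (refine c A M')" .
  have "\<Union>(snd ` set (refine c A M')) \<subseteq> A \<union> \<Union>(snd ` set M')" using refine_sets by fastforce
  then have "\<Union>(snd ` set (refine c A M')) \<subseteq> \<Union>(snd ` set (cA # M))" using M'(4) cA by auto
  then show ?case using 1 refine_B[OF A M'(2)] refine_disjoint[OF M'(3)] by blast
qed

text \<open>The \<open>v i\<close> are partial isometries with orthogonal sources and orthogonal
  ranges. Powers of \<open>nc_star z * z\<close> only raise the coefficients, so the triangle
  inequality loses the factor \<open>card K\<close>, which the spectral radius argument removes.
  Coefficients of null projections do not matter.\<close>

lemma block_bound:
  fixes K :: "'i set"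
  assumes K: "finite K" and v: "\<And>i. i \<in> K \<Longrightarrow> v i \<in> FF" and w: "\<And>i. i \<in> K \<Longrightarrow> w i \<in> FF"
    and vv: "\<And>i j. i \<in> K \<Longrightarrow> j \<in> K \<Longrightarrow> nc_star (v i) * v j \<doteq> (if i = j then w i else 0)"
    and ww: "\<And>i j. i \<in> K \<Longrightarrow> j \<in> K \<Longrightarrow> w i * w j \<doteq> (if i = j then w i else 0)"
    and wn: "\<And>i. i \<in> K \<Longrightarrow> uu (w i) \<le> 1"
    and M: "M \<ge> 0" "\<And>i. i \<in> K \<Longrightarrow> w i \<doteq> 0 \<or> cmod (c i) \<le> M"
  shows "uu (\<Sum>i\<in>K. cst (c i) * v i) \<le> M"
proof -
  define z where "z = (\<Sum>i\<in>K. cst (c i) * v i)"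
  define h where "h = nc_star z * z"
  have z: "z \<in> FF" unfolding z_def using v by (intro free_sum free_cst)
  have h: "h \<in> FF" "nc_star h = h" unfolding h_def using z by (auto intro: free_mult free_star)
  have prod: "(\<Sum>i\<in>K. cst (a i) * x i) * (\<Sum>i\<in>K. cst (b i) * y i) \<doteq> (\<Sum>i\<in>K. cst (a i * b i) * w i)"
    if xy: "\<And>i j. i \<in> K \<Longrightarrow> j \<in> K \<Longrightarrow> x i * y j \<doteq> (if i = j then w i else 0)"
    for a b :: "'i \<Rightarrow> complex" and x y :: "'i \<Rightarrow> ('v, 'l) generator ncpoly"
  proof -
    have "(\<Sum>i\<in>K. cst (a i) * x i) * (\<Sum>i\<in>K. cst (b i) * y i) = (\<Sum>i\<in>K. \<Sum>j\<in>K. cst (a i * b j) * (x i * y j))"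
      unfolding sum_product
    proof (intro sum.cong refl)
      fix i j
      have "cst (a i) * x i * (cst (b j) * y j) = cst (a i) * (x i * cst (b j)) * y j" by (simp add: mult.assoc)
      also have "\<dots> = (cst (a i) * cst (b j)) * (x i * y j)" by (simp only: cst_commute[of "x i"] mult.assoc)
      finally show "cst (a i) * x i * (cst (b j) * y j) = cst (a i * b j) * (x i * y j)" by (simp add: cst_mult)
    qed
    also have "\<dots> \<doteq> (\<Sum>i\<in>K. \<Sum>j\<in>K. cst (a i * b j) * (if i = j then w i else 0))"
      by (intro eqv_sum eqv_left xy)
    also have "\<dots> = (\<Sum>i\<in>K. \<Sum>j\<in>K. if j = i then cst (a i * b i) * w i else 0)"
      by (intro sum.cong) auto
    also have "\<dots> = (\<Sum>i\<in>K. cst (a i * b i) * w i)" using K by (simp add: sum.delta)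
    finally show ?thesis .
  qed
  have zs: "nc_star z = (\<Sum>i\<in>K. cst (cnj (c i)) * nc_star (v i))"
    by (simp add: z_def nc_star_sum cst_commute)
  have h1: "h \<doteq> (\<Sum>i\<in>K. cst (complex_of_real ((cmod (c i))\<^sup>2)) * w i)"
  proof -
    have "h \<doteq> (\<Sum>i\<in>K. cst (cnj (c i) * c i) * w i)" unfolding h_def zs unfolding z_def by (intro prod vv)
    then show ?thesis unfolding complex_norm_square by (simp only: mult.commute)
  qed
  have hm: "h ^ Suc m \<doteq> (\<Sum>i\<in>K. cst (complex_of_real ((cmod (c i))\<^sup>2 ^ Suc m)) * w i)" for m
  proof (induction m)
    case 0
    then show ?case using h1 by simp
  next
    case (Suc m)
    have "h ^ Suc (Suc m) = h * h ^ Suc m" by simp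
    also have "\<dots> \<doteq> (\<Sum>i\<in>K. cst (complex_of_real ((cmod (c i))\<^sup>2)) * w i) *
        (\<Sum>i\<in>K. cst (complex_of_real ((cmod (c i))\<^sup>2 ^ Suc m)) * w i)"
      by (intro eqv_mult h1 Suc)
    also have "\<dots> \<doteq> (\<Sum>i\<in>K. cst (complex_of_real ((cmod (c i))\<^sup>2) * complex_of_real ((cmod (c i))\<^sup>2 ^ Suc m)) * w i)"
      by (intro prod ww)
    finally show ?case by (simp only: power_Suc of_real_mult)
  qed
  have "uu h \<le> M\<^sup>2"
  \<comment> \<open>The polynomial factor is the constant \<open>card K\<close>, the number of
    summands.\<close>
  proof (rule U.le_by_powers[OF h, of _ 0 "real (card K)"])
    fix m :: nat assume "m > 0"
    then obtain k where k: "m = Suc k" using gr0_implies_Suc by blast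
    have F: "cst (complex_of_real ((cmod (c i))\<^sup>2 ^ m)) * w i \<in> FF" if "i \<in> K" for i using that w free_cst by blast
    have "uu (h ^ m) = uu (\<Sum>i\<in>K. cst (complex_of_real ((cmod (c i))\<^sup>2 ^ m)) * w i)"
      using hm[of k] F by (intro uu_eqv free_power h free_sum) (auto simp: k)
    also have "\<dots> \<le> (\<Sum>i\<in>K. uu (cst (complex_of_real ((cmod (c i))\<^sup>2 ^ m)) * w i))"
      by (intro U.sum_le F)
    also have "\<dots> \<le> (\<Sum>i\<in>K. M\<^sup>2 ^ m)"
    proof (intro sum_mono)
      fix i assume i: "i \<in> K"
      have eq: "uu (cst (complex_of_real ((cmod (c i))\<^sup>2 ^ m)) * w i) = (cmod (c i))\<^sup>2 ^ m * uu (w i)"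
        using w[OF i] by (simp add: U.scale norm_power)
      show "uu (cst (complex_of_real ((cmod (c i))\<^sup>2 ^ m)) * w i) \<le> M\<^sup>2 ^ m"
      proof (cases "w i \<doteq> 0")
        case True
        then show ?thesis unfolding eq using uu_eqv_0[OF w[OF i]] by simp
      next
        case False
        then have "(cmod (c i))\<^sup>2 ^ m \<le> M\<^sup>2 ^ m" using M(2)[OF i] by (intro power_mono) auto
        moreover have "(cmod (c i))\<^sup>2 ^ m * uu (w i) \<le> (cmod (c i))\<^sup>2 ^ m"
          using wn[OF i] U.nonneg[OF w[OF i]] by (intro mult_left_le) auto
        ultimately show ?thesis unfolding eq by linarith
      qed
    qed
    finally show "uu (h ^ m) \<le> (0 * real m + real (card K)) * M\<^sup>2 ^ m" by simp
  qed simp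
  moreover have "uu h = (uu z)\<^sup>2" unfolding h_def using z by (rule U.cstar)
  ultimately show ?thesis unfolding z_def[symmetric] using M(1) power2_le_imp_le by metis
qed

end

section \<open>Matrix entries of blocks\<close>

context bpath_rep
begin

context
  fixes S :: "'l set" and N :: nat
  assumes S: "finite S" "S \<subseteq> alphabet"
begin

text \<open>Describes paths \<open>pre \<gamma> \<xi>\<close> that are fixed by the cut-off
  projection of \<open>\<gamma>\<close>.\<close>

definition free_at :: "'l list \<Rightarrow> ('v, 'l) boundary \<Rightarrow> bool" where
  "free_at \<gamma> \<xi> \<longleftrightarrow> okp \<gamma> \<xi> \<and> (length \<gamma> < N \<longrightarrow> snd \<xi> 0 \<notin> Some ` S)"

lemma free_at_okp: "free_at \<gamma> \<xi> \<Longrightarrow> okp \<gamma> \<xi>"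
  by (simp add: free_at_def)

lemma act_qq: assumes "free_at \<gamma> \<xi>" "length \<delta> = length \<gamma>" shows "act_on (qq S N \<delta>) f (\<xi>, i) = f (\<xi>, i)"
proof (cases "length \<gamma> < N")
  case True
  have "act_on (gs a * nc_star (gs a)) f (\<xi>, i) = 0" if "a \<in> S" for a
    using assms True that by (auto simp: free_at_def act_on_mult act_gs)
  then show ?thesis using True assms(2) S by (simp add: qq_def[OF S] Qs_def act_on_diff act_on_one act_on_sum)
next
  case False
  then show ?thesis using assms(2) by (simp add: qq_def[OF S] act_on_one)
qed

lemma act_ee: assumes "free_at \<gamma> \<xi>" shows "act_on (ee S N \<gamma>) f (pre \<gamma> \<xi>, i) = f (pre \<gamma> \<xi>, i)"
  using act_qq[OF assms refl] free_at_okp[OF assms] by (simp add: ee_def[OF S] act_on_mult act_sw act_ss)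

text \<open>Both projections fix the corresponding point, so a block and the whole element share
  this entry. The right factor is moved to the left by taking adjoints.\<close>

lemma entry_ee:
  assumes "free_at \<gamma> \<xi>" "free_at \<gamma>' \<xi>'"
  shows "entry (ee S N \<gamma> * y * ee S N \<gamma>') (pre \<gamma> \<xi>, i) (pre \<gamma>' \<xi>', j) = entry y (pre \<gamma> \<xi>, i) (pre \<gamma>' \<xi>', j)"
proof -
  have 1: "entry (ee S N \<gamma> * z) (pre \<gamma> \<xi>, i) \<zeta> = entry z (pre \<gamma> \<xi>, i) \<zeta>" if "free_at \<gamma> \<xi>" for \<gamma> \<xi> i z \<zeta>
    using act_ee[OF that] by (simp add: entry_def act_on_mult)
  have "entry (ee S N \<gamma> * y * ee S N \<gamma>') (pre \<gamma> \<xi>, i) (pre \<gamma>' \<xi>', j) =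
      entry (y * ee S N \<gamma>') (pre \<gamma> \<xi>, i) (pre \<gamma>' \<xi>', j)"
    unfolding mult.assoc by (rule 1[OF assms(1)])
  also have "\<dots> = entry (nc_star (ee S N \<gamma>' * nc_star y)) (pre \<gamma> \<xi>, i) (pre \<gamma>' \<xi>', j)"
    by (simp add: ee_star[OF S])
  also have "\<dots> = cnj (entry (nc_star y) (pre \<gamma>' \<xi>', j) (pre \<gamma> \<xi>, i))"
    unfolding entry_star 1[OF assms(2)] entry_star ..
  finally show ?thesis by (simp add: entry_star)
qed

text \<open>The integer coordinates are chosen so that both points arise from \<open>\<xi>\<close>
  at level 0.\<close>

lemma entry_tq:
  assumes "free_at \<gamma> \<xi>" "okp \<gamma>' \<xi>"
  shows "entry (tq S N \<gamma> \<gamma> C \<gamma>') (pre \<gamma> \<xi>, d * int (length \<gamma>)) (pre \<gamma>' \<xi>, d * int (length \<gamma>')) =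
    (if C \<in> fst \<xi> 0 then 1 else 0)"
proof -
  have "bpath H \<xi>" using assms by (simp add: okp_def)
  then show ?thesis using act_qq[OF assms(1) refl] free_at_okp[OF assms(1)] assms(2)
    by (simp add: tq_def[OF S] entry_def act_on_mult act_sw act_ss act_gp delta_def)
qed

end

end

section \<open>Norms of elements of degree 0\<close>

locale graded_rep = bpath_rep E Lab B H d
  for E :: "('v, 'e) pre_digraph" and Lab :: "'e \<Rightarrow> 'l" and B :: "'v set set" and H d +
  assumes H_triv: "H = {{}}" and d_one: "d = 1"
begin

lemma bpath_ex: "A \<in> B \<Longrightarrow> A \<noteq> {} \<Longrightarrow> \<exists>\<xi>. bpath H \<xi> \<and> A \<in> fst \<xi> 0"
  using bpath_exists[OF hereditary_H saturated_H] H_triv by simp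

text \<open>If no path through \<open>C\<close> survives the cut-off, every nonempty member of
  \<open>B\<close> inside \<open>C\<close> emits a label and all labels of \<open>C\<close> lie in
  \<open>S\<close>. The summation relation then expresses \<open>gp C\<close> by ranges that
  \<open>Qs S\<close> kills: vanishing on all paths is a consequence of the relations.\<close>

lemma Qs_p_zero:
  assumes S: "finite S" "S \<subseteq> alphabet" and C: "C \<in> B"
    and all: "\<And>\<xi>. bpath H \<xi> \<Longrightarrow> C \<in> fst \<xi> 0 \<Longrightarrow> snd \<xi> 0 \<in> Some ` S"
  shows "Qs S * gp C \<doteq> 0"
proof (cases "C = {}")
  case True
  then show ?thesis using eqv_left[OF gp_empty, of "Qs S"] by simp
next
  case False
  have out: "out_labels D \<noteq> {}" if D: "D \<in> B" "D \<noteq> {}" "D \<subseteq> C" for D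
  proof -
    obtain \<xi> where \<xi>: "bpath H \<xi>" "D \<in> fst \<xi> 0" using bpath_ex[OF D(1,2)] by blast
    then have "C \<in> fst \<xi> 0" using ultra_up[OF bpath_ultra] C D(3) by blast
    then obtain a where "snd \<xi> 0 = Some a" using all \<xi> by blast
    then show ?thesis using bpath_out(2)[OF \<xi>] by blast
  qed
  have sub: "out_labels C \<subseteq> S"
  proof
    fix a assume "a \<in> out_labels C"
    then have "rel_range C [a] \<noteq> {}" by (simp add: out_labels_def)
    then obtain \<xi> where \<xi>: "bpath H \<xi>" "rel_range C [a] \<in> fst \<xi> 0"
      using bpath_ex B_rel[OF C] by blast
    have "word_range [a] \<in> fst \<xi> 0"
      using ultra_up[OF bpath_ultra[OF \<xi>] \<xi>(2) B_wr rel_range_subset] by simp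
    then have "bpath H (prepend a \<xi>)" using bpath_prepend[OF hereditary_H] \<xi> by blast
    moreover have "C \<in> fst (prepend a \<xi>) 0" using \<xi> C by (simp add: pull_def)
    ultimately have "snd (prepend a \<xi>) 0 \<in> Some ` S" by (rule all)
    then show "a \<in> S" by auto
  qed
  have fin: "finite (out_labels C)" using sub S finite_subset by blast
  have "\<not> (\<exists>D\<in>B. D \<noteq> {} \<and> D \<subseteq> C \<inter> sinks)"
    using out out_labels_sinks B_subset by (metis Int_subset_iff)
  then have "gp C \<doteq> (\<Sum>a\<in>out_labels C. gs a * gp (rel_range C [a]) * nc_star (gs a))"
    using C out[OF C False] fin by (intro eqv_base relators.p_sum) auto
  then have "Qs S * gp C \<doteq> Qs S * (\<Sum>a\<in>out_labels C. gs a * gp (rel_range C [a]) * nc_star (gs a))"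
    by (rule eqv_left)
  also have "\<dots> = (\<Sum>a\<in>out_labels C. (Qs S * gs a) * (gp (rel_range C [a]) * nc_star (gs a)))"
    by (simp add: sum_distrib_left mult.assoc)
  also have "\<dots> \<doteq> (\<Sum>a\<in>out_labels C. 0 * (gp (rel_range C [a]) * nc_star (gs a)))"
    using sub by (intro eqv_sum eqv_right Qs_gs[OF S]) auto
  finally show ?thesis by simp
qed

definition core :: "nat \<Rightarrow> 'l set \<Rightarrow> 'l list \<Rightarrow> 'l list \<Rightarrow> bool" where
  "core N S \<alpha> \<beta> \<longleftrightarrow> length \<alpha> = length \<beta> \<and> length \<alpha> \<le> N \<and> set \<alpha> \<subseteq> S \<and> set \<beta> \<subseteq> S"

context
  fixes S :: "'l set" and N :: nat
  assumes S: "finite S" "S \<subseteq> alphabet"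
begin

abbreviation "W \<equiv> bounded_words S N"
abbreviation "e \<equiv> ee S N"

lemma block_lin:
  assumes L: "good (core N S) L" and \<gamma>: "\<gamma> \<in> W" "\<gamma>' \<in> W"
  shows "\<exists>M. snd ` set M \<subseteq> B \<and> \<Union>(snd ` set M) \<subseteq> word_range \<gamma> \<inter> word_range \<gamma>' \<and>
    (length \<gamma> = length \<gamma>' \<or> \<Union>(snd ` set M) = {}) \<and>
    e \<gamma> * lin L * e \<gamma>' \<doteq> sw \<gamma> * (qq S N \<gamma> * plin M) * ss \<gamma>'"
  using L
proof (induction L rule: lin_induct)
  case Nil
  show ?case by (rule exI[of _ "[]"]) simp
next
  case (Cons c \<alpha> A \<beta> L)
  then obtain M where M: "snd ` set M \<subseteq> B" "\<Union>(snd ` set M) \<subseteq> word_range \<gamma> \<inter> word_range \<gamma>'"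
    "length \<gamma> = length \<gamma>' \<or> \<Union>(snd ` set M) = {}"
    "e \<gamma> * lin L * e \<gamma>' \<doteq> sw \<gamma> * (qq S N \<gamma> * plin M) * ss \<gamma>'" by auto
  have "\<exists>A'\<in>B. A' \<subseteq> word_range \<gamma> \<and> A' \<subseteq> word_range \<gamma>' \<and> (A' = {} \<or> length \<gamma> = length \<gamma>') \<and>
      e \<gamma> * tri \<alpha> A \<beta> * e \<gamma>' \<doteq> tq S N \<gamma> \<gamma> A' \<gamma>'"
    using Cons.prems \<gamma> by (intro block[OF S]) (auto simp: core_def bounded_words_def[OF S])
  then obtain A' where A': "A' \<in> B" "A' \<subseteq> word_range \<gamma>" "A' \<subseteq> word_range \<gamma>'"
    "A' = {} \<or> length \<gamma> = length \<gamma>'" "e \<gamma> * tri \<alpha> A \<beta> * e \<gamma>' \<doteq> tq S N \<gamma> \<gamma> A' \<gamma>'" by blast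
  have move: "x * (cst c * y) * z = cst c * (x * y * z)" for x y z :: "('v, 'l) generator ncpoly"
    by (simp only: cst_commute[of x] mult.assoc[symmetric])
  have "e \<gamma> * lin ((c, \<alpha>, A, \<beta>) # L) * e \<gamma>' = cst c * (e \<gamma> * tri \<alpha> A \<beta> * e \<gamma>') + e \<gamma> * lin L * e \<gamma>'"
    by (simp add: ring_distribs move)
  also have "\<dots> \<doteq> cst c * tq S N \<gamma> \<gamma> A' \<gamma>' + sw \<gamma> * (qq S N \<gamma> * plin M) * ss \<gamma>'"
    by (intro eqv_add eqv_left A' M)
  also have "\<dots> = sw \<gamma> * (qq S N \<gamma> * plin ((c, A') # M)) * ss \<gamma>'"
    using move[of "sw \<gamma> * qq S N \<gamma>" "gp A'" "ss \<gamma>'"]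
    by (simp add: tq_def[OF S] ring_distribs mult.assoc)
  finally show ?case using A' M by (intro exI[of _ "(c, A') # M"]) auto
qed

text \<open>Once the sets are disjoint, the block has the form required by
  \<open>block_bound\<close>, and each relevant coefficient is a matrix entry of \<open>y\<close>
  itself.\<close>

lemma block_le:
  assumes y: "y \<in> FF" "y \<doteq> lin L" "good (core N S) L" and \<gamma>: "\<gamma> \<in> W" "\<gamma>' \<in> W"
  shows "uu (e \<gamma> * y * e \<gamma>') \<le> opn y"
proof -
  have al: "set \<gamma> \<subseteq> alphabet" "set \<gamma>' \<subseteq> alphabet" using \<gamma> S by (auto simp: bounded_words_def[OF S])
  obtain M0 where M0: "snd ` set M0 \<subseteq> B" "\<Union>(snd ` set M0) \<subseteq> word_range \<gamma> \<inter> word_range \<gamma>'"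
    "length \<gamma> = length \<gamma>' \<or> \<Union>(snd ` set M0) = {}"
    "e \<gamma> * lin L * e \<gamma>' \<doteq> sw \<gamma> * (qq S N \<gamma> * plin M0) * ss \<gamma>'"
    using block_lin[OF y(3) \<gamma>] by blast
  obtain M where M: "plin M0 \<doteq> plin M" "snd ` set M \<subseteq> B" "disjoint_sets_list M" "\<Union>(snd ` set M) \<subseteq> \<Union>(snd ` set M0)"
    using plin_disjointify[OF M0(1)] by blast
  define K where "K = {..<length M}"
  define c where "c i = fst (M ! i)" for i
  define C where "C i = snd (M ! i)" for i
  have C: "C i \<in> B" "C i \<subseteq> word_range \<gamma>" "C i \<subseteq> word_range \<gamma>'" "length \<gamma> = length \<gamma>' \<or> C i = {}"
    if "i \<in> K" for i
  proof -
    have "M ! i \<in> set M" using that by (simp add: K_def)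
    then have mem: "C i \<in> snd ` set M" by (simp add: C_def)
    then show "C i \<in> B" using M(2) by blast
    have "C i \<subseteq> \<Union>(snd ` set M0)" using order_trans[OF Union_upper[OF mem] M(4)] .
    then show "C i \<subseteq> word_range \<gamma>" "C i \<subseteq> word_range \<gamma>'" "length \<gamma> = length \<gamma>' \<or> C i = {}"
      using M0(2,3) by auto
  qed
  have disj: "C i \<inter> C j = {}" if "i \<in> K" "j \<in> K" "i \<noteq> j" for i j
  proof -
    have "C i \<inter> C j = {}" if "i < j" "j < length M" for i j
      using M(3) that by (simp add: sorted_wrt_iff_nth_less C_def)
    then show ?thesis using that unfolding K_def by (metis lessThan_iff inf_commute linorder_neqE_nat)
  qed
  have inter: "tq S N \<gamma> \<alpha> (C i \<inter> C j) \<beta> \<doteq> (if i = j then tq S N \<gamma> \<alpha> (C i) \<beta> else 0)"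
    if "i \<in> K" "j \<in> K" for i j \<alpha> \<beta>
    using disj[OF that] tq_empty[OF S] by simp
  let ?v = "\<lambda>i. tq S N \<gamma> \<gamma> (C i) \<gamma>'" and ?w = "\<lambda>i. tq S N \<gamma> \<gamma>' (C i) \<gamma>'"
  have vF: "?v i \<in> FF" and wF: "?w i \<in> FF" if "i \<in> K" for i using C[OF that] al by (auto intro: tq_free[OF S])
  have move: "x * (cst c * y) * z = cst c * (x * y * z)" for c and x y z :: "('v, 'l) generator ncpoly"
    by (simp only: cst_commute[of x] mult.assoc[symmetric])
  have "plin M = (\<Sum>i\<in>K. cst (c i) * gp (C i))"
    unfolding plin_def K_def c_def C_def by (simp add: sum_list_sum_nth case_prod_unfold atLeast0LessThan)
  then have "sw \<gamma> * (qq S N \<gamma> * plin M) * ss \<gamma>' = (\<Sum>i\<in>K. cst (c i) * ?v i)"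
    using move[of "sw \<gamma> * qq S N \<gamma>" _ _ "ss \<gamma>'"]
    by (simp add: tq_def[OF S] sum_distrib_left sum_distrib_right mult.assoc)
  moreover have "e \<gamma> * y * e \<gamma>' \<doteq> sw \<gamma> * (qq S N \<gamma> * plin M) * ss \<gamma>'"
  proof -
    have "e \<gamma> * y * e \<gamma>' \<doteq> e \<gamma> * lin L * e \<gamma>'" by (intro eqv_left eqv_right y)
    also note M0(4)
    also have "sw \<gamma> * (qq S N \<gamma> * plin M0) * ss \<gamma>' \<doteq> sw \<gamma> * (qq S N \<gamma> * plin M) * ss \<gamma>'"
      by (intro eqv_left eqv_right M)
    finally show ?thesis .
  qed
  ultimately have eq: "e \<gamma> * y * e \<gamma>' \<doteq> (\<Sum>i\<in>K. cst (c i) * ?v i)" by simp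
  \<comment> \<open>A path through \<open>C i\<close> that survives the cut-off exhibits
    \<open>c i\<close> as an entry of \<open>y\<close>. If there is none, the projection
    \<open>?w i\<close> vanishes modulo the relations.\<close>
  have coeff: "?w i \<doteq> 0 \<or> cmod (c i) \<le> opn y" if i: "i \<in> K" for i
  proof (cases "\<exists>\<xi>. bpath H \<xi> \<and> C i \<in> fst \<xi> 0 \<and> (length \<gamma> < N \<longrightarrow> snd \<xi> 0 \<notin> Some ` S)")
    case True
    then obtain \<xi> where \<xi>: "bpath H \<xi>" "C i \<in> fst \<xi> 0" "length \<gamma> < N \<longrightarrow> snd \<xi> 0 \<notin> Some ` S" by blast
    have "C i \<noteq> {}" using \<xi>(2) bpath_empty[OF \<xi>(1), of 0] by auto
    then have len: "length \<gamma> = length \<gamma>'" using C(4)[OF i] by simp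
    have ok: "free_at S N \<gamma> \<xi>" "free_at S N \<gamma>' \<xi>"
      using okpI[OF \<xi>(1,2)] C[OF i] \<xi> len by (auto simp: free_at_def[OF S])
    let ?\<eta> = "(pre \<gamma> \<xi>, d * int (length \<gamma>))" and ?\<zeta> = "(pre \<gamma>' \<xi>, d * int (length \<gamma>'))"
    \<comment> \<open>An ultrafilter contains at most one of the disjoint sets, so the entry
      isolates a single coefficient.\<close>
    have nin: "C j \<notin> fst \<xi> 0" if "j \<in> K" "j \<noteq> i" for j
      using disj[OF i that(1)] that(2) bpath_Int[OF \<xi>(1) C(1)[OF i] C(1)[OF that(1)], of 0] \<xi>(2)
        bpath_empty[OF \<xi>(1), of 0] by auto
    have "entry y ?\<eta> ?\<zeta> = entry (e \<gamma> * y * e \<gamma>') ?\<eta> ?\<zeta>" by (rule entry_ee[OF S ok, symmetric])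
    also have "\<dots> = entry (\<Sum>j\<in>K. cst (c j) * ?v j) ?\<eta> ?\<zeta>" by (rule entry_eqv[OF eq])
    also have "\<dots> = (\<Sum>j\<in>K. c j * entry (?v j) ?\<eta> ?\<zeta>)"
      by (simp add: entry_def act_on_sum act_on_mult act_on_cst)
    also have "\<dots> = (\<Sum>j\<in>K. c j * (if C j \<in> fst \<xi> 0 then 1 else 0))"
      using entry_tq[OF S ok(1) free_at_okp[OF S ok(2)]] by simp
    also have "\<dots> = (\<Sum>j\<in>K. if j = i then c i else 0)"
      using nin \<xi> by (intro sum.cong) auto
    also have "\<dots> = c i" using i by (simp add: K_def)
    finally show ?thesis using entry_le[of y ?\<eta> ?\<zeta>] by simp
  next
    case False
    have "qq S N \<gamma> * gp (C i) \<doteq> 0"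
    proof (cases "length \<gamma> < N")
      case True
      then show ?thesis using False Qs_p_zero[OF S C(1)[OF i]] by (auto simp: qq_def[OF S])
    next
      case lenN: False
      then have "C i = {}" using False bpath_ex C(1)[OF i] by blast
      then show ?thesis using lenN gp_empty by (simp add: qq_def[OF S])
    qed
    from eqv_0_mult[OF this, of "sw \<gamma>'" "ss \<gamma>'"] show ?thesis by (simp add: tq_def[OF S])
  qed
  have ww: "?w i * ?w j \<doteq> (if i = j then ?w i else 0)" if "i \<in> K" "j \<in> K" for i j
    using eqv_trans[OF tq_mult[OF S C(1,3)[OF that(1)] al(2) C(1)[OF that(2)]] inter[OF that]] .
  have "uu (\<Sum>i\<in>K. cst (c i) * ?v i) \<le> opn y"
  proof (rule block_bound[OF _ vF wF _ ww _ opn_nonneg coeff])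
    fix i j assume ij: "i \<in> K" "j \<in> K"
    have "nc_star (?v i) * ?v j \<doteq> tq S N \<gamma> \<gamma>' (C i) \<gamma> * ?v j"
      using C[OF ij(1)] by (intro eqv_right tq_star[OF S])
    also have "\<dots> \<doteq> tq S N \<gamma> \<gamma>' (C i \<inter> C j) \<gamma>'"
      using C[OF ij(1)] C[OF ij(2)] al by (intro tq_mult[OF S])
    also note inter[OF ij]
    finally show "nc_star (?v i) * ?v j \<doteq> (if i = j then ?w i else 0)" .
  next
    fix i assume i: "i \<in> K"
    have "nc_star (?w i) * ?w i \<doteq> ?w i * ?w i" using C[OF i] by (intro eqv_right tq_star[OF S])
    also have "\<dots> \<doteq> ?w i" using ww[OF i i] by simp
    finally have "nc_star (?w i) * ?w i \<doteq> ?w i" .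
    then show "uu (?w i) \<le> 1"
      using wF[OF i] by (intro U.projection_le_one uu_eqv_diff free_mult free_star)
  qed (simp add: K_def)
  moreover have "uu (e \<gamma> * y * e \<gamma>') = uu (\<Sum>i\<in>K. cst (c i) * ?v i)"
    using eq vF y \<gamma> by (intro uu_eqv free_mult1[OF free_mult2] unital_ee[OF S] free_sum free_cst)
  ultimately show ?thesis by simp
qed

text \<open>The partition of unity has \<open>card W\<close> members, which gives
  \<open>(card W)\<^sup>2\<close> blocks.\<close>

lemma core_bound:
  assumes y: "y \<in> FF" "rep (core N S) y"
  shows "uu y \<le> (real (card W))\<^sup>2 * opn y"
proof -
  obtain L where L: "good (core N S) L" "y \<doteq> lin L" using y(2) by (auto simp: rep_def)
  have "y = (\<Sum>\<gamma>\<in>W. e \<gamma>) * y * (\<Sum>\<gamma>\<in>W. e \<gamma>)" by (simp add: sum_ee[OF S])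
  then have eq: "y = (\<Sum>\<gamma>'\<in>W. \<Sum>\<gamma>\<in>W. e \<gamma> * y * e \<gamma>')"
    by (simp add: sum_distrib_left sum_distrib_right mult.assoc)
  have F: "e \<gamma> * y * e \<gamma>' \<in> FF" if "\<gamma> \<in> W" "\<gamma>' \<in> W" for \<gamma> \<gamma>'
    using y that by (intro free_mult1[OF free_mult2] unital_ee[OF S])
  have "uu y = uu (\<Sum>\<gamma>'\<in>W. \<Sum>\<gamma>\<in>W. e \<gamma> * y * e \<gamma>')" using eq by simp
  also have "\<dots> \<le> (\<Sum>\<gamma>'\<in>W. uu (\<Sum>\<gamma>\<in>W. e \<gamma> * y * e \<gamma>'))"
    using F by (intro U.sum_le free_sum)
  also have "\<dots> \<le> (\<Sum>\<gamma>'\<in>W. \<Sum>\<gamma>\<in>W. uu (e \<gamma> * y * e \<gamma>'))"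
    using F by (intro sum_mono U.sum_le)
  also have "\<dots> \<le> (\<Sum>\<gamma>'\<in>W. \<Sum>\<gamma>\<in>W. opn y)"
    using y L by (intro sum_mono block_le)
  finally show ?thesis by (simp add: power2_eq_square mult.assoc)
qed

text \<open>Words of equal length keep their length in products, so the bounds \<open>N\<close> and
  \<open>S\<close> persist and the number of blocks is the same for all powers. This is what makes
  the constant in \<open>core_bound\<close> removable.\<close>

lemma core_rep_power: "rep (core N S) y \<Longrightarrow> rep (core N S) (y ^ Suc m)"
proof (induction m)
  case (Suc m)
  have "rep (core N S) (y * y ^ Suc m)"
    by (rule rep_mult[OF Suc.prems Suc.IH[OF Suc.prems]]) (auto simp: core_def)
  then show ?case by simp
qed simp

lemma core_le: assumes y: "y \<in> FF" "rep (core N S) y" shows "uu y \<le> opn y"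
proof -
  let ?h = "nc_star y * y"
  have "rep (core N S) (nc_star y)" by (rule rep_star[OF y(2)]) (auto simp: core_def)
  then have rh: "rep (core N S) ?h" by (rule rep_mult[OF _ y(2)]) (auto simp: core_def)
  have h: "?h \<in> FF" "nc_star ?h = ?h" using y by (auto intro: free_mult free_star)
  have "uu ?h \<le> opn ?h"
  proof (rule U.le_by_powers[OF h opn_nonneg, of 0 "(real (card W))\<^sup>2"])
    fix m :: nat assume "m > 0"
    then obtain k where k: "m = Suc k" using gr0_implies_Suc by blast
    have "uu (?h ^ m) \<le> (real (card W))\<^sup>2 * opn (?h ^ m)"
      using core_rep_power[OF rh] h k by (intro core_bound free_power) auto
    also have "\<dots> \<le> (real (card W))\<^sup>2 * opn ?h ^ m"
      unfolding k by (intro mult_left_mono opn_power) simp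
    finally show "uu (?h ^ m) \<le> (0 * real m + (real (card W))\<^sup>2) * opn ?h ^ m" by simp
  qed
  then have "(uu y)\<^sup>2 \<le> (opn y)\<^sup>2" using y by (simp add: U.cstar opn_cstar)
  then show ?thesis by (rule power2_le_imp_le[OF _ opn_nonneg])
qed

end

section \<open>Decomposition by degree\<close>

definition hdeg :: "'l list \<Rightarrow> 'l list \<Rightarrow> int" where
  "hdeg \<alpha> \<beta> = int (length \<alpha>) - int (length \<beta>)"

lemma degree_zero_le:
  assumes y: "y \<in> FF" "rep (\<lambda>\<alpha> \<beta>. hdeg \<alpha> \<beta> = 0) y" shows "uu y \<le> opn y"
proof -
  obtain L where L: "good (\<lambda>\<alpha> \<beta>. hdeg \<alpha> \<beta> = 0) L" "y \<doteq> lin L" using y(2) by (auto simp: rep_def)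
  \<comment> \<open>\<open>S\<close> and \<open>N\<close> are read off a representation of
    \<open>y\<close>; the extra 0 keeps the maximum over a nonempty set.\<close>
  define S where "S = (\<Union>(c, \<alpha>, A, \<beta>)\<in>set L. set \<alpha> \<union> set \<beta>)"
  define N where "N = Max (insert 0 ((\<lambda>(c, \<alpha>, A, \<beta>). length \<alpha>) ` set L))"
  have S: "finite S" "S \<subseteq> alphabet"
    unfolding S_def using L(1) by (fastforce simp: good_def valid_def)+
  have "good (core N S) L"
    unfolding good_def
  proof clarify
    fix c \<alpha> A \<beta> assume m: "(c, \<alpha>, A, \<beta>) \<in> set L"
    then have v: "valid \<alpha> A \<beta>" "hdeg \<alpha> \<beta> = 0" using L(1) by (auto simp: good_def)
    have "length \<alpha> \<le> N" unfolding N_def using m by (intro Max_ge) force+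
    moreover have "set \<alpha> \<subseteq> S" "set \<beta> \<subseteq> S" unfolding S_def using m by fastforce+
    ultimately show "valid \<alpha> A \<beta> \<and> core N S \<alpha> \<beta>" using v by (simp add: core_def hdeg_def)
  qed
  then show ?thesis using core_le[OF S y(1)] L(2) unfolding rep_def by blast
qed

text \<open>The projection onto the functions living at integer level \<open>m\<close>. Since
  \<open>d = 1\<close>, a homogeneous operator shifts the level by its degree.\<close>

definition slice :: "int \<Rightarrow> (('v, 'l) boundary \<times> int \<Rightarrow> complex) \<Rightarrow>
    ('v, 'l) boundary \<times> int \<Rightarrow> complex" where
  "slice m f x = (if snd x = m then f x else 0)"

lemma slice_slice: "slice m (slice n f) = (if m = n then slice m f else (\<lambda>x. 0))"
  by (auto simp: slice_def fun_eq_iff)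

lemma slice_add: "slice m (\<lambda>x. f x + g x) = (\<lambda>x. slice m f x + slice m g x)"
  by (auto simp: slice_def fun_eq_iff)

lemma slice_cmul: "slice m (\<lambda>x. c * f x) = (\<lambda>x. c * slice m f x)"
  by (auto simp: slice_def fun_eq_iff)

definition homog :: "int \<Rightarrow> ('v, 'l) generator ncpoly \<Rightarrow> bool" where
  "homog n x \<longleftrightarrow> (\<forall>f m. act_on x (slice m f) = slice (m + n) (act_on x f))"

lemma homog_mult: "homog n x \<Longrightarrow> homog n' y \<Longrightarrow> homog (n + n') (x * y)"
  unfolding homog_def act_on_mult by (simp add: ac_simps)

lemma d_shift: "i - d = m \<longleftrightarrow> i = m + 1" "i + d = m \<longleftrightarrow> i = m - 1"
  using d_one by auto

lemma homog_gp: "homog 0 (gp A)"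
  unfolding homog_def fun_eq_iff
  by (intro allI, rename_tac f m x, case_tac x) (simp add: act_gp slice_def)

lemma homog_gs: "homog 1 (gs a)"
  unfolding homog_def fun_eq_iff
  by (intro allI, rename_tac f m x, case_tac x) (simp add: act_gs slice_def d_shift)

lemma homog_gs_star: "homog (- 1) (nc_star (gs a))"
  unfolding homog_def fun_eq_iff
  by (intro allI, rename_tac f m x, case_tac x) (simp add: act_gs_star slice_def d_shift)

lemma homog_one: "homog 0 1"
  by (simp add: homog_def act_on_one)

lemma homog_sw: "homog (int (length \<alpha>)) (sw \<alpha>)"
proof (induction \<alpha>)
  case (Cons a \<alpha>)
  then show ?case using homog_mult[OF homog_gs Cons, of a] by (simp add: add.commute)
qed (simp add: homog_one)

lemma homog_ss: "homog (- int (length \<alpha>)) (ss \<alpha>)"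
proof (induction \<alpha>)
  case (Cons a \<alpha>)
  have "- int (length (a # \<alpha>)) = - int (length \<alpha>) + - 1" by simp
  then show ?case using homog_mult[OF Cons homog_gs_star, of a] by (simp only: sw_simps nc_star_mult)
qed (simp add: homog_one)

lemma homog_tri: "homog (hdeg \<alpha> \<beta>) (tri \<alpha> A \<beta>)"
  using homog_mult[OF homog_mult[OF homog_sw homog_gp] homog_ss, of \<alpha> \<beta> A]
  by (simp add: tri_def hdeg_def)

definition part :: "int \<Rightarrow> ('v, 'l) lincomb \<Rightarrow> ('v, 'l) lincomb" where
  "part n L = filter (\<lambda>(c, \<alpha>, A, \<beta>). hdeg \<alpha> \<beta> = n) L"

text \<open>Among all homogeneous summands only those of degree \<open>n\<close> lead from level
  \<open>m\<close> to level \<open>m + n\<close>.\<close>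

lemma slice_part: "slice (m + n) (act_on (lin L) (slice m f)) = slice (m + n) (act_on (lin (part n L)) f)"
proof (induction L rule: lin_induct)
  case Nil
  then show ?case by (simp add: part_def)
next
  case (Cons c \<alpha> A \<beta> L)
  have t: "slice (m + n) (act_on (tri \<alpha> A \<beta>) (slice m f)) =
      (if hdeg \<alpha> \<beta> = n then slice (m + n) (act_on (tri \<alpha> A \<beta>) f) else (\<lambda>x. 0))"
    using homog_tri[of \<alpha> \<beta> A] by (auto simp: homog_def slice_slice)
  show ?case using Cons
    by (auto simp: act_on_add act_on_mult act_on_cst slice_add slice_cmul t part_def)
qed

lemma fsupp_slice: "fsupp f \<Longrightarrow> fsupp (slice m f)"
  unfolding fsupp_def slice_def by (rule finite_subset) auto

lemma nrm2_slice_le: assumes "fsupp f" shows "nrm2 (slice m f) \<le> nrm2 f"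
proof (rule power2_le_imp_le)
  have "(nrm2 (slice m f))\<^sup>2 = (\<Sum>x | f x \<noteq> 0 \<and> snd x = m. (cmod (f x))\<^sup>2)"
    unfolding nrm2_sq by (intro sum.cong) (auto simp: slice_def)
  also have "\<dots> \<le> (\<Sum>x | f x \<noteq> 0. (cmod (f x))\<^sup>2)"
    using assms by (intro sum_mono2) (auto simp: fsupp_def)
  finally show "(nrm2 (slice m f))\<^sup>2 \<le> (nrm2 f)\<^sup>2" unfolding nrm2_sq[of f] .
qed simp

lemma nrm2_slices:
  assumes f: "fsupp f" and M: "finite M" "snd ` {x. f x \<noteq> 0} \<subseteq> M"
  shows "(nrm2 f)\<^sup>2 = (\<Sum>m\<in>M. (nrm2 (slice m f))\<^sup>2)"
proof -
  have "(\<Sum>m\<in>M. (nrm2 (slice m f))\<^sup>2) = (\<Sum>m\<in>M. \<Sum>x | x \<in> {x. f x \<noteq> 0} \<and> snd x = m. (cmod (f x))\<^sup>2)"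
    unfolding nrm2_sq by (intro sum.cong refl) (auto simp: slice_def)
  also have "\<dots> = (\<Sum>x | f x \<noteq> 0. (cmod (f x))\<^sup>2)"
    using f M by (intro sum.group) (auto simp: fsupp_def)
  finally show ?thesis by (simp only: nrm2_sq)
qed

text \<open>On each level the part of degree \<open>n\<close> is a compression of the whole
  operator, and different levels are orthogonal in the source and in the target. This replaces
  taking a Fourier coefficient of the gauge action.\<close>

lemma opn_part: "opn (lin (part n L)) \<le> opn (lin L)"
proof (rule opn_le[OF opn_nonneg])
  fix f :: "('v, 'l) boundary \<times> int \<Rightarrow> complex"
  assume f: "fsupp f"
  let ?g = "act_on (lin (part n L)) f"
  have g: "fsupp ?g" using f by (rule fsupp_act_on)
  \<comment> \<open>Contains the levels of \<open>f\<close> and the levels of the image shifted back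
    by \<open>n\<close>, so that both norms decompose over the same finite set.\<close>
  define M where "M = snd ` {x. f x \<noteq> 0} \<union> (\<lambda>x. snd x - n) ` {x. ?g x \<noteq> 0}"
  have M: "finite M" using f g by (simp add: M_def fsupp_def)
  have inj: "inj_on (\<lambda>m. m + n) M" by (simp add: inj_on_def)
  have sub: "snd ` {x. ?g x \<noteq> 0} \<subseteq> (\<lambda>m. m + n) ` M" by (force simp: M_def image_iff)
  have "(nrm2 ?g)\<^sup>2 = (\<Sum>m\<in>(\<lambda>m. m + n) ` M. (nrm2 (slice m ?g))\<^sup>2)"
    using M sub by (intro nrm2_slices g) auto
  also have "\<dots> = (\<Sum>m\<in>M. (nrm2 (slice (m + n) ?g))\<^sup>2)"
    by (simp add: sum.reindex[OF inj])
  also have "\<dots> \<le> (\<Sum>m\<in>M. (opn (lin L) * nrm2 (slice m f))\<^sup>2)"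
  proof (intro sum_mono power_mono nrm2_nonneg)
    fix m
    have "nrm2 (slice (m + n) ?g) = nrm2 (slice (m + n) (act_on (lin L) (slice m f)))"
      by (simp add: slice_part)
    also have "\<dots> \<le> nrm2 (act_on (lin L) (slice m f))"
      using f by (intro nrm2_slice_le fsupp_act_on fsupp_slice)
    also have "\<dots> \<le> opn (lin L) * nrm2 (slice m f)" using f by (intro opn_bound fsupp_slice)
    finally show "nrm2 (slice (m + n) ?g) \<le> opn (lin L) * nrm2 (slice m f)" .
  qed
  also have "\<dots> = (opn (lin L))\<^sup>2 * (\<Sum>m\<in>M. (nrm2 (slice m f))\<^sup>2)"
    by (simp add: power_mult_distrib sum_distrib_left)
  also have "(\<Sum>m\<in>M. (nrm2 (slice m f))\<^sup>2) = (nrm2 f)\<^sup>2"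
    using M by (intro nrm2_slices[symmetric] f) (auto simp: M_def)
  finally have "(nrm2 ?g)\<^sup>2 \<le> (opn (lin L) * nrm2 f)\<^sup>2" by (simp add: power_mult_distrib)
  then show "nrm2 ?g \<le> opn (lin L) * nrm2 f"
    by (rule power2_le_imp_le) (simp add: opn_nonneg)
qed

lemma good_part: "good P L \<Longrightarrow> good (\<lambda>\<alpha> \<beta>. hdeg \<alpha> \<beta> = n) (part n L)"
  by (auto simp: good_def part_def)

text \<open>If \<open>y\<close> is homogeneous, \<open>nc_star y * y\<close> has degree 0, and the
  C*-identity transports the inequality back to \<open>y\<close>.\<close>

lemma part_le: assumes "good P L" shows "uu (lin (part n L)) \<le> opn (lin L)"
proof -
  let ?y = "lin (part n L)"
  have g: "good (\<lambda>\<alpha> \<beta>. hdeg \<alpha> \<beta> = n) (part n L)" by (rule good_part[OF assms])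
  have F: "?y \<in> FF" by (rule lin_free[OF g])
  have r: "rep (\<lambda>\<alpha> \<beta>. hdeg \<alpha> \<beta> = n) ?y" using g unfolding rep_def by (metis eqv_refl)
  have "rep (\<lambda>\<alpha> \<beta>. hdeg \<alpha> \<beta> = - n) (nc_star ?y)" by (rule rep_star[OF r]) (auto simp: hdeg_def)
  then have "rep (\<lambda>\<alpha> \<beta>. hdeg \<alpha> \<beta> = 0) (nc_star ?y * ?y)"
    by (rule rep_mult[OF _ r]) (auto simp: hdeg_def)
  then have "uu (nc_star ?y * ?y) \<le> opn (nc_star ?y * ?y)"
    using F by (intro degree_zero_le free_mult free_star)
  then have "(uu ?y)\<^sup>2 \<le> (opn ?y)\<^sup>2" using F by (simp add: U.cstar opn_cstar)
  then have "uu ?y \<le> opn ?y" by (rule power2_le_imp_le[OF _ opn_nonneg])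
  then show ?thesis using opn_part[of n L] by simp
qed

lemma lin_parts:
  assumes "finite D" "\<And>c \<alpha> A \<beta>. (c, \<alpha>, A, \<beta>) \<in> set L \<Longrightarrow> hdeg \<alpha> \<beta> \<in> D"
  shows "lin L = (\<Sum>n\<in>D. lin (part n L))"
  using assms(2)
proof (induction L rule: lin_induct)
  case Nil
  then show ?case by (simp add: part_def)
next
  case (Cons c \<alpha> A \<beta> L)
  have "(\<Sum>n\<in>D. lin (part n ((c, \<alpha>, A, \<beta>) # L))) =
      (\<Sum>n\<in>D. (if n = hdeg \<alpha> \<beta> then cst c * tri \<alpha> A \<beta> else 0) + lin (part n L))"
    by (intro sum.cong) (auto simp: part_def)
  also have "\<dots> = cst c * tri \<alpha> A \<beta> + (\<Sum>n\<in>D. lin (part n L))"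
    using assms(1) Cons.prems[OF list.set_intros(1)] by (simp add: sum.distrib)
  also have "(\<Sum>n\<in>D. lin (part n L)) = lin L" using Cons by (metis list.set_intros(2))
  finally show ?case by simp
qed

text \<open>The factor is the number of degrees from \<open>- k\<close> to \<open>k\<close>.\<close>

lemma degree_bound:
  assumes x: "x \<in> FF" "rep (\<lambda>\<alpha> \<beta>. \<bar>hdeg \<alpha> \<beta>\<bar> \<le> int k) x"
  shows "uu x \<le> (2 * real k + 1) * opn x"
proof -
  obtain L where L: "good (\<lambda>\<alpha> \<beta>. \<bar>hdeg \<alpha> \<beta>\<bar> \<le> int k) L" "x \<doteq> lin L" using x(2) by (auto simp: rep_def)
  have eq: "lin L = (\<Sum>n\<in>{- int k..int k}. lin (part n L))"
    using L(1) by (intro lin_parts) (auto simp: good_def)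
  have "uu x = uu (lin L)" using x L lin_free by (intro uu_eqv) auto
  also have "\<dots> \<le> (\<Sum>n\<in>{- int k..int k}. uu (lin (part n L)))"
    unfolding eq by (intro U.sum_le lin_free[OF good_part[OF L(1)]])
  also have "\<dots> \<le> (\<Sum>n\<in>{- int k..int k}. opn (lin L))" by (intro sum_mono part_le[OF L(1)])
  also have "\<dots> = (2 * real k + 1) * opn (lin L)" by (simp add: nat_add_distrib)
  also have "opn (lin L) = opn x" using opn_eqv[OF L(2)] by simp
  finally show ?thesis .
qed

text \<open>The degrees occurring in \<open>h ^ m\<close> grow linearly with \<open>m\<close>, which is harmless by the spectral
  radius formula. This replaces the integration over the gauge action.\<close>
theorem uu_eq_opn: assumes x: "x \<in> FF" shows "uu x = opn x"
proof (rule antisym)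
  show "opn x \<le> uu x" by (rule opn_le_uu[OF x])
  let ?h = "nc_star x * x"
  have h: "?h \<in> FF" "nc_star ?h = ?h" using x by (auto intro: free_mult free_star)
  obtain L where L: "good (\<lambda>_ _. True) L" "?h \<doteq> lin L" using rep_free[OF h(1)] by (auto simp: rep_def)
  define k where "k = nat (Max (insert 0 ((\<lambda>(c, \<alpha>, A, \<beta>). \<bar>hdeg \<alpha> \<beta>\<bar>) ` set L)))"
  have "good (\<lambda>\<alpha> \<beta>. \<bar>hdeg \<alpha> \<beta>\<bar> \<le> int k) L"
    unfolding good_def
  proof clarify
    fix c \<alpha> A \<beta> assume m: "(c, \<alpha>, A, \<beta>) \<in> set L"
    have "\<bar>hdeg \<alpha> \<beta>\<bar> \<le> Max (insert 0 ((\<lambda>(c, \<alpha>, A, \<beta>). \<bar>hdeg \<alpha> \<beta>\<bar>) ` set L))"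
      using m by (intro Max_ge) force+
    then show "valid \<alpha> A \<beta> \<and> \<bar>hdeg \<alpha> \<beta>\<bar> \<le> int k" using L(1) m by (auto simp: k_def good_def)
  qed
  then have r: "rep (\<lambda>\<alpha> \<beta>. \<bar>hdeg \<alpha> \<beta>\<bar> \<le> int k) ?h" using L(2) unfolding rep_def by blast
  \<comment> \<open>Degrees add in products of spanning elements, so \<open>Suc m\<close> factors
    give at most \<open>k * Suc m\<close>.\<close>
  have rm: "rep (\<lambda>\<alpha> \<beta>. \<bar>hdeg \<alpha> \<beta>\<bar> \<le> int (k * Suc m)) (?h ^ Suc m)" for m
  proof (induction m)
    case (Suc m)
    have "rep (\<lambda>\<alpha> \<beta>. \<bar>hdeg \<alpha> \<beta>\<bar> \<le> int (k * Suc (Suc m))) (?h * ?h ^ Suc m)"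
      by (rule rep_mult[OF r Suc]) (auto simp: hdeg_def abs_le_iff algebra_simps)
    then show ?case by simp
  qed (use r in simp)
  have "uu ?h \<le> opn ?h"
  proof (rule U.le_by_powers[OF h opn_nonneg, of "2 * real k" 1])
    fix m :: nat assume "m > 0"
    then obtain j where j: "m = Suc j" using gr0_implies_Suc by blast
    have "uu (?h ^ m) \<le> (2 * real (k * m) + 1) * opn (?h ^ m)"
      using rm[of j] h unfolding j by (intro degree_bound free_power) auto
    also have "\<dots> \<le> (2 * real (k * m) + 1) * opn ?h ^ m"
      unfolding j by (intro mult_left_mono opn_power) simp
    finally show "uu (?h ^ m) \<le> (2 * real k * real m + 1) * opn ?h ^ m" by (simp add: mult.assoc)
  qed
  then have "(uu x)\<^sup>2 \<le> (opn x)\<^sup>2" using x by (simp add: U.cstar opn_cstar)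
  then show "uu x \<le> opn x" by (rule power2_le_imp_le[OF _ opn_nonneg])
qed

end

section \<open>Cylinders and aperiodicity\<close>

context normal_labelled_space
begin

definition cyl :: "'l list \<Rightarrow> 'v set \<Rightarrow> bool" where
  "cyl \<gamma> C \<longleftrightarrow> valid \<gamma> C \<gamma> \<and> C \<noteq> {}"

text \<open>On the cylinder, \<open>x\<close> is the scalar \<open>c\<close> modulo the relations.
  The aim is to find such a cylinder for a given polynomial and a prescribed diagonal entry.\<close>

definition dec :: "'l list \<Rightarrow> 'v set \<Rightarrow> ('v, 'l) generator ncpoly \<Rightarrow> complex \<Rightarrow> bool" where
  "dec \<gamma> C x c \<longleftrightarrow> tri \<gamma> C \<gamma> * x * tri \<gamma> C \<gamma> \<doteq> cst c * tri \<gamma> C \<gamma>"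

lemma cyl_valid: "cyl \<gamma> C \<Longrightarrow> valid \<gamma> C \<gamma>" and cyl_B: "cyl \<gamma> C \<Longrightarrow> C \<in> B"
  by (auto simp: cyl_def valid_def)

lemma cyl_subset: "cyl \<gamma> C \<Longrightarrow> D \<in> B \<Longrightarrow> D \<subseteq> C \<Longrightarrow> D \<noteq> {} \<Longrightarrow> cyl \<gamma> D"
  by (auto simp: cyl_def valid_def)

lemma cyl_extend: "cyl \<gamma> C \<Longrightarrow> D \<in> B \<Longrightarrow> D \<subseteq> rel_range C \<rho> \<Longrightarrow> D \<noteq> {} \<Longrightarrow> cyl (\<gamma> @ \<rho>) D"
proof -
  assume a: "cyl \<gamma> C" "D \<in> B" "D \<subseteq> rel_range C \<rho>" "D \<noteq> {}"
  have "\<rho> \<in> words" using rel_range_not_word[of \<rho> C] a by auto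
  then have "set \<rho> \<subseteq> alphabet" by (fastforce simp: words_def pos_words_def alphabet_def awalk_def)
  moreover have "rel_range C \<rho> \<subseteq> word_range (\<gamma> @ \<rho>)"
    using a by (intro rel_range_sub_wr) (auto simp: cyl_def valid_def)
  ultimately show ?thesis using a by (auto simp: cyl_def valid_def)
qed

lemma tri_idem: assumes "valid \<gamma> C \<gamma>" shows "tri \<gamma> C \<gamma> * tri \<gamma> C \<gamma> \<doteq> tri \<gamma> C \<gamma>"
proof -
  have "C \<in> B" using assms by (simp add: valid_def)
  then show ?thesis using tri_mult1[of \<gamma> C \<gamma> "[]" C \<gamma>] assms by simp
qed

text \<open>The projection of the smaller cylinder absorbs that of the larger one from both sides.
  Decisions therefore survive shrinking, and monomials can be handled successively.\<close>

lemma dec_refine: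
  assumes d: "dec \<gamma> C x c" and C: "cyl \<gamma> C" and C': "cyl (\<gamma> @ \<rho>) C'" "C' \<subseteq> rel_range C \<rho>"
  shows "dec (\<gamma> @ \<rho>) C' x c"
proof -
  let ?R = "tri \<gamma> C \<gamma>" and ?R' = "tri (\<gamma> @ \<rho>) C' (\<gamma> @ \<rho>)"
  have i: "C' \<inter> rel_range C \<rho> = C'" "rel_range C \<rho> \<inter> C' = C'" using C' by auto
  have l: "?R' * ?R \<doteq> ?R'" using tri_mult2[OF cyl_valid[OF C'(1)] cyl_valid[OF C]] i by simp
  have r: "?R * ?R' \<doteq> ?R'" using tri_mult1[OF cyl_valid[OF C] cyl_valid[OF C'(1)]] i by simp
  have "?R' * x * ?R' \<doteq> (?R' * ?R) * x * (?R * ?R')"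
    by (intro eqv_mult eqv_refl eqv_sym[OF l] eqv_sym[OF r])
  also have "\<dots> = ?R' * (?R * x * ?R) * ?R'" by (simp add: mult.assoc)
  also have "\<dots> \<doteq> ?R' * (cst c * ?R) * ?R'" by (rule eqv_right, rule eqv_left, rule d[unfolded dec_def])
  also have "\<dots> = cst c * ((?R' * ?R) * ?R')" by (simp only: cst_commute[of ?R'] mult.assoc[symmetric])
  also have "\<dots> \<doteq> cst c * (?R' * ?R')" by (intro eqv_left eqv_right l)
  also have "\<dots> \<doteq> cst c * ?R'" by (intro eqv_left tri_idem cyl_valid[OF C'(1)])
  finally show ?thesis by (simp add: dec_def)
qed

lemma dec_sub: "dec \<gamma> C x c \<Longrightarrow> cyl \<gamma> C \<Longrightarrow> cyl \<gamma> C' \<Longrightarrow> C' \<subseteq> C \<Longrightarrow> dec \<gamma> C' x c"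
  using dec_refine[of \<gamma> C x c "[]" C'] by (simp add: cyl_B)

lemma dec_zero1: "tri \<gamma> C \<gamma> * x \<doteq> 0 \<Longrightarrow> dec \<gamma> C x 0"
  using eqv_right[of "tri \<gamma> C \<gamma> * x" 0 "tri \<gamma> C \<gamma>"] by (simp add: dec_def)

lemma dec_zero2: "x * tri \<gamma> C \<gamma> \<doteq> 0 \<Longrightarrow> dec \<gamma> C x 0"
  using eqv_left[of "x * tri \<gamma> C \<gamma>" 0 "tri \<gamma> C \<gamma>"] by (simp add: dec_def mult.assoc)

text \<open>\<open>v\<close> will be a diagonal matrix entry, of which linearity is all that matters
  here.\<close>

lemma dec_lin:
  assumes "\<And>c \<alpha> A \<beta>. (c, \<alpha>, A, \<beta>) \<in> set L \<Longrightarrow> dec \<gamma> C (tri \<alpha> A \<beta>) (v (tri \<alpha> A \<beta>))"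
    and "v 0 = 0" "\<And>x y. v (x + y) = v x + v y" "\<And>c x. v (cst c * x) = c * v x"
  shows "dec \<gamma> C (lin L) (v (lin L))"
  using assms(1)
proof (induction L rule: lin_induct)
  case Nil
  then show ?case by (simp add: dec_def assms)
next
  case (Cons c \<alpha> A \<beta> L)
  let ?R = "tri \<gamma> C \<gamma>"
  have t: "dec \<gamma> C (tri \<alpha> A \<beta>) (v (tri \<alpha> A \<beta>))" by (rule Cons.prems[OF list.set_intros(1)])
  have L: "dec \<gamma> C (lin L) (v (lin L))" by (rule Cons.IH[OF Cons.prems[OF list.set_intros(2)]])
  have "?R * (cst c * tri \<alpha> A \<beta> + lin L) * ?R = cst c * (?R * tri \<alpha> A \<beta> * ?R) + ?R * lin L * ?R"
    by (simp only: ring_distribs cst_commute[of ?R] mult.assoc[symmetric])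
  also have "\<dots> \<doteq> cst c * (cst (v (tri \<alpha> A \<beta>)) * ?R) + cst (v (lin L)) * ?R"
    using t L by (intro eqv_add eqv_left) (simp_all add: dec_def)
  also have "\<dots> = cst (v (lin ((c, \<alpha>, A, \<beta>) # L))) * ?R"
    by (simp add: assms ring_distribs cst_mult flip: mult.assoc cst_add)
  finally show ?case by (simp add: dec_def)
qed

lemma dec_eqv: assumes "x \<doteq> y" "dec \<gamma> C y c" shows "dec \<gamma> C x c"
  unfolding dec_def by (rule eqv_trans[OF eqv_right[OF eqv_left[OF assms(1)]] assms(2)[unfolded dec_def]])

section \<open>Killing monomials of nonzero degree\<close>

lemma cyl_long:
  assumes "cyl \<gamma> C"
  shows "\<exists>\<rho> C'. cyl (\<gamma> @ \<rho>) C' \<and> C' \<subseteq> rel_range C \<rho> \<and> (length \<rho> \<ge> n \<or> out_labels C' = {})"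
proof (induction n)
  case 0
  then show ?case using assms cyl_B by (intro exI[of _ "[]"] exI[of _ C]) simp
next
  case (Suc n)
  then obtain \<rho> C' where C': "cyl (\<gamma> @ \<rho>) C'" "C' \<subseteq> rel_range C \<rho>" "length \<rho> \<ge> n \<or> out_labels C' = {}"
    by blast
  show ?case
  proof (cases "out_labels C' = {}")
    case True
    then show ?thesis using C' by blast
  next
    case False
    then obtain a where a: "rel_range C' [a] \<noteq> {}" by (auto simp: out_labels_def)
    have "cyl ((\<gamma> @ \<rho>) @ [a]) (rel_range C' [a])"
      using C' a by (intro cyl_extend[OF C'(1)] B_rel cyl_B) auto
    moreover have "rel_range C' [a] \<subseteq> rel_range C (\<rho> @ [a])"
      unfolding rel_range_append by (intro rel_range_mono C')
    ultimately show ?thesis using C'(3) False by (intro exI[of _ "\<rho> @ [a]"] exI[of _ "rel_range C' [a]"]) simp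
  qed
qed

lemma rel_range_no_out: "out_labels C = {} \<Longrightarrow> \<tau> \<noteq> [] \<Longrightarrow> rel_range C \<tau> = {}"
  by (cases \<tau>) (auto simp: rel_range_out_Cons)

lemma long_left:
  assumes C: "cyl \<gamma> C" and v: "valid \<alpha> A \<beta>" and len: "length \<alpha> > length \<gamma>"
    and no: "\<And>\<tau>. \<alpha> = \<gamma> @ \<tau> \<Longrightarrow> \<tau> \<noteq> [] \<Longrightarrow> rel_range C \<tau> = {}"
  shows "tri \<gamma> C \<gamma> * tri \<alpha> A \<beta> \<doteq> 0"
proof (cases rule: list_compare[of \<alpha> \<gamma>])
  case (1 \<tau>)
  then have "\<tau> \<noteq> []" using len by auto
  then have "rel_range C \<tau> \<inter> A = {}" using no 1 by blast
  then show ?thesis unfolding 1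
    using tri_mult1[OF cyl_valid[OF C] v[unfolded 1]] eqv_trans[OF _ tri_empty] by metis
next
  case (2 \<tau>)
  then show ?thesis using len by simp
next
  case (3 \<sigma> b c \<beta>' \<gamma>')
  show ?thesis using tri_mult0[of \<gamma> C \<sigma> b \<beta>' c \<gamma>' A \<beta>] C v 3 by (simp add: cyl_def)
qed

lemma long_right:
  assumes C: "cyl \<gamma> C" and v: "valid \<alpha> A \<beta>" and len: "length \<beta> > length \<gamma>"
    and no: "\<And>\<tau>. \<beta> = \<gamma> @ \<tau> \<Longrightarrow> \<tau> \<noteq> [] \<Longrightarrow> rel_range C \<tau> = {}"
  shows "tri \<alpha> A \<beta> * tri \<gamma> C \<gamma> \<doteq> 0"
proof (cases rule: list_compare[of \<gamma> \<beta>])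
  case (1 \<tau>)
  then show ?thesis using len by simp
next
  case (2 \<tau>)
  then have "A \<inter> rel_range C \<tau> = {}" using no by blast
  then show ?thesis unfolding 2
    using tri_mult2[OF v[unfolded 2] cyl_valid[OF C]] eqv_trans[OF _ tri_empty] by metis
next
  case (3 \<sigma> b c \<beta>' \<gamma>')
  show ?thesis using tri_mult0[of \<alpha> A \<sigma> b \<beta>' c \<gamma>' C \<gamma>] C v 3 by (simp add: cyl_def)
qed

text \<open>The partial map given by \<open>(\<alpha>, A, \<beta>)\<close> or its inverse deletes a beginning \<open>\<tau>\<close> from the tails
  following \<open>\<gamma>\<close>.\<close>
definition period :: "'l list \<Rightarrow> 'l list \<Rightarrow> 'l list \<Rightarrow> 'l list \<Rightarrow> bool" where
  "period \<alpha> \<beta> \<gamma> \<tau> \<longleftrightarrow> (\<exists>\<alpha>'. \<gamma> = \<alpha> @ \<alpha>' \<and> \<beta> @ \<alpha>' = \<gamma> @ \<tau>) \<or> (\<exists>\<beta>'. \<gamma> = \<beta> @ \<beta>' \<and> \<alpha> @ \<beta>' = \<gamma> @ \<tau>)"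

text \<open>The compression is nonzero only if all words involved are comparable. The leftover of
  the last comparison is then a word \<open>\<tau>\<close> as in \<open>period\<close>, and the
  compressed set lies in the intersection of \<open>C\<close> or its range along
  \<open>\<tau>\<close> with the other one.\<close>

lemma dec_period:
  assumes C: "cyl \<gamma> C" and v: "valid \<alpha> A \<beta>" and len: "length \<alpha> \<le> length \<gamma>" "length \<alpha> \<noteq> length \<beta>"
    and per: "\<And>\<tau>. \<tau> \<noteq> [] \<Longrightarrow> period \<alpha> \<beta> \<gamma> \<tau> \<Longrightarrow> C \<inter> rel_range C \<tau> = {}"
  shows "dec \<gamma> C (tri \<alpha> A \<beta>) 0"
proof (cases rule: list_compare[of \<gamma> \<alpha>])
  case (2 \<tau>)
  then show ?thesis using len by simp
next
  case (3 \<sigma> b c \<beta>' \<gamma>')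
  then have "tri \<gamma> C \<gamma> * tri \<alpha> A \<beta> \<doteq> 0"
    using tri_mult0[of \<gamma> C \<sigma> c \<gamma>' b \<beta>' A \<beta>] C v by (simp add: cyl_def)
  then show ?thesis by (rule dec_zero1)
next
  case (1 \<alpha>')
  define D where "D = C \<inter> rel_range A \<alpha>'"
  have vC: "valid \<gamma> C \<gamma>" by (rule cyl_valid[OF C])
  have m: "tri \<gamma> C \<gamma> * tri \<alpha> A \<beta> \<doteq> tri \<gamma> D (\<beta> @ \<alpha>')" and vD: "valid \<gamma> D (\<beta> @ \<alpha>')"
    using tri_mult2[of \<gamma> C \<alpha> \<alpha>' A \<beta>] valid_mult2[of \<gamma> C \<alpha> \<alpha>' A \<beta>] vC v 1 by (simp_all add: D_def)
  have DC: "D \<subseteq> C" by (simp add: D_def)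
  have "tri \<gamma> D (\<beta> @ \<alpha>') * tri \<gamma> C \<gamma> \<doteq> 0"
  proof (cases rule: list_compare[of \<gamma> "\<beta> @ \<alpha>'"])
    case 11: (1 \<tau>)
    have "\<tau> \<noteq> []" using arg_cong[OF 11, of length] arg_cong[OF 1, of length] len by auto
    moreover have "period \<alpha> \<beta> \<gamma> \<tau>" unfolding period_def using 1 11 by simp
    ultimately have "rel_range D \<tau> \<inter> C = {}" using per rel_range_mono[OF DC, of \<tau>] by blast
    then show ?thesis using tri_mult1[of \<gamma> D "\<beta> @ \<alpha>'" \<tau> C \<gamma>] vD vC 11 eqv_trans[OF _ tri_empty] by metis
  next
    case 12: (2 \<tau>)
    have "period \<alpha> \<beta> \<gamma> \<tau>" unfolding period_def using 1 12 by blast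
    then have "D \<inter> rel_range C \<tau> = {}" using per 12 DC by blast
    then show ?thesis using tri_mult2[of \<gamma> D \<gamma> \<tau> C \<gamma>] vD vC 12 eqv_trans[OF _ tri_empty] by metis
  next
    case 13: (3 \<sigma> b c \<beta>' \<gamma>')
    then show ?thesis using tri_mult0[of \<gamma> D \<sigma> b \<beta>' c \<gamma>' C \<gamma>] vD vC by simp
  qed
  with eqv_right[OF m, of "tri \<gamma> C \<gamma>"] show ?thesis
    unfolding dec_def using eqv_trans by (metis mult_zero_left single_zero)
qed

text \<open>The lengths decide which alternative of \<open>period\<close> applies; in that
  alternative \<open>\<tau>\<close> follows by cancellation.\<close>

lemma period_unique:
  assumes "period \<alpha> \<beta> \<gamma> \<tau>" "period \<alpha> \<beta> \<gamma> \<tau>'" "length \<alpha> \<noteq> length \<beta>"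
  shows "\<tau> = \<tau>'"
proof -
  have one: "length \<beta> > length \<alpha> \<and> (\<exists>\<alpha>'. \<gamma> = \<alpha> @ \<alpha>' \<and> \<beta> @ \<alpha>' = \<gamma> @ \<tau>) \<or>
      length \<alpha> > length \<beta> \<and> (\<exists>\<beta>'. \<gamma> = \<beta> @ \<beta>' \<and> \<alpha> @ \<beta>' = \<gamma> @ \<tau>)" if p: "period \<alpha> \<beta> \<gamma> \<tau>" for \<tau>
    using p unfolding period_def
  proof (elim disjE exE conjE)
    fix \<alpha>' assume a: "\<gamma> = \<alpha> @ \<alpha>'" "\<beta> @ \<alpha>' = \<gamma> @ \<tau>"
    have "length (\<beta> @ \<alpha>') = length (\<gamma> @ \<tau>)" by (simp only: a(2))
    then have "length \<beta> + length \<alpha>' = length \<alpha> + length \<alpha>' + length \<tau>" by (simp only: a(1) length_append)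
    then show ?thesis using a assms(3) by auto
  next
    fix \<beta>' assume a: "\<gamma> = \<beta> @ \<beta>'" "\<alpha> @ \<beta>' = \<gamma> @ \<tau>"
    have "length (\<alpha> @ \<beta>') = length (\<gamma> @ \<tau>)" by (simp only: a(2))
    then have "length \<alpha> + length \<beta>' = length \<beta> + length \<beta>' + length \<tau>" by (simp only: a(1) length_append)
    then show ?thesis using a assms(3) by auto
  qed
  from one[OF assms(1)] one[OF assms(2)] show ?thesis by auto
qed

text \<open>Prolonging \<open>\<gamma>\<close> by \<open>\<rho>\<close> conjugates the period,
  \<open>\<tau> @ \<rho> = \<rho> @ \<tau>'\<close>. This explains the shape of the conclusion of
  \<open>aperiodic_refinement\<close>.\<close>

lemma period_extend:
  assumes p: "period \<alpha> \<beta> (\<gamma> @ \<rho>) \<tau>'" and len: "length \<alpha> \<le> length \<gamma>" "length \<beta> \<le> length \<gamma>"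
  shows "\<exists>\<tau>. period \<alpha> \<beta> \<gamma> \<tau> \<and> \<tau> @ \<rho> = \<rho> @ \<tau>'"
proof -
  have *: "\<exists>\<alpha>' \<tau>. \<gamma> = \<alpha> @ \<alpha>' \<and> \<beta> @ \<alpha>' = \<gamma> @ \<tau> \<and> \<tau> @ \<rho> = \<rho> @ \<tau>'"
    if eq: "\<gamma> @ \<rho> = \<alpha> @ \<alpha>''" "\<beta> @ \<alpha>'' = (\<gamma> @ \<rho>) @ \<tau>'" and le: "length \<alpha> \<le> length \<gamma>" for \<alpha> \<beta> \<alpha>''
  proof -
    obtain \<alpha>' where \<alpha>': "\<gamma> = \<alpha> @ \<alpha>'" "\<alpha>'' = \<alpha>' @ \<rho>"
      using eq(1) le by (metis (no_types, lifting) append_eq_append_conv_if append_take_drop_id)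
    have eq2: "(\<beta> @ \<alpha>') @ \<rho> = \<gamma> @ (\<rho> @ \<tau>')" using eq(2) \<alpha>'(2) by simp
    have "length ((\<beta> @ \<alpha>') @ \<rho>) = length (\<gamma> @ (\<rho> @ \<tau>'))" by (simp only: eq2)
    then have "length (\<beta> @ \<alpha>') \<ge> length \<gamma>" by (simp only: length_append)
    then obtain \<tau> where \<tau>: "\<beta> @ \<alpha>' = \<gamma> @ \<tau>"
      using eq2 by (metis (no_types, lifting) append_eq_append_conv_if append_take_drop_id)
    then have "\<tau> @ \<rho> = \<rho> @ \<tau>'" using eq2 by simp
    then show ?thesis using \<alpha>' \<tau> by blast
  qed
  from p[unfolded period_def] show ?thesis
  proof (elim disjE exE conjE)
    fix \<alpha>'' assume "\<gamma> @ \<rho> = \<alpha> @ \<alpha>''" "\<beta> @ \<alpha>'' = (\<gamma> @ \<rho>) @ \<tau>'"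
    from *[OF this len(1)] show ?thesis unfolding period_def by blast
  next
    fix \<beta>'' assume "\<gamma> @ \<rho> = \<beta> @ \<beta>''" "\<alpha> @ \<beta>'' = (\<gamma> @ \<rho>) @ \<tau>'"
    from *[OF this len(2)] show ?thesis unfolding period_def by blast
  qed
qed

text \<open>If no subset of \<open>C\<close> is disjoint from its range along \<open>\<tau>\<close>,
  every subset is contained in its range. Then either the range of \<open>C\<close> has a part
  outside \<open>C\<close>, which will do, or \<open>(\<tau>, C)\<close> is a cycle. Following the
  cycle up to its exit destroys the period.\<close>

lemma aperiodic_refinement:
  assumes LB: condition_LB and C: "cyl \<gamma> C" and \<tau>: "\<tau> \<noteq> []"
  shows "\<exists>\<rho> C'. C' \<in> B \<and> C' \<noteq> {} \<and> C' \<subseteq> rel_range C \<rho> \<and>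
    (\<forall>\<tau>'. \<tau> @ \<rho> = \<rho> @ \<tau>' \<longrightarrow> C' \<inter> rel_range C' \<tau>' = {})"
proof -
  have CB: "C \<in> B" "C \<noteq> {}" using C cyl_B by (auto simp: cyl_def)
  show ?thesis
  proof (cases "\<exists>D\<in>B. D \<noteq> {} \<and> D \<subseteq> C \<and> D \<inter> rel_range D \<tau> = {}")
    case True
    then obtain D where "D \<in> B" "D \<noteq> {}" "D \<subseteq> C" "D \<inter> rel_range D \<tau> = {}" by blast
    then show ?thesis using CB by (intro exI[of _ "[]"] exI[of _ D]) simp
  next
    case False
    then have no: "D = {}" if "D \<in> B" "D \<subseteq> C" "D \<inter> rel_range D \<tau> = {}" for D using that by metis
    \<comment> \<open>The part of \<open>D\<close> outside its range is disjoint from its own range,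
      hence empty by assumption.\<close>
    have grow: "D \<subseteq> rel_range D \<tau>" if D: "D \<in> B" "D \<subseteq> C" for D
    proof -
      let ?D' = "D - rel_range D \<tau>"
      have "?D' \<inter> rel_range ?D' \<tau> = {}" using rel_range_mono[of ?D' D \<tau>] by blast
      moreover have "?D' \<in> B" using D by (intro B_Diff B_rel)
      moreover have "?D' \<subseteq> C" using D(2) by blast
      ultimately have "?D' = {}" using no[of ?D'] by simp
      then show ?thesis by (simp only: Diff_eq_empty_iff)
    qed
    show ?thesis
    proof (cases "rel_range C \<tau> = C")
      case False
      let ?C' = "rel_range C \<tau> - C"
      \<comment> \<open>\<open>?C'\<close> is disjoint from \<open>C\<close>, so its range misses
        the range of \<open>C\<close>, where \<open>?C'\<close> itself lies.\<close>
      have "rel_range ?C' \<tau> \<inter> rel_range C \<tau> = {}"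
        using CB by (intro rel_range_disjoint B_Diff B_rel) auto
      then have "?C' \<inter> rel_range ?C' \<tau> = {}" by blast
      moreover have "?C' \<noteq> {}" using grow[OF CB(1)] False by blast
      ultimately show ?thesis using CB by (intro exI[of _ \<tau>] exI[of _ ?C']) (auto intro: B_Diff B_rel)
    next
      case cyc: True
      have "lb_cycle \<tau> C"
        unfolding lb_cycle_def
      proof (intro conjI ballI impI)
        have sub: "C \<subseteq> word_range \<tau>" using rel_range_subset[of C \<tau>] cyc by simp
        then show "\<tau> \<in> pos_words" using \<tau> CB(2) by (auto simp: pos_words_iff)
        show "C \<in> B_at \<tau>" using CB sub by (simp add: B_at_iff)
        fix D assume D: "D \<in> B_at \<tau>" "D \<subseteq> C"
        then have DB: "D \<in> B" by (simp add: B_at_iff)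
        \<comment> \<open>The range of \<open>D\<close> lies in \<open>C\<close> and misses the
          range of \<open>C - D\<close>, which contains \<open>C - D\<close>; so it lies in
          \<open>D\<close>.\<close>
        have "C - D \<subseteq> rel_range (C - D) \<tau>" using CB DB by (intro grow B_Diff) auto
        moreover have "rel_range (C - D) \<tau> \<inter> rel_range D \<tau> = {}"
          using CB DB by (intro rel_range_disjoint B_Diff) auto
        moreover have "rel_range D \<tau> \<subseteq> C" using rel_range_mono[OF D(2), of \<tau>] cyc by simp
        ultimately show "rel_range D \<tau> = D" using grow[OF DB D(2)] by blast
      qed (rule CB(2))
      then have "has_exit \<tau> C" using LB by (simp add: condition_LB_def)
      then obtain k D where k: "k \<le> length \<tau>" and D: "D \<in> B" "D \<noteq> {}" "D \<subseteq> rel_range C (take k \<tau>)"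
        and ex: "out_labels D \<noteq> {\<tau> ! (k mod length \<tau>)}" unfolding has_exit_def by blast
      define b where "b = \<tau> ! (k mod length \<tau>)"
      \<comment> \<open>\<open>b\<close> is the letter by which the cycle continues after
        \<open>k\<close> steps, including \<open>k = length \<tau>\<close>, where the word starts
        anew.\<close>
      have nth: "(\<tau> @ take k \<tau> @ \<sigma>) ! k = b" for \<sigma>
        using k \<tau> by (cases "k = length \<tau>") (auto simp: b_def nth_append)
      show ?thesis
      proof (cases "b \<in> out_labels D")
        case False
        \<comment> \<open>Every conjugate \<open>\<tau>'\<close> begins with \<open>b\<close>, a
          label that \<open>D\<close> does not emit.\<close>
        have "D \<inter> rel_range D \<tau>' = {}" if eq: "\<tau> @ take k \<tau> = take k \<tau> @ \<tau>'" for \<tau>'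
        proof -
          have ne: "\<tau>' \<noteq> []" using arg_cong[OF eq, of length] \<tau> by auto
          have "(take k \<tau> @ \<tau>') ! k = b" using nth[of "[]"] eq by simp
          then have "\<tau>' ! 0 = b" using k by (simp add: nth_append)
          then have "\<tau>' = b # tl \<tau>'" using ne by (cases \<tau>') auto
          then show ?thesis using rel_range_out_Cons[OF False, of "tl \<tau>'"] by simp
        qed
        then show ?thesis using D by blast
      next
        case True
        then obtain c where c: "c \<in> out_labels D" "c \<noteq> b" using ex by (auto simp: b_def)
        \<comment> \<open>Leaving the cycle by \<open>c\<close> contradicts periodicity, so no
          conjugate \<open>\<tau>'\<close> exists at all.\<close>
        have "\<tau> @ (take k \<tau> @ [c]) \<noteq> (take k \<tau> @ [c]) @ \<tau>'" for \<tau>'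
        proof
          assume "\<tau> @ (take k \<tau> @ [c]) = (take k \<tau> @ [c]) @ \<tau>'"
          then have "((take k \<tau> @ [c]) @ \<tau>') ! k = b" using nth[of "[c]"] by simp
          then show False using k c(2) by (simp add: nth_append)
        qed
        moreover have "rel_range D [c] \<subseteq> rel_range C (take k \<tau> @ [c])"
          unfolding rel_range_append by (intro rel_range_mono D)
        moreover have "rel_range D [c] \<noteq> {}" using c by (simp add: out_labels_def)
        ultimately show ?thesis using B_rel[OF D(1)] by blast
      qed
    qed
  qed
qed

text \<open>On a long cylinder the words of the monomial are used up and at most one period remains,
  which an aperiodic refinement destroys.\<close>

lemma kill:
  assumes LB: condition_LB and C: "cyl \<gamma> C" and v: "valid \<alpha> A \<beta>" and deg: "length \<alpha> \<noteq> length \<beta>"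
  shows "\<exists>\<rho> C'. cyl (\<gamma> @ \<rho>) C' \<and> C' \<subseteq> rel_range C \<rho> \<and> dec (\<gamma> @ \<rho>) C' (tri \<alpha> A \<beta>) 0"
proof -
  obtain \<rho> D where D: "cyl (\<gamma> @ \<rho>) D" "D \<subseteq> rel_range C \<rho>"
    "length \<rho> \<ge> max (length \<alpha>) (length \<beta>) \<or> out_labels D = {}" using cyl_long[OF C] by blast
  let ?\<gamma> = "\<gamma> @ \<rho>"
  \<comment> \<open>A cylinder that cannot be prolonged emits no label, so any word longer than
    \<open>?\<gamma>\<close> is killed for that reason alone.\<close>
  consider "length \<alpha> > length ?\<gamma>" "out_labels D = {}" | "length \<beta> > length ?\<gamma>" "out_labels D = {}"
    | "length \<alpha> \<le> length ?\<gamma>" "length \<beta> \<le> length ?\<gamma>" using D(3) by fastforce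
  then show ?thesis
  proof cases
    case 1
    then have "tri ?\<gamma> D ?\<gamma> * tri \<alpha> A \<beta> \<doteq> 0" by (intro long_left D v rel_range_no_out)
    then show ?thesis using D dec_zero1 by blast
  next
    case 2
    then have "tri \<alpha> A \<beta> * tri ?\<gamma> D ?\<gamma> \<doteq> 0" by (intro long_right D v rel_range_no_out)
    then show ?thesis using D dec_zero2 by blast
  next
    case 3
    show ?thesis
    proof (cases "\<exists>\<tau>. \<tau> \<noteq> [] \<and> period \<alpha> \<beta> ?\<gamma> \<tau>")
      case False
      then have "dec ?\<gamma> D (tri \<alpha> A \<beta>) 0" using 3 by (intro dec_period[OF D(1) v _ deg]) auto
      then show ?thesis using D by blast
    next
      case True
      then obtain \<tau> where \<tau>: "\<tau> \<noteq> []" "period \<alpha> \<beta> ?\<gamma> \<tau>" by blast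
      obtain \<sigma> C' where C': "C' \<in> B" "C' \<noteq> {}" "C' \<subseteq> rel_range D \<sigma>"
        "\<And>\<tau>'. \<tau> @ \<sigma> = \<sigma> @ \<tau>' \<Longrightarrow> C' \<inter> rel_range C' \<tau>' = {}"
        using aperiodic_refinement[OF LB D(1) \<tau>(1)] by blast
      have cyl': "cyl (?\<gamma> @ \<sigma>) C'" by (rule cyl_extend[OF D(1) C'(1,3,2)])
      have "dec (?\<gamma> @ \<sigma>) C' (tri \<alpha> A \<beta>) 0"
      proof (rule dec_period[OF cyl' v _ deg])
        show "length \<alpha> \<le> length (?\<gamma> @ \<sigma>)" using 3 by simp
        fix \<tau>' assume "period \<alpha> \<beta> (?\<gamma> @ \<sigma>) \<tau>'"
        then obtain \<tau>'' where "period \<alpha> \<beta> ?\<gamma> \<tau>''" "\<tau>'' @ \<sigma> = \<sigma> @ \<tau>'" using period_extend 3 by blast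
        then show "C' \<inter> rel_range C' \<tau>' = {}" using C'(4) period_unique[OF \<tau>(2) _ deg] by blast
      qed
      moreover have "C' \<subseteq> rel_range C (\<rho> @ \<sigma>)"
        using C'(3) rel_range_mono[OF D(2), of \<sigma>] by (auto simp: rel_range_append)
      ultimately show ?thesis using cyl' by (intro exI[of _ "\<rho> @ \<sigma>"] exI[of _ C']) simp
    qed
  qed
qed

end

section \<open>Deciding monomials of degree 0 along a path\<close>

context bpath_rep
begin

lemma pre_append: "pre (\<alpha> @ \<beta>) \<xi> = pre \<alpha> (pre \<beta> \<xi>)"
  by (simp add: pre_def)

lemma okp_append: "okp (\<alpha> @ \<beta>) \<xi> \<Longrightarrow> okp \<beta> \<xi>"
  by (induction \<alpha>) (auto dest: okp_Cons)

lemma bpath_split: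
  assumes "bpath H \<xi>"
  shows "\<exists>\<gamma> \<zeta>. okp \<gamma> \<zeta> \<and> \<xi> = pre \<gamma> \<zeta> \<and> (length \<gamma> = n \<or> length \<gamma> < n \<and> snd \<zeta> 0 = None)"
proof (induction n)
  case 0
  show ?case using assms by (intro exI[of _ "[]"] exI[of _ \<xi>]) simp
next
  case (Suc n)
  then obtain \<gamma> \<zeta> where \<gamma>: "okp \<gamma> \<zeta>" "\<xi> = pre \<gamma> \<zeta>" "length \<gamma> = n \<or> length \<gamma> < n \<and> snd \<zeta> 0 = None" by blast
  show ?case
  proof (cases "snd \<zeta> 0")
    case None
    then show ?thesis using \<gamma> by (intro exI[of _ \<gamma>] exI[of _ \<zeta>]) auto
  next
    case (Some a)
    have \<zeta>: "bpath H \<zeta>" using \<gamma>(1) by (simp add: okp_def)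
    have "\<xi> = pre (\<gamma> @ [a]) (shift \<zeta>)" using \<gamma>(2) prepend_shift[OF \<zeta> Some] by (simp add: pre_append)
    moreover have "okp (\<gamma> @ [a]) (shift \<zeta>)"
      using \<gamma>(1) bpath_shift[OF \<zeta>] bpath_wr[OF \<zeta> Some] bpath_pull[OF \<zeta> Some, of "word_range \<gamma>"]
      by (cases "\<gamma> = []") (auto simp: okp_def word_range_append)
    moreover have "length \<gamma> = n" using \<gamma>(3) Some by auto
    ultimately show ?thesis by (intro exI[of _ "\<gamma> @ [a]"] exI[of _ "shift \<zeta>"]) simp
  qed
qed

lemma snd_pre: "k < length \<gamma> \<Longrightarrow> snd (pre \<gamma> \<xi>) k = Some (\<gamma> ! k)"
proof (induction \<gamma> arbitrary: k)
  case (Cons a \<gamma>)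
  then show ?case by (cases k) auto
qed simp

lemma pre_tail: "fst (pre \<gamma> \<xi>) (length \<gamma> + n) = fst \<xi> n" "snd (pre \<gamma> \<xi>) (length \<gamma> + n) = snd \<xi> n"
  by (induction \<gamma>) auto

lemma fst_pre: "k \<le> length \<gamma> \<Longrightarrow> fst (pre \<gamma> \<xi>) k = fst (pre (drop k \<gamma>) \<xi>) 0"
  using pre_append[of "take k \<gamma>" "drop k \<gamma>" \<xi>] pre_tail(1)[of "take k \<gamma>" "pre (drop k \<gamma>) \<xi>" 0] by simp

lemma act_tri: assumes "okp \<gamma> \<zeta>" "C \<in> fst \<zeta> 0"
  shows "act_on (tri \<gamma> C \<gamma>) f (pre \<gamma> \<zeta>, i) = f (pre \<gamma> \<zeta>, i)"
proof -
  have "bpath H \<zeta>" using assms by (simp add: okp_def)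
  then show ?thesis using assms by (simp add: tri_def act_on_mult act_sw act_ss act_gp)
qed

text \<open>The cylinder projection fixes every path in the cylinder, so the scalar can be read off
  at any of them.\<close>

lemma dec_entry:
  assumes d: "dec \<gamma> C x c" and C: "C \<in> B" and ok: "okp \<gamma> \<zeta>" "C \<in> fst \<zeta> 0"
  shows "c = entry x (pre \<gamma> \<zeta>, i) (pre \<gamma> \<zeta>, i)"
proof -
  let ?R = "tri \<gamma> C \<gamma>" and ?p = "(pre \<gamma> \<zeta>, i)"
  have left: "entry (?R * z) ?p \<eta> = entry z ?p \<eta>" for z \<eta>
    by (simp add: entry_def act_on_mult act_tri[OF ok])
  have "c = entry (cst c * (?R * 1)) ?p ?p" unfolding entry_cst left by (simp add: entry_def act_on_one delta_def)
  also have "\<dots> = entry (?R * x * ?R) ?p ?p" using entry_eqv[OF d[unfolded dec_def]] by simp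
  also have "\<dots> = entry (x * ?R) ?p ?p" by (simp only: mult.assoc left)
  also have "\<dots> = cnj (entry (nc_star (x * ?R)) ?p ?p)" by (simp only: entry_star complex_cnj_cnj)
  also have "nc_star (x * ?R) = nc_star ?R * nc_star x" by simp
  also have "entry (nc_star ?R * nc_star x) ?p ?p = entry (?R * nc_star x) ?p ?p"
    by (intro entry_eqv eqv_right tri_star C)
  also have "\<dots> = cnj (entry x ?p ?p)" by (simp only: left entry_star)
  finally show ?thesis by simp
qed

lemma act_sw_short: "snd \<zeta> 0 = None \<Longrightarrow> length \<alpha> > length \<gamma> \<Longrightarrow> act_on (sw \<alpha>) f (pre \<gamma> \<zeta>, i) = 0"
proof (induction \<gamma> arbitrary: \<alpha> i)
  case Nil
  then obtain a \<alpha>' where "\<alpha> = a # \<alpha>'" by (cases \<alpha>) auto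
  then show ?case using Nil by (simp add: act_on_mult act_gs)
next
  case (Cons c \<gamma>)
  then obtain a \<alpha>' where "\<alpha> = a # \<alpha>'" by (cases \<alpha>) auto
  then show ?case using Cons by (simp add: act_on_mult act_gs)
qed

text \<open>For words of equal length only \<open>\<alpha> = \<beta>\<close> needs work. The
  compression then cuts \<open>C\<close> down by \<open>?A\<close>, and the prime ultrafilter
  contains \<open>C \<inter> ?A\<close>, with value 1, or \<open>C - ?A\<close>, with value
  0.\<close>

lemma decide_short:
  assumes v: "valid \<alpha> A \<beta>" and len: "length \<alpha> = length \<beta>" "length \<alpha> \<le> length \<gamma>"
    and C: "cyl \<gamma> C" and ok: "okp \<gamma> \<zeta>" "C \<in> fst \<zeta> 0"
  shows "\<exists>D c. D \<in> fst \<zeta> 0 \<and> D \<subseteq> C \<and> dec \<gamma> D (tri \<alpha> A \<beta>) c"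
proof (cases rule: list_compare[of \<gamma> \<alpha>])
  case (2 \<tau>)
  then show ?thesis using len by (cases \<tau>) auto
next
  case (3 \<sigma> b c \<beta>' \<gamma>')
  then have "tri \<gamma> C \<gamma> * tri \<alpha> A \<beta> \<doteq> 0"
    using tri_mult0[of \<gamma> C \<sigma> c \<gamma>' b \<beta>' A \<beta>] C v by (simp add: cyl_def)
  then show ?thesis using dec_zero1 ok by blast
next
  case a: (1 \<alpha>')
  have vC: "valid \<gamma> C \<gamma>" by (rule cyl_valid[OF C])
  show ?thesis
  proof (cases rule: list_compare[of \<gamma> \<beta>])
    case (2 \<tau>)
    then show ?thesis using len by (cases \<tau>) auto
  next
    case (3 \<sigma> b c \<beta>' \<gamma>')
    then have "tri \<alpha> A \<beta> * tri \<gamma> C \<gamma> \<doteq> 0"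
      using tri_mult0[of \<alpha> A \<sigma> b \<beta>' c \<gamma>' C \<gamma>] C v by (simp add: cyl_def)
    then show ?thesis using dec_zero2 ok by blast
  next
    case (1 \<beta>')
    then have \<beta>: "\<beta> = \<alpha>" using a len by simp
    let ?A = "rel_range A \<alpha>'"
    have \<zeta>: "bpath H \<zeta>" using ok by (simp add: okp_def)
    have B: "?A \<in> B" "C \<in> B" using v vC by (auto simp: valid_def B_rel)
    have m: "tri \<gamma> D \<gamma> * tri \<alpha> A \<beta> * tri \<gamma> D \<gamma> \<doteq> tri \<gamma> (D \<inter> ?A) \<gamma>"
      if D: "D \<in> B" "D \<subseteq> C" for D
    proof -
      have vD: "valid \<gamma> D \<gamma>" using vC D by (auto simp: valid_def)
      have "tri \<gamma> D \<gamma> * tri \<alpha> A \<beta> \<doteq> tri \<gamma> (D \<inter> ?A) \<gamma>"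
        using tri_mult2[of \<gamma> D \<alpha> \<alpha>' A \<alpha>] vD v a \<beta> by simp
      then have "tri \<gamma> D \<gamma> * tri \<alpha> A \<beta> * tri \<gamma> D \<gamma> \<doteq> tri \<gamma> (D \<inter> ?A) \<gamma> * tri \<gamma> D \<gamma>" by (rule eqv_right)
      also have "\<dots> \<doteq> tri \<gamma> (D \<inter> ?A \<inter> D) \<gamma>"
        using tri_mult2[of \<gamma> "D \<inter> ?A" \<gamma> "[]" D \<gamma>] vD D B by (auto simp: valid_def B_Int)
      also have "D \<inter> ?A \<inter> D = D \<inter> ?A" by blast
      finally show ?thesis .
    qed
    from ultra_prime[OF bpath_ultra[OF \<zeta> ok(2)] ok(2) B(1)] show ?thesis
    proof
      assume i: "C \<inter> ?A \<in> fst \<zeta> 0"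
      have "dec \<gamma> (C \<inter> ?A) (tri \<alpha> A \<beta>) 1"
        using m[of "C \<inter> ?A"] B by (simp add: dec_def B_Int Int_assoc)
      then show ?thesis using i by blast
    next
      assume i: "C - ?A \<in> fst \<zeta> 0"
      have "tri \<gamma> (C - ?A) \<gamma> * tri \<alpha> A \<beta> * tri \<gamma> (C - ?A) \<gamma> \<doteq> tri \<gamma> {} \<gamma>"
        using m[of "C - ?A"] B by (simp add: B_Diff Diff_Int_distrib2 Int_commute)
      then have "dec \<gamma> (C - ?A) (tri \<alpha> A \<beta>) 0"
        using eqv_trans[OF _ tri_empty] by (simp add: dec_def)
      then show ?thesis using i by blast
    qed
  qed
qed

end

context graded_rep
begin

lemma entry_degree: assumes "hdeg \<alpha> \<beta> \<noteq> 0" shows "entry (tri \<alpha> A \<beta>) (\<xi>, i) (\<xi>, i) = 0"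
proof -
  have d: "delta (\<xi>, i) = slice i (delta (\<xi>, i))" by (auto simp: slice_def delta_def fun_eq_iff)
  have "act_on (tri \<alpha> A \<beta>) (delta (\<xi>, i)) = slice (i + hdeg \<alpha> \<beta>) (act_on (tri \<alpha> A \<beta>) (delta (\<xi>, i)))"
    using homog_tri[of \<alpha> \<beta> A] d unfolding homog_def by metis
  then have "entry (tri \<alpha> A \<beta>) (\<xi>, i) (\<xi>, i) =
      slice (i + hdeg \<alpha> \<beta>) (act_on (tri \<alpha> A \<beta>) (delta (\<xi>, i))) (\<xi>, i)"
    unfolding entry_def by (rule fun_cong)
  then show ?thesis using assms by (simp add: slice_def)
qed

text \<open>A beginning of \<open>\<xi>\<close> at least as long as all words reduces everything to
  \<open>decide_short\<close>. If \<open>\<xi>\<close> stops too early, its last ultrafilter has no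
  regular member, which leaves room to avoid the longer words; their entries at \<open>\<xi>\<close>
  vanish as well.\<close>

lemma decide_degree_zero:
  assumes \<xi>: "bpath H \<xi>" and L: "good P L"
  shows "\<exists>\<gamma> C. cyl \<gamma> C \<and> (\<forall>(c, \<alpha>, A, \<beta>)\<in>set L. length \<alpha> = length \<beta> \<longrightarrow>
    dec \<gamma> C (tri \<alpha> A \<beta>) (entry (tri \<alpha> A \<beta>) (\<xi>, i) (\<xi>, i)))"
proof -
  \<comment> \<open>The inserted 1 ensures that \<open>\<gamma> = []\<close> occurs only if the path
    stops at once; its initial component is then an ultrafilter and not empty.\<close>
  define n where "n = Max (insert 1 ((\<lambda>(c, \<alpha>, A, \<beta>). length \<alpha>) ` set L))"
  have n: "length \<alpha> \<le> n" if "(c, \<alpha>, A, \<beta>) \<in> set L" for c \<alpha> A \<beta>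
    unfolding n_def using that by (intro Max_ge) force+
  have n1: "n \<ge> 1" unfolding n_def by (intro Max_ge) auto
  obtain \<gamma> \<zeta> where \<gamma>: "okp \<gamma> \<zeta>" "\<xi> = pre \<gamma> \<zeta>" "length \<gamma> = n \<or> length \<gamma> < n \<and> snd \<zeta> 0 = None"
    using bpath_split[OF \<xi>] by blast
  have \<zeta>: "bpath H \<zeta>" using \<gamma> by (simp add: okp_def)
  have cylI: "cyl \<gamma> C" if C: "C \<in> fst \<zeta> 0" "C \<subseteq> word_range \<gamma>" for C
  proof -
    have "C \<in> B" using ultra_B[OF bpath_ultra[OF \<zeta> C(1)] C(1)] .
    moreover have "C \<noteq> {}" using C(1) bpath_empty[OF \<zeta>] by blast
    moreover have "set \<gamma> \<subseteq> alphabet"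
    proof -
      have "\<gamma> \<in> words" using rel_range_not_word[of \<gamma> "verts E"] C(2) \<open>C \<noteq> {}\<close>
        by (auto simp: word_range_def[symmetric])
      then show ?thesis by (fastforce simp: words_def pos_words_def alphabet_def awalk_def)
    qed
    ultimately show ?thesis using C(2) by (simp add: cyl_def valid_def)
  qed
  have "\<exists>C0. C0 \<in> fst \<zeta> 0 \<and> C0 \<subseteq> word_range \<gamma>"
  proof (cases "\<gamma> = []")
    case True
    then have u: "ultra (fst \<zeta> 0)" using \<gamma>(3) n1 bpath_None[OF \<zeta>, of 0] by auto
    then obtain C where "C \<in> fst \<zeta> 0" using ultra_ne by blast
    then show ?thesis using True ultra_B[OF u] B_subset by (auto simp: word_range_Nil)
  next
    case False
    then show ?thesis using \<gamma>(1) by (auto simp: okp_def)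
  qed
  then obtain C0 where C0: "C0 \<in> fst \<zeta> 0" "C0 \<subseteq> word_range \<gamma>" by blast
  have "\<exists>C. C \<in> fst \<zeta> 0 \<and> C \<subseteq> word_range \<gamma> \<and> (\<forall>(c, \<alpha>, A, \<beta>)\<in>set L'. length \<alpha> = length \<beta> \<and> length \<alpha> \<le> length \<gamma> \<longrightarrow>
      dec \<gamma> C (tri \<alpha> A \<beta>) (entry (tri \<alpha> A \<beta>) (\<xi>, i) (\<xi>, i)))" if "good P L'" for L'
    using that
  proof (induction L' rule: lin_induct)
    case Nil
    then show ?case using C0 by auto
  next
    case (Cons c \<alpha> A \<beta> L')
    then obtain C where C: "C \<in> fst \<zeta> 0" "C \<subseteq> word_range \<gamma>"
      "\<forall>(c, \<alpha>, A, \<beta>)\<in>set L'. length \<alpha> = length \<beta> \<and> length \<alpha> \<le> length \<gamma> \<longrightarrow>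
        dec \<gamma> C (tri \<alpha> A \<beta>) (entry (tri \<alpha> A \<beta>) (\<xi>, i) (\<xi>, i))" by auto
    show ?case
    proof (cases "length \<alpha> = length \<beta> \<and> length \<alpha> \<le> length \<gamma>")
      case True
      obtain D e where D: "D \<in> fst \<zeta> 0" "D \<subseteq> C" "dec \<gamma> D (tri \<alpha> A \<beta>) e"
        using decide_short[of \<alpha> A \<beta> \<gamma> C \<zeta>] True Cons.prems cylI[OF C(1,2)] \<gamma>(1) C(1) by auto
      have DW: "D \<subseteq> word_range \<gamma>" using D C by blast
      have "D \<in> B" using cylI[OF D(1) DW] cyl_B by blast
      then have "e = entry (tri \<alpha> A \<beta>) (\<xi>, i) (\<xi>, i)"
        unfolding \<gamma>(2) by (rule dec_entry[OF D(3) _ \<gamma>(1) D(1)])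
      moreover have "dec \<gamma> D x v" if "dec \<gamma> C x v" for x v
        by (rule dec_sub[OF that cylI[OF C(1,2)] cylI[OF D(1) DW] D(2)])
      ultimately show ?thesis using C(3) D DW by (intro exI[of _ D]) auto
    next
      case False
      then show ?thesis using C by (intro exI[of _ C]) auto
    qed
  qed
  from this[OF L] obtain C where C: "C \<in> fst \<zeta> 0" "C \<subseteq> word_range \<gamma>"
    and short: "\<And>c \<alpha> A \<beta>. (c, \<alpha>, A, \<beta>) \<in> set L \<Longrightarrow> length \<alpha> = length \<beta> \<Longrightarrow> length \<alpha> \<le> length \<gamma> \<Longrightarrow>
      dec \<gamma> C (tri \<alpha> A \<beta>) (entry (tri \<alpha> A \<beta>) (\<xi>, i) (\<xi>, i))" by blast
  have cC: "cyl \<gamma> C" by (rule cylI[OF C])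
  have valid: "valid \<alpha> A \<beta>" if "(c, \<alpha>, A, \<beta>) \<in> set L" for c \<alpha> A \<beta> using L that by (auto simp: good_def)
  show ?thesis
  proof (cases "length \<gamma> = n")
    case True
    have "dec \<gamma> C (tri \<alpha> A \<beta>) (entry (tri \<alpha> A \<beta>) (\<xi>, i) (\<xi>, i))"
      if t: "(c, \<alpha>, A, \<beta>) \<in> set L" "length \<alpha> = length \<beta>" for c \<alpha> A \<beta>
      using short[OF t] n[OF t(1)] True by simp
    then show ?thesis using cC by blast
  next
    case False
    then have None: "snd \<zeta> 0 = None" using \<gamma>(3) by blast
    have long: "entry (tri \<alpha> A \<beta>) (\<xi>, i) (\<xi>, i) = 0" if "length \<alpha> > length \<gamma>" for \<alpha> A \<beta>
      using act_sw_short[OF None that] by (simp add: \<gamma>(2) entry_def tri_def act_on_mult)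
    \<comment> \<open>Non-regularity provides a subset emitting either no label or infinitely
      many.\<close>
    have "\<not> regular_set C" using bpath_None[OF \<zeta> None] C(1) by blast
    then obtain D where D: "D \<in> B" "D \<noteq> {}" "D \<subseteq> C" "out_labels D = {} \<or> infinite (out_labels D)"
      using cyl_B[OF cC] cC by (auto simp: regular_set_def cyl_def)
    have cD: "cyl \<gamma> D" by (rule cyl_subset[OF cC D(1,3,2)])
    show ?thesis
    proof (cases "out_labels D = {}")
      case True
      have "dec \<gamma> D (tri \<alpha> A \<beta>) (entry (tri \<alpha> A \<beta>) (\<xi>, i) (\<xi>, i))"
        if t: "(c, \<alpha>, A, \<beta>) \<in> set L" "length \<alpha> = length \<beta>" for c \<alpha> A \<beta>
      proof (cases "length \<alpha> \<le> length \<gamma>")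
        case True
        then show ?thesis using short[OF t] dec_sub[OF _ cC cD D(3)] by blast
      next
        case False
        then have "tri \<gamma> D \<gamma> * tri \<alpha> A \<beta> \<doteq> 0"
          using rel_range_no_out[OF True] by (intro long_left[OF cD valid[OF t(1)]]) auto
        then show ?thesis using long False by (simp add: dec_zero1)
      qed
      then show ?thesis using cD by blast
    next
      case False
      \<comment> \<open>The letters by which longer words could continue after
        \<open>\<gamma>\<close>. For short words the value of \<open>!\<close> is arbitrary, which
        is harmless since only finiteness matters.\<close>
      define bad where "bad = (\<lambda>(c, \<alpha>, A, \<beta>). \<alpha> ! length \<gamma>) ` set L"
      have "infinite (out_labels D - bad)" using D(4) False by (simp add: bad_def)
      then have "out_labels D - bad \<noteq> {}" by (rule infinite_imp_nonempty)
      then obtain a where a: "a \<in> out_labels D" "a \<notin> bad" by blast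
      let ?D = "rel_range D [a]"
      have cD': "cyl (\<gamma> @ [a]) ?D" using a(1) by (intro cyl_extend[OF cD] B_rel D) (auto simp: out_labels_def)
      have "dec (\<gamma> @ [a]) ?D (tri \<alpha> A \<beta>) (entry (tri \<alpha> A \<beta>) (\<xi>, i) (\<xi>, i))"
        if t: "(c, \<alpha>, A, \<beta>) \<in> set L" "length \<alpha> = length \<beta>" for c \<alpha> A \<beta>
      proof (cases "length \<alpha> \<le> length \<gamma>")
        case True
        then have "dec \<gamma> D (tri \<alpha> A \<beta>) (entry (tri \<alpha> A \<beta>) (\<xi>, i) (\<xi>, i))"
          using short[OF t] dec_sub[OF _ cC cD D(3)] by blast
        then show ?thesis by (rule dec_refine[OF _ cD cD' order_refl])
      next
        case False
        have na: "\<alpha> ! length \<gamma> \<noteq> a" using a(2) t(1) unfolding bad_def by force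
        have "tri (\<gamma> @ [a]) ?D (\<gamma> @ [a]) * tri \<alpha> A \<beta> \<doteq> 0"
        proof (cases rule: list_compare[of \<alpha> "\<gamma> @ [a]"])
          case (1 \<tau>)
          then show ?thesis using na by simp
        next
          case (2 \<tau>)
          then have "length \<alpha> < length (\<gamma> @ [a])" by (metis length_append length_greater_0_conv less_add_same_cancel1)
          then show ?thesis using False by simp
        next
          case (3 \<sigma> b c \<beta>' \<gamma>')
          show ?thesis using tri_mult0[of "\<gamma> @ [a]" ?D \<sigma> b \<beta>' c \<gamma>' A \<beta>] cyl_valid[OF cD'] valid[OF t(1)] 3 by simp
        qed
        then show ?thesis using long False by (simp add: dec_zero1)
      qed
      then show ?thesis using cD' by blast
    qed
  qed
qed

lemma kill_all:
  assumes LB: condition_LB and C: "cyl \<gamma> C" and L: "good P L"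
  shows "\<exists>\<rho> C'. cyl (\<gamma> @ \<rho>) C' \<and> C' \<subseteq> rel_range C \<rho> \<and>
    (\<forall>(c, \<alpha>, A, \<beta>)\<in>set L. length \<alpha> \<noteq> length \<beta> \<longrightarrow> dec (\<gamma> @ \<rho>) C' (tri \<alpha> A \<beta>) 0)"
  using L
proof (induction L rule: lin_induct)
  case Nil
  then show ?case using C cyl_B by (intro exI[of _ "[]"] exI[of _ C]) simp
next
  case (Cons c \<alpha> A \<beta> L)
  then obtain \<rho> C' where C': "cyl (\<gamma> @ \<rho>) C'" "C' \<subseteq> rel_range C \<rho>"
    "\<forall>(c, \<alpha>, A, \<beta>)\<in>set L. length \<alpha> \<noteq> length \<beta> \<longrightarrow> dec (\<gamma> @ \<rho>) C' (tri \<alpha> A \<beta>) 0" by auto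
  show ?case
  proof (cases "length \<alpha> = length \<beta>")
    case True
    then show ?thesis using C' by (intro exI[of _ \<rho>] exI[of _ C']) auto
  next
    case False
    have "valid \<alpha> A \<beta>" using Cons.prems by simp
    from kill[OF LB C'(1) this False] obtain \<sigma> D where D: "cyl ((\<gamma> @ \<rho>) @ \<sigma>) D"
      "D \<subseteq> rel_range C' \<sigma>" "dec ((\<gamma> @ \<rho>) @ \<sigma>) D (tri \<alpha> A \<beta>) 0" by blast
    have "D \<subseteq> rel_range C (\<rho> @ \<sigma>)" using D(2) rel_range_mono[OF C'(2), of \<sigma>] by (auto simp: rel_range_append)
    moreover have "dec ((\<gamma> @ \<rho>) @ \<sigma>) D x v" if "dec (\<gamma> @ \<rho>) C' x v" for x v
      by (rule dec_refine[OF that C'(1) D(1,2)])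
    ultimately show ?thesis using D C'(3)
      by (intro exI[of _ "\<rho> @ \<sigma>"] exI[of _ D]) auto
  qed
qed

text \<open>The final cylinder need not contain \<open>\<xi>\<close>. The scalar is nevertheless the
  entry at \<open>\<xi>\<close>: degree 0 was decided around \<open>\<xi>\<close>, and the other
  degrees contribute 0 both to the entry and on the cylinder.\<close>

lemma decide:
  assumes LB: condition_LB and x: "x \<in> FF" and \<xi>: "bpath H \<xi>"
  shows "\<exists>\<gamma> C. cyl \<gamma> C \<and> dec \<gamma> C x (entry x (\<xi>, i) (\<xi>, i))"
proof -
  obtain L where L: "good (\<lambda>_ _. True) L" "x \<doteq> lin L" using rep_free[OF x] by (auto simp: rep_def)
  let ?v = "\<lambda>x. entry x (\<xi>, i) (\<xi>, i)"
  obtain \<gamma> C where C: "cyl \<gamma> C"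
    and zero: "\<And>c \<alpha> A \<beta>. (c, \<alpha>, A, \<beta>) \<in> set L \<Longrightarrow> length \<alpha> = length \<beta> \<Longrightarrow> dec \<gamma> C (tri \<alpha> A \<beta>) (?v (tri \<alpha> A \<beta>))"
    using decide_degree_zero[OF \<xi> L(1), of i] by blast
  obtain \<rho> D where D: "cyl (\<gamma> @ \<rho>) D" "D \<subseteq> rel_range C \<rho>"
    and nonzero: "\<And>c \<alpha> A \<beta>. (c, \<alpha>, A, \<beta>) \<in> set L \<Longrightarrow> length \<alpha> \<noteq> length \<beta> \<Longrightarrow> dec (\<gamma> @ \<rho>) D (tri \<alpha> A \<beta>) 0"
    using kill_all[OF LB C L(1)] by blast
  have "dec (\<gamma> @ \<rho>) D (tri \<alpha> A \<beta>) (?v (tri \<alpha> A \<beta>))" if "(c, \<alpha>, A, \<beta>) \<in> set L" for c \<alpha> A \<beta>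
    using dec_refine[OF zero[OF that] C D] nonzero[OF that] entry_degree[of \<alpha> \<beta> A \<xi> i]
    by (cases "length \<alpha> = length \<beta>") (auto simp: hdeg_def)
  then have "dec (\<gamma> @ \<rho>) D (lin L) (?v (lin L))"
    by (rule dec_lin) (simp_all add: entry_zero entry_add entry_cst)
  then have "dec (\<gamma> @ \<rho>) D x (?v x)"
    using dec_eqv[OF L(2)] entry_eqv[OF L(2)] by simp
  then show ?thesis using D by blast
qed

section \<open>Simplicity\<close>

text \<open>Some monomial of \<open>x\<close> sends the point mass at \<open>\<xi>\<close> to the
  one at \<open>\<eta>\<close>, and its adjoint moves the entry to the diagonal. The monomial is
  nonempty, so \<open>\<xi>\<close> lies in the domain of a letter and is a genuine path.\<close>

lemma entry_nonzero_word:
  assumes x: "x \<in> FF" and nz: "entry x \<eta> \<xi> \<noteq> 0"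
  shows "bpath H (fst \<xi>) \<and> (\<exists>\<mu>\<in>FF. \<forall>y. entry (\<mu> * y) \<xi> \<xi> = entry y \<eta> \<xi>)"
proof -
  have "\<exists>m\<in>Poly_Mapping.keys x. Poly_Mapping.lookup x m * mop m (delta \<xi>) \<eta> \<noteq> 0"
    using nz unfolding entry_def act_on_def by (metis (no_types, lifting) sum.neutral)
  then obtain m where m: "m \<in> Poly_Mapping.keys x" "mop m (delta \<xi>) \<eta> \<noteq> 0" by auto
  then have "mact m \<eta> = Some \<xi>" by (auto simp: mop_def delta_def split: option.splits if_splits)
  then have ma: "mact (mono_star m) \<xi> = Some \<eta>" by (simp add: mact_star[of m])
  have let_ne: "letters m \<noteq> []" "fst ` set (letters m) \<subseteq> generators"
    using x m(1) by (auto simp: free_star_algebra_def)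
  then have "letters (mono_star m) \<noteq> []" by (simp add: letters_mono_star)
  then obtain g b w where w: "letters (mono_star m) = (g, b) # w" by (metis list.exhaust surj_pair)
  then have "tau g b \<xi> \<noteq> None" using ma by (cases "tau g b \<xi>") (simp_all add: mact_def)
  then have "bpath H (fst \<xi>)" by (cases g; cases b; cases \<xi>) (auto split: if_splits)
  moreover let ?\<mu> = "Poly_Mapping.single (mono_star m) 1"
  have "?\<mu> \<in> FF" using let_ne by (simp add: free_star_algebra_def letters_mono_star)
  moreover have "entry (?\<mu> * y) \<xi> \<xi> = entry y \<eta> \<xi>" for y
    by (simp add: entry_def act_on_mult act_on_single mop_def ma)
  ultimately show ?thesis by blast
qed

lemma entry_convergent:
  assumes f: "f \<in> U.CS" shows "convergent (\<lambda>n. entry (f n) \<eta> \<xi>)"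
proof -
  have "Cauchy (\<lambda>n. entry (f n) \<eta> \<xi>)"
  proof (rule metric_CauchyI)
    fix r :: real assume "r > 0"
    then obtain N where N: "\<And>m n. m \<ge> N \<Longrightarrow> n \<ge> N \<Longrightarrow> uu (f m - f n) < r" using U.CS_cauchy[OF f] by blast
    have "dist (entry (f m) \<eta> \<xi>) (entry (f n) \<eta> \<xi>) < r" if "m \<ge> N" "n \<ge> N" for m n
    proof -
      have "dist (entry (f m) \<eta> \<xi>) (entry (f n) \<eta> \<xi>) = cmod (entry (f m - f n) \<eta> \<xi>)"
        by (simp add: dist_norm entry_diff)
      also have "\<dots> \<le> opn (f m - f n)" by (rule entry_le)
      also have "\<dots> \<le> uu (f m - f n)" using f by (intro opn_le_uu free_diff U.CS_F)
      finally show ?thesis using N[OF that] by simp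
    qed
    then show "\<exists>M. \<forall>m\<ge>M. \<forall>n\<ge>M. dist (entry (f m) \<eta> \<xi>) (entry (f n) \<eta> \<xi>) < r" by blast
  qed
  then show ?thesis by (simp add: Cauchy_convergent_iff)
qed

text \<open>Aperiodicity yields a cylinder projection \<open>R\<close> such that \<open>R f R\<close> is approximately a nonzero
  multiple of \<open>R\<close>.\<close>
lemma ideal_contains_projection:
  assumes LB: condition_LB and J: "U.seq_ideal J" and f: "f \<in> J" "\<not> U.null_seq f"
  shows "\<exists>C\<in>B. C \<noteq> {} \<and> (\<lambda>_. gp C) \<in> J"
proof -
  have fC: "f \<in> U.CS" by (rule U.seq_ideal_CS[OF J f(1)])
  have "\<exists>\<eta> \<xi>. \<not> (\<lambda>k. entry (f k) \<eta> \<xi>) \<longlonglongrightarrow> 0"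
  proof (rule ccontr)
    assume "\<not> ?thesis"
    then have "(\<lambda>k. opn (f k)) \<longlonglongrightarrow> 0"
    proof (intro opn_null_of_entries)
      fix r :: real assume "r > 0"
      then show "\<exists>N. \<forall>m\<ge>N. \<forall>n\<ge>N. opn (f m - f n) < r"
        using U.CS_cauchy[OF fC] uu_eq_opn[OF free_diff[OF U.CS_F[OF fC] U.CS_F[OF fC]]] by simp
    qed blast
    then show False using f(2) uu_eq_opn[OF U.CS_F[OF fC]] by (simp add: U.null_seq_def)
  qed
  then obtain \<eta> \<xi> where ne: "\<not> (\<lambda>k. entry (f k) \<eta> \<xi>) \<longlonglongrightarrow> 0" by blast
  obtain c where c: "(\<lambda>k. entry (f k) \<eta> \<xi>) \<longlonglongrightarrow> c"
    using entry_convergent[OF fC, of \<eta> \<xi>] unfolding convergent_def by blast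
  have c0: "c \<noteq> 0" using c ne by blast
  have "\<exists>k. entry (f k) \<eta> \<xi> \<noteq> 0"
  proof (rule ccontr)
    assume "\<not> ?thesis"
    then show False using ne by simp
  qed
  then obtain \<mu> where \<xi>: "bpath H (fst \<xi>)" and \<mu>: "\<mu> \<in> FF" "\<And>y. entry (\<mu> * y) \<xi> \<xi> = entry y \<eta> \<xi>"
    using entry_nonzero_word U.CS_F[OF fC] by blast
  define z where "z n = \<mu> * f n" for n
  have z: "z \<in> J" unfolding z_def[abs_def] using U.seq_ideal_mult2[OF J f(1) U.CS_const[OF \<mu>(1)]] .
  have zC: "z \<in> U.CS" by (rule U.seq_ideal_CS[OF J z])
  have zF: "z n \<in> FF" for n by (rule U.CS_F[OF zC])
  \<comment> \<open>Errors below a quarter of \<open>cmod c\<close> leave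
    \<open>cmod c' > 3 * cmod c / 4\<close>. After division by \<open>c'\<close> the distance from
    \<open>?R\<close> to the ideal is at most 1/3, as needed for
    \<open>projection_in_ideal\<close>.\<close>
  have c4: "cmod c / 4 > 0" using c0 by simp
  obtain N1 where N1: "\<And>m n. m \<ge> N1 \<Longrightarrow> n \<ge> N1 \<Longrightarrow> uu (z m - z n) < cmod c / 4"
    using U.CS_cauchy[OF zC c4] by blast
  obtain N2 where N2: "\<And>n. n \<ge> N2 \<Longrightarrow> dist (entry (z n) \<xi> \<xi>) c < cmod c / 4"
    using metric_LIMSEQ_D[OF c c4] unfolding z_def \<mu>(2) by blast
  define k where "k = max N1 N2"
  define c' where "c' = entry (z k) \<xi> \<xi>"
  have "cmod c \<le> cmod c' + cmod (c' - c)" using norm_triangle_ineq4[of c' "c' - c"] by simp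
  then have c': "cmod c' > 3 * cmod c / 4" using N2[of k] by (simp add: k_def c'_def dist_norm)
  then have c'0: "c' \<noteq> 0" using c4 by auto
  obtain \<gamma> C where C: "cyl \<gamma> C" "dec \<gamma> C (z k) c'"
    using decide[OF LB zF \<xi>, of k "snd \<xi>"] by (auto simp: c'_def)
  let ?R = "tri \<gamma> C \<gamma>"
  have v: "valid \<gamma> C \<gamma>" by (rule cyl_valid[OF C(1)])
  have RF: "?R \<in> FF" by (rule tri_free[OF v])
  have CB: "C \<in> B" by (rule cyl_B[OF C(1)])
  have R1: "uu ?R \<le> 1"
  proof (rule U.projection_le_one[OF RF uu_eqv_diff])
    have "nc_star ?R * ?R \<doteq> ?R * ?R" by (intro eqv_right tri_star CB)
    also note tri_idem[OF v]
    finally show "nc_star ?R * ?R \<doteq> ?R" .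
  qed (use RF in \<open>auto intro: free_mult free_star\<close>)
  define h where "h n = nc_scale (1 / c') (?R * z n * ?R)" for n
  have hJ: "h \<in> J"
  proof -
    have "(\<lambda>n. ?R * z n) \<in> J" by (rule U.seq_ideal_mult2[OF J z U.CS_const[OF RF]])
    then have "(\<lambda>n. ?R * z n * ?R) \<in> J" by (rule U.seq_ideal_mult1[OF J _ U.CS_const[OF RF]])
    then show ?thesis unfolding h_def[abs_def] by (rule U.seq_ideal_scale[OF J])
  qed
  have near: "uu (?R - h n) \<le> 1 / 3" if n: "n \<ge> N1" for n
  proof -
    have d: "cst (1 / c') * (cst c' * ?R - ?R * z k * ?R) \<doteq> 0"
      using eqv_left[OF eqv_diff[OF eqv_sym[OF C(2)[unfolded dec_def]] eqv_refl[of "?R * z k * ?R"]], of "cst (1 / c')"]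
      by simp
    have eq: "?R - h n = cst (1 / c') * (cst c' * ?R - ?R * z k * ?R) + cst (1 / c') * (?R * (z k - z n) * ?R)"
      using c'0 by (simp add: h_def nc_scale_eq algebra_simps) (simp add: cst_mult flip: mult.assoc)
    have F: "?R * (z k - z n) * ?R \<in> FF" using RF zF by (intro free_mult free_diff)
    have "?R - h n \<doteq> 0 + cst (1 / c') * (?R * (z k - z n) * ?R)" unfolding eq by (intro eqv_add d eqv_refl)
    then have "uu (?R - h n) = uu (cst (1 / c') * (?R * (z k - z n) * ?R))"
      using RF zF F by (intro uu_eqv free_diff free_cst) (auto simp: h_def intro: free_scale free_mult)
    also have "\<dots> = uu (?R * (z k - z n) * ?R) / cmod c'" using F by (simp add: U.scale norm_divide)
    also have "uu (?R * (z k - z n) * ?R) \<le> uu (z k - z n)"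
    proof -
      have "uu (?R * (z k - z n) * ?R) \<le> uu (?R * (z k - z n)) * uu ?R"
        using RF zF by (intro U.submult free_mult free_diff)
      also have "\<dots> \<le> uu (?R * (z k - z n))"
        using R1 RF zF by (intro mult_left_le U.nonneg free_mult free_diff)
      also have "\<dots> \<le> uu ?R * uu (z k - z n)" using RF zF by (intro U.submult free_diff)
      also have "\<dots> \<le> uu (z k - z n)"
        using R1 RF zF by (intro mult_left_le_one_le U.nonneg free_diff)
      finally show ?thesis .
    qed
    also have "uu (z k - z n) \<le> cmod c / 4" using N1[of k n] n by (simp add: k_def)
    finally have "uu (?R - h n) \<le> cmod c / 4 / cmod c'" using c'0 by (simp add: divide_right_mono)
    also have "\<dots> \<le> 1 / 3" using c' c'0 by (simp add: divide_simps)
    finally show ?thesis .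
  qed
  have RJ: "(\<lambda>_. ?R) \<in> J"
    by (rule U.projection_in_ideal[OF J RF _ hJ _ near]) (use RF v in \<open>auto intro: uu_eqv_diff tri_idem free_mult\<close>)
  have v0: "valid [] C \<gamma>" "valid \<gamma> C []" using v B_subset by (auto simp: valid_def word_range_Nil)
  \<comment> \<open>The projection of the cylinder is conjugated into \<open>gp C\<close> by partial
    isometries of the algebra, so \<open>gp C\<close> lies in the ideal too.\<close>
  have gpC: "tri [] C \<gamma> * ?R * tri \<gamma> C [] \<doteq> gp C"
  proof -
    have "tri [] C \<gamma> * ?R \<doteq> tri [] C \<gamma>" using tri_mult1[of "[]" C \<gamma> "[]" C \<gamma>] v v0 CB by simp
    then have "tri [] C \<gamma> * ?R * tri \<gamma> C [] \<doteq> tri [] C \<gamma> * tri \<gamma> C []" by (rule eqv_right)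
    also have "\<dots> \<doteq> tri [] C []" using tri_mult1[of "[]" C \<gamma> "[]" C "[]"] v0 CB by simp
    finally show ?thesis by (simp add: tri_def)
  qed
  have "(\<lambda>_. tri [] C \<gamma> * ?R * tri \<gamma> C []) \<in> J"
    using U.seq_ideal_mult1[OF J U.seq_ideal_mult2[OF J RJ U.CS_const[OF tri_free[OF v0(1)]]]
        U.CS_const[OF tri_free[OF v0(2)]]] .
  moreover have "U.null_seq (\<lambda>_. gp C - tri [] C \<gamma> * ?R * tri \<gamma> C [])"
  proof -
    have "tri [] C \<gamma> * ?R * tri \<gamma> C [] \<in> FF" by (intro free_mult RF tri_free v0)
    from uu_eqv_diff[OF gp_free[OF CB] this eqv_sym[OF gpC]] show ?thesis by (simp add: U.null_seq_def)
  qed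
  ultimately have "(\<lambda>_. gp C) \<in> J"
    using U.seq_ideal_eq[OF J _ U.CS_const[OF gp_free[OF CB]]] by blast
  then show ?thesis using CB C(1) by (auto simp: cyl_def)
qed

section \<open>The hereditary saturated set of an ideal\<close>

context
  fixes J assumes J: "U.seq_ideal J"
begin

lemma const_eqv: "(\<lambda>_. x) \<in> J \<Longrightarrow> y \<in> FF \<Longrightarrow> y \<doteq> x \<Longrightarrow> (\<lambda>_. y) \<in> J"
proof -
  assume x: "(\<lambda>_. x) \<in> J" and y: "y \<in> FF" "y \<doteq> x"
  have "x \<in> FF" using U.CS_F[OF U.seq_ideal_CS[OF J x]] by simp
  then show ?thesis
    using uu_eqv_diff[OF y(1) _ y(2)] y(1) x
    by (intro U.seq_ideal_eq[OF J x] U.CS_const) (simp_all add: U.null_seq_def)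
qed

lemma const_mult: "(\<lambda>_. x) \<in> J \<Longrightarrow> y \<in> FF \<Longrightarrow> (\<lambda>_. x * y) \<in> J" "(\<lambda>_. x) \<in> J \<Longrightarrow> y \<in> FF \<Longrightarrow> (\<lambda>_. y * x) \<in> J"
  using U.seq_ideal_mult1[OF J, of "\<lambda>_. x" "\<lambda>_. y"] U.seq_ideal_mult2[OF J, of "\<lambda>_. x" "\<lambda>_. y"] U.CS_const
  by auto

lemma const_zero: "(\<lambda>_. 0) \<in> J"
  by (rule U.seq_ideal_null[OF J U.CS_const[OF free_zero]]) (simp add: U.null_seq_def U.zero)

lemma const_add: "(\<lambda>_. x) \<in> J \<Longrightarrow> (\<lambda>_. y) \<in> J \<Longrightarrow> (\<lambda>_. x + y) \<in> J"
  by (rule U.seq_ideal_add[OF J])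

lemma const_sum: "(\<And>i. i \<in> I \<Longrightarrow> (\<lambda>_. x i) \<in> J) \<Longrightarrow> (\<lambda>_. sum x I) \<in> J"
  by (induction I rule: infinite_finite_induct) (auto intro: const_zero const_add)

definition ideal_sets :: "'v set set" where
  "ideal_sets = {A \<in> B. (\<lambda>_. gp A) \<in> J}"

lemma ideal_sets_rel_range: assumes A: "A \<in> ideal_sets" shows "rel_range A [a] \<in> ideal_sets"
proof (cases "a \<in> alphabet")
  case True
  have AB: "A \<in> B" and AJ: "(\<lambda>_. gp A) \<in> J" using A by (auto simp: ideal_sets_def)
  have r: "rel_range A [a] \<in> B" by (rule B_rel[OF AB])
  have "nc_star (gs a) * gp A * gs a = nc_star (gs a) * (gp A * gs a)" by (simp add: mult.assoc)
  also have "\<dots> \<doteq> nc_star (gs a) * (gs a * gp (rel_range A [a]))" by (intro eqv_left gp_gs AB True)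
  also have "\<dots> = (nc_star (gs a) * gs a) * gp (rel_range A [a])" by (simp add: mult.assoc)
  also have "\<dots> \<doteq> gp (word_range [a]) * gp (rel_range A [a])" by (intro eqv_right gs_star_gs True)
  also have "\<dots> \<doteq> gp (word_range [a] \<inter> rel_range A [a])" by (intro gp_mult B_wr r) simp
  also have "word_range [a] \<inter> rel_range A [a] = rel_range A [a]" using rel_range_subset by blast
  finally have "nc_star (gs a) * gp A * gs a \<doteq> gp (rel_range A [a])" .
  moreover have "(\<lambda>_. nc_star (gs a) * gp A * gs a) \<in> J"
    using True by (intro const_mult AJ free_star gs_free)
  ultimately show ?thesis using const_eqv eqv_sym gp_free r by (auto simp: ideal_sets_def)
next
  case False
  then have "rel_range A [a] = {}" using rel_range_alphabet by blast
  then show ?thesis using const_eqv[OF const_zero gp_free[OF B_empty] gp_empty] B_empty by (simp add: ideal_sets_def)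
qed

lemma hereditary_ideal_sets: "hereditary ideal_sets"
  unfolding hereditary_def
proof (intro conjI ballI impI)
  show "ideal_sets \<subseteq> B" by (auto simp: ideal_sets_def)
  have "{} \<in> ideal_sets" using const_eqv[OF const_zero gp_free[OF B_empty] gp_empty] B_empty by (simp add: ideal_sets_def)
  then show "ideal_sets \<noteq> {}" by blast
  show "rel_range A \<alpha> \<in> ideal_sets" if "A \<in> ideal_sets" for A \<alpha>
    using that
  proof (induction \<alpha> arbitrary: A)
    case Nil
    then show ?case by (simp add: ideal_sets_def)
  next
    case (Cons a \<alpha>)
    then show ?case using ideal_sets_rel_range by (subst rel_range_Cons) blast
  qed
  have sub: "C \<in> ideal_sets" if A: "A \<in> ideal_sets" and C: "C \<in> B" "C \<subseteq> A" for A C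
  proof -
    have AB: "A \<in> B" and AJ: "(\<lambda>_. gp A) \<in> J" using A by (auto simp: ideal_sets_def)
    have "gp A * gp C \<doteq> gp C" using gp_mult[OF AB C(1)] C(2) by (simp add: Int_absorb1)
    then show ?thesis using const_eqv[OF const_mult(1)[OF AJ gp_free[OF C(1)]] gp_free[OF C(1)]] eqv_sym C(1)
      by (simp add: ideal_sets_def)
  qed
  show "C \<in> ideal_sets" if "A \<in> ideal_sets" "C \<in> B" "C \<subseteq> A" for A C using sub[OF that] .
  show "A \<union> C \<in> ideal_sets" if A: "A \<in> ideal_sets" and C: "C \<in> ideal_sets" for A C
  proof -
    have B: "A \<in> B" "C \<in> B" using A C by (auto simp: ideal_sets_def)
    have D: "C - A \<in> ideal_sets" using sub[OF C] B B_Diff by blast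
    have "gp (A \<union> (C - A)) \<doteq> gp A + gp (C - A)" using B by (intro gp_Un_disjoint B_Diff) auto
    moreover have "(\<lambda>_. gp A + gp (C - A)) \<in> J" using A D const_add by (simp add: ideal_sets_def)
    moreover have "A \<union> (C - A) = A \<union> C" by blast
    ultimately have "(\<lambda>_. gp (A \<union> C)) \<in> J" using const_eqv[of "gp A + gp (C - A)"] gp_free[OF B_Un[OF B]] by simp
    then show ?thesis using B B_Un by (simp add: ideal_sets_def)
  qed
qed

text \<open>A nonempty regular set satisfies the side conditions of \<open>p_sum\<close>, which
  writes its projection as a finite sum of elements of the ideal.\<close>

lemma saturated_ideal_sets: "saturated ideal_sets"
  unfolding saturated_def
proof (intro ballI impI)
  fix A assume A: "A \<in> B_reg" and all: "\<forall>a\<in>alphabet. rel_range A [a] \<in> ideal_sets"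
  show "A \<in> ideal_sets"
  proof (cases "A = {}")
    case True
    then show ?thesis using hereditary_empty[OF hereditary_ideal_sets] by simp
  next
    case False
    then have reg: "regular_set A" using A by (simp add: B_reg_def)
    then have AB: "A \<in> B" by (simp add: regular_set_def)
    have "\<not> (\<exists>C\<in>B. C \<noteq> {} \<and> C \<subseteq> A \<inter> sinks)"
      using reg out_labels_sinks B_subset by (metis Int_subset_iff regular_set_def)
    moreover have "out_labels A \<noteq> {}" "finite (out_labels A)" using reg False by (auto simp: regular_set_def)
    ultimately have "gp A \<doteq> (\<Sum>a\<in>out_labels A. gs a * gp (rel_range A [a]) * nc_star (gs a))"
      using AB by (intro eqv_base relators.p_sum)
    moreover have "(\<lambda>_. \<Sum>a\<in>out_labels A. gs a * gp (rel_range A [a]) * nc_star (gs a)) \<in> J"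
    proof (intro const_sum)
      fix a assume "a \<in> out_labels A"
      then have a: "a \<in> alphabet" by (simp add: out_labels_def)
      then have "(\<lambda>_. gp (rel_range A [a])) \<in> J" using all by (simp add: ideal_sets_def)
      then show "(\<lambda>_. gs a * gp (rel_range A [a]) * nc_star (gs a)) \<in> J"
        by (rule const_mult(1)[OF const_mult(2)[OF _ gs_free[OF a]] free_star[OF gs_free[OF a]]])
    qed
    ultimately show ?thesis using const_eqv gp_free[OF AB] AB by (simp add: ideal_sets_def)
  qed
qed

text \<open>A spanning element factors through \<open>gp A\<close>, so all polynomials lie in
  \<open>J\<close>.\<close>

lemma ideal_sets_all: assumes "ideal_sets = B" shows "J = U.CS"
proof
  show "J \<subseteq> U.CS" using U.seq_ideal_CS[OF J] by blast
  have gp: "(\<lambda>_. gp A) \<in> J" if "A \<in> B" for A using assms that by (auto simp: ideal_sets_def)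
  have gs: "(\<lambda>_. gs a) \<in> J" if a: "a \<in> alphabet" for a
    by (rule const_eqv[OF const_mult(2)[OF gp[OF B_wr] gs_free[OF a]] gs_free[OF a] eqv_sym[OF gs_gp_word_range[OF a]]]) simp
  have tri: "(\<lambda>_. tri \<alpha> A \<beta>) \<in> J" if v: "valid \<alpha> A \<beta>" for \<alpha> A \<beta>
  proof -
    have AB: "A \<in> B" using v by (simp add: valid_def)
    have v0: "valid \<alpha> A []" "valid [] A \<beta>" "valid [] A []" using v B_subset by (auto simp: valid_def word_range_Nil)
    have "tri \<alpha> A [] * gp A * tri [] A \<beta> = tri \<alpha> A [] * tri [] A [] * tri [] A \<beta>" by (simp add: tri_def)
    also have "\<dots> \<doteq> tri \<alpha> A [] * tri [] A \<beta>"
      using tri_mult1[of \<alpha> A "[]" "[]" A "[]"] v0 AB by (intro eqv_right) simp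
    also have "\<dots> \<doteq> tri \<alpha> A \<beta>" using tri_mult1[of \<alpha> A "[]" "[]" A \<beta>] v0 AB by simp
    finally have "tri \<alpha> A [] * gp A * tri [] A \<beta> \<doteq> tri \<alpha> A \<beta>" .
    moreover have "(\<lambda>_. tri \<alpha> A [] * gp A * tri [] A \<beta>) \<in> J"
      by (rule const_mult(1)[OF const_mult(2)[OF gp[OF AB] tri_free[OF v0(1)]] tri_free[OF v0(2)]])
    ultimately show ?thesis using const_eqv tri_free[OF v] eqv_sym by blast
  qed
  have lin: "(\<lambda>_. lin L) \<in> J" if "good P L" for P L
    using that
  proof (induction L rule: lin_induct)
    case (Cons c \<alpha> A \<beta> L)
    then have "(\<lambda>_. nc_scale c (tri \<alpha> A \<beta>)) \<in> J" using U.seq_ideal_scale[OF J tri] by simp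
    then show ?case using Cons const_add by (simp add: nc_scale_eq)
  qed (simp add: const_zero)
  have const: "(\<lambda>_. x) \<in> J" if x: "x \<in> FF" for x
  proof -
    obtain L where "good (\<lambda>_ _. True) L" "x \<doteq> lin L" using rep_free[OF x] by (auto simp: rep_def)
    then show ?thesis using const_eqv[OF lin x] by blast
  qed
  show "U.CS \<subseteq> J"
  proof
    fix g assume g: "g \<in> U.CS"
    show "g \<in> J"
    proof (rule U.seq_ideal_closed[OF J g])
      fix r :: real assume "r > 0"
      then obtain N where "\<And>m n. m \<ge> N \<Longrightarrow> n \<ge> N \<Longrightarrow> uu (g m - g n) < r" using U.CS_cauchy[OF g] by blast
      \<comment> \<open>Constant sequences are dense: \<open>g N\<close>, read as a constant
        sequence, approximates \<open>g\<close>.\<close>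
      then have "\<forall>n\<ge>N. uu (g N - g n) < r" by blast
      then show "\<exists>f\<in>J. \<exists>N. \<forall>n\<ge>N. uu (f n - g n) < r"
        by (intro bexI[OF _ const[OF U.CS_F[OF g, of N]]] exI[of _ N])
    qed
  qed
qed

end

section \<open>Simplicity from the two conditions, and proper ideals from hereditary saturated
  sets\<close>

lemma cstar_alg_eq: "cstar_alg = U.CC"
  by (simp add: cstar_alg_def universal_cstar_def)

lemma simple_if:
  assumes LB: condition_LB and hs: "\<And>H. hereditary H \<Longrightarrow> saturated H \<Longrightarrow> H = {{}} \<or> H = B"
  shows "simple_cstar cstar_alg"
  unfolding cstar_alg_eq
proof (rule U.simple_completionI)
  fix J f assume J: "U.seq_ideal J" and f: "f \<in> J" "\<not> U.null_seq f"
  obtain C where C: "C \<in> B" "C \<noteq> {}" "(\<lambda>_. gp C) \<in> J" using ideal_contains_projection[OF LB J f] by blast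
  have "C \<in> ideal_sets J" using C by (simp add: ideal_sets_def[OF J])
  then have "ideal_sets J \<noteq> {{}}" using C(2) by blast
  then have "ideal_sets J = B" using hs[OF hereditary_ideal_sets[OF J] saturated_ideal_sets[OF J]] by blast
  then show "J = U.CS" by (rule ideal_sets_all[OF J])
qed

lemma entry_gp: "bpath H \<xi> \<Longrightarrow> A \<in> fst \<xi> 0 \<Longrightarrow> entry (gp A) (\<xi>, i) (\<xi>, i) = 1"
  by (simp add: entry_def act_gp delta_def)

lemma uu_pos: assumes "x \<in> FF" "entry x \<eta> \<xi> \<noteq> 0" shows "uu x \<noteq> 0"
  using entry_le[of x \<eta> \<xi>] opn_le_uu[OF assms(1)] assms(2) zero_less_norm_iff[of "entry x \<eta> \<xi>"]
  by linarith

text \<open>\<open>gp A\<close> vanishes in the representation \<open>K\<close>, as components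
  avoiding \<open>H'\<close> never contain \<open>A\<close>. \<open>gp D\<close> does not vanish,
  because saturation supplies a path through \<open>D\<close> that avoids \<open>H'\<close>.\<close>

lemma not_simple_ideal:
  assumes H': "hereditary H'" "saturated H'" and A: "A \<in> H'" "A \<noteq> {}" and D: "D \<in> B" "D \<notin> H'"
  shows "\<not> simple_cstar cstar_alg"
proof
  assume s: "simple_cstar cstar_alg"
  interpret K: bpath_rep E Lab B H' 0 using H' by unfold_locales
  have AB: "A \<in> B" using H'(1) A by (auto simp: hereditary_def)
  have "K.act_on (gp A) f (\<xi>, i) = 0" for f \<xi> i
    using bpath_avoid[of H' \<xi> 0] A(1) by (auto simp: K.act_gp)
  then have "K.opn (gp A) = 0" by (intro K.opn_eq_0) (auto simp: fun_eq_iff)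
  moreover obtain \<xi> where "bpath H \<xi>" "A \<in> fst \<xi> 0" using bpath_ex[OF AB A(2)] by blast
  then have "uu (gp A) \<noteq> 0" using entry_gp[of \<xi> A 0] uu_pos[OF gp_free[OF AB], of "(\<xi>, 0)" "(\<xi>, 0)"] by simp
  ultimately have "K.opn (gp D) = 0"
    using U.simple_completionD[OF s[unfolded cstar_alg_eq] K.cstar_seminorm_opn K.opn_le_uu gp_free[OF AB] _ _ gp_free[OF D(1)]]
    by blast
  moreover obtain \<zeta> where \<zeta>: "bpath H' \<zeta>" "D \<in> fst \<zeta> 0" using bpath_exists[OF H' D] by blast
  have "K.entry (gp D) (\<zeta>, 0) (\<zeta>, 0) = 1" using \<zeta> by (simp add: K.entry_def K.act_gp delta_def)
  ultimately show False using K.entry_le[of "gp D" "(\<zeta>, 0)" "(\<zeta>, 0)"] by simp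
qed

end

section \<open>Cycles without exits\<close>

context bpath_rep
begin

text \<open>Without an exit each \<open>rel_range A (take k \<alpha>)\<close> is regular with the
  single label \<open>\<alpha> ! k\<close>, so a path through \<open>A\<close> can neither stop nor
  leave \<open>\<alpha>\<close> during the turn.\<close>

lemma cycle_prefix:
  assumes cyc: "lb_cycle \<alpha> A" "\<not> has_exit \<alpha> A" and \<xi>: "bpath H \<xi>" "A \<in> fst \<xi> 0"
  shows "\<exists>\<zeta>. okp \<alpha> \<zeta> \<and> \<xi> = pre \<alpha> \<zeta> \<and> A \<in> fst \<zeta> 0 \<and> fst \<zeta> 0 = fst \<xi> 0"
proof -
  have AB: "A \<in> B" "A \<subseteq> word_range \<alpha>" and \<alpha>: "\<alpha> \<noteq> []"
    and fix_sub: "\<And>C. C \<in> B \<Longrightarrow> C \<subseteq> A \<Longrightarrow> rel_range C \<alpha> = C"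
    using cyc(1) by (auto simp: lb_cycle_def B_at_iff pos_words_iff)
  have out: "out_labels C = {\<alpha> ! (k mod length \<alpha>)}"
    if "k \<le> length \<alpha>" "C \<in> B" "C \<noteq> {}" "C \<subseteq> rel_range A (take k \<alpha>)" for k C
    using cyc(2) that unfolding has_exit_def by blast
  have step: "snd \<xi> k = Some (\<alpha> ! k) \<and> rel_range A (take (Suc k) \<alpha>) \<in> fst \<xi> (Suc k)"
    if k: "k < length \<alpha>" and r: "rel_range A (take k \<alpha>) \<in> fst \<xi> k" for k
  proof -
    let ?C = "rel_range A (take k \<alpha>)"
    have ne: "?C \<noteq> {}" using r bpath_empty[OF \<xi>(1)] by metis
    have "regular_set ?C" unfolding regular_set_def
      using B_rel[OF AB(1)] ne out[of k] k by auto
    then have "snd \<xi> k \<noteq> None" using bpath_None[OF \<xi>(1)] r by blast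
    then obtain a where a: "snd \<xi> k = Some a" by blast
    have "a \<in> out_labels ?C" by (rule bpath_out(2)[OF \<xi>(1) r a])
    then have "a = \<alpha> ! k" using out[of k ?C] k B_rel[OF AB(1)] ne by simp
    then show ?thesis using a bpath_out(1)[OF \<xi>(1) r a] k
      by (simp add: take_Suc_conv_app_nth rel_range_append)
  qed
  have all: "rel_range A (take k \<alpha>) \<in> fst \<xi> k" if "k \<le> length \<alpha>" for k
    using that
  proof (induction k)
    case 0
    then show ?case using \<xi>(2) AB by simp
  next
    case (Suc k)
    then show ?case using step[of k] by simp
  qed
  have labels: "snd \<xi> k = Some (\<alpha> ! k)" if "k < length \<alpha>" for k using step[OF that all] that by simp
  obtain \<gamma> \<zeta> where \<gamma>: "okp \<gamma> \<zeta>" "\<xi> = pre \<gamma> \<zeta>" "length \<gamma> = length \<alpha> \<or> length \<gamma> < length \<alpha> \<and> snd \<zeta> 0 = None"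
    using bpath_split[OF \<xi>(1)] by blast
  have "length \<gamma> = length \<alpha>" using \<gamma>(2,3) labels pre_tail(2)[of \<gamma> \<zeta> 0] by auto
  then have "\<gamma> = \<alpha>" using labels snd_pre[of _ \<gamma> \<zeta>] \<gamma>(2) by (intro nth_equalityI) auto
  then have z: "okp \<alpha> \<zeta>" "\<xi> = pre \<alpha> \<zeta>" using \<gamma> by auto
  have "rel_range A \<alpha> = A" using fix_sub AB by simp
  then have A: "A \<in> fst \<zeta> 0" using all[of "length \<alpha>"] pre_tail(1)[of \<alpha> \<zeta> 0] z(2) by simp
  have \<zeta>: "bpath H \<zeta>" using z by (simp add: okp_def)
  note U\<zeta> = bpath_ultra[OF \<zeta> A] and U\<xi> = bpath_ultra[OF \<xi>]
  \<comment> \<open>Subsets of \<open>A\<close> are fixed by the range along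
    \<open>\<alpha>\<close>, so intersecting with \<open>A\<close> shows that the ultrafilter is the
    same after a full turn.\<close>
  have "fst \<zeta> 0 \<subseteq> fst \<xi> 0"
  proof
    fix D assume D: "D \<in> fst \<zeta> 0"
    have DB: "D \<in> B" by (rule ultra_B[OF U\<zeta> D])
    have "D \<inter> A \<in> fst \<zeta> 0" by (rule ultra_Int[OF U\<zeta> D A])
    moreover have "rel_range (D \<inter> A) \<alpha> = D \<inter> A" using fix_sub DB AB B_Int by simp
    ultimately have "D \<inter> A \<in> fst \<xi> 0" using pre_fst[OF z(1), of "D \<inter> A"] DB AB z(2) by (simp add: B_Int)
    then show "D \<in> fst \<xi> 0" using ultra_up[OF U\<xi>] DB by blast
  qed
  then show ?thesis using z A ultra_subset_eq[OF U\<zeta> U\<xi>] \<xi>(2) by blast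
qed

text \<open>Both paths begin with \<open>\<alpha>\<close>, and the components along this beginning
  are determined by the ultrafilter at its end, which equals the initial one. The induction goes
  down by whole turns.\<close>

lemma cycle_unique:
  assumes cyc: "lb_cycle \<alpha> A" "\<not> has_exit \<alpha> A"
  shows "bpath H \<xi> \<Longrightarrow> bpath H \<xi>' \<Longrightarrow> A \<in> fst \<xi> 0 \<Longrightarrow> fst \<xi> 0 = fst \<xi>' 0 \<Longrightarrow>
    fst \<xi> n = fst \<xi>' n \<and> snd \<xi> n = snd \<xi>' n"
proof (induction n arbitrary: \<xi> \<xi>' rule: less_induct)
  case (less n)
  have \<alpha>: "\<alpha> \<noteq> []" using cyc(1) by (auto simp: lb_cycle_def pos_words_iff)
  obtain \<zeta> where \<zeta>: "okp \<alpha> \<zeta>" "\<xi> = pre \<alpha> \<zeta>" "A \<in> fst \<zeta> 0" "fst \<zeta> 0 = fst \<xi> 0"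
    using cycle_prefix[OF cyc less.prems(1,3)] by blast
  have "A \<in> fst \<xi>' 0" using less.prems by simp
  from cycle_prefix[OF cyc less.prems(2) this] obtain \<zeta>' where
    \<zeta>': "okp \<alpha> \<zeta>'" "\<xi>' = pre \<alpha> \<zeta>'" "A \<in> fst \<zeta>' 0" "fst \<zeta>' 0 = fst \<xi>' 0" by blast
  show ?case
  proof (cases "n < length \<alpha>")
    case True
    have ok: "okp (drop n \<alpha>) \<zeta>" "okp (drop n \<alpha>) \<zeta>'"
      using okp_append[of "take n \<alpha>" "drop n \<alpha>"] \<zeta>(1) \<zeta>'(1) by auto
    have B: "D \<in> B" if "okp \<gamma> \<zeta>" "D \<in> fst (pre \<gamma> \<zeta>) 0" for D \<gamma> \<zeta>
      using ultra_B[OF bpath_ultra[OF bpath_pre[OF that(1)] that(2)] that(2)] .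
    have "D \<in> fst (pre (drop n \<alpha>) \<zeta>) 0 \<longleftrightarrow> D \<in> fst (pre (drop n \<alpha>) \<zeta>') 0" for D
      using pre_fst[OF ok(1), of D] pre_fst[OF ok(2), of D] B[OF ok(1)] B[OF ok(2)] \<zeta>(4) \<zeta>'(4) less.prems(4)
      by metis
    then show ?thesis using True fst_pre[of n \<alpha>] snd_pre[of n \<alpha>] \<zeta>(2) \<zeta>'(2) by auto
  next
    case False
    have "fst \<zeta> (n - length \<alpha>) = fst \<zeta>' (n - length \<alpha>) \<and> snd \<zeta> (n - length \<alpha>) = snd \<zeta>' (n - length \<alpha>)"
    proof (rule less.IH)
      show "n - length \<alpha> < n" using False \<alpha> by (cases \<alpha>) auto
      show "fst \<zeta> 0 = fst \<zeta>' 0" using \<zeta>(4) \<zeta>'(4) less.prems(4) by simp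
    qed (use \<zeta>(1,3) \<zeta>'(1) in \<open>simp_all add: okp_def\<close>)
    then show ?thesis
      using False pre_tail[of \<alpha> \<zeta> "n - length \<alpha>"] pre_tail[of \<alpha> \<zeta>' "n - length \<alpha>"] \<zeta>(2) \<zeta>'(2) by simp
  qed
qed

text \<open>Removing one turn leaves a path with the same initial ultrafilter, hence the same
  path.\<close>

lemma cycle_fixed:
  assumes cyc: "lb_cycle \<alpha> A" "\<not> has_exit \<alpha> A" and \<xi>: "bpath H \<xi>" "A \<in> fst \<xi> 0"
  shows "okp \<alpha> \<xi> \<and> pre \<alpha> \<xi> = \<xi>"
proof -
  obtain \<zeta> where \<zeta>: "okp \<alpha> \<zeta>" "\<xi> = pre \<alpha> \<zeta>" "A \<in> fst \<zeta> 0" "fst \<zeta> 0 = fst \<xi> 0"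
    using cycle_prefix[OF cyc \<xi>] by blast
  have "fst \<zeta> n = fst \<xi> n \<and> snd \<zeta> n = snd \<xi> n" for n
    using cycle_unique[OF cyc _ \<xi>(1) \<zeta>(3,4)] \<zeta>(1) by (simp add: okp_def)
  then have eq: "\<zeta> = \<xi>" by (intro prod_eqI ext) auto
  show ?thesis using \<zeta>(1) \<zeta>(2)[symmetric] unfolding eq by (rule conjI)
qed

end

context graded_rep
begin

text \<open>For a cycle \<open>(\<alpha>, A)\<close> without exit the boundary path representation kills \<open>s\<^sub>\<alpha> p\<^sub>A - p\<^sub>A\<close>, which
  is nonzero since \<open>s\<^sub>\<alpha> p\<^sub>A\<close> has nonzero degree.\<close>
lemma not_simple_cycle:
  assumes cyc: "lb_cycle \<alpha> A" "\<not> has_exit \<alpha> A"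
  shows "\<not> simple_cstar cstar_alg"
proof
  assume s: "simple_cstar cstar_alg"
  \<comment> \<open>With grading 0, a path through \<open>A\<close> and its prolongation by the
    cycle are the same basis point.\<close>
  interpret K: bpath_rep E Lab B "{{}}" 0 using hereditary_trivial saturated_trivial by unfold_locales
  have A: "A \<in> B" "A \<noteq> {}" "A \<subseteq> word_range \<alpha>" and fixA: "rel_range A \<alpha> = A" and \<alpha>: "\<alpha> \<noteq> []" "\<alpha> \<in> pos_words"
    using cyc(1) by (auto simp: lb_cycle_def B_at_iff pos_words_iff)
  have al: "set \<alpha> \<subseteq> alphabet" using \<alpha>(2) by (fastforce simp: pos_words_def alphabet_def awalk_def)
  let ?x = "sw \<alpha> * gp A - gp A"
  have xF: "?x \<in> FF" using A al by (intro free_diff free_mult2 unital_sw gp_free)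
  \<comment> \<open>In this form \<open>gp A\<close> acts outermost: at points not through
    \<open>A\<close> everything vanishes, and at the others \<open>cycle_fixed\<close>
    applies.\<close>
  have "gp A * sw \<alpha> - gp A \<doteq> ?x" using gp_sw[OF A(1) al] fixA by (intro eqv_diff) auto
  moreover have "K.opn (gp A * sw \<alpha> - gp A) = 0"
  proof (intro K.opn_eq_0 ext)
    fix f and p :: "('v, 'l) boundary \<times> int"
    obtain \<xi> i where p: "p = (\<xi>, i)" by (cases p)
    show "K.act_on (gp A * sw \<alpha> - gp A) f p = 0"
    proof (cases "bpath {{}} \<xi> \<and> A \<in> fst \<xi> 0")
      case True
      then have ok: "K.okp \<alpha> \<xi>" "K.pre \<alpha> \<xi> = \<xi>" using K.cycle_fixed[OF cyc] by auto
      then show ?thesis using True K.act_sw[OF ok(1), of f i] by (simp add: p K.act_on_diff K.act_on_mult K.act_gp)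
    next
      case False
      then show ?thesis by (auto simp: p K.act_on_diff K.act_on_mult K.act_gp)
    qed
  qed
  ultimately have "K.opn ?x = 0" using K.opn_eqv by metis
  moreover obtain \<xi> where \<xi>: "bpath H \<xi>" "A \<in> fst \<xi> 0" using bpath_ex[OF A(1,2)] by blast
  have "entry ?x (\<xi>, 0) (\<xi>, 0) = - 1"
    using entry_degree[of \<alpha> "[]" A \<xi> 0] \<alpha>(1) entry_gp[OF \<xi>, of 0] by (simp add: entry_diff tri_def hdeg_def)
  then have "uu ?x \<noteq> 0" using uu_pos[OF xF, of "(\<xi>, 0)" "(\<xi>, 0)"] by simp
  ultimately have "K.opn (gp A) = 0"
    using U.simple_completionD[OF s[unfolded cstar_alg_eq] K.cstar_seminorm_opn K.opn_le_uu xF _ _ gp_free[OF A(1)]]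
    by blast
  moreover obtain \<zeta> where \<zeta>: "bpath {{}} \<zeta>" "A \<in> fst \<zeta> 0"
    using bpath_exists[OF hereditary_trivial saturated_trivial A(1)] A(2) by blast
  have "K.entry (gp A) (\<zeta>, 0) (\<zeta>, 0) = 1" using \<zeta> by (simp add: K.entry_def K.act_gp delta_def)
  ultimately show False using K.entry_le[of "gp A" "(\<zeta>, 0)" "(\<zeta>, 0)"] by simp
qed

lemma simple_iff:
  "simple_cstar cstar_alg \<longleftrightarrow> condition_LB \<and> {H. hereditary H \<and> saturated H} = {{{}}, B}"
proof
  assume s: "simple_cstar cstar_alg"
  have "hereditary B" unfolding hereditary_def using B_empty B_rel B_Un by auto
  moreover have "saturated B" by (auto simp: saturated_def B_reg_def regular_set_def B_empty)
  moreover have "H = {{}} \<or> H = B" if H: "hereditary H" "saturated H" for H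
  proof (rule ccontr)
    assume no: "\<not> (H = {{}} \<or> H = B)"
    have "{} \<in> H" "H \<subseteq> B" using H hereditary_empty by (auto simp: hereditary_def)
    then obtain A D where "A \<in> H" "A \<noteq> {}" "D \<in> B" "D \<notin> H" using no by blast
    then show False using not_simple_ideal[OF H] s by blast
  qed
  ultimately have "{H. hereditary H \<and> saturated H} = {{{}}, B}"
    using hereditary_trivial saturated_trivial by blast
  then show "condition_LB \<and> {H. hereditary H \<and> saturated H} = {{{}}, B}"
    using s not_simple_cycle by (auto simp: condition_LB_def)
next
  assume "condition_LB \<and> {H. hereditary H \<and> saturated H} = {{{}}, B}"
  then show "simple_cstar cstar_alg" by (intro simple_if) blast+
qed

end

theorem theorem6p16:
  fixes E :: "('v, 'e) pre_digraph" and Lab :: "'e \<Rightarrow> 'l" and B :: "'v set set"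
  assumes "normal_labelled_space E Lab B"
  shows
    "(labelled_triple.condition_LB E Lab B \<and>
      {H. labelled_triple.hereditary E Lab B H \<and> labelled_triple.saturated E Lab B H} = {{{}}, B}
        \<longrightarrow> simple_cstar (labelled_triple.cstar_alg E Lab B)) \<and>
     (second_countable (labelled_triple.groupoid_topology E Lab B) \<longrightarrow>
        simple_cstar (labelled_triple.cstar_alg E Lab B) \<longrightarrow>
        labelled_triple.condition_LB E Lab B \<and>
        {H. labelled_triple.hereditary E Lab B H \<and> labelled_triple.saturated E Lab B H} = {{{}}, B})"
proof -
  interpret normal_labelled_space E Lab B by (rule assms)
  interpret G: graded_rep E Lab B "{{}}" 1
    using hereditary_trivial saturated_trivial by unfold_locales auto
  show ?thesis using G.simple_iff by blast
qed

end
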